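(* Let $\mathcal K=(K,\mathcal F(K))$ be a model of $T_{\mathrm{rec}}$, let $\mathbf N=\mathbf N(\mathcal K)$ and $n\in\mathbf N$. If $f\in K^{(n)}$, then the type of $f$ over $\mathbf N$ (in $\mathcal K^{eq}$) is determined by its definable ideal $$\mathcal I_f=\{p\in\mathbf Q[x_i]^{\rm def}_{i<n}:\operatorname{ev}(p,f)=0\};$$ that is, if $f,g\in K^{(n)}$ and $\mathcal I_f=\mathcal I_g$, then $f$ and $g$ have the same complete type over the parameter set $\mathbf N$.
   Context: **Definable finite power sets.** "Definable" means first-order definable with parameters. Let $X,Y$ be definable sets in a structure and $\in^*\subseteq X\times Y$ a definable relation. $Y$ is a definable finite power set of $X$ with respect to $\in^*$ (written $\mathcal F(X)=Y$) if: (i) $B,C\in\mathcal F(X)$ are equal iff for all $x\in X$, $x\in^* B\iff x\in^* C$; (ii) there is $\emptyset^*\in\mathcal F(X)$ with $x\notin^*\emptyset^*$ for all $x\in X$; (iii) for each $a\in X$ there is $\{a\}^*\in\mathcal F(X)$ with $x\in^*\{a\}^*\iff x=a$; (iv) for $B,C\in\mathcal F(X)$ there is $B\cup^*C\in\mathcal F(X)$ with $x\in^* B\cup^* C\iff x\in^*B\lor x\in^*C$; (v) every definable $\mathcal U\subseteq\mathcal F(X)$ such that $\emptyset^*\in\mathcal U$ and $B\cup^*\{x\}^*\in\mathcal U$ for all $B\in\mathcal U$, $x\in X$, equals $\mathcal F(X)$. For $a\in\mathcal F(X)$ let $\operatorname{ext}(a)=\{x\in X: x\in^*a\}$. A definable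 set $X$ is hyperfinite if it has a definable finite power set $\mathcal F(X)$ and $X=\operatorname{ext}(a)$ for some $a\in\mathcal F(X)$. **Fields.** Consider structures $\mathcal K=(K,\mathcal F(K))$ with a field sort $K$, a second sort $\mathcal F(K)$ and a relation $\in^*$ making $\mathcal F(K)$ a definable finite power set of $K$. Let $K_0$ be the set of $x\in K$ for which there is $F\in\mathcal F(K)$ with $x\in^*F$ and, for all $z\in^* F$, if $z\ne0$ then $z-1\in^*F$. $\mathcal K$ has definable characteristic zero if $-1\notin K_0$. In that case put $\mathbf N=\mathbf N(\mathcal K)=K_0$, which with $+,\cdot$ is a model of Peano Arithmetic (ordered by $x\le y\iff y-x\in\mathbf N$) satisfying induction for all $\mathcal K$-definable subsets; $\mathbf Z=\mathbf N\cup-\mathbf N$; $\mathbf Q\subseteq K$ is the field of quotients $a/b$, $a,b\in\mathbf Z$, $b\neq0$. In $\mathcal K^{eq}$ every definable set $X$ has a definable finite power set $\mathcal F(X)$, unique up to a definable bijection preserving extensions. For $n\in\mathbf N$, $(n)=\{i\in\mathbf N:i<n\}$, and for a definable set $X$, $X^{(n)}$ is the (definable) set of hyperfinite functions $(n)\to X$ (elements of $\mathcal F((n)\times X)$ whose extension is such a function). **Non-standard polynomials.** For $R\subseteq K$ a definable subring and $n\in\mathbf N$, $R[x_i]^{\rm def}_{i<n}$ is the set of hyperfinite partial functions $p$ from $\mathbf N^{(n)}$ to $R\setminus\{0\}$ (with hyperfinite domain); $I\in\mathbf N^{(n)}$ is regarded as the monomial $x^I=\prod_{k<n}x_k^{I(k)}$,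 and $p_I$ is $p(I)$ if $I\in\operatorname{dom}(p)$ and $0$ otherwise. For $f\in K^{(n)}$ the value $\operatorname{ev}(p,f)\in K$ is defined by definable recursion: $\operatorname{ev}(x^I,f)=\prod_{m<n}f(m)^{I(m)}$ (powers and products by recursion on $\mathbf N$), and $\operatorname{ev}(p,f)=G(\operatorname{dom} p)$, where $G$ is the unique definable function on hyperfinite subsets of $\operatorname{dom}(p)$ with $G(\emptyset)=0$ and $G(A\cup\{I\})=G(A)+p_I\operatorname{ev}(x^I,f)$ for $I\notin A$. For $A\in\mathcal F(K)$, $\mathbf Q[A]^{\rm def}=\{\operatorname{ev}(p,f):p\in\mathbf Q[x_i]^{\rm def}_{i<n}\}$ for any $n\in\mathbf N$, $f\in K^{(n)}$ with image $\operatorname{ext}(A)$ (such $f$ exists and the ring does not depend on it). For $a\in K$ and $p\in R[x]^{\rm def}:=R[x_i]^{\rm def}_{i<1}$, $p(a)$ is the value of $p$ at the sequence of length $1$ with value $a$. An element $a\in K$ is definably algebraic over $R$ if $p(a)=0$ for some non-zero $p\in R[x]^{\rm def}$, and definably algebraic over $A\in\mathcal F(K)$ if it is so over $\mathbf Q[A]^{\rm def}$. **Theory.** $T_{\mathrm{rec}}$ is the first-order theory whose models are the structures $\mathcal K=(K,\mathcal F(K))$ such that: (1) $K$ is a field; (2) $\mathcal F(K)$ is a definable finite power set of $K$; (3) $\mathcal K$ has definable characteristic zero; (4) $\mathcal K$ is definably algebraically closed: every non-constant $p\in K[x]^{\rm def}$ has a zero in $K$; (5) $\mathcal K$ has hyper-infinite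 transcendence degree: for every $A\in\mathcal F(K)$ some $x\in K$ is not definably algebraic over $A$. *)

theory Defs
  imports Complex_Main
begin

section \<open>Many-sorted first-order structures\<close>

text \<open>Relational languages with sorts in \<open>'s\<close> and relation symbols in \<open>'r\<close>.
  Variables are natural numbers; only quantifiers carry a sort.  The sort of a free variable is
  that of the element assigned to it, and an ill-sorted atom is simply false (the carriers of
  different sorts are disjoint in all structures considered below), so on tuples of fixed sorts
  this has the same expressive power as well-sorted formulas.\<close>

datatype ('s, 'r) fm =
    Rel 'r "nat list"
  | Equal nat nat
  | Neg "('s, 'r) fm"
  | Conj "('s, 'r) fm" "('s, 'r) fm"
  | Ex 's nat "('s, 'r) fm"

primrec fv :: "('s, 'r) fm \<Rightarrow> nat set" where
  "fv (Rel r xs) = set xs"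
| "fv (Equal x y) = {x, y}"
| "fv (Neg \<phi>) = fv \<phi>"
| "fv (Conj \<phi> \<psi>) = fv \<phi> \<union> fv \<psi>"
| "fv (Ex s x \<phi>) = fv \<phi> - {x}"

record ('a, 's, 'r) fostruct =
  Carr :: "'s \<Rightarrow> 'a set"
  Intp :: "'r \<Rightarrow> 'a list set"

primrec sat :: "('a, 's, 'r) fostruct \<Rightarrow> (nat \<Rightarrow> 'a) \<Rightarrow> ('s, 'r) fm \<Rightarrow> bool" where
  "sat M e (Rel r xs) \<longleftrightarrow> map e xs \<in> Intp M r"
| "sat M e (Equal x y) \<longleftrightarrow> e x = e y"
| "sat M e (Neg \<phi>) \<longleftrightarrow> \<not> sat M e \<phi>"
| "sat M e (Conj \<phi> \<psi>) \<longleftrightarrow> sat M e \<phi> \<and> sat M e \<psi>"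
| "sat M e (Ex s x \<phi>) \<longleftrightarrow> (\<exists>a\<in>Carr M s. sat M (e(x := a)) \<phi>)"

text \<open>A list \<open>as\<close> is used as the assignment \<open>(!) as\<close>; the free variables are always required to be
  below its length.\<close>

definition holds :: "('a, 's, 'r) fostruct \<Rightarrow> ('s, 'r) fm \<Rightarrow> 'a list \<Rightarrow> bool" where
  "holds M \<phi> as \<longleftrightarrow> sat M ((!) as) \<phi>"

definition univ :: "('a, 's, 'r) fostruct \<Rightarrow> 'a set" where
  "univ M = (\<Union>s. Carr M s)"

definition tuples :: "('a, 's, 'r) fostruct \<Rightarrow> 's list \<Rightarrow> 'a list set" where
  "tuples M ss = {as. list_all2 (\<lambda>a s. a \<in> Carr M s) as ss}"

definition definable_over :: "('a, 's, 'r) fostruct \<Rightarrow> 'a set \<Rightarrow> 'a list set \<Rightarrow> bool" where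
  "definable_over M B X \<longleftrightarrow>
     (\<exists>ss \<phi> bs. set bs \<subseteq> B \<and> fv \<phi> \<subseteq> {..<length ss + length bs} \<and>
        X = {as \<in> tuples M ss. holds M \<phi> (as @ bs)})"

definition definable :: "('a, 's, 'r) fostruct \<Rightarrow> 'a list set \<Rightarrow> bool" where
  "definable M X \<longleftrightarrow> definable_over M (univ M) X"

text \<open>The complete type of a tuple over a set of parameters, as the set of formulas with parameters
  that the tuple satisfies.\<close>

definition tp :: "('a, 's, 'r) fostruct \<Rightarrow> 'a set \<Rightarrow> 'a list \<Rightarrow> (('s, 'r) fm \<times> 'a list) set" where
  "tp M B as = {(\<phi>, bs). set bs \<subseteq> B \<and> fv \<phi> \<subseteq> {..<length as + length bs} \<and> holds M \<phi> (as @ bs)}"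

section \<open>The structure of imaginaries\<close>

text \<open>For a formula \<open>\<phi>\<close> without parameters that defines an equivalence relation on the tuples of
  sorts \<open>ss\<close> there is a sort \<open>Quot ss \<phi>\<close> of its classes, together with (the graph of) the
  projection.  Formulas \<open>\<phi>\<close> that do not define an equivalence relation give an empty sort.\<close>

datatype ('s, 'r) eqsort = Real 's | Quot "'s list" "('s, 'r) fm"

datatype ('s, 'r) eqsym = Base 'r | Proj "'s list" "('s, 'r) fm"

datatype ('a, 's, 'r) eqelem = El 'a | Cls "'s list" "('s, 'r) fm" "'a list set"

definition eqrel :: "('a, 's, 'r) fostruct \<Rightarrow> 's list \<Rightarrow> ('s, 'r) fm \<Rightarrow> ('a list \<times> 'a list) set" where
  "eqrel M ss \<phi> = {(as, bs). as \<in> tuples M ss \<and> bs \<in> tuples M ss \<and> holds M \<phi> (as @ bs)}"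

definition quotients :: "('a, 's, 'r) fostruct \<Rightarrow> ('s list \<times> ('s, 'r) fm) set" where
  "quotients M = {(ss, \<phi>). fv \<phi> \<subseteq> {..<2 * length ss} \<and> equiv (tuples M ss) (eqrel M ss \<phi>)}"

primrec eq_carr :: "('a, 's, 'r) fostruct \<Rightarrow> ('s, 'r) eqsort \<Rightarrow> ('a, 's, 'r) eqelem set" where
  "eq_carr M (Real s) = El ` Carr M s"
| "eq_carr M (Quot ss \<phi>) =
     {c. (ss, \<phi>) \<in> quotients M \<and> c \<in> Cls ss \<phi> ` (tuples M ss // eqrel M ss \<phi>)}"

primrec eq_intp :: "('a, 's, 'r) fostruct \<Rightarrow> ('s, 'r) eqsym \<Rightarrow> ('a, 's, 'r) eqelem list set" where
  "eq_intp M (Base r) = map El ` Intp M r"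
| "eq_intp M (Proj ss \<phi>) =
     {map El as @ [Cls ss \<phi> (eqrel M ss \<phi> `` {as})] |as. (ss, \<phi>) \<in> quotients M \<and> as \<in> tuples M ss}"

definition eq_struct ::
    "('a, 's, 'r) fostruct \<Rightarrow> (('a, 's, 'r) eqelem, ('s, 'r) eqsort, ('s, 'r) eqsym) fostruct" where
  "eq_struct M = \<lparr>Carr = eq_carr M, Intp = eq_intp M\<rparr>"

section \<open>Definable finite power sets\<close>

definition prod_set :: "'a list set \<Rightarrow> 'a list set \<Rightarrow> 'a list set" where
  "prod_set X Y = {x @ y |x y. x \<in> X \<and> y \<in> Y}"

text \<open>A candidate for a definable finite power set is a pair \<open>(Y, E)\<close> of a set and a membership
  relation; \<open>(x, B) \<in> E\<close> is \<open>x \<in>\<^sup>* B\<close>.\<close>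

type_synonym 'a fps = "'a list set \<times> ('a list \<times> 'a list) set"

definition graph_of :: "('a list \<times> 'a list) set \<Rightarrow> 'a list set" where
  "graph_of E = {x @ y |x y. (x, y) \<in> E}"

definition is_fps :: "('a, 's, 'r) fostruct \<Rightarrow> 'a list set \<Rightarrow> 'a fps \<Rightarrow> bool" where
  "is_fps M X P \<longleftrightarrow> (case P of (Y, E) \<Rightarrow>
     definable M X \<and> definable M Y \<and> E \<subseteq> X \<times> Y \<and> definable M (graph_of E) \<and>
     (\<forall>B\<in>Y. \<forall>C\<in>Y. B = C \<longleftrightarrow> (\<forall>x\<in>X. (x, B) \<in> E \<longleftrightarrow> (x, C) \<in> E)) \<and>
     (\<exists>B\<in>Y. \<forall>x\<in>X. (x, B) \<notin> E) \<and>
     (\<forall>a\<in>X. \<exists>B\<in>Y. \<forall>x\<in>X. (x, B) \<in> E \<longleftrightarrow> x = a) \<and>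
     (\<forall>B\<in>Y. \<forall>C\<in>Y. \<exists>D\<in>Y. \<forall>x\<in>X. (x, D) \<in> E \<longleftrightarrow> (x, B) \<in> E \<or> (x, C) \<in> E) \<and>
     (\<forall>U. definable M U \<and> U \<subseteq> Y \<and>
        (\<forall>B\<in>Y. (\<forall>x\<in>X. (x, B) \<notin> E) \<longrightarrow> B \<in> U) \<and>
        (\<forall>B\<in>U. \<forall>a\<in>X. \<forall>C\<in>Y. (\<forall>x\<in>X. (x, C) \<in> E \<longleftrightarrow> (x, B) \<in> E \<or> x = a) \<longrightarrow> C \<in> U)
        \<longrightarrow> U = Y))"

definition hyperfinite :: "('a, 's, 'r) fostruct \<Rightarrow> 'a list set \<Rightarrow> bool" where
  "hyperfinite M X \<longleftrightarrow> (\<exists>Y E. is_fps M X (Y, E) \<and> (\<exists>a\<in>Y. X = {x \<in> X. (x, a) \<in> E}))"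

text \<open>A definable finite power set is only determined up to a definable bijection that preserves
  extensions.  \<open>fps M X\<close> is a fixed choice that needs no other parameters than \<open>X\<close> itself: it is
  definable over every set of parameters over which \<open>X\<close> is.  This matters for types of elements of
  \<open>fps M X\<close>: any two such choices are in bijection over the parameters of \<open>X\<close>.\<close>

definition fps :: "('a, 's, 'r) fostruct \<Rightarrow> 'a list set \<Rightarrow> 'a fps" where
  "fps M X = (SOME P. is_fps M X P \<and>
     (\<forall>B \<subseteq> univ M. definable_over M B X \<longrightarrow>
        definable_over M B (fst P) \<and> definable_over M B (graph_of (snd P))))"

definition Fin :: "('a, 's, 'r) fostruct \<Rightarrow> 'a list set \<Rightarrow> 'a list set" where
  "Fin M X = fst (fps M X)"

definition ext :: "('a, 's, 'r) fostruct \<Rightarrow> 'a list set \<Rightarrow> 'a list \<Rightarrow> 'a list set" where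
  "ext M X a = {x \<in> X. (x, a) \<in> snd (fps M X)}"

section \<open>Fields with a definable finite power set\<close>

text \<open>The structure \<open>(K, F(K))\<close> is given by a type \<open>'k\<close> of class \<open>field\<close>, a type \<open>'f\<close> and the
  relation \<open>mem :: 'k \<Rightarrow> 'f \<Rightarrow> bool\<close>.  Its language has the graphs of addition and multiplication,
  from which \<open>0\<close>, \<open>1\<close> and subtraction are definable without parameters.\<close>

datatype sort = KSort | FSort

datatype sym = Add | Mult | Mem

datatype ('k, 'f) elem = KEl 'k | FEl 'f

primrec k_carr :: "sort \<Rightarrow> ('k, 'f) elem set" where
  "k_carr KSort = range KEl"
| "k_carr FSort = range FEl"

primrec k_intp :: "('k::field \<Rightarrow> 'f \<Rightarrow> bool) \<Rightarrow> sym \<Rightarrow> ('k, 'f) elem list set" where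
  "k_intp mem Add = {[KEl x, KEl y, KEl (x + y)] |x y. True}"
| "k_intp mem Mult = {[KEl x, KEl y, KEl (x * y)] |x y. True}"
| "k_intp mem Mem = {[KEl x, FEl A] |x A. mem x A}"

definition KK :: "('k::field \<Rightarrow> 'f \<Rightarrow> bool) \<Rightarrow> (('k, 'f) elem, sort, sym) fostruct" where
  "KK mem = \<lparr>Carr = k_carr, Intp = k_intp mem\<rparr>"

type_synonym ('k, 'f) keq = "(('k, 'f) elem, sort, sym) eqelem"

definition Keq ::
    "('k::field \<Rightarrow> 'f \<Rightarrow> bool) \<Rightarrow> (('k, 'f) keq, (sort, sym) eqsort, (sort, sym) eqsym) fostruct" where
  "Keq mem = eq_struct (KK mem)"

abbreviation kel :: "'k \<Rightarrow> ('k, 'f) keq" where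
  "kel x \<equiv> El (KEl x)"

definition kset :: "'k set \<Rightarrow> ('k, 'f) keq list set" where
  "kset S = {[kel x] |x. x \<in> S}"

definition K_is_fps :: "('k::field \<Rightarrow> 'f \<Rightarrow> bool) \<Rightarrow> bool" where
  "K_is_fps mem \<longleftrightarrow>
     is_fps (KK mem) {[KEl x] |x. True}
       ({[FEl A] |A. True}, {([KEl x], [FEl A]) |x A. mem x A})"

definition NN :: "('k::field \<Rightarrow> 'f \<Rightarrow> bool) \<Rightarrow> 'k set" where
  "NN mem = {x. \<exists>F. mem x F \<and> (\<forall>z. mem z F \<longrightarrow> z \<noteq> 0 \<longrightarrow> mem (z - 1) F)}"

definition char_zero :: "('k::field \<Rightarrow> 'f \<Rightarrow> bool) \<Rightarrow> bool" where
  "char_zero mem \<longleftrightarrow> - 1 \<notin> NN mem"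

definition below :: "('k::field \<Rightarrow> 'f \<Rightarrow> bool) \<Rightarrow> 'k \<Rightarrow> 'k set" where
  "below mem n = {i \<in> NN mem. n - i \<in> NN mem \<and> i \<noteq> n}"

definition ZZ :: "('k::field \<Rightarrow> 'f \<Rightarrow> bool) \<Rightarrow> 'k set" where
  "ZZ mem = NN mem \<union> uminus ` NN mem"

definition QQ :: "('k::field \<Rightarrow> 'f \<Rightarrow> bool) \<Rightarrow> 'k set" where
  "QQ mem = {a / b |a b. a \<in> ZZ mem \<and> b \<in> ZZ mem \<and> b \<noteq> 0}"

section \<open>Hyperfinite functions with values in the field\<close>

text \<open>A hyperfinite (partial) function from \<open>D\<close> to \<open>S\<close> is an element of \<open>Fin (D \<times> S)\<close> in the
  structure of imaginaries.\<close>

definition fgraph ::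
    "('k::field \<Rightarrow> 'f \<Rightarrow> bool) \<Rightarrow> ('k, 'f) keq list set \<Rightarrow> 'k set \<Rightarrow> ('k, 'f) keq list
       \<Rightarrow> (('k, 'f) keq list \<times> 'k) set" where
  "fgraph mem D S f =
     {(d, v). d \<in> D \<and> v \<in> S \<and> d @ [kel v] \<in> ext (Keq mem) (prod_set D (kset S)) f}"

definition hfun ::
    "('k::field \<Rightarrow> 'f \<Rightarrow> bool) \<Rightarrow> ('k, 'f) keq list set \<Rightarrow> 'k set \<Rightarrow> ('k, 'f) keq list set" where
  "hfun mem D S =
     {f \<in> Fin (Keq mem) (prod_set D (kset S)). \<forall>d\<in>D. \<exists>!v. (d, v) \<in> fgraph mem D S f}"

definition hpfun ::
    "('k::field \<Rightarrow> 'f \<Rightarrow> bool) \<Rightarrow> ('k, 'f) keq list set \<Rightarrow> 'k set \<Rightarrow> ('k, 'f) keq list set" where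
  "hpfun mem D S =
     {f \<in> Fin (Keq mem) (prod_set D (kset S)).
        single_valued (fgraph mem D S f) \<and> hyperfinite (Keq mem) (Domain (fgraph mem D S f))}"

definition fval ::
    "('k::field \<Rightarrow> 'f \<Rightarrow> bool) \<Rightarrow> ('k, 'f) keq list set \<Rightarrow> 'k set
       \<Rightarrow> ('k, 'f) keq list \<Rightarrow> ('k, 'f) keq list \<Rightarrow> 'k" where
  "fval mem D S f d = (THE v. (d, v) \<in> fgraph mem D S f)"

definition seqs :: "('k::field \<Rightarrow> 'f \<Rightarrow> bool) \<Rightarrow> 'k \<Rightarrow> 'k set \<Rightarrow> ('k, 'f) keq list set" where
  "seqs mem n S = hfun mem (kset (below mem n)) S"

definition entry ::
    "('k::field \<Rightarrow> 'f \<Rightarrow> bool) \<Rightarrow> 'k \<Rightarrow> 'k set \<Rightarrow> ('k, 'f) keq list \<Rightarrow> 'k \<Rightarrow> 'k" where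
  "entry mem n S f i = fval mem (kset (below mem n)) S f [kel i]"

section \<open>Non-standard polynomials\<close>

abbreviation exponents :: "('k::field \<Rightarrow> 'f \<Rightarrow> bool) \<Rightarrow> 'k \<Rightarrow> ('k, 'f) keq list set" where
  "exponents mem n \<equiv> seqs mem n (NN mem)"

definition polys :: "('k::field \<Rightarrow> 'f \<Rightarrow> bool) \<Rightarrow> 'k \<Rightarrow> 'k set \<Rightarrow> ('k, 'f) keq list set" where
  "polys mem n R = hpfun mem (exponents mem n) (R - {0})"

definition pdom ::
    "('k::field \<Rightarrow> 'f \<Rightarrow> bool) \<Rightarrow> 'k \<Rightarrow> 'k set \<Rightarrow> ('k, 'f) keq list \<Rightarrow> ('k, 'f) keq list set" where
  "pdom mem n R p = Domain (fgraph mem (exponents mem n) (R - {0}) p)"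

definition pcoeff ::
    "('k::field \<Rightarrow> 'f \<Rightarrow> bool) \<Rightarrow> 'k \<Rightarrow> 'k set \<Rightarrow> ('k, 'f) keq list \<Rightarrow> ('k, 'f) keq list \<Rightarrow> 'k" where
  "pcoeff mem n R p I =
     (if I \<in> pdom mem n R p then fval mem (exponents mem n) (R - {0}) p I else 0)"

text \<open>Definable recursion on \<open>NN mem\<close>: the value at \<open>n\<close> of the unique definable \<open>h\<close> on \<open>{0..n}\<close> with
  \<open>h 0 = c\<close> and \<open>h (j + 1) = t j (h j)\<close> for \<open>j < n\<close>.\<close>

definition drec :: "('k::field \<Rightarrow> 'f \<Rightarrow> bool) \<Rightarrow> 'k \<Rightarrow> ('k \<Rightarrow> 'k \<Rightarrow> 'k) \<Rightarrow> 'k \<Rightarrow> 'k" where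
  "drec mem c t n =
     (THE v. \<exists>h. definable (Keq mem) {[kel j, kel (h j)] |j. j \<in> insert n (below mem n)} \<and>
        h 0 = c \<and> (\<forall>j\<in>below mem n. h (j + 1) = t j (h j)) \<and> v = h n)"

definition dpower :: "('k::field \<Rightarrow> 'f \<Rightarrow> bool) \<Rightarrow> 'k \<Rightarrow> 'k \<Rightarrow> 'k" where
  "dpower mem x k = drec mem 1 (\<lambda>j y. y * x) k"

definition dprod :: "('k::field \<Rightarrow> 'f \<Rightarrow> bool) \<Rightarrow> ('k \<Rightarrow> 'k) \<Rightarrow> 'k \<Rightarrow> 'k" where
  "dprod mem u n = drec mem 1 (\<lambda>j y. y * u j) n"

definition ev_monom ::
    "('k::field \<Rightarrow> 'f \<Rightarrow> bool) \<Rightarrow> 'k \<Rightarrow> ('k, 'f) keq list \<Rightarrow> ('k, 'f) keq list \<Rightarrow> 'k" where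
  "ev_monom mem n I f =
     dprod mem (\<lambda>m. dpower mem (entry mem n UNIV f m) (entry mem n (NN mem) I m)) n"

definition ev ::
    "('k::field \<Rightarrow> 'f \<Rightarrow> bool) \<Rightarrow> 'k \<Rightarrow> 'k set \<Rightarrow> ('k, 'f) keq list \<Rightarrow> ('k, 'f) keq list \<Rightarrow> 'k" where
  "ev mem n R p f =
     (let X = pdom mem n R p; \<F> = Fin (Keq mem) X; xt = ext (Keq mem) X in
      THE v. \<exists>G. definable (Keq mem) {A @ [kel (G A)] |A. A \<in> \<F>} \<and>
        (\<forall>A\<in>\<F>. xt A = {} \<longrightarrow> G A = 0) \<and>
        (\<forall>A\<in>\<F>. \<forall>I\<in>X - xt A. \<forall>C\<in>\<F>. xt C = insert I (xt A) \<longrightarrow>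
           G C = G A + pcoeff mem n R p I * ev_monom mem n I f) \<and>
        (\<exists>A\<in>\<F>. xt A = X \<and> v = G A))"

text \<open>The ring \<open>\<Q>[A]\<close>; the values do not depend on the enumeration \<open>f\<close> of the extension of \<open>A\<close>.\<close>

definition Q_adjoin :: "('k::field \<Rightarrow> 'f \<Rightarrow> bool) \<Rightarrow> 'f \<Rightarrow> 'k set" where
  "Q_adjoin mem A =
     {v. \<exists>n\<in>NN mem. \<exists>f\<in>seqs mem n UNIV. entry mem n UNIV f ` below mem n = {x. mem x A} \<and>
        (\<exists>p\<in>polys mem n (QQ mem). v = ev mem n (QQ mem) p f)}"

definition single :: "('k::field \<Rightarrow> 'f \<Rightarrow> bool) \<Rightarrow> 'k \<Rightarrow> ('k, 'f) keq list" where
  "single mem a = (THE f. f \<in> seqs mem 1 UNIV \<and> entry mem 1 UNIV f 0 = a)"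

definition is_root :: "('k::field \<Rightarrow> 'f \<Rightarrow> bool) \<Rightarrow> 'k set \<Rightarrow> ('k, 'f) keq list \<Rightarrow> 'k \<Rightarrow> bool" where
  "is_root mem R p a \<longleftrightarrow> ev mem 1 R p (single mem a) = 0"

definition def_algebraic :: "('k::field \<Rightarrow> 'f \<Rightarrow> bool) \<Rightarrow> 'k set \<Rightarrow> 'k \<Rightarrow> bool" where
  "def_algebraic mem R a \<longleftrightarrow> (\<exists>p\<in>polys mem 1 R. pdom mem 1 R p \<noteq> {} \<and> is_root mem R p a)"

definition nonconstant :: "('k::field \<Rightarrow> 'f \<Rightarrow> bool) \<Rightarrow> 'k set \<Rightarrow> ('k, 'f) keq list \<Rightarrow> bool" where
  "nonconstant mem R p \<longleftrightarrow> (\<exists>I\<in>pdom mem 1 R p. entry mem 1 (NN mem) I 0 \<noteq> 0)"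

section \<open>The theory and definable ideals\<close>

definition T_rec :: "('k::field \<Rightarrow> 'f \<Rightarrow> bool) \<Rightarrow> bool" where
  "T_rec mem \<longleftrightarrow>
     K_is_fps mem \<and>
     char_zero mem \<and>
     (\<forall>p\<in>polys mem 1 UNIV. nonconstant mem UNIV p \<longrightarrow> (\<exists>a. is_root mem UNIV p a)) \<and>
     (\<forall>A. \<exists>x. \<not> def_algebraic mem (Q_adjoin mem A) x)"

definition def_ideal ::
    "('k::field \<Rightarrow> 'f \<Rightarrow> bool) \<Rightarrow> 'k \<Rightarrow> ('k, 'f) keq list \<Rightarrow> ('k, 'f) keq list set" where
  "def_ideal mem n f = {p \<in> polys mem n (QQ mem). ev mem n (QQ mem) p f = 0}"

end

theory Submission
  imports Defs "HOL-Library.Nat_Bijection"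
begin

text \<open>Call a hyperfinite set \<open>h\<close> of pairs good if the set of pairs \<open>Sg h\<close> obtained from \<open>h\<close> and
  \<open>(1, 1)\<close> by the field operations of \<open>K \<times> K\<close> is an isomorphism between subfields of \<open>K\<close>.  These
  isomorphisms, which are the identity on \<open>N\<close>, form a back-and-forth system: if \<open>x\<close> is definably
  algebraic over the domain, then its minimal polynomial has a root in \<open>K\<close> after transport to the
  range, and otherwise \<open>x\<close> can be sent to an element that is transcendental over the range.  A
  hyperfinite set is absorbed by induction on it, which is possible since \<open>Sg h\<close> is definable uniformly
  in \<open>h\<close>; hence the system also acts on \<open>F(K)\<close>, and then on all imaginaries.  Equality of
  the ideals of \<open>f\<close> and \<open>g\<close> says exactly that the set of pairs \<open>(f i, g i)\<close> is good.  Extending this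
  isomorphism to the imaginary \<open>f\<close> gives an element with the extension of \<open>g\<close>, that is \<open>g\<close>.

  Existence of definable finite power sets in the structure of imaginaries reduces to subsets of \<open>K\<close>
  by coding pairs as \<open>x + t * y\<close> with a slope \<open>t\<close> that is generic for the hyperfinite set at hand.\<close>

section \<open>Definable predicates of tuple-valued variables\<close>

text \<open>The obstacle is that \<open>N\<close> and \<open>F(K)\<close> are not well-founded from
  outside: induction holds for definable predicates only. Every object that an induction mentions
  (sums, powers, values of polynomials, generated fields) must first be shown to depend definably on
  all its arguments, uniformly in the codes over which the induction quantifies. Hence the calculus
  of definable predicates, and hence the form of the extension argument: an isomorphism is carried
  by a hyperfinite code \<open>h\<close>, its field by a closure that is definable in
  \<open>h\<close>. Polynomials are awkward here, since the sort of a sequence may vary with its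
  length. So no product of polynomials is formed; the pairs of values of one polynomial at two
  points are shown to be a ring, and an extension by \<open>x\<close> is described by pairs of
  combinations of powers, filtered by degree. Inverses of algebraic elements come from division with
  remainder in that filtration. Parameters matter at the end: the power set in which
  \<open>f\<close> lives is definable over \<open>n\<close>, and the isomorphisms fix
  \<open>N\<close>.\<close>

lemma finite_fv: "finite (fv \<phi>)"
  by (induction \<phi>) auto

lemma sat_cong:
  assumes "\<And>x. x \<in> fv \<phi> \<Longrightarrow> e x = e' x"
  shows "sat M e \<phi> \<longleftrightarrow> sat M e' \<phi>"
  using assms
proof (induction \<phi> arbitrary: e e')
  case (Rel r xs)
  then have "map e xs = map e' xs" by simp
  then show ?case by (simp only: sat.simps)
next
  case (Ex s x \<phi>)
  have "sat M (e(x := a)) \<phi> \<longleftrightarrow> sat M (e'(x := a)) \<phi>" for a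
    using Ex.prems by (intro Ex.IH) auto
  then show ?case by simp
next
  case (Equal x y)
  then show ?case by simp
next
  case (Neg \<phi>)
  show ?case using Neg.IH[of e e'] Neg.prems by simp
next
  case (Conj \<phi> \<psi>)
  show ?case using Conj.IH(1)[of e e'] Conj.IH(2)[of e e'] Conj.prems by simp
qed

text \<open>The renaming \<open>r\<close> need not be injective, so a bound variable could collide
  with a renamed free one. Under a quantifier the bound variable is sent to a \<open>y\<close>
  outside the image of the other free variables; the induction is therefore over arbitrary
  \<open>r\<close>.\<close>

lemma rename_formula:
  "\<exists>\<phi>'. fv \<phi>' \<subseteq> r ` fv \<phi> \<and> (\<forall>e. sat M e \<phi>' \<longleftrightarrow> sat M (e \<circ> r) \<phi>)"
proof (induction \<phi> arbitrary: r)
  case (Rel R xs)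
  show ?case by (rule exI[of _ "Rel R (map r xs)"]) (auto simp: comp_def)
next
  case (Equal x y)
  show ?case by (rule exI[of _ "Equal (r x) (r y)"]) auto
next
  case (Neg \<phi>)
  from Neg[of r] obtain \<phi>' where "fv \<phi>' \<subseteq> r ` fv \<phi> \<and> (\<forall>e. sat M e \<phi>' = sat M (e \<circ> r) \<phi>)" by blast
  then show ?case by (intro exI[of _ "Neg \<phi>'"]) (simp add: comp_def)
next
  case (Conj \<phi> \<psi>)
  from Conj(1)[of r] obtain \<phi>' where "fv \<phi>' \<subseteq> r ` fv \<phi> \<and> (\<forall>e. sat M e \<phi>' = sat M (e \<circ> r) \<phi>)" by blast
  moreover from Conj(2)[of r] obtain \<psi>'
    where "fv \<psi>' \<subseteq> r ` fv \<psi> \<and> (\<forall>e. sat M e \<psi>' = sat M (e \<circ> r) \<psi>)" by blast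
  ultimately show ?case by (intro exI[of _ "Conj \<phi>' \<psi>'"]) (auto simp: comp_def)
next
  case (Ex s x \<phi>)
  have "\<exists>y. y \<notin> r ` (fv \<phi> - {x})"
    by (intro ex_new_if_finite) (auto simp: finite_fv)
  then obtain y where y: "y \<notin> r ` (fv \<phi> - {x})" ..
  from Ex[of "r(x := y)"] obtain \<phi>' where fv': "fv \<phi>' \<subseteq> r(x := y) ` fv \<phi>"
    and sat': "\<And>e. sat M e \<phi>' \<longleftrightarrow> sat M (e \<circ> r(x := y)) \<phi>" by blast
  have "sat M (e(y := a)) \<phi>' \<longleftrightarrow> sat M ((e \<circ> r)(x := a)) \<phi>" for e a
    unfolding sat' by (rule sat_cong) (use y in auto)
  moreover have "fv \<phi>' - {y} \<subseteq> r ` (fv \<phi> - {x})" using fv' by (auto split: if_splits)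
  ultimately show ?case by (intro exI[of _ "Ex s y \<phi>'"]) (simp add: comp_def)
qed

text \<open>Component \<open>i\<close> of the tuple in slot \<open>x\<close>. The sum and pairing
  codes put all components of all slots and all parameters into one supply of variables without
  overlap.\<close>

definition slot :: "nat \<Rightarrow> nat \<Rightarrow> nat" where
  "slot x i = sum_encode (Inl (prod_encode (x, i)))"

definition par :: "nat \<Rightarrow> nat" where
  "par j = sum_encode (Inr j)"

lemma slot_par_simps [simp]:
  "slot x i = slot y j \<longleftrightarrow> x = y \<and> i = j" "par i = par j \<longleftrightarrow> i = j"
  "slot x i \<noteq> par j" "par j \<noteq> slot x i"
  "sum_decode (slot x i) = Inl (prod_encode (x, i))" "sum_decode (par j) = Inr j"
  by (auto simp: slot_def par_def sum_encode_eq prod_encode_eq)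

definition asg :: "(nat \<Rightarrow> 'a list) \<Rightarrow> 'a list \<Rightarrow> nat \<Rightarrow> 'a" where
  "asg e bs v = (case sum_decode v of
      Inl w \<Rightarrow> (case prod_decode w of (x, i) \<Rightarrow> e x ! i) | Inr j \<Rightarrow> bs ! j)"

lemma asg_slot [simp]: "asg e bs (slot x i) = e x ! i"
  by (simp add: asg_def)

lemma asg_par [simp]: "asg e bs (par j) = bs ! j"
  by (simp add: asg_def)

definition scope :: "(nat \<Rightarrow> 's list) \<Rightarrow> nat \<Rightarrow> nat set" where
  "scope \<Gamma> k = {slot x i |x i. i < length (\<Gamma> x)} \<union> {par j |j. j < k}"

lemma slot_scope [simp]: "slot x i \<in> scope \<Gamma> k \<longleftrightarrow> i < length (\<Gamma> x)"
  by (auto simp: scope_def)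

lemma par_scope [simp]: "par j \<in> scope \<Gamma> k \<longleftrightarrow> j < k"
  by (auto simp: scope_def)

lemma var_cases:
  obtains (slot) x i where "v = slot x i" | (par) j where "v = par j"
proof (cases "sum_decode v")
  case (Inl w)
  then have "v = slot (fst (prod_decode w)) (snd (prod_decode w))"
    by (metis prod.collapse prod_decode_inverse sum_decode_inverse slot_def)
  then show ?thesis by (rule slot)
next
  case (Inr j)
  then show ?thesis by (metis par sum_decode_inverse par_def)
qed

definition Env :: "('a, 's, 'r) fostruct \<Rightarrow> (nat \<Rightarrow> 's list) \<Rightarrow> (nat \<Rightarrow> 'a list) set" where
  "Env M \<Gamma> = {e. \<forall>x. e x \<in> tuples M (\<Gamma> x)}"

text \<open>The variables of a predicate are slots that hold tuples: slot \<open>x\<close> holds a tuple of sorts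
  \<open>\<Gamma> x\<close>.  Slots are de Bruijn indices, so a quantifier shifts them by one.\<close>

definition DP ::
    "('a, 's, 'r) fostruct \<Rightarrow> 'a set \<Rightarrow> (nat \<Rightarrow> 's list) \<Rightarrow> ((nat \<Rightarrow> 'a list) \<Rightarrow> bool) \<Rightarrow> bool" where
  "DP M B \<Gamma> P \<longleftrightarrow> (\<exists>\<phi> bs. set bs \<subseteq> B \<and> fv \<phi> \<subseteq> scope \<Gamma> (length bs) \<and>
     (\<forall>e\<in>Env M \<Gamma>. P e \<longleftrightarrow> sat M (asg e bs) \<phi>))"

lemma DPI:
  assumes "set bs \<subseteq> B" "fv \<phi> \<subseteq> scope \<Gamma> (length bs)"
    and "\<And>e. e \<in> Env M \<Gamma> \<Longrightarrow> P e \<longleftrightarrow> sat M (asg e bs) \<phi>"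
  shows "DP M B \<Gamma> P"
  using assms unfolding DP_def by blast

lemma DP_cong:
  assumes "DP M B \<Gamma> P" "\<And>e. e \<in> Env M \<Gamma> \<Longrightarrow> P e \<longleftrightarrow> Q e"
  shows "DP M B \<Gamma> Q"
  using assms unfolding DP_def by (metis (no_types, lifting))

lemma tuples_length: "u \<in> tuples M ss \<Longrightarrow> length u = length ss"
  by (auto simp: tuples_def dest: list_all2_lengthD)

lemma tuples_nth: "u \<in> tuples M ss \<Longrightarrow> i < length ss \<Longrightarrow> u ! i \<in> Carr M (ss ! i)"
  by (auto simp: tuples_def list_all2_conv_all_nth)

lemma tuples_eq_iff:
  "u \<in> tuples M ss \<Longrightarrow> v \<in> tuples M ss \<Longrightarrow> (\<forall>i<length ss. u ! i = v ! i) \<longleftrightarrow> u = v"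
  using tuples_length[of u M ss] tuples_length[of v M ss] by (auto intro: nth_equalityI)

lemma Nil_tuples [simp]: "u \<in> tuples M [] \<longleftrightarrow> u = []"
  by (auto simp: tuples_def)

lemma Cons_tuples: "u \<in> tuples M (s # ss) \<longleftrightarrow> (\<exists>a v. u = a # v \<and> a \<in> Carr M s \<and> v \<in> tuples M ss)"
  by (auto simp: tuples_def list_all2_Cons2)

lemma append_tuples: "u \<in> tuples M (ss @ ts) \<longleftrightarrow> (\<exists>v w. u = v @ w \<and> v \<in> tuples M ss \<and> w \<in> tuples M ts)"
  by (auto simp: tuples_def list_all2_append2 dest: list_all2_lengthD)

lemma append_tuplesI: "u \<in> tuples M ss \<Longrightarrow> v \<in> tuples M ts \<Longrightarrow> u @ v \<in> tuples M (ss @ ts)"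
  by (auto simp: append_tuples)

lemma tuples_subset_univ: "u \<in> tuples M ss \<Longrightarrow> set u \<subseteq> univ M"
  by (induction ss arbitrary: u) (fastforce simp: Cons_tuples univ_def)+

lemma univ_tuples: "set u \<subseteq> univ M \<Longrightarrow> \<exists>ss. u \<in> tuples M ss"
proof (induction u)
  case (Cons a u)
  then obtain ss s where "u \<in> tuples M ss" "a \<in> Carr M s" by (auto simp: univ_def)
  then have "a # u \<in> tuples M (s # ss)" by (auto simp: Cons_tuples)
  then show ?case ..
qed (auto intro: exI[of _ "[]"])

lemma Env_nth: "e \<in> Env M \<Gamma> \<Longrightarrow> e x \<in> tuples M (\<Gamma> x)"
  by (simp add: Env_def)

lemma Env_case: "case_nat u e \<in> Env M (case_nat ss \<Gamma>) \<longleftrightarrow> u \<in> tuples M ss \<and> e \<in> Env M \<Gamma>"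
proof
  assume *: "case_nat u e \<in> Env M (case_nat ss \<Gamma>)"
  have "e x \<in> tuples M (\<Gamma> x)" for x using Env_nth[OF *, of "Suc x"] by simp
  then show "u \<in> tuples M ss \<and> e \<in> Env M \<Gamma>" using Env_nth[OF *, of 0] by (auto simp: Env_def)
next
  assume "u \<in> tuples M ss \<and> e \<in> Env M \<Gamma>"
  then show "case_nat u e \<in> Env M (case_nat ss \<Gamma>)" by (auto simp: Env_def split: nat.split)
qed

lemma Env_tail: "e \<in> Env M (case_nat ss \<Gamma>) \<Longrightarrow> (\<lambda>x. e (Suc x)) \<in> Env M \<Gamma>"
proof -
  assume *: "e \<in> Env M (case_nat ss \<Gamma>)"
  show ?thesis using Env_nth[OF *, of "Suc _"] by (auto simp: Env_def)
qed

lemma Env_head: "e \<in> Env M (case_nat ss \<Gamma>) \<Longrightarrow> e 0 \<in> tuples M ss"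
  using Env_nth[of e M "case_nat ss \<Gamma>" 0] by simp

lemma DP_not: "DP M B \<Gamma> P \<Longrightarrow> DP M B \<Gamma> (\<lambda>e. \<not> P e)"
proof -
  assume "DP M B \<Gamma> P"
  then obtain \<phi> bs where "set bs \<subseteq> B" "fv \<phi> \<subseteq> scope \<Gamma> (length bs)"
    "\<And>e. e \<in> Env M \<Gamma> \<Longrightarrow> P e \<longleftrightarrow> sat M (asg e bs) \<phi>" by (auto simp: DP_def)
  then show ?thesis by (intro DPI[of bs _ "Neg \<phi>"]) auto
qed

lemma DP_conj:
  assumes "DP M B \<Gamma> P" "DP M B \<Gamma> Q"
  shows "DP M B \<Gamma> (\<lambda>e. P e \<and> Q e)"
proof -
  obtain \<phi> bs where 1: "set bs \<subseteq> B" "fv \<phi> \<subseteq> scope \<Gamma> (length bs)"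
    "\<And>e. e \<in> Env M \<Gamma> \<Longrightarrow> P e \<longleftrightarrow> sat M (asg e bs) \<phi>" using assms(1) by (auto simp: DP_def)
  obtain \<psi> cs where 2: "set cs \<subseteq> B" "fv \<psi> \<subseteq> scope \<Gamma> (length cs)"
    "\<And>e. e \<in> Env M \<Gamma> \<Longrightarrow> Q e \<longleftrightarrow> sat M (asg e cs) \<psi>" using assms(2) by (auto simp: DP_def)
  \<comment> \<open>Both formulas share one list of parameters: those of \<open>\<psi>\<close> are
    moved past those of \<open>\<phi>\<close>.\<close>
  define r where "r = (\<lambda>v. case sum_decode v of Inl w \<Rightarrow> v | Inr j \<Rightarrow> par (j + length bs))"
  have r: "r (slot x i) = slot x i" "r (par j) = par (j + length bs)" for x i j
    by (auto simp: r_def)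
  obtain \<psi>' where \<psi>': "fv \<psi>' \<subseteq> r ` fv \<psi>" "\<And>e. sat M e \<psi>' \<longleftrightarrow> sat M (e \<circ> r) \<psi>"
    using rename_formula[of r \<psi> M] by blast
  show ?thesis
  proof (rule DPI[of "bs @ cs" _ "Conj \<phi> \<psi>'"])
    show "set (bs @ cs) \<subseteq> B" using 1 2 by simp
    have "v \<in> scope \<Gamma> (length (bs @ cs))" if "v \<in> scope \<Gamma> (length bs)" for v
      using that by (cases v rule: var_cases) auto
    moreover have "r v \<in> scope \<Gamma> (length (bs @ cs))" if "v \<in> scope \<Gamma> (length cs)" for v
      using that by (cases v rule: var_cases) (auto simp: r)
    ultimately show "fv (Conj \<phi> \<psi>') \<subseteq> scope \<Gamma> (length (bs @ cs))" using 1(2) 2(2) \<psi>'(1) by fastforce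
  next
    fix e assume e: "e \<in> Env M \<Gamma>"
    have "asg e (bs @ cs) v = asg e bs v" if "v \<in> scope \<Gamma> (length bs)" for v
      using that by (cases v rule: var_cases) (auto simp: nth_append)
    then have "sat M (asg e (bs @ cs)) \<phi> \<longleftrightarrow> sat M (asg e bs) \<phi>" using 1(2) by (intro sat_cong) auto
    moreover have "asg e (bs @ cs) (r v) = asg e cs v" if "v \<in> scope \<Gamma> (length cs)" for v
      using that by (cases v rule: var_cases) (auto simp: nth_append r)
    then have "sat M (asg e (bs @ cs) \<circ> r) \<psi> \<longleftrightarrow> sat M (asg e cs) \<psi>" using 2(2) by (intro sat_cong) auto
    ultimately show "P e \<and> Q e \<longleftrightarrow> sat M (asg e (bs @ cs)) (Conj \<phi> \<psi>')"
      using 1(3)[OF e] 2(3)[OF e] \<psi>'(2) by simp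
  qed
qed

text \<open>The formula \<open>\<not> \<exists>x:s. \<not> x = x\<close> is true even if the sort \<open>s\<close> is empty.\<close>

lemma DP_True: "DP M B \<Gamma> (\<lambda>e. True)"
  by (rule DPI[of "[]" _ "Neg (Ex undefined 0 (Neg (Equal 0 0)))"]) auto

lemma DP_const: "DP M B \<Gamma> (\<lambda>e. b)"
  using DP_True[of M B \<Gamma>] DP_not[OF DP_True, of M B \<Gamma>] by (cases b) auto

lemma DP_imp:
  assumes "DP M B \<Gamma> P" "DP M B \<Gamma> Q"
  shows "DP M B \<Gamma> (\<lambda>e. P e \<longrightarrow> Q e)"
proof -
  have "DP M B \<Gamma> (\<lambda>e. \<not> (P e \<and> \<not> Q e))" by (intro DP_conj DP_not assms)
  then show ?thesis by (rule DP_cong) auto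
qed

lemma DP_disj:
  assumes "DP M B \<Gamma> P" "DP M B \<Gamma> Q"
  shows "DP M B \<Gamma> (\<lambda>e. P e \<or> Q e)"
proof -
  have "DP M B \<Gamma> (\<lambda>e. \<not> (\<not> P e \<and> \<not> Q e))" by (intro DP_conj DP_not assms)
  then show ?thesis by (rule DP_cong) auto
qed

lemma DP_iff:
  assumes "DP M B \<Gamma> P" "DP M B \<Gamma> Q"
  shows "DP M B \<Gamma> (\<lambda>e. P e \<longleftrightarrow> Q e)"
proof -
  have "DP M B \<Gamma> (\<lambda>e. (P e \<longrightarrow> Q e) \<and> (Q e \<longrightarrow> P e))" by (intro DP_conj DP_imp DP_not assms)
  then show ?thesis by (rule DP_cong) auto
qed

lemma DP_if:
  assumes "DP M B \<Gamma> C" "DP M B \<Gamma> P" "DP M B \<Gamma> Q"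
  shows "DP M B \<Gamma> (\<lambda>e. if C e then P e else Q e)"
proof -
  have "DP M B \<Gamma> (\<lambda>e. (C e \<longrightarrow> P e) \<and> (\<not> C e \<longrightarrow> Q e))" by (intro DP_conj DP_imp DP_not assms)
  then show ?thesis by (rule DP_cong) auto
qed

lemma DP_ball_nat: "(\<And>i. i < k \<Longrightarrow> DP M B \<Gamma> (P i)) \<Longrightarrow> DP M B \<Gamma> (\<lambda>e. \<forall>i<(k::nat). P i e)"
proof (induction k)
  case 0
  then show ?case using DP_True by simp
next
  case (Suc k)
  then have "DP M B \<Gamma> (\<lambda>e. (\<forall>i<k. P i e) \<and> P k e)" by (intro DP_conj) auto
  then show ?case by (rule DP_cong) (auto simp: less_Suc_eq)
qed

text \<open>One quantifier per component. Distinctness of \<open>vs\<close> makes the iterated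
  updates agree with the simultaneous override.\<close>

lemma block_ex:
  "distinct vs \<Longrightarrow> length vs = length ss \<Longrightarrow> \<exists>\<phi>'. fv \<phi>' \<subseteq> fv \<phi> - set vs \<and>
    (\<forall>a. sat M a \<phi>' \<longleftrightarrow> (\<exists>u\<in>tuples M ss.
       sat M (\<lambda>v. case map_of (zip vs u) v of None \<Rightarrow> a v | Some y \<Rightarrow> y) \<phi>))"
proof (induction ss arbitrary: vs)
  case Nil
  then show ?case by (intro exI[of _ \<phi>]) auto
next
  case (Cons s ss)
  then obtain v ws where vs: "vs = v # ws" "v \<notin> set ws" "distinct ws" "length ws = length ss"
    by (cases vs) auto
  obtain \<phi>' where \<phi>': "fv \<phi>' \<subseteq> fv \<phi> - set ws" "\<And>a. sat M a \<phi>' \<longleftrightarrow> (\<exists>u\<in>tuples M ss.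
       sat M (\<lambda>v. case map_of (zip ws u) v of None \<Rightarrow> a v | Some y \<Rightarrow> y) \<phi>)"
    using Cons.IH[OF vs(3,4)] by blast
  have "(\<lambda>w. case map_of (zip ws u) w of None \<Rightarrow> (a(v := y)) w | Some y \<Rightarrow> y) =
      (\<lambda>w. case map_of (zip vs (y # u)) w of None \<Rightarrow> a w | Some y \<Rightarrow> y)"
    if "u \<in> tuples M ss" for u y a
    using vs tuples_length[OF that] by (auto simp: fun_eq_iff map_of_zip_is_None split: option.split
        dest: map_of_SomeD set_zip_leftD)
  then have "sat M a (Ex s v \<phi>') \<longleftrightarrow> (\<exists>u\<in>tuples M (s # ss).
       sat M (\<lambda>v. case map_of (zip vs u) v of None \<Rightarrow> a v | Some y \<Rightarrow> y) \<phi>)" for a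
    by (auto simp: \<phi>'(2) Cons_tuples Bex_def)
  then show ?case using \<phi>'(1) vs by (intro exI[of _ "Ex s v \<phi>'"]) auto
qed

lemma DP_ex:
  assumes "DP M B (case_nat ss \<Gamma>) (\<lambda>e. P (\<lambda>x. e (Suc x)) (e 0))"
  shows "DP M B \<Gamma> (\<lambda>e. \<exists>u\<in>tuples M ss. P e u)"
proof -
  obtain \<phi> bs where 1: "set bs \<subseteq> B" "fv \<phi> \<subseteq> scope (case_nat ss \<Gamma>) (length bs)"
    "\<And>e. e \<in> Env M (case_nat ss \<Gamma>) \<Longrightarrow> P (\<lambda>x. e (Suc x)) (e 0) \<longleftrightarrow> sat M (asg e bs) \<phi>"
    using assms by (auto simp: DP_def)
  \<comment> \<open>The components of slot 0 become variables just beyond the parameters, where they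
    are bound as a block; all other slots move down by one.\<close>
  define r where "r = (\<lambda>v. case sum_decode v of
      Inl w \<Rightarrow> (case prod_decode w of (x, i) \<Rightarrow> if x = 0 then par (length bs + i) else slot (x - 1) i)
      | Inr j \<Rightarrow> par j)"
  have r: "r (slot 0 i) = par (length bs + i)" "r (slot (Suc x) i) = slot x i" "r (par j) = par j" for x i j
    by (auto simp: r_def)
  obtain \<phi>' where \<phi>': "fv \<phi>' \<subseteq> r ` fv \<phi>" "\<And>e. sat M e \<phi>' \<longleftrightarrow> sat M (e \<circ> r) \<phi>"
    using rename_formula[of r \<phi> M] by blast
  define vs where "vs = map (\<lambda>i. par (length bs + i)) [0..<length ss]"
  have vs: "distinct vs" "length vs = length ss" by (auto simp: vs_def distinct_map inj_on_def)
  obtain \<psi> where \<psi>: "fv \<psi> \<subseteq> fv \<phi>' - set vs" "\<And>a. sat M a \<psi> \<longleftrightarrow> (\<exists>u\<in>tuples M ss.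
       sat M (\<lambda>v. case map_of (zip vs u) v of None \<Rightarrow> a v | Some y \<Rightarrow> y) \<phi>')"
    using block_ex[OF vs, of \<phi>' M] by blast
  show ?thesis
  proof (rule DPI[of bs _ \<psi>])
    show "set bs \<subseteq> B" by fact
    have "r v \<in> scope \<Gamma> (length bs) \<union> set vs" if "v \<in> scope (case_nat ss \<Gamma>) (length bs)" for v
      using that
    proof (cases v rule: var_cases)
      case (slot x i)
      then show ?thesis using that by (cases x) (auto simp: r vs_def)
    qed (use that in \<open>auto simp: r\<close>)
    then show "fv \<psi> \<subseteq> scope \<Gamma> (length bs)" using \<psi>(1) \<phi>'(1) 1(2) by blast
  next
    fix e assume e: "e \<in> Env M \<Gamma>"
    have "sat M (\<lambda>v. case map_of (zip vs u) v of None \<Rightarrow> asg e bs v | Some y \<Rightarrow> y) \<phi>' \<longleftrightarrow> P e u"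
      if u: "u \<in> tuples M ss" for u
    proof -
      let ?a = "\<lambda>v. case map_of (zip vs u) v of None \<Rightarrow> asg e bs v | Some y \<Rightarrow> y"
      have lu: "length u = length ss" by (rule tuples_length[OF u])
      have par1: "map_of (zip vs u) (par (length bs + i)) = Some (u ! i)" if "i < length ss" for i
      proof -
        have "vs ! i = par (length bs + i)" using that by (simp add: vs_def)
        then show ?thesis using map_of_zip_nth[of vs u i] vs lu that by metis
      qed
      have no: "map_of (zip vs u) v = None" if "v \<notin> set vs" for v
        using that vs lu by (simp add: map_of_zip_is_None)
      have "(?a \<circ> r) v = asg (case_nat u e) bs v" if "v \<in> scope (case_nat ss \<Gamma>) (length bs)" for v
        using that
      proof (cases v rule: var_cases)
        case (slot x i)
        show ?thesis
        proof (cases x)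
          case 0
          then show ?thesis using slot that par1 by (auto simp: r)
        next
          case (Suc y)
          have "slot y i \<notin> set vs" by (auto simp: vs_def)
          then show ?thesis using Suc slot that no[of "slot y i"] by (simp add: r)
        qed
      next
        case (par j)
        then have "par j \<notin> set vs" using that by (auto simp: vs_def)
        then show ?thesis using par no[of "par j"] by (simp add: r)
      qed
      then have "sat M (?a \<circ> r) \<phi> \<longleftrightarrow> sat M (asg (case_nat u e) bs) \<phi>"
        using 1(2) by (intro sat_cong) auto
      moreover have "case_nat u e \<in> Env M (case_nat ss \<Gamma>)" using e u by (simp add: Env_case)
      ultimately show ?thesis using 1(3)[of "case_nat u e"] \<phi>'(2) by simp
    qed
    then show "(\<exists>u\<in>tuples M ss. P e u) \<longleftrightarrow> sat M (asg e bs) \<psi>" by (auto simp: \<psi>(2))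
  qed
qed

lemma DP_all:
  assumes "DP M B (case_nat ss \<Gamma>) (\<lambda>e. P (\<lambda>x. e (Suc x)) (e 0))"
  shows "DP M B \<Gamma> (\<lambda>e. \<forall>u\<in>tuples M ss. P e u)"
  using DP_not[OF DP_ex[where P = "\<lambda>e u. \<not> P e u", OF DP_not[OF assms]]] by (rule DP_cong) auto

text \<open>\<open>h\<close> only rearranges components of the environment, as told by
  \<open>r\<close>, and this is a renaming of variables. Permuting, duplicating and regrouping slots
  are all instances.\<close>

lemma DP_rename:
  assumes "DP M B \<Gamma> P"
    and h: "\<And>e. e \<in> Env M \<Gamma>' \<Longrightarrow> h e \<in> Env M \<Gamma>"
      "\<And>e x i. e \<in> Env M \<Gamma>' \<Longrightarrow> i < length (\<Gamma> x) \<Longrightarrow> h e x ! i = e (fst (r (x, i))) ! snd (r (x, i))"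
    and r: "\<And>x i. i < length (\<Gamma> x) \<Longrightarrow> snd (r (x, i)) < length (\<Gamma>' (fst (r (x, i))))"
  shows "DP M B \<Gamma>' (\<lambda>e. P (h e))"
proof -
  obtain \<phi> bs where 1: "set bs \<subseteq> B" "fv \<phi> \<subseteq> scope \<Gamma> (length bs)"
    "\<And>e. e \<in> Env M \<Gamma> \<Longrightarrow> P e \<longleftrightarrow> sat M (asg e bs) \<phi>" using assms(1) by (auto simp: DP_def)
  define r' where "r' = (\<lambda>v. case sum_decode v of
      Inl w \<Rightarrow> (case r (prod_decode w) of (x, i) \<Rightarrow> slot x i) | Inr j \<Rightarrow> par j)"
  have r': "r' (slot x i) = slot (fst (r (x, i))) (snd (r (x, i)))" "r' (par j) = par j" for x i j
    by (auto simp: r'_def split: prod.split)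
  obtain \<phi>' where \<phi>': "fv \<phi>' \<subseteq> r' ` fv \<phi>" "\<And>e. sat M e \<phi>' \<longleftrightarrow> sat M (e \<circ> r') \<phi>"
    using rename_formula[of r' \<phi> M] by blast
  show ?thesis
  proof (rule DPI[of bs _ \<phi>'])
    show "set bs \<subseteq> B" by fact
    have "r' v \<in> scope \<Gamma>' (length bs)" if "v \<in> scope \<Gamma> (length bs)" for v
      using that by (cases v rule: var_cases) (auto simp: r' r)
    then show "fv \<phi>' \<subseteq> scope \<Gamma>' (length bs)" using \<phi>'(1) 1(2) by blast
  next
    fix e assume e: "e \<in> Env M \<Gamma>'"
    have "(asg e bs \<circ> r') v = asg (h e) bs v" if "v \<in> scope \<Gamma> (length bs)" for v
      using that by (cases v rule: var_cases) (auto simp: r' h(2)[OF e])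
    then have "sat M (asg e bs \<circ> r') \<phi> \<longleftrightarrow> sat M (asg (h e) bs) \<phi>" using 1(2) by (intro sat_cong) auto
    then show "P (h e) \<longleftrightarrow> sat M (asg e bs) \<phi>'" using 1(3)[OF h(1)[OF e]] \<phi>'(2) by simp
  qed
qed

text \<open>A slot with the empty list of sorts can only hold the empty tuple, so it has no
  counterpart in the new context; this is why the substituted environment is \<open>[]\<close>
  there.\<close>

lemma DP_reindex:
  assumes "DP M B \<Gamma> P" "\<And>x. \<Gamma> x = [] \<or> \<Gamma>' (f x) = \<Gamma> x"
  shows "DP M B \<Gamma>' (\<lambda>e. P (\<lambda>x. if \<Gamma> x = [] then [] else e (f x)))"
proof (rule DP_rename[where r = "\<lambda>(x, i). (f x, i)", OF assms(1)])
  show "(\<lambda>x. if \<Gamma> x = [] then [] else e (f x)) \<in> Env M \<Gamma>" if e: "e \<in> Env M \<Gamma>'" for e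
  proof -
    have "(if \<Gamma> x = [] then [] else e (f x)) \<in> tuples M (\<Gamma> x)" for x
    proof (cases "\<Gamma> x = []")
      case False
      then have "\<Gamma>' (f x) = \<Gamma> x" using assms(2)[of x] by blast
      then show ?thesis using Env_nth[OF e, of "f x"] False by (simp only: if_False)
    qed simp
    then show ?thesis by (simp only: Env_def mem_Collect_eq) blast
  qed
  fix x i assume i: "i < length (\<Gamma> x)"
  then have "\<Gamma> x \<noteq> []" by auto
  then show "(if \<Gamma> x = [] then [] else e (f x)) ! i = e (fst (case (x, i) of (x, i) \<Rightarrow> (f x, i))) !
      snd (case (x, i) of (x, i) \<Rightarrow> (f x, i))" for e
    by simp
  show "snd (case (x, i) of (x, i) \<Rightarrow> (f x, i)) < length (\<Gamma>' (fst (case (x, i) of (x, i) \<Rightarrow> (f x, i))))"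
    using assms(2)[of x] i \<open>\<Gamma> x \<noteq> []\<close> by simp
qed

subsection \<open>Definable terms\<close>

definition DT ::
    "('a, 's, 'r) fostruct \<Rightarrow> 'a set \<Rightarrow> (nat \<Rightarrow> 's list) \<Rightarrow> 's list \<Rightarrow> ((nat \<Rightarrow> 'a list) \<Rightarrow> 'a list) \<Rightarrow> bool" where
  "DT M B \<Gamma> ss t \<longleftrightarrow> (\<forall>e\<in>Env M \<Gamma>. t e \<in> tuples M ss) \<and>
     DP M B (case_nat ss \<Gamma>) (\<lambda>e. e 0 = t (\<lambda>x. e (Suc x)))"

lemma DT_tuples: "DT M B \<Gamma> ss t \<Longrightarrow> e \<in> Env M \<Gamma> \<Longrightarrow> t e \<in> tuples M ss"
  by (simp add: DT_def)

text \<open>The language has no function symbols. A definable function is substituted by quantifying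
  over its value, which its graph determines.\<close>

lemma DP_cut:
  assumes "DT M B \<Gamma> ss t" "DP M B (case_nat ss \<Gamma>) (\<lambda>e. P (e 0) (\<lambda>x. e (Suc x)))"
  shows "DP M B \<Gamma> (\<lambda>e. P (t e) e)"
proof -
  have "DP M B \<Gamma> (\<lambda>e. \<exists>u\<in>tuples M ss. u = t e \<and> P u e)"
    using assms by (intro DP_ex DP_conj) (auto simp: DT_def)
  then show ?thesis by (rule DP_cong) (use DT_tuples[OF assms(1)] in auto)
qed

lemma DP_eq_slots: "\<Gamma> x = \<Gamma> y \<Longrightarrow> DP M B \<Gamma> (\<lambda>e. e x = e y)"
proof -
  assume *: "\<Gamma> x = \<Gamma> y"
  have "DP M B \<Gamma> (\<lambda>e. \<forall>i<length (\<Gamma> x). e x ! i = e y ! i)"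
    by (rule DP_ball_nat, rule DPI[of "[]" _ "Equal (slot x _) (slot y _)"]) (use * in auto)
  then show ?thesis
    by (rule DP_cong) (use * Env_nth tuples_eq_iff in \<open>metis (no_types)\<close>)
qed

lemma DT_slot: "\<Gamma> x = ss \<Longrightarrow> DT M B \<Gamma> ss (\<lambda>e. e x)"
  unfolding DT_def using DP_eq_slots[of "case_nat ss \<Gamma>" 0 "Suc x" M B] by (auto dest: Env_nth)

lemma DT_const:
  assumes "u \<in> tuples M ss" "set u \<subseteq> B"
  shows "DT M B \<Gamma> ss (\<lambda>e. u)"
proof -
  have "DP M B (case_nat ss \<Gamma>) (\<lambda>e. \<forall>i<length ss. e 0 ! i = u ! i)"
    by (rule DP_ball_nat, rule DPI[of u _ "Equal (slot 0 _) (par _)"])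
      (use assms tuples_length[OF assms(1)] in auto)
  then have "DP M B (case_nat ss \<Gamma>) (\<lambda>e. e 0 = u)"
    by (rule DP_cong) (rule tuples_eq_iff[OF Env_head assms(1)])
  then show ?thesis using assms by (simp add: DT_def)
qed

lemma DP_weaken1:
  assumes "DP M B (case_nat ts \<Gamma>) P"
  shows "DP M B (case_nat ts (case_nat ss \<Gamma>)) (\<lambda>e. P (case_nat (e 0) (\<lambda>x. e (Suc (Suc x)))))"
proof (rule DP_rename[OF assms, where r = "\<lambda>(x, i). (if x = 0 then 0 else Suc x, i)"])
  fix e assume e: "e \<in> Env M (case_nat ts (case_nat ss \<Gamma>))"
  show "case_nat (e 0) (\<lambda>x. e (Suc (Suc x))) \<in> Env M (case_nat ts \<Gamma>)"
    using Env_head[OF e] Env_tail[OF Env_tail[OF e]] by (simp add: Env_case)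
  show "case_nat (e 0) (\<lambda>x. e (Suc (Suc x))) x ! i =
      e (fst (case (x, i) of (x, i) \<Rightarrow> (if x = 0 then 0 else Suc x, i))) !
      snd (case (x, i) of (x, i) \<Rightarrow> (if x = 0 then 0 else Suc x, i))" for x i
    by (cases x) auto
next
  fix x i assume "i < length (case x of 0 \<Rightarrow> ts | Suc x \<Rightarrow> \<Gamma> x)"
  then show "snd (case (x, i) of (x, i) \<Rightarrow> (if x = 0 then 0 else Suc x, i)) <
      length (case fst (case (x, i) of (x, i) \<Rightarrow> (if x = 0 then 0 else Suc x, i)) of
        0 \<Rightarrow> ts | Suc x \<Rightarrow> case x of 0 \<Rightarrow> ss | Suc x \<Rightarrow> \<Gamma> x)"
    by (cases x) auto
qed

lemma DT_weaken:
  assumes "DT M B \<Gamma> ts t"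
  shows "DT M B (case_nat ss \<Gamma>) ts (\<lambda>e. t (\<lambda>x. e (Suc x)))"
proof -
  have "DP M B (case_nat ts \<Gamma>) (\<lambda>e. e 0 = t (\<lambda>x. e (Suc x)))" using assms by (simp add: DT_def)
  from DP_weaken1[OF this] show ?thesis using assms by (auto simp: DT_def dest: Env_tail)
qed

lemma DP_eq:
  assumes "DT M B \<Gamma> ss s" "DT M B \<Gamma> ss t"
  shows "DP M B \<Gamma> (\<lambda>e. s e = t e)"
  by (rule DP_cut[OF assms(1), where P = "\<lambda>u e. u = t e"]) (use assms(2) in \<open>simp add: DT_def\<close>)

lemma DT_append:
  assumes "DT M B \<Gamma> ss s" "DT M B \<Gamma> ts t"
  shows "DT M B \<Gamma> (ss @ ts) (\<lambda>e. s e @ t e)"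
proof -
  \<comment> \<open>Slots 0 and 1 hold the two parts and slot 2 the whole, where equality is
    componentwise; afterwards \<open>DP_cut\<close> replaces the parts by \<open>s\<close> and
    \<open>t\<close>.\<close>
  let ?G = "case_nat ss (case_nat ts (case_nat (ss @ ts) \<Gamma>))"
  have "DP M B ?G (\<lambda>e. \<forall>i<length (ss @ ts). if i < length ss then e 2 ! i = e 0 ! i else e 2 ! i = e 1 ! (i - length ss))"
  proof (rule DP_ball_nat)
    fix i assume "i < length (ss @ ts)"
    then show "DP M B ?G (\<lambda>e. if i < length ss then e 2 ! i = e 0 ! i else e 2 ! i = e 1 ! (i - length ss))"
      by (cases "i < length ss"; intro DPI[of "[]" _ "Equal (slot 2 i) (if i < length ss then slot 0 i else slot 1 (i - length ss))"])
        (auto simp: numeral_2_eq_2)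
  qed
  then have "DP M B ?G (\<lambda>e. e 2 = e 0 @ e 1)"
  proof (rule DP_cong)
    fix e assume e: "e \<in> Env M ?G"
    have "e 0 \<in> tuples M ss" "e 1 \<in> tuples M ts" "e 2 \<in> tuples M (ss @ ts)"
      using Env_nth[OF e, of 0] Env_nth[OF e, of 1] Env_nth[OF e, of 2] by (auto simp: numeral_2_eq_2)
    then have "length (e 0) = length ss" "length (e 1) = length ts" "length (e 2) = length (ss @ ts)"
      by (auto dest: tuples_length)
    then show "(\<forall>i<length (ss @ ts). if i < length ss then e 2 ! i = e 0 ! i else e 2 ! i = e 1 ! (i - length ss)) \<longleftrightarrow> e 2 = e 0 @ e 1"
      by (auto simp: list_eq_iff_nth_eq nth_append)
  qed
  then have "DP M B ?G (\<lambda>e. (\<lambda>u e. (\<lambda>v e. e 0 = u @ v) (e 0) (\<lambda>x. e (Suc x))) (e 0) (\<lambda>x. e (Suc x)))"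
    by (simp add: numeral_2_eq_2)
  from DP_cut[OF DT_weaken[OF DT_weaken[OF assms(1)]] this]
  have "DP M B (case_nat ts (case_nat (ss @ ts) \<Gamma>)) (\<lambda>e. (\<lambda>v e. e 0 = s (\<lambda>x. e (Suc x)) @ v) (e 0) (\<lambda>x. e (Suc x)))"
    by simp
  from DP_cut[OF DT_weaken[OF assms(2)] this]
  have "DP M B (case_nat (ss @ ts) \<Gamma>) (\<lambda>e. e 0 = s (\<lambda>x. e (Suc x)) @ t (\<lambda>x. e (Suc x)))" by simp
  then show ?thesis using assms by (auto simp: DT_def intro: append_tuplesI)
qed

text \<open>Every slot has the empty list of sorts and so a single possible value. A predicate over
  this context, extended by some slots in front, depends on those slots alone and can later be moved
  to any context.\<close>

definition closed_ctx :: "nat \<Rightarrow> 's list" where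
  "closed_ctx = (\<lambda>_. [])"

lemma DP_closed1:
  assumes "DP M B (case_nat ss closed_ctx) (\<lambda>e. P (e 0))"
  shows "DP M B (case_nat ss \<Gamma>) (\<lambda>e. P (e 0))"
proof -
  have "DP M B (case_nat ss \<Gamma>) (\<lambda>e. P (if ss = [] then [] else e 0))"
    using DP_reindex[OF assms, where f = "\<lambda>x. x" and \<Gamma>' = "case_nat ss \<Gamma>"]
    by (auto simp: closed_ctx_def split: nat.split)
  then show ?thesis by (rule DP_cong) (auto dest!: Env_head)
qed

subsection \<open>Definable sets\<close>

definition DS :: "('a, 's, 'r) fostruct \<Rightarrow> 'a set \<Rightarrow> 's list \<Rightarrow> 'a list set \<Rightarrow> bool" where
  "DS M B ss X \<longleftrightarrow> X \<subseteq> tuples M ss \<and> DP M B (case_nat ss closed_ctx) (\<lambda>e. e 0 \<in> X)"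

lemma DS_subset: "DS M B ss X \<Longrightarrow> X \<subseteq> tuples M ss"
  by (simp add: DS_def)

lemma DP_in:
  assumes "DS M B ss X" "DT M B \<Gamma> ss t"
  shows "DP M B \<Gamma> (\<lambda>e. t e \<in> X)"
  by (rule DP_cut[OF assms(2), where P = "\<lambda>u e. u \<in> X"]) (use assms(1) DP_closed1 in \<open>auto simp: DS_def\<close>)

lemma DP_bex:
  assumes "DS M B ss X" "DP M B (case_nat ss \<Gamma>) (\<lambda>e. P (\<lambda>x. e (Suc x)) (e 0))"
  shows "DP M B \<Gamma> (\<lambda>e. \<exists>u\<in>X. P e u)"
proof -
  have "DP M B \<Gamma> (\<lambda>e. \<exists>u\<in>tuples M ss. u \<in> X \<and> P e u)"
    by (intro DP_ex DP_conj assms(2) DP_in[OF assms(1)] DT_slot) simp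
  then show ?thesis by (rule DP_cong) (use assms(1) in \<open>auto simp: DS_def\<close>)
qed

lemma DP_ball:
  assumes "DS M B ss X" "DP M B (case_nat ss \<Gamma>) (\<lambda>e. P (\<lambda>x. e (Suc x)) (e 0))"
  shows "DP M B \<Gamma> (\<lambda>e. \<forall>u\<in>X. P e u)"
  using DP_not[OF DP_bex[where P = "\<lambda>e u. \<not> P e u", OF assms(1) DP_not[OF assms(2)]]]
  by (rule DP_cong) auto

lemma DP_mono: "DP M B \<Gamma> P \<Longrightarrow> B \<subseteq> B' \<Longrightarrow> DP M B' \<Gamma> P"
  unfolding DP_def by (meson order_trans)

text \<open>Position \<open>v\<close> of the tuple becomes component \<open>v\<close> of slot 0, and
  the positions beyond the tuple become parameters.\<close>

lemma definable_overD:
  assumes "definable_over M B X"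
  shows "\<exists>ss. DS M B ss X"
proof -
  obtain ss \<phi> bs where *: "set bs \<subseteq> B" "fv \<phi> \<subseteq> {..<length ss + length bs}"
    "X = {as \<in> tuples M ss. holds M \<phi> (as @ bs)}" using assms by (auto simp: definable_over_def)
  define r where "r = (\<lambda>v. if v < length ss then slot 0 v else par (v - length ss))"
  obtain \<phi>' where \<phi>': "fv \<phi>' \<subseteq> r ` fv \<phi>" "\<And>e. sat M e \<phi>' \<longleftrightarrow> sat M (e \<circ> r) \<phi>"
    using rename_formula[of r \<phi> M] by blast
  have "DP M B (case_nat ss closed_ctx) (\<lambda>e. e 0 \<in> X)"
  proof (rule DPI[of bs _ \<phi>'])
    show "fv \<phi>' \<subseteq> scope (case_nat ss closed_ctx) (length bs)"
    proof
      fix w assume "w \<in> fv \<phi>'"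
      then obtain v where "w = r v" "v \<in> fv \<phi>" using \<phi>'(1) by auto
      then show "w \<in> scope (case_nat ss closed_ctx) (length bs)" using *(2) by (auto simp: r_def)
    qed
    fix e assume "e \<in> Env M (case_nat ss closed_ctx)"
    then have e: "e 0 \<in> tuples M ss" by (rule Env_head)
    have "sat M (asg e bs \<circ> r) \<phi> \<longleftrightarrow> sat M ((!) (e 0 @ bs)) \<phi>"
      using tuples_length[OF e] by (intro sat_cong) (auto simp: r_def nth_append)
    then show "e 0 \<in> X \<longleftrightarrow> sat M (asg e bs) \<phi>'" using e by (simp add: *(3) holds_def \<phi>'(2))
  qed fact
  then show ?thesis using *(3) by (auto simp: DS_def)
qed

lemma definable_overI:
  assumes "DS M B ss X"
  shows "definable_over M B X"
proof -
  obtain \<phi> bs where 1: "set bs \<subseteq> B" "fv \<phi> \<subseteq> scope (case_nat ss closed_ctx) (length bs)"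
    "\<And>e. e \<in> Env M (case_nat ss closed_ctx) \<Longrightarrow> e 0 \<in> X \<longleftrightarrow> sat M (asg e bs) \<phi>"
    using assms by (auto simp: DS_def DP_def)
  define r where "r = (\<lambda>v. case sum_decode v of Inl w \<Rightarrow> snd (prod_decode w) | Inr j \<Rightarrow> length ss + j)"
  have r: "r (slot x i) = i" "r (par j) = length ss + j" for x i j by (auto simp: r_def)
  obtain \<phi>' where \<phi>': "fv \<phi>' \<subseteq> r ` fv \<phi>" "\<And>e. sat M e \<phi>' \<longleftrightarrow> sat M (e \<circ> r) \<phi>"
    using rename_formula[of r \<phi> M] by blast
  have sc: "(\<exists>i<length ss. v = slot 0 i) \<or> (\<exists>j<length bs. v = par j)" if "v \<in> fv \<phi>" for v
    using 1(2) that by (cases v rule: var_cases) (auto simp: closed_ctx_def split: nat.splits)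
  have fv': "fv \<phi>' \<subseteq> {..<length ss + length bs}" using \<phi>'(1) sc by (fastforce simp: r)
  have "as \<in> X \<longleftrightarrow> holds M \<phi>' (as @ bs)" if as: "as \<in> tuples M ss" for as
  proof -
    let ?e = "case_nat as (\<lambda>_. [])"
    have "?e \<in> Env M (case_nat ss closed_ctx)" using as by (auto simp: Env_case) (auto simp: Env_def closed_ctx_def)
    then have "as \<in> X \<longleftrightarrow> sat M (asg ?e bs) \<phi>" using 1(3)[of ?e] by simp
    also have "\<dots> \<longleftrightarrow> sat M ((!) (as @ bs) \<circ> r) \<phi>"
    proof (rule sat_cong)
      fix v assume "v \<in> fv \<phi>"
      from sc[OF this] show "asg ?e bs v = ((!) (as @ bs) \<circ> r) v"
        using tuples_length[OF as] by (auto simp: r nth_append)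
    qed
    finally show ?thesis by (simp add: holds_def \<phi>'(2))
  qed
  then have "X = {as \<in> tuples M ss. holds M \<phi>' (as @ bs)}" using DS_subset[OF assms] by blast
  then show ?thesis unfolding definable_over_def using fv' 1(1) by blast
qed

section \<open>Eliminating imaginaries from formulas about real tuples\<close>

text \<open>The real sorts of a representative of an element of the given sort.\<close>

primrec rsorts :: "('s, 'r) eqsort \<Rightarrow> 's list" where
  "rsorts (Real s) = [s]"
| "rsorts (Quot ss \<phi>) = ss"

primrec valid_sort :: "('a, 's, 'r) fostruct \<Rightarrow> ('s, 'r) eqsort \<Rightarrow> bool" where
  "valid_sort M (Real s) \<longleftrightarrow> True"
| "valid_sort M (Quot ss \<phi>) \<longleftrightarrow> (ss, \<phi>) \<in> quotients M"

primrec elem_of :: "('a, 's, 'r) fostruct \<Rightarrow> ('s, 'r) eqsort \<Rightarrow> 'a list \<Rightarrow> ('a, 's, 'r) eqelem" where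
  "elem_of M (Real s) u = El (u ! 0)"
| "elem_of M (Quot ss \<phi>) u = Cls ss \<phi> (eqrel M ss \<phi> `` {u})"

lemma Carr_eq_struct:
  "Carr (eq_struct M) s = {elem_of M s u |u. u \<in> tuples M (rsorts s) \<and> valid_sort M s}"
proof (cases s)
  case (Real x)
  have *: "u \<in> tuples M [x] \<longleftrightarrow> (\<exists>a\<in>Carr M x. u = [a])" for u by (auto simp: Cons_tuples)
  have "\<exists>u. El a = El (u ! 0) \<and> (\<exists>b\<in>Carr M x. u = [b])" if "a \<in> Carr M x" for a
    using that by (intro exI[of _ "[a]"]) auto
  with * show ?thesis by (auto simp: Real eq_struct_def)
next
  case (Quot ss \<phi>)
  then show ?thesis by (auto simp: eq_struct_def quotient_def)
qed

lemma map_El_eq: "map El u = map El v \<longleftrightarrow> u = v"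
  by (rule inj_map_eq_map) (simp add: inj_def)

lemma quotients_eq_iff:
  assumes "(ss, \<phi>) \<in> quotients M" "u \<in> tuples M ss" "v \<in> tuples M ss"
  shows "eqrel M ss \<phi> `` {u} = eqrel M ss \<phi> `` {v} \<longleftrightarrow> holds M \<phi> (u @ v)"
proof -
  have "equiv (tuples M ss) (eqrel M ss \<phi>)" using assms(1) by (simp add: quotients_def)
  from eq_equiv_class_iff[OF this assms(2,3)] show ?thesis using assms by (simp add: eqrel_def)
qed

text \<open>The variable \<open>x\<close> of sort \<open>\<sigma> x\<close> is replaced by the block of the real variables
  \<open>prod_encode (x, i)\<close>.\<close>

definition block :: "nat \<Rightarrow> ('s, 'r) eqsort \<Rightarrow> (nat \<Rightarrow> 'a) \<Rightarrow> 'a list" where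
  "block x s \<epsilon> = map (\<lambda>i. \<epsilon> (prod_encode (x, i))) [0..<length (rsorts s)]"

definition good_block :: "('a, 's, 'r) fostruct \<Rightarrow> nat \<Rightarrow> ('s, 'r) eqsort \<Rightarrow> (nat \<Rightarrow> 'a) \<Rightarrow> bool" where
  "good_block M x s \<epsilon> \<longleftrightarrow> block x s \<epsilon> \<in> tuples M (rsorts s) \<and> valid_sort M s"

definition block_vars :: "('s, 'r) eqsort \<Rightarrow> nat \<Rightarrow> nat set" where
  "block_vars s x = {prod_encode (x, i) |i. i < length (rsorts s)}"

lemma length_block [simp]: "length (block x s \<epsilon>) = length (rsorts s)"
  by (simp add: block_def)

lemma block_nth [simp]: "i < length (rsorts s) \<Longrightarrow> block x s \<epsilon> ! i = \<epsilon> (prod_encode (x, i))"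
  by (simp add: block_def)

text \<open>The formula of an equivalence relation expects its two arguments at the first
  \<open>2 * length ss\<close> variables; here they are read off at arbitrary places
  \<open>r\<close> and \<open>r'\<close>.\<close>

lemma class_formula:
  assumes "fv \<chi> \<subseteq> {..<2 * length ss}"
  shows "\<exists>\<psi>. fv \<psi> \<subseteq> r ` {..<length ss} \<union> r' ` {..<length ss} \<and>
    (\<forall>\<epsilon>. sat M \<epsilon> \<psi> \<longleftrightarrow> holds M \<chi> (map (\<lambda>i. \<epsilon> (r i)) [0..<length ss] @ map (\<lambda>i. \<epsilon> (r' i)) [0..<length ss]))"
proof -
  define q where "q = (\<lambda>v. if v < length ss then r v else r' (v - length ss))"
  obtain \<psi> where \<psi>: "fv \<psi> \<subseteq> q ` fv \<chi>" "\<And>e. sat M e \<psi> \<longleftrightarrow> sat M (e \<circ> q) \<chi>"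
    using rename_formula[of q \<chi> M] by blast
  have "fv \<psi> \<subseteq> r ` {..<length ss} \<union> r' ` {..<length ss}"
  proof
    fix w assume "w \<in> fv \<psi>"
    then obtain v where v: "v \<in> fv \<chi>" "w = q v" using \<psi>(1) by auto
    then have "v < 2 * length ss" using assms by auto
    then have "v - length ss < length ss \<or> v < length ss" by auto
    then show "w \<in> r ` {..<length ss} \<union> r' ` {..<length ss}" using v by (auto simp: q_def)
  qed
  moreover have "sat M \<epsilon> \<psi> \<longleftrightarrow> holds M \<chi> (map (\<lambda>i. \<epsilon> (r i)) [0..<length ss] @ map (\<lambda>i. \<epsilon> (r' i)) [0..<length ss])" for \<epsilon>
    unfolding \<psi>(2) holds_def
  proof (rule sat_cong)
    fix v assume "v \<in> fv \<chi>"
    then have "v < 2 * length ss" using assms by auto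
    then have "v < length ss \<or> \<not> v < length ss \<and> v - length ss < length ss" by auto
    then show "(\<epsilon> \<circ> q) v = (map (\<lambda>i. \<epsilon> (r i)) [0..<length ss] @ map (\<lambda>i. \<epsilon> (r' i)) [0..<length ss]) ! v"
      by (auto simp: q_def nth_append)
  qed
  ultimately show ?thesis by blast
qed

lemma false_formula: "\<exists>\<psi>. fv \<psi> = {} \<and> (\<forall>\<epsilon>. \<not> sat M \<epsilon> \<psi>)"
  by (rule exI[of _ "Ex undefined 0 (Neg (Equal 0 0))"]) auto

text \<open>Each imaginary variable is replaced by a block of variables for a representative.
  Equality of classes and the projections become the equivalence formula between blocks, and an atom
  that cannot hold for the given sorts becomes a false formula. Disjointness of the real carriers
  ensures that an ill-sorted projection atom is indeed false. As a quantifier changes the sort of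
  its variable, the induction is over all assignments \<open>\<sigma>\<close> of sorts.\<close>

lemma real_translation:
  assumes disj: "\<And>s s'. s \<noteq> s' \<Longrightarrow> Carr M s \<inter> Carr M s' = {}"
  shows "\<exists>\<psi>. fv \<psi> \<subseteq> (\<Union>x\<in>fv \<phi>. block_vars (\<sigma> x) x) \<and>
    (\<forall>\<epsilon>. (\<forall>x\<in>fv \<phi>. good_block M x (\<sigma> x) \<epsilon>) \<longrightarrow>
       sat M \<epsilon> \<psi> \<longleftrightarrow> sat (eq_struct M) (\<lambda>x. elem_of M (\<sigma> x) (block x (\<sigma> x) \<epsilon>)) \<phi>)"
proof (induction \<phi> arbitrary: \<sigma>)
  case (Rel R xs)
  let ?e = "\<lambda>\<epsilon> x. elem_of M (\<sigma> x) (block x (\<sigma> x) \<epsilon>)"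
  show ?case
  proof (cases R)
    case (Base q)
    show ?thesis
    proof (cases "\<forall>x\<in>set xs. \<exists>s. \<sigma> x = Real s")
      case True
      have "map (?e \<epsilon>) xs = map El (map (\<lambda>x. \<epsilon> (prod_encode (x, 0))) xs)" for \<epsilon>
        using True by (auto simp: block_def)
      moreover have "map El u \<in> map El ` Intp M q \<longleftrightarrow> u \<in> Intp M q" for u
        by (auto simp: inj_map_eq_map[of El] inj_def)
      ultimately have "map (?e \<epsilon>) xs \<in> map El ` Intp M q \<longleftrightarrow> map (\<lambda>x. \<epsilon> (prod_encode (x, 0))) xs \<in> Intp M q" for \<epsilon>
        by (simp only:)
      moreover have "prod_encode (x, 0) \<in> block_vars (\<sigma> x) x" if "x \<in> set xs" for x
        using True that by (auto simp: block_vars_def)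
      ultimately show ?thesis
        by (intro exI[of _ "Rel q (map (\<lambda>x. prod_encode (x, 0)) xs)"])
          (auto simp: Base eq_struct_def comp_def)
    next
      case False
      then obtain x ss \<chi> where x: "x \<in> set xs" "\<sigma> x = Quot ss \<chi>" by (metis eqsort.exhaust)
      have "map (?e \<epsilon>) xs \<notin> map El ` Intp M q" for \<epsilon>
      proof
        assume "map (?e \<epsilon>) xs \<in> map El ` Intp M q"
        then obtain u where "map (?e \<epsilon>) xs = map El u" by blast
        then have "set (map (?e \<epsilon>) xs) = El ` set u" by (simp only: set_map)
        moreover have "?e \<epsilon> x \<in> set (map (?e \<epsilon>) xs)" using x(1) by simp
        ultimately show False using x(2) by auto
      qed
      then show ?thesis using false_formula[of M] by (auto simp: Base eq_struct_def)
    qed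
  next
    case (Proj ss \<chi>)
    \<comment> \<open>These are the only assignments of sorts under which the projection atom can
      hold.\<close>
    define shape where "shape \<longleftrightarrow> (ss, \<chi>) \<in> quotients M \<and> (\<exists>ys y. xs = ys @ [y] \<and> length ys = length ss \<and>
      (\<forall>i<length ss. \<sigma> (ys ! i) = Real (ss ! i)) \<and> \<sigma> y = Quot ss \<chi>)"
    show ?thesis
    proof (cases shape)
      case True
      then obtain ys y where ys: "xs = ys @ [y]" "length ys = length ss" "(ss, \<chi>) \<in> quotients M"
        "\<And>i. i < length ss \<Longrightarrow> \<sigma> (ys ! i) = Real (ss ! i)" "\<sigma> y = Quot ss \<chi>" by (auto simp: shape_def)
      have fvs: "fv \<chi> \<subseteq> {..<2 * length ss}" using ys(3) by (auto simp: quotients_def)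
      obtain \<psi> where \<psi>: "fv \<psi> \<subseteq> (\<lambda>i. prod_encode (ys ! i, 0)) ` {..<length ss} \<union> (\<lambda>i. prod_encode (y, i)) ` {..<length ss}"
        "\<And>\<epsilon>. sat M \<epsilon> \<psi> \<longleftrightarrow> holds M \<chi> (map (\<lambda>i. \<epsilon> (prod_encode (ys ! i, 0))) [0..<length ss] @ map (\<lambda>i. \<epsilon> (prod_encode (y, i))) [0..<length ss])"
        using class_formula[OF fvs, of "\<lambda>i. prod_encode (ys ! i, 0)" "\<lambda>i. prod_encode (y, i)" M] by blast
      have "sat M \<epsilon> \<psi> \<longleftrightarrow> map (?e \<epsilon>) xs \<in> eq_intp M (Proj ss \<chi>)" if g: "\<forall>x\<in>set xs. good_block M x (\<sigma> x) \<epsilon>" for \<epsilon>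
      proof -
        let ?u = "map (\<lambda>i. \<epsilon> (prod_encode (ys ! i, 0))) [0..<length ss]"
        let ?v = "map (\<lambda>i. \<epsilon> (prod_encode (y, i))) [0..<length ss]"
        have "\<epsilon> (prod_encode (ys ! i, 0)) \<in> Carr M (ss ! i)" if "i < length ss" for i
        proof -
          have "ys ! i \<in> set xs" using ys(1,2) that by simp
          then have "good_block M (ys ! i) (Real (ss ! i)) \<epsilon>" using g ys(4)[OF that] by metis
          then show ?thesis by (auto simp: good_block_def block_def Cons_tuples)
        qed
        then have u: "?u \<in> tuples M ss" by (auto simp: tuples_def list_all2_conv_all_nth)
        have "good_block M y (Quot ss \<chi>) \<epsilon>" using g ys(1,5) by (metis in_set_conv_decomp)
        then have v: "?v \<in> tuples M ss" by (auto simp: good_block_def block_def)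
        have "map (?e \<epsilon>) ys = map El ?u"
          by (rule nth_equalityI) (use ys in \<open>auto simp: block_def\<close>)
        moreover have "?e \<epsilon> y = Cls ss \<chi> (eqrel M ss \<chi> `` {?v})" using ys by (simp add: block_def)
        ultimately have e: "map (?e \<epsilon>) xs = map El ?u @ [Cls ss \<chi> (eqrel M ss \<chi> `` {?v})]"
          by (simp only: ys(1) map_append list.map)
        have "map (?e \<epsilon>) xs \<in> eq_intp M (Proj ss \<chi>) \<longleftrightarrow> eqrel M ss \<chi> `` {?v} = eqrel M ss \<chi> `` {?u}"
          unfolding e eq_intp.simps using u ys(3) by (auto simp del: map_map simp add: map_El_eq)
        also have "\<dots> \<longleftrightarrow> holds M \<chi> (?u @ ?v)" using quotients_eq_iff[OF ys(3) u v] by auto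
        finally show ?thesis by (simp add: \<psi>(2))
      qed
      moreover have "fv \<psi> \<subseteq> (\<Union>x\<in>set xs. block_vars (\<sigma> x) x)"
      proof
        fix w assume "w \<in> fv \<psi>"
        then consider i where "i < length ss" "w = prod_encode (ys ! i, 0)" | i where "i < length ss" "w = prod_encode (y, i)"
          using \<psi>(1) by auto
        then show "w \<in> (\<Union>x\<in>set xs. block_vars (\<sigma> x) x)"
        proof cases
          case 1
          then have "w \<in> block_vars (\<sigma> (ys ! i)) (ys ! i)" using ys(4) by (auto simp: block_vars_def)
          then show ?thesis using 1 ys(1,2) by auto
        next
          case 2
          then show ?thesis using ys by (auto simp: block_vars_def)
        qed
      qed
      ultimately show ?thesis by (intro exI[of _ \<psi>]) (simp add: Proj eq_struct_def comp_def)
    next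
      case False
      have "map (?e \<epsilon>) xs \<notin> eq_intp M (Proj ss \<chi>)" if g: "\<forall>x\<in>set xs. good_block M x (\<sigma> x) \<epsilon>" for \<epsilon>
      proof
        assume "map (?e \<epsilon>) xs \<in> eq_intp M (Proj ss \<chi>)"
        then obtain u where u: "map (?e \<epsilon>) xs = map El u @ [Cls ss \<chi> (eqrel M ss \<chi> `` {u})]"
          "(ss, \<chi>) \<in> quotients M" "u \<in> tuples M ss" by auto
        then obtain ys y where ys: "xs = ys @ [y]" by (cases xs rule: rev_cases) auto
        then have e: "map (?e \<epsilon>) ys = map El u" "?e \<epsilon> y = Cls ss \<chi> (eqrel M ss \<chi> `` {u})" using u(1) by auto
        have len: "length ys = length ss" using e(1) tuples_length[OF u(3)] by (metis length_map)
        have "\<sigma> y = Quot ss \<chi>" using e(2) by (cases "\<sigma> y") auto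
        moreover have "\<sigma> (ys ! i) = Real (ss ! i)" if "i < length ss" for i
        proof -
          have "?e \<epsilon> (ys ! i) = El (u ! i)" 
            using arg_cong[OF e(1), of "\<lambda>w. w ! i"] that len tuples_length[OF u(3)] by simp
          then obtain s where s: "\<sigma> (ys ! i) = Real s" "u ! i = \<epsilon> (prod_encode (ys ! i, 0))"
            by (cases "\<sigma> (ys ! i)") (auto simp: block_def)
          have "good_block M (ys ! i) (\<sigma> (ys ! i)) \<epsilon>" using g ys that len by auto
          then have "u ! i \<in> Carr M s" using s by (auto simp: good_block_def block_def Cons_tuples)
          moreover have "u ! i \<in> Carr M (ss ! i)" using tuples_nth[OF u(3) that] .
          ultimately have "s = ss ! i" using disj by blast
          then show ?thesis using s by simp
        qed
        ultimately have shape using ys len u(2) by (auto simp: shape_def)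
        then show False using False by simp
      qed
      moreover obtain \<psi> where "fv \<psi> = {}" "\<And>\<epsilon>. \<not> sat M \<epsilon> \<psi>" using false_formula[of M] by blast
      ultimately show ?thesis by (intro exI[of _ \<psi>]) (simp add: Proj eq_struct_def)
    qed
  qed
next
  case (Equal x y)
  let ?e = "\<lambda>\<epsilon> x. elem_of M (\<sigma> x) (block x (\<sigma> x) \<epsilon>)"
  show ?case
  proof (cases "\<exists>s s'. \<sigma> x = Real s \<and> \<sigma> y = Real s'")
    case True
    then show ?thesis
      by (intro exI[of _ "Equal (prod_encode (x, 0)) (prod_encode (y, 0))"]) (auto simp: block_def block_vars_def)
  next
    case F: False
    show ?thesis
    proof (cases "\<exists>ss \<chi>. \<sigma> x = Quot ss \<chi> \<and> \<sigma> y = Quot ss \<chi> \<and> (ss, \<chi>) \<in> quotients M")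
      case True
      then obtain ss \<chi> where s: "\<sigma> x = Quot ss \<chi>" "\<sigma> y = Quot ss \<chi>" and q: "(ss, \<chi>) \<in> quotients M" by blast
      have fvs: "fv \<chi> \<subseteq> {..<2 * length ss}" using q by (auto simp: quotients_def)
      obtain \<psi> where \<psi>: "fv \<psi> \<subseteq> (\<lambda>i. prod_encode (x, i)) ` {..<length ss} \<union> (\<lambda>i. prod_encode (y, i)) ` {..<length ss}"
        "\<And>\<epsilon>. sat M \<epsilon> \<psi> \<longleftrightarrow> holds M \<chi> (block x (\<sigma> x) \<epsilon> @ block y (\<sigma> y) \<epsilon>)"
        using class_formula[OF fvs, of "\<lambda>i. prod_encode (x, i)" "\<lambda>i. prod_encode (y, i)" M] s by (auto simp: block_def)
      then show ?thesis using s q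
        by (intro exI[of _ \<psi>]) (fastforce simp: good_block_def quotients_eq_iff[OF q] block_vars_def)
    next
      case False
      have "?e \<epsilon> x \<noteq> ?e \<epsilon> y" if "good_block M x (\<sigma> x) \<epsilon>" for \<epsilon>
        using F False that by (cases "\<sigma> x"; cases "\<sigma> y") (auto simp: good_block_def)
      then show ?thesis using false_formula[of M] by auto
    qed
  qed
next
  case (Neg \<phi>)
  from Neg[of \<sigma>] obtain \<psi> where "fv \<psi> \<subseteq> (\<Union>x\<in>fv \<phi>. block_vars (\<sigma> x) x) \<and>
    (\<forall>\<epsilon>. (\<forall>x\<in>fv \<phi>. good_block M x (\<sigma> x) \<epsilon>) \<longrightarrow>
       sat M \<epsilon> \<psi> = sat (eq_struct M) (\<lambda>x. elem_of M (\<sigma> x) (block x (\<sigma> x) \<epsilon>)) \<phi>)" ..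
  then show ?case by (intro exI[of _ "Neg \<psi>"]) simp
next
  case (Conj \<phi>1 \<phi>2)
  from Conj(1)[of \<sigma>] obtain \<psi>1 where 1: "fv \<psi>1 \<subseteq> (\<Union>x\<in>fv \<phi>1. block_vars (\<sigma> x) x) \<and>
    (\<forall>\<epsilon>. (\<forall>x\<in>fv \<phi>1. good_block M x (\<sigma> x) \<epsilon>) \<longrightarrow>
       sat M \<epsilon> \<psi>1 = sat (eq_struct M) (\<lambda>x. elem_of M (\<sigma> x) (block x (\<sigma> x) \<epsilon>)) \<phi>1)" ..
  from Conj(2)[of \<sigma>] obtain \<psi>2 where 2: "fv \<psi>2 \<subseteq> (\<Union>x\<in>fv \<phi>2. block_vars (\<sigma> x) x) \<and>
    (\<forall>\<epsilon>. (\<forall>x\<in>fv \<phi>2. good_block M x (\<sigma> x) \<epsilon>) \<longrightarrow>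
       sat M \<epsilon> \<psi>2 = sat (eq_struct M) (\<lambda>x. elem_of M (\<sigma> x) (block x (\<sigma> x) \<epsilon>)) \<phi>2)" ..
  from 1 2 show ?case by (intro exI[of _ "Conj \<psi>1 \<psi>2"]) auto
next
  case (Ex s x \<phi>)
  let ?\<sigma> = "\<sigma>(x := s)"
  from Ex[of ?\<sigma>] obtain \<psi> where \<psi>: "fv \<psi> \<subseteq> (\<Union>y\<in>fv \<phi>. block_vars (?\<sigma> y) y)"
    "\<And>\<epsilon>. (\<forall>y\<in>fv \<phi>. good_block M y (?\<sigma> y) \<epsilon>) \<Longrightarrow>
       sat M \<epsilon> \<psi> \<longleftrightarrow> sat (eq_struct M) (\<lambda>y. elem_of M (?\<sigma> y) (block y (?\<sigma> y) \<epsilon>)) \<phi>" by blast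
  show ?case
  proof (cases "valid_sort M s")
    case False
    \<comment> \<open>A formula that does not define an equivalence relation gives an empty sort,
      over which nothing exists.\<close>
    then have "Carr (eq_struct M) s = {}" by (simp add: Carr_eq_struct)
    then show ?thesis using false_formula[of M] by auto
  next
    case True
    define vs where "vs = map (\<lambda>i. prod_encode (x, i)) [0..<length (rsorts s)]"
    have vs: "distinct vs" "length vs = length (rsorts s)" "set vs = block_vars s x"
      by (auto simp: vs_def distinct_map inj_on_def prod_encode_eq block_vars_def)
    obtain \<theta> where \<theta>: "fv \<theta> \<subseteq> fv \<psi> - set vs" "\<And>a. sat M a \<theta> \<longleftrightarrow> (\<exists>u\<in>tuples M (rsorts s).
       sat M (\<lambda>v. case map_of (zip vs u) v of None \<Rightarrow> a v | Some y \<Rightarrow> y) \<psi>)"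
      using block_ex[OF vs(1,2), of \<psi> M] by blast
    have "fv \<theta> \<subseteq> (\<Union>y\<in>fv (Ex s x \<phi>). block_vars (\<sigma> y) y)"
    proof
      fix w assume "w \<in> fv \<theta>"
      then have w: "w \<in> fv \<psi>" "w \<notin> block_vars s x" using \<theta>(1) vs(3) by auto
      then obtain y where "y \<in> fv \<phi>" "w \<in> block_vars (?\<sigma> y) y" using \<psi>(1) by blast
      then show "w \<in> (\<Union>y\<in>fv (Ex s x \<phi>). block_vars (\<sigma> y) y)" using w(2) by (cases "y = x") auto
    qed
    moreover have "sat M \<epsilon> \<theta> \<longleftrightarrow>
        sat (eq_struct M) (\<lambda>x. elem_of M (\<sigma> x) (block x (\<sigma> x) \<epsilon>)) (Ex s x \<phi>)"
      if g: "\<forall>y\<in>fv (Ex s x \<phi>). good_block M y (\<sigma> y) \<epsilon>" for \<epsilon>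
    proof -
      have "sat M (\<lambda>v. case map_of (zip vs u) v of None \<Rightarrow> \<epsilon> v | Some y \<Rightarrow> y) \<psi> \<longleftrightarrow>
          sat (eq_struct M) ((\<lambda>x. elem_of M (\<sigma> x) (block x (\<sigma> x) \<epsilon>))(x := elem_of M s u)) \<phi>"
        if u: "u \<in> tuples M (rsorts s)" for u
      proof -
        let ?\<epsilon> = "\<lambda>v. case map_of (zip vs u) v of None \<Rightarrow> \<epsilon> v | Some y \<Rightarrow> y"
        have lu: "length u = length (rsorts s)" by (rule tuples_length[OF u])
        have "?\<epsilon> (prod_encode (x, i)) = u ! i" if "i < length (rsorts s)" for i
        proof -
          have "vs ! i = prod_encode (x, i)" using that by (simp add: vs_def)
          then have "map_of (zip vs u) (prod_encode (x, i)) = Some (u ! i)"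
            using map_of_zip_nth[of vs u i] vs(1,2) lu that by metis
          then show ?thesis by simp
        qed
        then have bx: "block x s ?\<epsilon> = u" using lu by (auto intro!: nth_equalityI)
        have "?\<epsilon> (prod_encode (y, i)) = \<epsilon> (prod_encode (y, i))" if "y \<noteq> x" for y i
        proof -
          have "prod_encode (y, i) \<notin> set vs" using that by (auto simp: vs_def prod_encode_eq)
          then have "map_of (zip vs u) (prod_encode (y, i)) = None" using vs lu by (simp add: map_of_zip_is_None)
          then show ?thesis by simp
        qed
        then have by': "block y s' ?\<epsilon> = block y s' \<epsilon>" if "y \<noteq> x" for y s' using that by (simp add: block_def)
        have gb: "good_block M y (?\<sigma> y) ?\<epsilon>" if "y \<in> fv \<phi>" for y
          using g that True u by (cases "y = x") (auto simp: good_block_def bx by')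
        have "sat M ?\<epsilon> \<psi> \<longleftrightarrow> sat (eq_struct M) (\<lambda>y. elem_of M (?\<sigma> y) (block y (?\<sigma> y) ?\<epsilon>)) \<phi>"
          by (rule \<psi>(2)) (use gb in blast)
        also have "(\<lambda>y. elem_of M (?\<sigma> y) (block y (?\<sigma> y) ?\<epsilon>)) =
            (\<lambda>x. elem_of M (\<sigma> x) (block x (\<sigma> x) \<epsilon>))(x := elem_of M s u)"
          by (rule ext) (simp add: bx by')
        finally show ?thesis .
      qed
      then show ?thesis using True by (auto simp: \<theta>(2) Carr_eq_struct)
    qed
    ultimately show ?thesis by blast
  qed
qed

lemma map_El_tuples: "map El u \<in> tuples (eq_struct M) (map Real ss) \<longleftrightarrow> u \<in> tuples M ss"
  by (auto simp: tuples_def list_all2_conv_all_nth eq_struct_def)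

lemma tuples_Real: "v \<in> tuples (eq_struct M) (map Real ss) \<longleftrightarrow> (\<exists>u\<in>tuples M ss. v = map El u)"
proof (induction ss arbitrary: v)
  case (Cons s ss)
  have "v \<in> tuples (eq_struct M) (map Real (s # ss)) \<longleftrightarrow>
      (\<exists>a\<in>Carr M s. \<exists>u\<in>tuples M ss. v = map El (a # u))"
    unfolding list.map Cons_tuples Cons.IH by (auto simp: eq_struct_def)
  also have "\<dots> \<longleftrightarrow> (\<exists>u\<in>tuples M (s # ss). v = map El u)"
  proof
    assume "\<exists>a\<in>Carr M s. \<exists>u\<in>tuples M ss. v = map El (a # u)"
    then obtain a u where "a \<in> Carr M s" "u \<in> tuples M ss" "v = map El (a # u)" by blast
    then show "\<exists>u\<in>tuples M (s # ss). v = map El u" by (intro bexI[of _ "a # u"]) (simp_all add: Cons_tuples)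
  next
    assume "\<exists>u\<in>tuples M (s # ss). v = map El u"
    then show "\<exists>a\<in>Carr M s. \<exists>u\<in>tuples M ss. v = map El (a # u)" by (force simp: Cons_tuples)
  qed
  finally show ?case .
qed simp

text \<open>Imaginary parameters are replaced by the components of chosen representatives, so that
  none arise if none were allowed. This transfers definability to the real structure, where the
  induction axiom for \<open>F(K)\<close> is stated and where the formulas of quotient sorts
  live.\<close>

lemma real_definable:
  assumes disj: "\<And>s s'. s \<noteq> s' \<Longrightarrow> Carr M s \<inter> Carr M s' = {}"
    and X: "DS (eq_struct M) B (map Real ss) X" and B: "B \<subseteq> univ (eq_struct M)"
  shows "\<exists>\<phi> bs. set bs \<subseteq> univ M \<and> (B = {} \<longrightarrow> bs = []) \<and> fv \<phi> \<subseteq> {..<length ss + length bs} \<and>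
    (\<forall>u\<in>tuples M ss. map El u \<in> X \<longleftrightarrow> holds M \<phi> (u @ bs))"
proof -
  obtain ss' \<phi> bs where 1: "set bs \<subseteq> B" "fv \<phi> \<subseteq> {..<length ss' + length bs}"
    "X = {as \<in> tuples (eq_struct M) ss'. holds (eq_struct M) \<phi> (as @ bs)}"
    using definable_overI[OF X] by (auto simp: definable_over_def)
  show ?thesis
  proof (cases "length ss' = length ss \<and> tuples (eq_struct M) ss' \<inter> tuples (eq_struct M) (map Real ss) \<noteq> {}")
    case False
    \<comment> \<open>The sorts \<open>ss'\<close> of the defining formula need not be those of
      \<open>X\<close>; without a common tuple \<open>X\<close> has no member of the form
      \<open>map El u\<close>.\<close>
    then have "map El u \<notin> X" if "u \<in> tuples M ss" for u
      using that 1(3) map_El_tuples[of u M ss] tuples_length[of "map El u" "eq_struct M" ss'] tuples_length[of u M ss]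
      by auto
    then show ?thesis using false_formula[of M] unfolding holds_def
      by (metis append_Nil2 empty_iff empty_set empty_subsetI list.size(3))
  next
    case True
    then obtain w where w: "w \<in> tuples (eq_struct M) ss'" "w \<in> tuples (eq_struct M) (map Real ss)" by blast
    have "ss' = map Real ss"
    proof (rule nth_equalityI)
      show "length ss' = length (map Real ss)" using True by simp
      fix i assume i: "i < length ss'"
      then have a: "w ! i \<in> Carr (eq_struct M) (ss' ! i)" "w ! i \<in> Carr (eq_struct M) (Real (ss ! i))"
        using tuples_nth[OF w(1), of i] tuples_nth[OF w(2), of i] True by auto
      then obtain s where "ss' ! i = Real s" by (cases "ss' ! i") (auto simp: eq_struct_def)
      then show "ss' ! i = map Real ss ! i" using a disj[of s "ss ! i"] i True by (auto simp: eq_struct_def)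
    qed
    note 1 = 1[unfolded this length_map]
    obtain ts where ts: "bs \<in> tuples (eq_struct M) ts" using univ_tuples[of bs "eq_struct M"] 1(1) B by blast
    have lts: "length bs = length ts" using tuples_length[OF ts] .
    have "\<forall>j\<in>{..<length ts}. \<exists>u. bs ! j = elem_of M (ts ! j) u \<and> u \<in> tuples M (rsorts (ts ! j)) \<and> valid_sort M (ts ! j)"
      using tuples_nth[OF ts] by (auto simp: Carr_eq_struct)
    from bchoice[OF this] obtain R where R: "\<And>j. j < length ts \<Longrightarrow> bs ! j = elem_of M (ts ! j) (R j) \<and>
        R j \<in> tuples M (rsorts (ts ! j)) \<and> valid_sort M (ts ! j)" by auto
    define \<sigma> where "\<sigma> = (\<lambda>x. (map Real ss @ ts) ! x)"
    define \<epsilon> where "\<epsilon> = (\<lambda>u v. case prod_decode v of (x, i) \<Rightarrow> if x < length ss then u ! x else R (x - length ss) ! i)"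
    obtain \<psi> where \<psi>: "fv \<psi> \<subseteq> (\<Union>x\<in>fv \<phi>. block_vars (\<sigma> x) x)"
      "\<And>\<epsilon>. (\<forall>x\<in>fv \<phi>. good_block M x (\<sigma> x) \<epsilon>) \<Longrightarrow>
         sat M \<epsilon> \<psi> \<longleftrightarrow> sat (eq_struct M) (\<lambda>x. elem_of M (\<sigma> x) (block x (\<sigma> x) \<epsilon>)) \<phi>"
      using real_translation[where \<phi> = \<phi> and \<sigma> = \<sigma>, OF disj] by blast
    \<comment> \<open>The variables of \<open>\<psi>\<close> that belong to blocks of parameters.
      They are finitely many, and listing them in \<open>L\<close> turns their values into a list of
      real parameters.\<close>
    define V where "V = {v \<in> fv \<psi>. length ss \<le> fst (prod_decode v)}"
    have fV: "finite V" using finite_fv[of \<psi>] by (auto simp: V_def)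
    define L where "L = sorted_list_of_set V"
    have setL: "set L = V" using fV by (simp add: L_def)
    define pos where "pos = (\<lambda>v. SOME p. p < length L \<and> L ! p = v)"
    have pos: "pos v < length L \<and> L ! pos v = v" if "v \<in> V" for v
      unfolding pos_def by (rule someI_ex) (use that setL in \<open>auto simp: in_set_conv_nth\<close>)
    define r where "r = (\<lambda>v. if v \<in> V then length ss + pos v else fst (prod_decode v))"
    obtain \<theta> where \<theta>: "fv \<theta> \<subseteq> r ` fv \<psi>" "\<And>e. sat M e \<theta> \<longleftrightarrow> sat M (e \<circ> r) \<psi>"
      using rename_formula[of r \<psi> M] by blast
    let ?bs = "map (\<epsilon> undefined) L"
    have shape: "\<exists>x i. v = prod_encode (x, i) \<and> x \<in> fv \<phi> \<and> i < length (rsorts (\<sigma> x))" if "v \<in> fv \<psi>" for v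
      using that \<psi>(1) by (fastforce simp: block_vars_def)
    have \<epsilon>V: "\<epsilon> u v = \<epsilon> u' v" if "v \<in> V" for v u u' using that by (auto simp: V_def \<epsilon>_def split: prod.split)
    have "set ?bs \<subseteq> univ M"
    proof
      fix a assume "a \<in> set ?bs"
      then obtain v where v: "v \<in> V" "a = \<epsilon> undefined v" using setL by auto
      then obtain x i where x: "v = prod_encode (x, i)" "x \<in> fv \<phi>" "i < length (rsorts (\<sigma> x))" "length ss \<le> x"
        using shape[of v] by (auto simp: V_def)
      then have xj: "x - length ss < length ts" using 1(2) lts by auto
      have "\<sigma> x = ts ! (x - length ss)" using x by (simp add: \<sigma>_def nth_append)
      then have "R (x - length ss) ! i \<in> Carr M (rsorts (\<sigma> x) ! i)"
        using R[OF xj] x(3) by (auto intro: tuples_nth)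
      then show "a \<in> univ M" using v x by (auto simp: \<epsilon>_def univ_def)
    qed
    moreover have "?bs = []" if "B = {}"
    proof -
      have "bs = []" using that 1(1) by auto
      then have "V = {}" using 1(2) shape by (fastforce simp: V_def)
      then show ?thesis using setL by simp
    qed
    moreover have "fv \<theta> \<subseteq> {..<length ss + length ?bs}"
    proof
      fix w assume "w \<in> fv \<theta>"
      then obtain v where v: "v \<in> fv \<psi>" "w = r v" using \<theta>(1) by auto
      then show "w \<in> {..<length ss + length ?bs}" using pos[of v] by (auto simp: r_def V_def)
    qed
    moreover have "map El u \<in> X \<longleftrightarrow> holds M \<theta> (u @ ?bs)" if u: "u \<in> tuples M ss" for u
    proof -
      have lu: "length u = length ss" by (rule tuples_length[OF u])
      have bl: "block x (\<sigma> x) (\<epsilon> u) = (if x < length ss then [u ! x] else R (x - length ss))" if "x < length ss + length ts" for x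
      proof (cases "x < length ss")
        case False
        then have "length (R (x - length ss)) = length (rsorts (\<sigma> x))"
          using that R[of "x - length ss"] tuples_length[of "R (x - length ss)" M "rsorts (ts ! (x - length ss))"]
          by (simp add: \<sigma>_def nth_append)
        then show ?thesis using False by (auto simp: \<epsilon>_def intro!: nth_equalityI)
      qed (auto simp: block_def \<epsilon>_def \<sigma>_def nth_append)
      have gb: "good_block M x (\<sigma> x) (\<epsilon> u)" if "x < length ss + length ts" for x
        using bl[OF that] that R[of "x - length ss"] tuples_nth[OF u, of x]
        by (cases "x < length ss") (auto simp: good_block_def \<sigma>_def nth_append Cons_tuples)
      have "holds M \<theta> (u @ ?bs) \<longleftrightarrow> sat M ((!) (u @ ?bs) \<circ> r) \<psi>" by (simp add: holds_def \<theta>(2))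
      also have "\<dots> \<longleftrightarrow> sat M (\<epsilon> u) \<psi>"
      proof (rule sat_cong)
        fix v assume v: "v \<in> fv \<psi>"
        show "((!) (u @ ?bs) \<circ> r) v = \<epsilon> u v"
        proof (cases "v \<in> V")
          case True
          then show ?thesis using pos[OF True] lu \<epsilon>V[OF True, of undefined u] by (simp add: r_def nth_append)
        next
          case False
          then have "fst (prod_decode v) < length ss" using v by (auto simp: V_def)
          then show ?thesis using False lu by (auto simp: r_def nth_append \<epsilon>_def split: prod.split)
        qed
      qed
      also have "\<dots> \<longleftrightarrow> sat (eq_struct M) (\<lambda>x. elem_of M (\<sigma> x) (block x (\<sigma> x) (\<epsilon> u))) \<phi>"
        by (rule \<psi>(2)) (use gb 1(2) lts in auto)
      also have "\<dots> \<longleftrightarrow> sat (eq_struct M) ((!) (map El u @ bs)) \<phi>"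
      proof (rule sat_cong)
        fix x assume "x \<in> fv \<phi>"
        then have x: "x < length ss + length ts" using 1(2) lts by auto
        then show "elem_of M (\<sigma> x) (block x (\<sigma> x) (\<epsilon> u)) = (map El u @ bs) ! x"
          using R[of "x - length ss"] lu bl[OF x] by (cases "x < length ss") (auto simp: \<sigma>_def nth_append)
      qed
      also have "\<dots> \<longleftrightarrow> map El u \<in> X" using u by (simp add: 1(3) holds_def map_El_tuples)
      finally show ?thesis by simp
    qed
    ultimately show ?thesis by blast
  qed
qed

section \<open>Definability in the structure of imaginaries of a field\<close>

abbreviation kS :: "(sort, sym) eqsort list" where "kS \<equiv> [Real KSort]"
abbreviation fS :: "(sort, sym) eqsort list" where "fS \<equiv> [Real FSort]"

abbreviation fel :: "'f \<Rightarrow> ('k, 'f) keq" where "fel A \<equiv> El (FEl A)"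

abbreviation UU :: "('k::field \<Rightarrow> 'f \<Rightarrow> bool) \<Rightarrow> ('k, 'f) keq set" where
  "UU mem \<equiv> univ (Keq mem)"

definition kval :: "('k, 'f) keq list \<Rightarrow> 'k" where "kval u = (THE x. u = [kel x])"
definition sval :: "('k, 'f) keq list \<Rightarrow> 'f" where "sval u = (THE A. u = [fel A])"

lemma kval [simp]: "kval [kel x] = x" and sval [simp]: "sval [fel A] = A"
  by (auto simp: kval_def sval_def)

lemma kS_tuples: "u \<in> tuples (Keq mem) kS \<longleftrightarrow> u = [kel (kval u)]"
  by (auto simp: Cons_tuples Keq_def eq_struct_def KK_def)

lemma fS_tuples: "u \<in> tuples (Keq mem) fS \<longleftrightarrow> u = [fel (sval u)]"
  by (auto simp: Cons_tuples Keq_def eq_struct_def KK_def)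

lemma kel_tuples [simp]: "[kel x] \<in> tuples (Keq mem) kS"
  by (simp add: kS_tuples)

lemma fel_tuples [simp]: "[fel x] \<in> tuples (Keq mem) fS"
  by (simp add: fS_tuples)

lemma kel_Carr [simp]: "kel x \<in> Carr (Keq mem) (Real KSort)" "fel A \<in> Carr (Keq mem) (Real FSort)"
  by (auto simp: Keq_def eq_struct_def KK_def)

lemma ex_kS: "(\<exists>u\<in>tuples (Keq mem) kS. P u) \<longleftrightarrow> (\<exists>x. P [kel x])"
  by (metis kS_tuples kel_tuples)

lemma ex_fS: "(\<exists>u\<in>tuples (Keq mem) fS. P u) \<longleftrightarrow> (\<exists>x. P [fel x])"
  by (metis fS_tuples fel_tuples)

lemma kel_univ [simp]: "kel x \<in> UU mem" "fel A \<in> UU mem"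
  using tuples_subset_univ[OF kel_tuples, of x mem] tuples_subset_univ[OF fel_tuples, of A mem] by simp_all

definition DK :: "('k::field \<Rightarrow> 'f \<Rightarrow> bool) \<Rightarrow> ('k, 'f) keq set \<Rightarrow> (nat \<Rightarrow> (sort, sym) eqsort list)
    \<Rightarrow> ((nat \<Rightarrow> ('k, 'f) keq list) \<Rightarrow> 'k) \<Rightarrow> bool" where
  "DK mem B \<Gamma> t \<longleftrightarrow> DT (Keq mem) B \<Gamma> kS (\<lambda>e. [kel (t e)])"

definition DF :: "('k::field \<Rightarrow> 'f \<Rightarrow> bool) \<Rightarrow> ('k, 'f) keq set \<Rightarrow> (nat \<Rightarrow> (sort, sym) eqsort list)
    \<Rightarrow> ((nat \<Rightarrow> ('k, 'f) keq list) \<Rightarrow> 'f) \<Rightarrow> bool" where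
  "DF mem B \<Gamma> t \<longleftrightarrow> DT (Keq mem) B \<Gamma> fS (\<lambda>e. [fel (t e)])"

text \<open>The rules follow the syntax of predicates and terms, so that a definability proof
  consists in reading off the expression.\<close>

named_theorems dp

lemmas [dp] = DP_const DP_not DP_conj DP_imp DP_disj DP_iff DP_if DP_ball DP_bex DP_in DP_eq DT_append

lemma DT_slot' [dp]: "ss = \<Gamma> x \<Longrightarrow> DT M B \<Gamma> ss (\<lambda>e. e x)"
  by (rule DT_slot) simp

lemma DT_cong: "DT M B \<Gamma> ss t \<Longrightarrow> (\<And>e. e \<in> Env M \<Gamma> \<Longrightarrow> t e = t' e) \<Longrightarrow> DT M B \<Gamma> ss t'"
  unfolding DT_def by (auto elim!: DP_cong dest: Env_tail)

lemma DK_slot [dp]: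
  assumes "kS = \<Gamma> x"
  shows "DK mem B \<Gamma> (\<lambda>e. kval (e x))"
  unfolding DK_def
proof (rule DT_cong[OF DT_slot[of \<Gamma> x, OF assms[symmetric]]])
  fix e assume "e \<in> Env (Keq mem) \<Gamma>"
  then have "e x \<in> tuples (Keq mem) kS" using assms Env_nth by metis
  then show "e x = [kel (kval (e x))]" by (rule kS_tuples[THEN iffD1])
qed

lemma DF_slot [dp]:
  assumes "fS = \<Gamma> x"
  shows "DF mem B \<Gamma> (\<lambda>e. sval (e x))"
  unfolding DF_def
proof (rule DT_cong[OF DT_slot[of \<Gamma> x, OF assms[symmetric]]])
  fix e assume "e \<in> Env (Keq mem) \<Gamma>"
  then have "e x \<in> tuples (Keq mem) fS" using assms Env_nth by metis
  then show "e x = [fel (sval (e x))]" by (rule fS_tuples[THEN iffD1])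
qed

lemma DT_kel [dp]: "DK mem B \<Gamma> t \<Longrightarrow> DT (Keq mem) B \<Gamma> kS (\<lambda>e. [kel (t e)])"
  by (simp add: DK_def)

lemma DT_fel [dp]: "DF mem B \<Gamma> t \<Longrightarrow> DT (Keq mem) B \<Gamma> fS (\<lambda>e. [fel (t e)])"
  by (simp add: DF_def)

lemma DT_kel_Cons [dp]:
  "DK mem B \<Gamma> t \<Longrightarrow> DT (Keq mem) B \<Gamma> ss u \<Longrightarrow> DT (Keq mem) B \<Gamma> (Real KSort # ss) (\<lambda>e. kel (t e) # u e)"
  using DT_append[of "Keq mem" B \<Gamma> kS "\<lambda>e. [kel (t e)]" ss u] by (simp add: DK_def)

lemma DT_fel_Cons [dp]:
  "DF mem B \<Gamma> t \<Longrightarrow> DT (Keq mem) B \<Gamma> ss u \<Longrightarrow> DT (Keq mem) B \<Gamma> (Real FSort # ss) (\<lambda>e. fel (t e) # u e)"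
  using DT_append[of "Keq mem" B \<Gamma> fS "\<lambda>e. [fel (t e)]" ss u] by (simp add: DF_def)

lemma DP_ex_k [dp]:
  assumes "DP (Keq mem) B (case_nat kS \<Gamma>) (\<lambda>e. P (\<lambda>x. e (Suc x)) (kval (e 0)))"
  shows "DP (Keq mem) B \<Gamma> (\<lambda>e. \<exists>x. P e x)"
  using DP_ex[where P = "\<lambda>e u. P e (kval u)", OF assms] by (rule DP_cong) (simp add: ex_kS)

lemma DP_ex_f [dp]:
  assumes "DP (Keq mem) B (case_nat fS \<Gamma>) (\<lambda>e. P (\<lambda>x. e (Suc x)) (sval (e 0)))"
  shows "DP (Keq mem) B \<Gamma> (\<lambda>e. \<exists>x. P e x)"
  using DP_ex[where P = "\<lambda>e u. P e (sval u)", OF assms] by (rule DP_cong) (simp add: ex_fS)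

lemma DP_all_k [dp]:
  assumes "DP (Keq mem) B (case_nat kS \<Gamma>) (\<lambda>e. P (\<lambda>x. e (Suc x)) (kval (e 0)))"
  shows "DP (Keq mem) B \<Gamma> (\<lambda>e. \<forall>x. P e x)"
  using DP_not[OF DP_ex_k[where P = "\<lambda>e x. \<not> P e x", OF DP_not[OF assms]]] by (rule DP_cong) simp

lemma DP_all_f [dp]:
  assumes "DP (Keq mem) B (case_nat fS \<Gamma>) (\<lambda>e. P (\<lambda>x. e (Suc x)) (sval (e 0)))"
  shows "DP (Keq mem) B \<Gamma> (\<lambda>e. \<forall>x. P e x)"
  using DP_not[OF DP_ex_f[where P = "\<lambda>e x. \<not> P e x", OF DP_not[OF assms]]] by (rule DP_cong) simp

lemma DP_cut_k:
  assumes "DK mem B \<Gamma> t" "DP (Keq mem) B (case_nat kS \<Gamma>) (\<lambda>e. P (kval (e 0)) (\<lambda>x. e (Suc x)))"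
  shows "DP (Keq mem) B \<Gamma> (\<lambda>e. P (t e) e)"
  using DP_cut[OF assms(1)[unfolded DK_def], where P = "\<lambda>u. P (kval u)", OF assms(2)] by simp

lemma DP_cut_f:
  assumes "DF mem B \<Gamma> t" "DP (Keq mem) B (case_nat fS \<Gamma>) (\<lambda>e. P (sval (e 0)) (\<lambda>x. e (Suc x)))"
  shows "DP (Keq mem) B \<Gamma> (\<lambda>e. P (t e) e)"
  using DP_cut[OF assms(1)[unfolded DF_def], where P = "\<lambda>u. P (sval u)", OF assms(2)] by simp

lemma DK_weaken: "DK mem B \<Gamma> t \<Longrightarrow> DK mem B (case_nat ss \<Gamma>) (\<lambda>e. t (\<lambda>x. e (Suc x)))"
  unfolding DK_def by (rule DT_weaken)

lemma DF_weaken: "DF mem B \<Gamma> t \<Longrightarrow> DF mem B (case_nat ss \<Gamma>) (\<lambda>e. t (\<lambda>x. e (Suc x)))"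
  unfolding DF_def by (rule DT_weaken)

lemma DP_eq_k [dp]: "DK mem B \<Gamma> s \<Longrightarrow> DK mem B \<Gamma> t \<Longrightarrow> DP (Keq mem) B \<Gamma> (\<lambda>e. s e = t e)"
  using DP_eq[of "Keq mem" B \<Gamma> kS "\<lambda>e. [kel (s e)]" "\<lambda>e. [kel (t e)]"] by (simp add: DK_def)

lemma DKI:
  assumes "DP (Keq mem) B (case_nat kS \<Gamma>) (\<lambda>e. kval (e 0) = t (\<lambda>x. e (Suc x)))"
  shows "DK mem B \<Gamma> t"
  unfolding DK_def DT_def
proof
  show "DP (Keq mem) B (case_nat kS \<Gamma>) (\<lambda>e. e 0 = [kel (t (\<lambda>x. e (Suc x)))])"
    by (rule DP_cong[OF assms]) (metis Env_head kS_tuples kval)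
qed simp

lemma DK_const [dp]: "kel c \<in> B \<Longrightarrow> DK mem B \<Gamma> (\<lambda>e. c)"
  unfolding DK_def by (rule DT_const) auto

lemma DF_const [dp]: "fel c \<in> B \<Longrightarrow> DF mem B \<Gamma> (\<lambda>e. c)"
  unfolding DF_def by (rule DT_const) auto

lemma DP_base3:
  assumes q: "Intp (KK mem) q = {[KEl x, KEl y, KEl (h x y)] |x y. True}"
  shows "DP (Keq mem) B (case_nat kS (case_nat kS (case_nat kS \<Gamma>)))
    (\<lambda>e. h (kval (e (Suc 0))) (kval (e 0)) = kval (e (Suc (Suc 0))))" (is "DP _ _ ?G _")
proof (rule DPI[of "[]" _ "Rel (Base q) [slot 1 0, slot 0 0, slot 2 0]"])
  fix e assume e: "e \<in> Env (Keq mem) ?G"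
  have "e 0 = [kel (kval (e 0))]" "e (Suc 0) = [kel (kval (e (Suc 0)))]" "e (Suc (Suc 0)) = [kel (kval (e (Suc (Suc 0))))]"
    using Env_nth[OF e, of 0] Env_nth[OF e, of "Suc 0"] Env_nth[OF e, of "Suc (Suc 0)"] by (auto simp: kS_tuples)
  then obtain x y z where "e 0 = [kel y]" "e (Suc 0) = [kel x]" "e (Suc (Suc 0)) = [kel z]" by metis
  moreover have "[kel x, kel y, kel z] \<in> map El ` Intp (KK mem) q \<longleftrightarrow> h x y = z"
    using map_El_eq[of "[KEl x, KEl y, KEl z]"] unfolding q by (auto simp: image_iff)
  ultimately show "h (kval (e (Suc 0))) (kval (e 0)) = kval (e (Suc (Suc 0))) \<longleftrightarrow>
      sat (Keq mem) (asg e []) (Rel (Base q) [slot 1 0, slot 0 0, slot 2 0])"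
    by (simp add: Keq_def eq_struct_def numeral_2_eq_2)
qed (auto simp: numeral_2_eq_2)

lemma DK_op:
  assumes q: "Intp (KK mem) q = {[KEl x, KEl y, KEl (h x y)] |x y. True}"
    and "DK mem B \<Gamma> s" "DK mem B \<Gamma> t"
  shows "DK mem B \<Gamma> (\<lambda>e. h (s e) (t e))"
proof (rule DKI)
  have "DP (Keq mem) B (case_nat kS \<Gamma>) (\<lambda>e. h (s (\<lambda>x. e (Suc x))) (t (\<lambda>x. e (Suc x))) = kval (e 0))"
    by (rule DP_cut_k[where P = "\<lambda>u e. h u (t (\<lambda>x. e (Suc x))) = kval (e 0)", OF DK_weaken[OF assms(2)]],
        rule DP_cut_k[where P = "\<lambda>u e. h (kval (e 0)) u = kval (e (Suc 0))", OF DK_weaken[OF DK_weaken[OF assms(3)]]],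
        rule DP_base3[OF q])
  then show "DP (Keq mem) B (case_nat kS \<Gamma>) (\<lambda>e. kval (e 0) = h (s (\<lambda>x. e (Suc x))) (t (\<lambda>x. e (Suc x))))"
    by (rule DP_cong) auto
qed

lemma DK_add [dp]: "DK mem B \<Gamma> s \<Longrightarrow> DK mem B \<Gamma> t \<Longrightarrow> DK mem B \<Gamma> (\<lambda>e. s e + t e)"
  by (rule DK_op[of _ Add]) (auto simp: KK_def)

lemma DK_mult [dp]: "DK mem B \<Gamma> s \<Longrightarrow> DK mem B \<Gamma> t \<Longrightarrow> DK mem B \<Gamma> (\<lambda>e. s e * t e)"
  by (rule DK_op[of _ Mult]) (auto simp: KK_def)

lemma DK_zero [dp]: "DK mem B \<Gamma> (\<lambda>e. 0)"
proof (rule DKI)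
  have "DP (Keq mem) B (case_nat kS \<Gamma>) (\<lambda>e. kval (e 0) + kval (e 0) = kval (e 0))"
    by (intro dp) simp_all
  then show "DP (Keq mem) B (case_nat kS \<Gamma>) (\<lambda>e. kval (e 0) = 0)" by (rule DP_cong) (simp only: add_cancel_left_right)
qed

lemma DK_one [dp]: "DK mem B \<Gamma> (\<lambda>e. 1)"
proof (rule DKI)
  have "DP (Keq mem) B (case_nat kS \<Gamma>) (\<lambda>e. kval (e 0) * kval (e 0) = kval (e 0) \<and> kval (e 0) \<noteq> 0)"
    by (intro DK_zero dp) simp_all
  then show "DP (Keq mem) B (case_nat kS \<Gamma>) (\<lambda>e. kval (e 0) = 1)" by (rule DP_cong) auto
qed

lemma DK_diff [dp]:
  assumes "DK mem B \<Gamma> s" "DK mem B \<Gamma> t"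
  shows "DK mem B \<Gamma> (\<lambda>e. s e - t e)"
proof (rule DKI)
  have "DP (Keq mem) B (case_nat kS \<Gamma>) (\<lambda>e. kval (e 0) + t (\<lambda>x. e (Suc x)) = s (\<lambda>x. e (Suc x)))"
    by (intro DP_eq_k DK_add DK_slot DK_weaken assms) simp_all
  then show "DP (Keq mem) B (case_nat kS \<Gamma>) (\<lambda>e. kval (e 0) = s (\<lambda>x. e (Suc x)) - t (\<lambda>x. e (Suc x)))"
    by (rule DP_cong) (auto simp: algebra_simps)
qed

lemma DK_inverse [dp]:
  assumes "DK mem B \<Gamma> s"
  shows "DK mem B \<Gamma> (\<lambda>e. inverse (s e))"
proof (rule DKI)
  have "DP (Keq mem) B (case_nat kS \<Gamma>) (\<lambda>e. if s (\<lambda>x. e (Suc x)) = 0 then kval (e 0) = 0 else kval (e 0) * s (\<lambda>x. e (Suc x)) = 1)"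
    by (intro DP_if DP_eq_k DK_mult DK_slot DK_zero DK_one DK_weaken assms) simp_all
  then show "DP (Keq mem) B (case_nat kS \<Gamma>) (\<lambda>e. kval (e 0) = inverse (s (\<lambda>x. e (Suc x))))"
    by (rule DP_cong) (auto simp: field_simps split: if_splits)
qed

lemma DK_divide [dp]: "DK mem B \<Gamma> s \<Longrightarrow> DK mem B \<Gamma> t \<Longrightarrow> DK mem B \<Gamma> (\<lambda>e. s e / t e)"
  unfolding divide_inverse by (intro dp)

lemma DP_mem [dp]:
  assumes "DK mem B \<Gamma> s" "DF mem B \<Gamma> t"
  shows "DP (Keq mem) B \<Gamma> (\<lambda>e. mem (s e) (t e))"
proof -
  let ?G = "case_nat fS (case_nat kS \<Gamma>)"
  have "DP (Keq mem) B ?G (\<lambda>e. mem (kval (e (Suc 0))) (sval (e 0)))"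
  proof (rule DPI[of "[]" _ "Rel (Base Mem) [slot 1 0, slot 0 0]"])
    fix e assume e: "e \<in> Env (Keq mem) ?G"
    have "e 0 = [fel (sval (e 0))]" "e (Suc 0) = [kel (kval (e (Suc 0)))]"
      using Env_nth[OF e, of 0] Env_nth[OF e, of "Suc 0"] by (auto simp: kS_tuples fS_tuples)
    then obtain x A where "e 0 = [fel A]" "e (Suc 0) = [kel x]" by metis
    moreover have "[kel x, fel A] \<in> map El ` Intp (KK mem) Mem \<longleftrightarrow> mem x A"
      using map_El_eq[of "[KEl x, FEl A]"] by (auto simp: image_iff KK_def)
    ultimately show "mem (kval (e (Suc 0))) (sval (e 0)) \<longleftrightarrow>
        sat (Keq mem) (asg e []) (Rel (Base Mem) [slot 1 0, slot 0 0])"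
      by (simp add: Keq_def eq_struct_def)
  qed auto
  then have "DP (Keq mem) B (case_nat kS \<Gamma>) (\<lambda>e. mem (kval (e 0)) (t (\<lambda>x. e (Suc x))))"
    by (rule DP_cut_f[where P = "\<lambda>u e. mem (kval (e 0)) u", OF DF_weaken[OF assms(2)]])
  then show ?thesis by (rule DP_cut_k[where P = "\<lambda>u e. mem u (t e)", OF assms(1)])
qed

lemma KK_disjoint: "s \<noteq> s' \<Longrightarrow> Carr (KK mem) s \<inter> Carr (KK mem) s' = {}"
  by (cases s; cases s') (auto simp: KK_def)

lemma definable_iff: "definable M X \<longleftrightarrow> (\<exists>ss. DS M (univ M) ss X)"
  unfolding definable_def by (meson definable_overD definable_overI)

section \<open>Substitution into predicates over the closed context\<close>

lemma DP_closed:
  assumes "DP M B \<Delta> P" "\<And>x. \<Delta> x = [] \<or> \<Gamma> x = \<Delta> x"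
    and "\<And>e. e \<in> Env M \<Gamma> \<Longrightarrow> P (\<lambda>x. if \<Delta> x = [] then [] else e x) \<longleftrightarrow> Q e"
  shows "DP M B \<Gamma> Q"
  using DP_reindex[OF assms(1), of \<Gamma> "\<lambda>x. x", OF assms(2)] by (rule DP_cong) (rule assms(3))

lemma Env_Nil: "e \<in> Env M \<Gamma> \<Longrightarrow> \<Gamma> x = [] \<Longrightarrow> e x = []"
  by (drule Env_nth[of _ _ _ x]) simp

lemma DP_closed2:
  assumes "DP M B (case_nat s1 (case_nat s2 closed_ctx)) (\<lambda>e. P (e 0) (e (Suc 0)))"
  shows "DP M B (case_nat s1 (case_nat s2 \<Gamma>)) (\<lambda>e. P (e 0) (e (Suc 0)))"
proof (rule DP_closed[OF assms])
  show "case_nat s1 (case_nat s2 closed_ctx) x = [] \<or> case_nat s1 (case_nat s2 \<Gamma>) x = case_nat s1 (case_nat s2 closed_ctx) x" for x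
    by (auto simp: closed_ctx_def split: nat.split)
  fix e assume e: "e \<in> Env M (case_nat s1 (case_nat s2 \<Gamma>))"
  have "s1 = [] \<Longrightarrow> e 0 = []" "s2 = [] \<Longrightarrow> e (Suc 0) = []"
    using Env_Nil[OF e, of 0] Env_Nil[OF e, of "Suc 0"] by auto
  then show "P (if case_nat s1 (case_nat s2 closed_ctx) 0 = [] then [] else e 0)
      (if case_nat s1 (case_nat s2 closed_ctx) (Suc 0) = [] then [] else e (Suc 0)) \<longleftrightarrow> P (e 0) (e (Suc 0))"
    by auto
qed

lemma DP_closed3:
  assumes "DP M B (case_nat s1 (case_nat s2 (case_nat s3 closed_ctx))) (\<lambda>e. P (e 0) (e (Suc 0)) (e (Suc (Suc 0))))"
  shows "DP M B (case_nat s1 (case_nat s2 (case_nat s3 \<Gamma>))) (\<lambda>e. P (e 0) (e (Suc 0)) (e (Suc (Suc 0))))"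
proof (rule DP_closed[OF assms])
  show "case_nat s1 (case_nat s2 (case_nat s3 closed_ctx)) x = [] \<or>
      case_nat s1 (case_nat s2 (case_nat s3 \<Gamma>)) x = case_nat s1 (case_nat s2 (case_nat s3 closed_ctx)) x" for x
    by (auto simp: closed_ctx_def split: nat.split)
  fix e assume e: "e \<in> Env M (case_nat s1 (case_nat s2 (case_nat s3 \<Gamma>)))"
  have "s1 = [] \<Longrightarrow> e 0 = []" "s2 = [] \<Longrightarrow> e (Suc 0) = []" "s3 = [] \<Longrightarrow> e (Suc (Suc 0)) = []"
    using Env_Nil[OF e, of 0] Env_Nil[OF e, of "Suc 0"] Env_Nil[OF e, of "Suc (Suc 0)"] by auto
  then show "P (if case_nat s1 (case_nat s2 (case_nat s3 closed_ctx)) 0 = [] then [] else e 0)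
      (if case_nat s1 (case_nat s2 (case_nat s3 closed_ctx)) (Suc 0) = [] then [] else e (Suc 0))
      (if case_nat s1 (case_nat s2 (case_nat s3 closed_ctx)) (Suc (Suc 0)) = [] then [] else e (Suc (Suc 0)))
      \<longleftrightarrow> P (e 0) (e (Suc 0)) (e (Suc (Suc 0)))"
    by auto
qed

text \<open>Definability is proved once over the closed context and then used in any context with
  definable terms as arguments; \<open>DP_app2\<close> and \<open>DP_app3\<close> do the same for
  more arguments.\<close>

lemma DP_app1:
  assumes "DP M B (case_nat s1 closed_ctx) (\<lambda>e. P (e 0))" "DT M B \<Gamma> s1 t1"
  shows "DP M B \<Gamma> (\<lambda>e. P (t1 e))"
  by (rule DP_cut[OF assms(2), where P = "\<lambda>u e. P u"]) (rule DP_closed1[OF assms(1)])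

lemma DP_app2:
  assumes "DP M B (case_nat s1 (case_nat s2 closed_ctx)) (\<lambda>e. P (e 0) (e (Suc 0)))"
    and "DT M B \<Gamma> s1 t1" "DT M B \<Gamma> s2 t2"
  shows "DP M B \<Gamma> (\<lambda>e. P (t1 e) (t2 e))"
  by (rule DP_cut[OF assms(3), where P = "\<lambda>u e. P (t1 e) u"],
      rule DP_cut[OF DT_weaken[OF assms(2)], where P = "\<lambda>u e. P u (e 0)"], rule DP_closed2[OF assms(1)])

lemma DP_app3:
  assumes "DP M B (case_nat s1 (case_nat s2 (case_nat s3 closed_ctx))) (\<lambda>e. P (e 0) (e (Suc 0)) (e (Suc (Suc 0))))"
    and "DT M B \<Gamma> s1 t1" "DT M B \<Gamma> s2 t2" "DT M B \<Gamma> s3 t3"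
  shows "DP M B \<Gamma> (\<lambda>e. P (t1 e) (t2 e) (t3 e))"
  by (rule DP_cut[OF assms(4), where P = "\<lambda>u e. P (t1 e) (t2 e) u"],
      rule DP_cut[OF DT_weaken[OF assms(3)], where P = "\<lambda>u e. P (t1 (\<lambda>x. e (Suc x))) u (e 0)"],
      rule DP_cut[OF DT_weaken[OF DT_weaken[OF assms(2)]], where P = "\<lambda>u e. P u (e 0) (e (Suc 0))"],
      rule DP_closed3[OF assms(1)])

lemma DP_app_k:
  "DP (Keq mem) B (case_nat kS closed_ctx) (\<lambda>e. P (kval (e 0))) \<Longrightarrow> DK mem B \<Gamma> t1 \<Longrightarrow>
    DP (Keq mem) B \<Gamma> (\<lambda>e. P (t1 e))"
  using DP_app1[of "Keq mem" B kS "\<lambda>u. P (kval u)" \<Gamma> "\<lambda>e. [kel (t1 e)]"] by (simp add: DK_def)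

lemma DP_app_kk:
  "DP (Keq mem) B (case_nat kS (case_nat kS closed_ctx)) (\<lambda>e. P (kval (e 0)) (kval (e (Suc 0)))) \<Longrightarrow>
    DK mem B \<Gamma> t1 \<Longrightarrow> DK mem B \<Gamma> t2 \<Longrightarrow> DP (Keq mem) B \<Gamma> (\<lambda>e. P (t1 e) (t2 e))"
  using DP_app2[of "Keq mem" B kS kS "\<lambda>u v. P (kval u) (kval v)" \<Gamma> "\<lambda>e. [kel (t1 e)]" "\<lambda>e. [kel (t2 e)]"]
  by (simp add: DK_def)

lemma DP_app_kkk:
  "DP (Keq mem) B (case_nat kS (case_nat kS (case_nat kS closed_ctx)))
      (\<lambda>e. P (kval (e 0)) (kval (e (Suc 0))) (kval (e (Suc (Suc 0))))) \<Longrightarrow>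
    DK mem B \<Gamma> t1 \<Longrightarrow> DK mem B \<Gamma> t2 \<Longrightarrow> DK mem B \<Gamma> t3 \<Longrightarrow> DP (Keq mem) B \<Gamma> (\<lambda>e. P (t1 e) (t2 e) (t3 e))"
  using DP_app3[of "Keq mem" B kS kS kS "\<lambda>u v w. P (kval u) (kval v) (kval w)" \<Gamma>
      "\<lambda>e. [kel (t1 e)]" "\<lambda>e. [kel (t2 e)]" "\<lambda>e. [kel (t3 e)]"]
  by (simp add: DK_def)

section \<open>Hyperfinite subsets of the field\<close>

lemma is_fpsD:
  assumes "is_fps M X (Y, E)"
  shows "definable M X" "definable M Y" "E \<subseteq> X \<times> Y" "definable M (graph_of E)"
    and "\<forall>B\<in>Y. \<forall>C\<in>Y. B = C \<longleftrightarrow> (\<forall>x\<in>X. (x, B) \<in> E \<longleftrightarrow> (x, C) \<in> E)"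
    and "\<exists>B\<in>Y. \<forall>x\<in>X. (x, B) \<notin> E"
    and "\<forall>a\<in>X. \<exists>B\<in>Y. \<forall>x\<in>X. (x, B) \<in> E \<longleftrightarrow> x = a"
    and "\<forall>B\<in>Y. \<forall>C\<in>Y. \<exists>D\<in>Y. \<forall>x\<in>X. (x, D) \<in> E \<longleftrightarrow> (x, B) \<in> E \<or> (x, C) \<in> E"
    and "\<forall>U. definable M U \<and> U \<subseteq> Y \<and> (\<forall>B\<in>Y. (\<forall>x\<in>X. (x, B) \<notin> E) \<longrightarrow> B \<in> U) \<and>
        (\<forall>B\<in>U. \<forall>a\<in>X. \<forall>C\<in>Y. (\<forall>x\<in>X. (x, C) \<in> E \<longleftrightarrow> (x, B) \<in> E \<or> x = a) \<longrightarrow> C \<in> U)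
        \<longrightarrow> U = Y"
  using assms unfolding is_fps_def prod.case by - (elim conjE; assumption)+

lemma fps_ext:
  assumes "is_fps M X (Y, E)" "B \<in> Y" "C \<in> Y" "\<And>x. x \<in> X \<Longrightarrow> (x, B) \<in> E \<longleftrightarrow> (x, C) \<in> E"
  shows "B = C"
  using is_fpsD(5)[OF assms(1)] assms(2-4) by blast

lemma fps_induct:
  assumes "is_fps M X (Y, E)" "definable M {B \<in> Y. P B}"
    and empty: "\<And>B. B \<in> Y \<Longrightarrow> (\<And>x. x \<in> X \<Longrightarrow> (x, B) \<notin> E) \<Longrightarrow> P B"
    and insert: "\<And>B a C. B \<in> Y \<Longrightarrow> C \<in> Y \<Longrightarrow> P B \<Longrightarrow> a \<in> X \<Longrightarrow>
       (\<And>x. x \<in> X \<Longrightarrow> (x, C) \<in> E \<longleftrightarrow> (x, B) \<in> E \<or> x = a) \<Longrightarrow> P C"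
    and "B \<in> Y"
  shows "P B"
proof -
  have "{B \<in> Y. P B} = Y"
  proof (rule is_fpsD(9)[OF assms(1), rule_format], intro conjI ballI impI)
    show "B \<in> {B \<in> Y. P B}" if "B \<in> Y" "\<forall>x\<in>X. (x, B) \<notin> E" for B
      using that empty[of B] by simp
    show "C \<in> {B \<in> Y. P B}" if "B \<in> {B \<in> Y. P B}" "a \<in> X" "C \<in> Y"
      "\<forall>x\<in>X. (x, C) \<in> E \<longleftrightarrow> (x, B) \<in> E \<or> x = a" for B a C
      using that insert[of B C a] by simp
  qed (use assms(2) in auto)
  then show ?thesis using assms(5) by blast
qed

locale fps_field =
  fixes mem :: "'k::field \<Rightarrow> 'f \<Rightarrow> bool"
  assumes K_fps: "K_is_fps mem" and K_char: "char_zero mem"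
begin

abbreviation "KQ \<equiv> Keq mem"
abbreviation "U \<equiv> UU mem"

abbreviation DP1 :: "('k \<Rightarrow> bool) \<Rightarrow> bool" where
  "DP1 P \<equiv> DP KQ U (case_nat kS closed_ctx) (\<lambda>e. P (kval (e 0)))"

abbreviation DP2 :: "('k \<Rightarrow> 'k \<Rightarrow> bool) \<Rightarrow> bool" where
  "DP2 P \<equiv> DP KQ U (case_nat kS (case_nat kS closed_ctx)) (\<lambda>e. P (kval (e 0)) (kval (e (Suc 0))))"

abbreviation DP3 :: "('k \<Rightarrow> 'k \<Rightarrow> 'k \<Rightarrow> bool) \<Rightarrow> bool" where
  "DP3 P \<equiv> DP KQ U (case_nat kS (case_nat kS (case_nat kS closed_ctx)))
     (\<lambda>e. P (kval (e 0)) (kval (e (Suc 0))) (kval (e (Suc (Suc 0)))))"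

lemma K_fps': "is_fps (KK mem) {[KEl x] |x. True} ({[FEl A] |A. True}, {([KEl x], [FEl A]) |x A. mem x A})"
  using K_fps unfolding K_is_fps_def .

lemma F_ext: "(\<And>x. mem x A \<longleftrightarrow> mem x B) \<Longrightarrow> A = B"
  using fps_ext[OF K_fps', of "[FEl A]" "[FEl B]"] by auto

lemma F_empty: "\<exists>A. \<forall>x. \<not> mem x A"
proof -
  obtain A where "\<forall>x\<in>{[KEl x] |x. True}. (x, [FEl A]) \<notin> {([KEl x], [FEl A]) |x A. mem x A}"
    using is_fpsD(6)[OF K_fps'] by blast
  then have "\<not> mem x A" for x by (drule_tac bspec[of _ _ "[KEl x]"]) auto
  then show ?thesis by blast
qed

lemma F_single: "\<exists>A. \<forall>x. mem x A \<longleftrightarrow> x = a"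
proof -
  have "[KEl a] \<in> {[KEl x] |x. True}" by blast
  then show ?thesis
  proof (rule bexE[OF bspec[OF is_fpsD(7)[OF K_fps']]])
    fix Z assume Z: "Z \<in> {[FEl A] |A. True}"
      "\<forall>x\<in>{[KEl x] |x. True}. (x, Z) \<in> {([KEl x], [FEl A]) |x A. mem x A} \<longleftrightarrow> x = [KEl a]"
    from Z(1) obtain A where A: "Z = [FEl A]" by blast
    have "mem x A \<longleftrightarrow> x = a" for x using bspec[OF Z(2), of "[KEl x]"] by (auto simp: A)
    then show ?thesis by blast
  qed
qed

lemma F_union: "\<exists>A. \<forall>x. mem x A \<longleftrightarrow> mem x B \<or> mem x C"
proof -
  have BC: "[FEl B] \<in> {[FEl A] |A. True}" "[FEl C] \<in> {[FEl A] |A. True}" by blast+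
  show ?thesis
  proof (rule bexE[OF bspec[OF bspec[OF is_fpsD(8)[OF K_fps'] BC(1)] BC(2)]])
    fix Z assume Z: "Z \<in> {[FEl A] |A. True}"
      "\<forall>x\<in>{[KEl x] |x. True}. (x, Z) \<in> {([KEl x], [FEl A]) |x A. mem x A} \<longleftrightarrow>
        (x, [FEl B]) \<in> {([KEl x], [FEl A]) |x A. mem x A} \<or> (x, [FEl C]) \<in> {([KEl x], [FEl A]) |x A. mem x A}"
    from Z(1) obtain A where A: "Z = [FEl A]" by blast
    have "mem x A \<longleftrightarrow> mem x B \<or> mem x C" for x using bspec[OF Z(2), of "[KEl x]"] by (auto simp: A)
    then show ?thesis by blast
  qed
qed

text \<open>The induction axiom is stated for sets definable in \<open>KK mem\<close>. Elimination
  of imaginaries makes it available for predicates definable in the structure of imaginaries, with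
  imaginary parameters.\<close>

lemma F_induct:
  assumes P: "DP KQ U (case_nat fS closed_ctx) (\<lambda>e. P (sval (e 0)))"
    and empty: "\<And>A. (\<And>x. \<not> mem x A) \<Longrightarrow> P A"
    and insert: "\<And>A a B. P A \<Longrightarrow> (\<And>x. mem x B \<longleftrightarrow> mem x A \<or> x = a) \<Longrightarrow> P B"
  shows "P A"
proof -
  have "DS KQ U fS {[fel A] |A. P A}"
  proof -
    have "DP KQ U (case_nat fS closed_ctx) (\<lambda>e. e 0 \<in> {[fel A] |A. P A})"
    proof (rule DP_cong[OF P])
      fix e assume "e \<in> Env KQ (case_nat fS closed_ctx)"
      then obtain x where "e 0 = [fel x]" using fS_tuples[THEN iffD1, OF Env_head] by blast
      then show "P (sval (e 0)) \<longleftrightarrow> e 0 \<in> {[fel x] |x. P x}" by simp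
    qed
    then show ?thesis by (auto simp: DS_def)
  qed
  then have "DS (eq_struct (KK mem)) U (map Real [FSort]) {[fel A] |A. P A}" by (simp add: Keq_def)
  from real_definable[OF KK_disjoint this] have "\<exists>\<phi> bs. set bs \<subseteq> univ (KK mem) \<and>
      fv \<phi> \<subseteq> {..<length [FSort] + length bs} \<and> (\<forall>u\<in>tuples (KK mem) [FSort].
        map El u \<in> {[fel A] |A. P A} \<longleftrightarrow> holds (KK mem) \<phi> (u @ bs))"
    unfolding Keq_def by blast
  then obtain \<phi> bs where 0: "set bs \<subseteq> univ (KK mem) \<and>
      fv \<phi> \<subseteq> {..<length [FSort] + length bs} \<and> (\<forall>u\<in>tuples (KK mem) [FSort].
        map El u \<in> {[fel A] |A. P A} \<longleftrightarrow> holds (KK mem) \<phi> (u @ bs))"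
    by (elim exE)
  note 1 = 0[THEN conjunct1] 0[THEN conjunct2, THEN conjunct1]
  note 2 = 0[THEN conjunct2, THEN conjunct2, rule_format]
  have t: "u \<in> tuples (KK mem) [FSort] \<longleftrightarrow> (\<exists>A. u = [FEl A])" for u
    by (auto simp: Cons_tuples KK_def)
  have "P A \<longleftrightarrow> holds (KK mem) \<phi> ([FEl A] @ bs)" for A
    using 2[of "[FEl A]"] by (auto simp: t)
  then have "{[FEl A] |A. P A} = {u \<in> tuples (KK mem) [FSort]. holds (KK mem) \<phi> (u @ bs)}"
    by (auto simp: t)
  then have D: "definable (KK mem) {[FEl A] |A. P A}"
    unfolding definable_def definable_over_def using 1 by blast
  let ?P = "\<lambda>u :: ('k, 'f) elem list. \<exists>A. u = [FEl A] \<and> P A"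
  have "?P [FEl A]"
  proof (rule fps_induct[OF K_fps', where P = ?P and B = "[FEl A]"])
    show "definable (KK mem) {B \<in> {[FEl A] |A. True}. \<exists>A. B = [FEl A] \<and> P A}"
      using D by (rule back_subst[of "definable (KK mem)"]) auto
    show "?P B" if "B \<in> {[FEl A] |A. True}"
      "\<And>x. x \<in> {[KEl x] |x. True} \<Longrightarrow> (x, B) \<notin> {([KEl x], [FEl A]) |x A. mem x A}" for B
    proof -
      note h = that
      obtain A where A: "B = [FEl A]" using h(1) by blast
      have "\<not> mem x A" for x using that(2)[of "[KEl x]"] A by auto
      then show ?thesis using empty A by blast
    qed
    show "?P C" if "?P B" "C \<in> {[FEl A] |A. True}" "a \<in> {[KEl x] |x. True}"
      "\<And>x. x \<in> {[KEl x] |x. True} \<Longrightarrow> (x, C) \<in> {([KEl x], [FEl A]) |x A. mem x A} \<longleftrightarrow>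
         (x, B) \<in> {([KEl x], [FEl A]) |x A. mem x A} \<or> x = a" for B a C
    proof -
      note h = that
      obtain A A' c where A: "B = [FEl A]" "P A" "C = [FEl A']" "a = [KEl c]" using h(1-3) by blast
      have "mem x A' \<longleftrightarrow> mem x A \<or> x = c" for x using that(4)[of "[KEl x]"] A by auto
      then show ?thesis using insert A by blast
    qed
  qed auto
  then show "P A" by blast
qed

section \<open>Closure properties of hyperfinite subsets of the field\<close>

definition kfin :: "'k set \<Rightarrow> bool" where
  "kfin S \<longleftrightarrow> (\<exists>A. S = {x. mem x A})"

lemma kfin_iff: "kfin S \<longleftrightarrow> (\<exists>A. \<forall>x. mem x A \<longleftrightarrow> x \<in> S)"
  unfolding kfin_def by blast

lemma kfin_mem [simp]: "kfin {x. mem x A}"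
  by (auto simp: kfin_def)

lemma kfin_empty [simp]: "kfin {}"
  using F_empty by (force simp: kfin_def)

lemma kfin_single: "kfin {a}"
  using F_single[of a] by (force simp: kfin_def)

lemma kfin_union: "kfin S \<Longrightarrow> kfin T \<Longrightarrow> kfin (S \<union> T)"
proof -
  assume "kfin S" "kfin T"
  then obtain A B where "\<forall>x. mem x A \<longleftrightarrow> x \<in> S" "\<forall>x. mem x B \<longleftrightarrow> x \<in> T" by (auto simp: kfin_iff)
  then show ?thesis using F_union[of A B] by (simp add: kfin_iff)
qed

lemma kfin_insert: "kfin S \<Longrightarrow> kfin (insert a S)"
  using kfin_union[OF kfin_single, of S a] by simp

text \<open>Hyperfinite induction on the index set, one column \<open>{y. R x y}\<close> being added
  at each step.\<close>

lemma kfin_UN: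
  assumes S: "kfin S" and R: "\<And>x. x \<in> S \<Longrightarrow> kfin {y. R x y}" "DP2 R"
  shows "kfin {y. \<exists>x\<in>S. R x y}"
proof -
  obtain A0 where A0: "S = {x. mem x A0}" using S by (auto simp: kfin_def)
  \<comment> \<open>Columns are known to be hyperfinite for indices in \<open>S\<close> only, hence
    the extra condition \<open>mem x A0\<close> while \<open>A\<close> varies.\<close>
  have "\<exists>C. \<forall>y. mem y C \<longleftrightarrow> (\<exists>x. mem x A \<and> mem x A0 \<and> R x y)" for A
  proof (induction A rule: F_induct)
    case 1
    show ?case by (intro dp DP_app_kk[OF R(2)]) simp_all
  next
    case (2 A)
    then show ?case using F_empty by auto
  next
    case (3 A a B)
    then obtain C where C: "\<And>y. mem y C \<longleftrightarrow> (\<exists>x. mem x A \<and> mem x A0 \<and> R x y)" by blast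
    show ?case
    proof (cases "mem a A0")
      case True
      then have "kfin {y. R a y}" using R(1) A0 by simp
      then obtain D where D: "\<And>y. mem y D \<longleftrightarrow> R a y" by (auto simp: kfin_iff)
      obtain E where "\<And>x. mem x E \<longleftrightarrow> mem x C \<or> mem x D" using F_union by blast
      then show ?thesis using True 3(2) C D by (intro exI[of _ E]) auto
    next
      case False
      then show ?thesis using 3(2) C by (intro exI[of _ C]) auto
    qed
  qed
  then obtain C where "\<And>y. mem y C \<longleftrightarrow> (\<exists>x. mem x A0 \<and> R x y)" by meson
  then show ?thesis by (auto simp: kfin_iff A0)
qed

lemma kfin_subset:
  assumes "kfin S" "DP1 Q"
  shows "kfin {x \<in> S. Q x}"
proof -
  have "kfin {y. x = y \<and> Q y}" for x
  proof -
    have "{y. x = y \<and> Q y} = (if Q x then {x} else {})" by auto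
    then show ?thesis by (simp add: kfin_single)
  qed
  moreover have "DP2 (\<lambda>x y. x = y \<and> Q y)" by (intro dp DP_app_k[OF assms(2)]) simp_all
  ultimately have "kfin {y. \<exists>x\<in>S. x = y \<and> Q y}" by (intro kfin_UN assms(1))
  then show ?thesis by (rule back_subst[of kfin]) auto
qed

lemma kfin_image:
  assumes "kfin S" "DP2 (\<lambda>x y. y = h x)"
  shows "kfin (h ` S)"
proof -
  have "kfin {y. \<exists>x\<in>S. y = h x}" by (rule kfin_UN[OF assms(1) _ assms(2)]) (simp add: kfin_single)
  then show ?thesis by (rule back_subst[of kfin]) auto
qed

lemma kfin_image2:
  assumes "kfin S" "kfin T" "DP3 (\<lambda>x y z. z = h x y)"
  shows "kfin {h x y |x y. x \<in> S \<and> y \<in> T}"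
proof -
  obtain A where A: "\<And>x. mem x A \<longleftrightarrow> x \<in> T" using assms(2) by (auto simp: kfin_iff)
  have "kfin {z. \<exists>x\<in>S. \<exists>y. mem y A \<and> z = h x y}"
  proof (rule kfin_UN[OF assms(1)])
    show "DP2 (\<lambda>x z. \<exists>y. mem y A \<and> z = h x y)"
      by (intro dp DP_app_kkk[OF assms(3)]) simp_all
    show "kfin {z. \<exists>y. mem y A \<and> z = h x y}" for x
    proof -
      have "DP2 (\<lambda>y z. z = h x y)" by (intro dp DP_app_kkk[OF assms(3)]) simp_all
      from kfin_image[OF assms(2) this] show ?thesis by (rule back_subst[of kfin]) (auto simp: A)
    qed
  qed
  then show ?thesis by (rule back_subst[of kfin]) (auto simp: A)
qed

text \<open>A code of all of \<open>K\<close> would be closed under predecessors and would put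
  \<open>- 1\<close> into \<open>NN mem\<close>.\<close>

lemma not_kfin_UNIV: "\<not> kfin UNIV"
  using K_char by (auto simp: kfin_def char_zero_def NN_def)

lemma kfin_new: "kfin S \<Longrightarrow> \<exists>x. x \<notin> S"
  using not_kfin_UNIV by (metis UNIV_eq_I)

text \<open>The slopes of the lines through two points of \<open>S \<times> S\<close> form a hyperfinite set.\<close>

lemma generic_slope:
  assumes "kfin S"
  shows "\<exists>t. \<forall>x\<in>S. \<forall>y\<in>S. \<forall>x'\<in>S. \<forall>y'\<in>S. x + t * y = x' + t * y' \<longrightarrow> x = x' \<and> y = y'"
proof -
  let ?D = "{x - y |x y. x \<in> S \<and> y \<in> S}"
  have "kfin ?D" by (rule kfin_image2[OF assms assms]) (intro dp, simp_all)
  from kfin_image2[OF this this, of "\<lambda>x y. x / y"]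
  have "kfin {x / y |x y. x \<in> ?D \<and> y \<in> ?D}" by (rule meta_mp) (intro dp, simp_all)
  then obtain t where t: "t \<notin> {x / y |x y. x \<in> ?D \<and> y \<in> ?D}"
    using kfin_new by blast
  have "x = x' \<and> y = y'" if S: "x \<in> S" "y \<in> S" "x' \<in> S" "y' \<in> S" and eq: "x + t * y = x' + t * y'" for x y x' y'
  proof (cases "y = y'")
    case False
    then have "t = (x' - x) / (y - y')" using eq by (simp add: field_simps)
    then have "t \<in> {x / y |x y. x \<in> ?D \<and> y \<in> ?D}" using S by blast
    then show ?thesis using t by blast
  qed (use eq in auto)
  then show ?thesis by blast
qed

text \<open>A hyperfinite binary relation coded by real elements: if the slope \<open>t\<close> is
  generic for the set coded by \<open>B\<close>, then \<open>x + t * y\<close> determines the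
  pair.\<close>

definition rel2 :: "'f \<Rightarrow> 'k \<Rightarrow> 'f \<Rightarrow> 'k \<Rightarrow> 'k \<Rightarrow> bool" where
  "rel2 B t C x y \<longleftrightarrow> mem x B \<and> mem y B \<and> mem (x + t * y) C"

lemma rel2_ex:
  assumes "kfin S" "DP2 P" "\<And>x y. P x y \<Longrightarrow> x \<in> S \<and> y \<in> S"
  shows "\<exists>B t C. \<forall>x y. P x y \<longleftrightarrow> rel2 B t C x y"
proof -
  obtain B where B: "\<And>x. mem x B \<longleftrightarrow> x \<in> S" using assms(1) by (auto simp: kfin_iff)
  obtain t where t: "\<And>x y x' y'. x \<in> S \<Longrightarrow> y \<in> S \<Longrightarrow> x' \<in> S \<Longrightarrow> y' \<in> S \<Longrightarrow> x + t * y = x' + t * y' \<Longrightarrow> x = x' \<and> y = y'"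
    using generic_slope[OF assms(1)] by blast
  have "kfin {x + t * y |x y. x \<in> S \<and> y \<in> S}"
    by (rule kfin_image2[OF assms(1,1)]) (intro dp, simp_all)
  then have "kfin {z \<in> {x + t * y |x y. x \<in> S \<and> y \<in> S}. \<exists>x y. P x y \<and> z = x + t * y}"
    by (rule kfin_subset) (intro dp DP_app_kk[OF assms(2)], simp_all)
  moreover have "{z \<in> {x + t * y |x y. x \<in> S \<and> y \<in> S}. \<exists>x y. P x y \<and> z = x + t * y} =
      {z. \<exists>x y. P x y \<and> z = x + t * y}" using assms(3) by blast
  ultimately have "kfin {z. \<exists>x y. P x y \<and> z = x + t * y}" by (simp only:)
  then obtain C where C: "\<And>z. mem z C \<longleftrightarrow> (\<exists>x y. P x y \<and> z = x + t * y)"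
    unfolding kfin_iff mem_Collect_eq by blast
  have "P x y \<longleftrightarrow> rel2 B t C x y" for x y
  proof
    assume "rel2 B t C x y"
    then obtain x' y' where "x \<in> S" "y \<in> S" "P x' y'" "x + t * y = x' + t * y'"
      by (auto simp: rel2_def B C)
    then show "P x y" using t[of x y x' y'] assms(3)[of x' y'] by simp
  qed (use assms(3) in \<open>auto simp: rel2_def B C\<close>)
  then show ?thesis by blast
qed

end

lemma DT_Nil [dp]: "DT M B \<Gamma> [] (\<lambda>e. [])"
  by (rule DT_const) auto

section \<open>Existence of definable finite power sets\<close>

lemma Keq_disjoint: "s \<noteq> s' \<Longrightarrow> Carr (Keq mem) s \<inter> Carr (Keq mem) s' = {}"
proof (cases s; cases s')
  fix x y assume "s \<noteq> s'" "s = Real x" "s' = Real y"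
  then show ?thesis using KK_disjoint[of x y mem] by (auto simp: Keq_def eq_struct_def)
qed (auto simp: Keq_def eq_struct_def)

lemma tuples_sorts_eq: "u \<in> tuples (Keq mem) ss \<Longrightarrow> u \<in> tuples (Keq mem) ts \<Longrightarrow> ss = ts"
proof (rule nth_equalityI)
  assume u: "u \<in> tuples (Keq mem) ss" "u \<in> tuples (Keq mem) ts"
  then show l: "length ss = length ts" by (metis tuples_length)
  fix i assume "i < length ss"
  then show "ss ! i = ts ! i"
    using tuples_nth[OF u(1), of i] tuples_nth[OF u(2), of i] Keq_disjoint[of "ss ! i" "ts ! i" mem] l by auto
qed

text \<open>Carriers of different sorts are disjoint, so a non-empty set determines its sorts; the
  empty set is definable with any sorts.\<close>

lemma DS_sort_transfer:
  assumes "DS (Keq mem) B ss X" "X \<subseteq> tuples (Keq mem) ts"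
  shows "DS (Keq mem) B ts X"
proof (cases "X = {}")
  case True
  then show ?thesis using DP_const[of "Keq mem" B _ False] by (simp add: DS_def)
next
  case False
  then obtain x where "x \<in> X" by blast
  then have "ss = ts" using assms DS_subset[OF assms(1)] tuples_sorts_eq by blast
  then show ?thesis using assms(1) by simp
qed

abbreviation proj_graph :: "('k::field \<Rightarrow> 'f \<Rightarrow> bool) \<Rightarrow> sort list \<Rightarrow> (sort, sym) fm \<Rightarrow> ('k, 'f) keq list set" where
  "proj_graph mem qs \<phi> \<equiv> eq_intp (KK mem) (Proj qs \<phi>)"

lemma DP_proj:
  "DP (Keq mem) B (case_nat (map Real qs) (case_nat [Quot qs \<phi>] closed_ctx)) (\<lambda>e. e 0 @ e (Suc 0) \<in> proj_graph mem qs \<phi>)"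
  (is "DP _ _ ?G _")
proof (rule DPI[of "[]" _ "Rel (Proj qs \<phi>) (map (slot 0) [0..<length qs] @ [slot 1 0])"])
  fix e assume e: "e \<in> Env (Keq mem) ?G"
  have 1: "length (e 0) = length qs" "length (e (Suc 0)) = Suc 0"
    using tuples_length[OF Env_nth[OF e, of 0]] tuples_length[OF Env_nth[OF e, of "Suc 0"]] by auto
  have "map (asg e []) (map (slot 0) [0..<length qs]) = e 0"
    by (rule nth_equalityI) (use 1 in auto)
  moreover have "[asg e [] (slot 1 0)] = e (Suc 0)" using 1(2) by (auto simp: length_Suc_conv)
  ultimately have "map (asg e []) (map (slot 0) [0..<length qs] @ [slot 1 0]) = e 0 @ e (Suc 0)"
    by (simp only: map_append list.map)
  moreover have "Intp (Keq mem) (Proj qs \<phi>) = proj_graph mem qs \<phi>" by (simp only: Keq_def eq_struct_def fostruct.simps)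
  ultimately show "e 0 @ e (Suc 0) \<in> proj_graph mem qs \<phi> \<longleftrightarrow>
      sat (Keq mem) (asg e []) (Rel (Proj qs \<phi>) (map (slot 0) [0..<length qs] @ [slot 1 0]))"
    by (simp only: sat.simps)
qed auto

lemma proj_graph_iff:
  assumes "length u = length qs" "length a = 1"
  shows "u @ a \<in> proj_graph mem qs \<phi> \<longleftrightarrow> (\<exists>v\<in>tuples (KK mem) qs. (qs, \<phi>) \<in> quotients (KK mem) \<and>
    u = map El v \<and> a = [Cls qs \<phi> (eqrel (KK mem) qs \<phi> `` {v})])"
proof
  assume "u @ a \<in> proj_graph mem qs \<phi>"
  then obtain v where v: "u @ a = map El v @ [Cls qs \<phi> (eqrel (KK mem) qs \<phi> `` {v})]"
    "(qs, \<phi>) \<in> quotients (KK mem)" "v \<in> tuples (KK mem) qs" by auto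
  have "length u = length (map El v)" using assms(1) tuples_length[OF v(3)] by simp
  then have "u = map El v \<and> a = [Cls qs \<phi> (eqrel (KK mem) qs \<phi> `` {v})]"
    using v(1) by (simp add: append_eq_append_conv)
  then show "\<exists>v\<in>tuples (KK mem) qs. (qs, \<phi>) \<in> quotients (KK mem) \<and>
    u = map El v \<and> a = [Cls qs \<phi> (eqrel (KK mem) qs \<phi> `` {v})]" using v by blast
qed auto

lemma Quot_tuples: "a \<in> tuples (Keq mem) [Quot qs \<phi>] \<longleftrightarrow> (\<exists>v\<in>tuples (KK mem) qs.
    (qs, \<phi>) \<in> quotients (KK mem) \<and> a = [Cls qs \<phi> (eqrel (KK mem) qs \<phi> `` {v})])"
  by (auto simp: Cons_tuples Keq_def Carr_eq_struct)

lemma Real_tuples: "u \<in> tuples (Keq mem) (map Real qs) \<longleftrightarrow> (\<exists>v\<in>tuples (KK mem) qs. u = map El v)"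
  unfolding Keq_def by (rule tuples_Real)

lemma proj_graph_ex: "a \<in> tuples (Keq mem) [Quot qs \<phi>] \<Longrightarrow>
    \<exists>u\<in>tuples (Keq mem) (map Real qs). u @ a \<in> proj_graph mem qs \<phi>"
proof -
  assume "a \<in> tuples (Keq mem) [Quot qs \<phi>]"
  then obtain v where v: "v \<in> tuples (KK mem) qs" "(qs, \<phi>) \<in> quotients (KK mem)"
    "a = [Cls qs \<phi> (eqrel (KK mem) qs \<phi> `` {v})]" by (auto simp: Quot_tuples)
  then have "map El v @ a \<in> proj_graph mem qs \<phi>"
    using proj_graph_iff[of "map El v" qs a mem \<phi>] tuples_length[OF v(1)] by auto
  moreover have "map El v \<in> tuples (Keq mem) (map Real qs)" using v(1) by (auto simp: Real_tuples)
  ultimately show ?thesis by blast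
qed

context fps_field
begin

text \<open>A family of partial functions from \<open>K\<close> to the tuples of sorts \<open>ss\<close>, indexed by real codes
  of sorts \<open>cs\<close>; \<open>\<Theta> d a c\<close> says that the function with code \<open>c\<close> maps \<open>d\<close> to \<open>a\<close>.\<close>

definition good_fam ::
    "(sort, sym) eqsort list \<Rightarrow> sort list \<Rightarrow> ('k \<Rightarrow> ('k, 'f) keq list \<Rightarrow> ('k, 'f) keq list \<Rightarrow> bool) \<Rightarrow> bool" where
  "good_fam ss cs \<Theta> \<longleftrightarrow>
     (\<forall>d a c. \<Theta> d a c \<longrightarrow> a \<in> tuples KQ ss \<and> c \<in> tuples KQ (map Real cs)) \<and>
     DP KQ {} (case_nat kS (case_nat ss (case_nat (map Real cs) closed_ctx)))
       (\<lambda>e. \<Theta> (kval (e 0)) (e (Suc 0)) (e (Suc (Suc 0)))) \<and>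
     (\<forall>d a a' c. \<Theta> d a c \<longrightarrow> \<Theta> d a' c \<longrightarrow> a = a') \<and>
     (\<forall>c\<in>tuples KQ (map Real cs). \<forall>D d. \<forall>a\<in>tuples KQ ss. \<not> mem d D \<longrightarrow>
        (\<exists>c'\<in>tuples KQ (map Real cs). \<Theta> d a c' \<and> (\<forall>d' a'. mem d' D \<longrightarrow> (\<Theta> d' a' c' \<longleftrightarrow> \<Theta> d' a' c))))"

lemma good_famD:
  assumes "good_fam ss cs \<Theta>"
  shows "\<Theta> d a c \<Longrightarrow> a \<in> tuples KQ ss" "\<Theta> d a c \<Longrightarrow> c \<in> tuples KQ (map Real cs)"
    and "DP KQ {} (case_nat kS (case_nat ss (case_nat (map Real cs) closed_ctx)))
       (\<lambda>e. \<Theta> (kval (e 0)) (e (Suc 0)) (e (Suc (Suc 0))))"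
    and "\<Theta> d a c \<Longrightarrow> \<Theta> d a' c \<Longrightarrow> a = a'"
    and "c \<in> tuples KQ (map Real cs) \<Longrightarrow> \<not> mem d D \<Longrightarrow> a \<in> tuples KQ ss \<Longrightarrow>
        \<exists>c'\<in>tuples KQ (map Real cs). \<Theta> d a c' \<and> (\<forall>d' a'. mem d' D \<longrightarrow> (\<Theta> d' a' c' \<longleftrightarrow> \<Theta> d' a' c))"
  using assms unfolding good_fam_def by blast+

lemma good_famI:
  assumes "\<And>d a c. \<Theta> d a c \<Longrightarrow> a \<in> tuples KQ ss \<and> c \<in> tuples KQ (map Real cs)"
    and "DP KQ {} (case_nat kS (case_nat ss (case_nat (map Real cs) closed_ctx)))
       (\<lambda>e. \<Theta> (kval (e 0)) (e (Suc 0)) (e (Suc (Suc 0))))"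
    and "\<And>d a a' c. \<Theta> d a c \<Longrightarrow> \<Theta> d a' c \<Longrightarrow> a = a'"
    and "\<And>c d D a. c \<in> tuples KQ (map Real cs) \<Longrightarrow> \<not> mem d D \<Longrightarrow> a \<in> tuples KQ ss \<Longrightarrow>
        \<exists>c'\<in>tuples KQ (map Real cs). \<Theta> d a c' \<and> (\<forall>d' a'. mem d' D \<longrightarrow> (\<Theta> d' a' c' \<longleftrightarrow> \<Theta> d' a' c))"
  shows "good_fam ss cs \<Theta>"
  using assms unfolding good_fam_def by blast

lemma DP_app_Theta:
  assumes "good_fam ss cs \<Theta>" "DK mem B \<Gamma> d" "DT KQ B \<Gamma> ss a" "DT KQ B \<Gamma> (map Real cs) c"
  shows "DP KQ B \<Gamma> (\<lambda>e. \<Theta> (d e) (a e) (c e))"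
  using DP_app3[OF DP_mono[OF good_famD(3)[OF assms(1)], of B] assms(2)[unfolded DK_def] assms(3,4)] by simp

text \<open>The column of a new point \<open>d\<close> is prescribed while the columns over
  \<open>D\<close> are kept; columns elsewhere may be lost. This is the extension property that a
  family of codes must have.\<close>

lemma rel2_update:
  assumes "kfin {y. Q y}" "DP1 Q" "\<not> mem d D"
  shows "\<exists>B' t' C'. (\<forall>y. rel2 B' t' C' d y \<longleftrightarrow> Q y) \<and>
    (\<forall>d' y. mem d' D \<longrightarrow> (rel2 B' t' C' d' y \<longleftrightarrow> rel2 B t C d' y))"
proof -
  let ?P = "\<lambda>d' y. mem d' D \<and> rel2 B t C d' y \<or> d' = d \<and> Q y"
  have "kfin ({y. Q y} \<union> insert d {x. mem x B})" by (intro kfin_union kfin_insert kfin_mem assms(1))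
  moreover have "DP2 ?P" unfolding rel2_def by (intro dp DP_app_k[OF assms(2)]) simp_all
  ultimately have "\<exists>B t C. \<forall>x y. ?P x y \<longleftrightarrow> rel2 B t C x y"
    by (rule rel2_ex) (auto simp: rel2_def)
  then obtain B' t' C' where "\<forall>x y. ?P x y \<longleftrightarrow> rel2 B' t' C' x y" by (elim exE)
  then show ?thesis using assms(3) by (intro exI[of _ B'] exI[of _ t'] exI[of _ C']) auto
qed

lemma FKF_tuples: "c \<in> tuples KQ (map Real [FSort, KSort, FSort]) \<longleftrightarrow> (\<exists>B t C. c = [fel B, kel t, fel C])"
  by (auto simp: Cons_tuples Keq_def eq_struct_def KK_def)

lemma FKF_in [simp]: "[fel B, kel t, fel C] \<in> tuples KQ [Real FSort, Real KSort, Real FSort]"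
  by (simp add: Cons_tuples)

text \<open>The code is a relation, and the function is defined at those \<open>d\<close> whose
  column is a singleton.\<close>

lemma good_k:
  "good_fam kS [FSort, KSort, FSort]
    (\<lambda>d a c. \<exists>x B t C. a = [kel x] \<and> c = [fel B, kel t, fel C] \<and> (\<forall>y. rel2 B t C d y \<longleftrightarrow> y = x))"
proof (rule good_famI)
  fix c d D a assume c: "c \<in> tuples KQ (map Real [FSort, KSort, FSort])" and d: "\<not> mem d D" and a: "a \<in> tuples KQ kS"
  obtain B t C where c: "c = [fel B, kel t, fel C]" using FKF_tuples[THEN iffD1, OF c] by blast
  obtain x where x: "a = [kel x]" using a kS_tuples by blast
  have "kfin {y. y = x}" "DP1 (\<lambda>y. y = x)" using kfin_single by (simp, intro dp, simp_all)
  from rel2_update[OF this d, of B t C] obtain B' t' C' where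
    "\<forall>y. rel2 B' t' C' d y \<longleftrightarrow> y = x" "\<forall>d' y. mem d' D \<longrightarrow> (rel2 B' t' C' d' y \<longleftrightarrow> rel2 B t C d' y)" by blast
  then show "\<exists>c'\<in>tuples KQ (map Real [FSort, KSort, FSort]).
      (\<exists>x B t C. a = [kel x] \<and> c' = [fel B, kel t, fel C] \<and> (\<forall>y. rel2 B t C d y \<longleftrightarrow> y = x)) \<and>
      (\<forall>d' a'. mem d' D \<longrightarrow>
         (\<exists>x B t C. a' = [kel x] \<and> c' = [fel B, kel t, fel C] \<and> (\<forall>y. rel2 B t C d' y \<longleftrightarrow> y = x)) =
         (\<exists>x B t C. a' = [kel x] \<and> c = [fel B, kel t, fel C] \<and> (\<forall>y. rel2 B t C d' y \<longleftrightarrow> y = x)))"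
    by (intro bexI[of _ "[fel B', kel t', fel C']"]) (simp_all add: c x FKF_tuples)
next
  show "DP KQ {} (case_nat kS (case_nat kS (case_nat (map Real [FSort, KSort, FSort]) closed_ctx)))
     (\<lambda>e. \<exists>x B t C. e (Suc 0) = [kel x] \<and> e (Suc (Suc 0)) = [fel B, kel t, fel C] \<and>
        (\<forall>y. rel2 B t C (kval (e 0)) y \<longleftrightarrow> y = x))"
    unfolding rel2_def by (intro dp | simp)+
qed (auto simp: FKF_tuples kS_tuples)

text \<open>The same codes, read differently: the value at \<open>d\<close> is the whole column,
  taken as an element of \<open>F(K)\<close>.\<close>

lemma good_f:
  "good_fam fS [FSort, KSort, FSort]
    (\<lambda>d a c. \<exists>A B t C. a = [fel A] \<and> c = [fel B, kel t, fel C] \<and> (\<forall>y. rel2 B t C d y \<longleftrightarrow> mem y A))"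
proof (rule good_famI)
  fix c d D a assume c: "c \<in> tuples KQ (map Real [FSort, KSort, FSort])" and d: "\<not> mem d D" and a: "a \<in> tuples KQ fS"
  obtain B t C where c: "c = [fel B, kel t, fel C]" using FKF_tuples[THEN iffD1, OF c] by blast
  obtain A where A: "a = [fel A]" using a fS_tuples by blast
  have "kfin {y. mem y A}" "DP1 (\<lambda>y. mem y A)" by (simp, intro dp, simp_all)
  from rel2_update[OF this d, of B t C] obtain B' t' C' where
    "\<forall>y. rel2 B' t' C' d y \<longleftrightarrow> mem y A" "\<forall>d' y. mem d' D \<longrightarrow> (rel2 B' t' C' d' y \<longleftrightarrow> rel2 B t C d' y)" by blast
  then show "\<exists>c'\<in>tuples KQ (map Real [FSort, KSort, FSort]).
      (\<exists>A B t C. a = [fel A] \<and> c' = [fel B, kel t, fel C] \<and> (\<forall>y. rel2 B t C d y \<longleftrightarrow> mem y A)) \<and>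
      (\<forall>d' a'. mem d' D \<longrightarrow>
         (\<exists>A B t C. a' = [fel A] \<and> c' = [fel B, kel t, fel C] \<and> (\<forall>y. rel2 B t C d' y \<longleftrightarrow> mem y A)) =
         (\<exists>A B t C. a' = [fel A] \<and> c = [fel B, kel t, fel C] \<and> (\<forall>y. rel2 B t C d' y \<longleftrightarrow> mem y A)))"
    by (intro bexI[of _ "[fel B', kel t', fel C']"]) (simp_all add: c A FKF_tuples)
next
  show "DP KQ {} (case_nat kS (case_nat fS (case_nat (map Real [FSort, KSort, FSort]) closed_ctx)))
     (\<lambda>e. \<exists>A B t C. e (Suc 0) = [fel A] \<and> e (Suc (Suc 0)) = [fel B, kel t, fel C] \<and>
        (\<forall>y. rel2 B t C (kval (e 0)) y \<longleftrightarrow> mem y A))"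
    unfolding rel2_def by (intro dp | simp)+
next
  fix d :: 'k and a a' c :: "('k, 'f) keq list"
  assume "\<exists>A B t C. a = [fel A] \<and> c = [fel B, kel t, fel C] \<and> (\<forall>y. rel2 B t C d y \<longleftrightarrow> mem y A)"
    "\<exists>A B t C. a' = [fel A] \<and> c = [fel B, kel t, fel C] \<and> (\<forall>y. rel2 B t C d y \<longleftrightarrow> mem y A)"
  then obtain A A' where "a = [fel A]" "a' = [fel A']" "\<And>y. mem y A \<longleftrightarrow> mem y A'" by auto
  then show "a = a'" using F_ext[of A A'] by simp
qed (auto simp: FKF_tuples fS_tuples)

lemma good_Nil: "good_fam [] [] (\<lambda>d a c. a = [] \<and> c = [])"
proof (rule good_famI)
  show "DP KQ {} (case_nat kS (case_nat [] (case_nat (map Real []) closed_ctx)))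
     (\<lambda>e. e (Suc 0) = [] \<and> e (Suc (Suc 0)) = [])"
    by (intro dp | simp)+
qed auto

lemma good_append:
  assumes 1: "good_fam ss cs \<Theta>" and 2: "good_fam ts ds \<Theta>'"
  shows "good_fam (ss @ ts) (cs @ ds) (\<lambda>d a c. \<exists>a1\<in>tuples KQ ss. \<exists>a2\<in>tuples KQ ts.
    \<exists>c1\<in>tuples KQ (map Real cs). \<exists>c2\<in>tuples KQ (map Real ds). a = a1 @ a2 \<and> c = c1 @ c2 \<and> \<Theta> d a1 c1 \<and> \<Theta>' d a2 c2)"
    (is "good_fam _ _ ?T")
proof (rule good_famI)
  show "a \<in> tuples KQ (ss @ ts) \<and> c \<in> tuples KQ (map Real (cs @ ds))" if "?T d a c" for d a c
    using that by (auto intro: append_tuplesI)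
  show "DP KQ {} (case_nat kS (case_nat (ss @ ts) (case_nat (map Real (cs @ ds)) closed_ctx)))
       (\<lambda>e. ?T (kval (e 0)) (e (Suc 0)) (e (Suc (Suc 0))))"
    by (intro DP_ex dp DP_app_Theta[OF 1] DP_app_Theta[OF 2] | simp)+
  have iff: "?T d (a1 @ a2) (c1 @ c2) \<longleftrightarrow> \<Theta> d a1 c1 \<and> \<Theta>' d a2 c2"
    if l: "length a1 = length ss" "c1 \<in> tuples KQ (map Real cs)" for d a1 a2 c1 c2
  proof
    assume "?T d (a1 @ a2) (c1 @ c2)"
    then obtain b1 b2 d1 d2 where b: "b1 \<in> tuples KQ ss" "d1 \<in> tuples KQ (map Real cs)"
      "a1 @ a2 = b1 @ b2" "c1 @ c2 = d1 @ d2" "\<Theta> d b1 d1" "\<Theta>' d b2 d2" by blast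
    have "length a1 = length b1" "length c1 = length d1" using l tuples_length[OF b(1)] tuples_length[OF b(2)] tuples_length[OF l(2)] by simp_all
    then show "\<Theta> d a1 c1 \<and> \<Theta>' d a2 c2" using b by (simp add: append_eq_append_conv)
  next
    assume T: "\<Theta> d a1 c1 \<and> \<Theta>' d a2 c2"
    have "a1 \<in> tuples KQ ss" "c1 \<in> tuples KQ (map Real cs)" "a2 \<in> tuples KQ ts" "c2 \<in> tuples KQ (map Real ds)"
      using good_famD(1,2)[OF 1 T[THEN conjunct1]] good_famD(1,2)[OF 2 T[THEN conjunct2]] by simp_all
    with T show "?T d (a1 @ a2) (c1 @ c2)" by blast
  qed
  show "a = a'" if T: "?T d a c" "?T d a' c" for d a a' c
  proof -
    obtain a1 a2 c1 c2 where b: "a1 \<in> tuples KQ ss" "c1 \<in> tuples KQ (map Real cs)"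
      "a = a1 @ a2" "c = c1 @ c2" "\<Theta> d a1 c1" "\<Theta>' d a2 c2" using T(1) by blast
    obtain a1' a2' c1' c2' where b': "a1' \<in> tuples KQ ss" "a' = a1' @ a2'" using T(2) by blast
    have "\<Theta> d a1' c1 \<and> \<Theta>' d a2' c2" 
      using iff[OF tuples_length[OF b'(1)] b(2)] T(2) unfolding b(4) b'(2) by blast
    then have "a1' = a1" "a2' = a2" using good_famD(4)[OF 1 _ b(5)] good_famD(4)[OF 2 _ b(6)] by blast+
    then show ?thesis using b b' by simp
  qed
  fix c d D a assume c: "c \<in> tuples KQ (map Real (cs @ ds))" and d: "\<not> mem d D" and a: "a \<in> tuples KQ (ss @ ts)"
  obtain c1 c2 where c12: "c = c1 @ c2" "c1 \<in> tuples KQ (map Real cs)" "c2 \<in> tuples KQ (map Real ds)"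
    using c by (auto simp: append_tuples)
  obtain a1 a2 where a12: "a = a1 @ a2" "a1 \<in> tuples KQ ss" "a2 \<in> tuples KQ ts"
    using a by (auto simp: append_tuples)
  obtain c1' where c1': "c1' \<in> tuples KQ (map Real cs)" "\<Theta> d a1 c1'" "\<And>d' a'. mem d' D \<Longrightarrow> \<Theta> d' a' c1' \<longleftrightarrow> \<Theta> d' a' c1"
    using good_famD(5)[OF 1 c12(2) d a12(2)] by blast
  obtain c2' where c2': "c2' \<in> tuples KQ (map Real ds)" "\<Theta>' d a2 c2'" "\<And>d' a'. mem d' D \<Longrightarrow> \<Theta>' d' a' c2' \<longleftrightarrow> \<Theta>' d' a' c2"
    using good_famD(5)[OF 2 c12(3) d a12(3)] by blast
  show "\<exists>c'\<in>tuples KQ (map Real (cs @ ds)). ?T d a c' \<and> (\<forall>d' a'. mem d' D \<longrightarrow> ?T d' a' c' = ?T d' a' c)"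
  proof (rule bexI[of _ "c1' @ c2'"], intro conjI allI impI)
    show "?T d a (c1' @ c2')" unfolding a12(1) iff[OF tuples_length[OF a12(2)] c1'(1)] using c1' c2' by blast
    show "c1' @ c2' \<in> tuples KQ (map Real (cs @ ds))" using c1' c2' by (simp add: append_tuplesI)
    fix d' a' assume d': "mem d' D"
    show "?T d' a' (c1' @ c2') = ?T d' a' c"
    proof (cases "a' \<in> tuples KQ (ss @ ts)")
      case True
      then obtain b1 b2 where b: "a' = b1 @ b2" "b1 \<in> tuples KQ ss" by (auto simp: append_tuples)
      show ?thesis unfolding b(1) c12(1) iff[OF tuples_length[OF b(2)] c1'(1)] iff[OF tuples_length[OF b(2)] c12(2)]
        using c1'(3)[OF d'] c2'(3)[OF d'] by blast
    next
      case False
      then show ?thesis by (auto intro: append_tuplesI)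
    qed
  qed
qed

text \<open>Every class has a representative, so a code for a function into representatives also
  codes a function into classes.\<close>

lemma good_proj:
  assumes 1: "good_fam (map Real qs) cs \<Theta>"
  shows "good_fam [Quot qs \<phi>] cs (\<lambda>d a c. \<exists>u\<in>tuples KQ (map Real qs). a \<in> tuples KQ [Quot qs \<phi>] \<and>
    u @ a \<in> proj_graph mem qs \<phi> \<and> \<Theta> d u c)" (is "good_fam _ _ ?T")
proof (rule good_famI)
  show "a \<in> tuples KQ [Quot qs \<phi>] \<and> c \<in> tuples KQ (map Real cs)" if "?T d a c" for d a c
    using that good_famD(2)[OF 1] by blast
  have "DP KQ {} (case_nat kS (case_nat [Quot qs \<phi>] (case_nat (map Real cs) closed_ctx)))
       (\<lambda>e. \<exists>u\<in>tuples KQ (map Real qs). u @ e (Suc 0) \<in> proj_graph mem qs \<phi> \<and> \<Theta> (kval (e 0)) u (e (Suc (Suc 0))))"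
    by (rule DP_ex, rule DP_conj, rule DP_app2[OF DP_proj], (rule DT_slot, simp)+,
        rule DP_app_Theta[OF 1], rule DK_slot, simp, (rule DT_slot, simp)+)
  then show "DP KQ {} (case_nat kS (case_nat [Quot qs \<phi>] (case_nat (map Real cs) closed_ctx)))
       (\<lambda>e. ?T (kval (e 0)) (e (Suc 0)) (e (Suc (Suc 0))))"
    by (rule DP_cong) (use Env_nth[of _ KQ _ "Suc 0"] in force)
  show "a = a'" if T: "?T d a c" "?T d a' c" for d a a' c
  proof -
    obtain u where u: "u \<in> tuples KQ (map Real qs)" "a \<in> tuples KQ [Quot qs \<phi>]" "u @ a \<in> proj_graph mem qs \<phi>" "\<Theta> d u c"
      using T(1) by blast
    obtain u' where u': "u' \<in> tuples KQ (map Real qs)" "a' \<in> tuples KQ [Quot qs \<phi>]" "u' @ a' \<in> proj_graph mem qs \<phi>" "\<Theta> d u' c"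
      using T(2) by blast
    have eq: "u' = u" using good_famD(4)[OF 1 u'(4) u(4)] .
    have l: "length u = length qs" "length a = 1" "length a' = 1"
      using tuples_length[OF u(1)] tuples_length[OF u(2)] tuples_length[OF u'(2)] by auto
    show ?thesis using u(3) u'(3)[unfolded eq] unfolding proj_graph_iff[OF l(1,2)] proj_graph_iff[OF l(1,3)]
      by (auto simp: map_El_eq)
  qed
  fix c d D a assume c: "c \<in> tuples KQ (map Real cs)" and d: "\<not> mem d D" and a: "a \<in> tuples KQ [Quot qs \<phi>]"
  obtain u where u: "u \<in> tuples KQ (map Real qs)" "u @ a \<in> proj_graph mem qs \<phi>" using proj_graph_ex[OF a] by blast
  obtain c' where "c' \<in> tuples KQ (map Real cs)" "\<Theta> d u c'" "\<And>d' a'. mem d' D \<Longrightarrow> \<Theta> d' a' c' \<longleftrightarrow> \<Theta> d' a' c"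
    using good_famD(5)[OF 1 c d u(1)] by blast
  then show "\<exists>c'\<in>tuples KQ (map Real cs). ?T d a c' \<and> (\<forall>d' a'. mem d' D \<longrightarrow> ?T d' a' c' = ?T d' a' c)"
    using u a by (intro bexI[of _ c']) (simp_all, blast)
qed

lemma good_real: "\<exists>cs \<Theta>. good_fam (map Real qs) cs \<Theta>"
proof (induction qs)
  case Nil
  show ?case using good_Nil by auto
next
  case (Cons q qs)
  then obtain cs \<Theta> where *: "good_fam (map Real qs) cs \<Theta>" by blast
  show ?case using good_append[OF good_k *] good_append[OF good_f *] by (cases q) (simp_all, blast+)
qed

lemma good_exists: "\<exists>cs \<Theta>. good_fam ss cs \<Theta>"
proof (induction ss)
  case Nil
  show ?case using good_Nil by auto
next
  case (Cons s ss)
  then obtain cs \<Theta> where *: "good_fam ss cs \<Theta>" by blast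
  have "\<exists>ds \<Theta>'. good_fam [s] ds \<Theta>'"
  proof (cases s)
    case (Real q)
    then show ?thesis using good_real[of "[q]"] by simp
  next
    case (Quot qs \<phi>)
    then show ?thesis using good_real[of qs] good_proj by blast
  qed
  then obtain ds \<Theta>' where "good_fam [s] ds \<Theta>'" by blast
  from good_append[OF this *] show ?case by (simp only: append.simps) blast
qed

end

lemma real_definable_KK:
  fixes mem :: "'k::field \<Rightarrow> 'f \<Rightarrow> bool"
  assumes "DS (Keq mem) {} (map Real ss) X"
  shows "\<exists>\<phi>. fv \<phi> \<subseteq> {..<length ss} \<and> (\<forall>u\<in>tuples (KK mem) ss. map El u \<in> X \<longleftrightarrow> holds (KK mem) \<phi> u)"
proof -
  have "\<exists>\<phi> bs. set bs \<subseteq> univ (KK mem) \<and> (({} :: ('k, 'f) keq set) = {} \<longrightarrow> bs = []) \<and> fv \<phi> \<subseteq> {..<length ss + length bs} \<and>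
    (\<forall>u\<in>tuples (KK mem) ss. map El u \<in> X \<longleftrightarrow> holds (KK mem) \<phi> (u @ bs))"
    by (rule real_definable[where B = "{}"]) (use KK_disjoint assms in \<open>simp_all add: Keq_def\<close>)
  then obtain \<phi> bs where *: "(({} :: ('k, 'f) keq set) = {} \<longrightarrow> bs = []) \<and> fv \<phi> \<subseteq> {..<length ss + length bs} \<and>
    (\<forall>u\<in>tuples (KK mem) ss. map El u \<in> X \<longleftrightarrow> holds (KK mem) \<phi> (u @ bs))" by (elim exE conjE) blast
  then have "bs = []" by simp
  with * show ?thesis by (intro exI[of _ \<phi>]) simp
qed

lemma is_fpsI:
  assumes "definable M X" "definable M Y" "E \<subseteq> X \<times> Y" "definable M (graph_of E)"
    and "\<And>B C. B \<in> Y \<Longrightarrow> C \<in> Y \<Longrightarrow> (\<And>x. x \<in> X \<Longrightarrow> (x, B) \<in> E \<longleftrightarrow> (x, C) \<in> E) \<Longrightarrow> B = C"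
    and "\<exists>B\<in>Y. \<forall>x\<in>X. (x, B) \<notin> E"
    and "\<And>a. a \<in> X \<Longrightarrow> \<exists>B\<in>Y. \<forall>x\<in>X. (x, B) \<in> E \<longleftrightarrow> x = a"
    and "\<And>B C. B \<in> Y \<Longrightarrow> C \<in> Y \<Longrightarrow> \<exists>D\<in>Y. \<forall>x\<in>X. (x, D) \<in> E \<longleftrightarrow> (x, B) \<in> E \<or> (x, C) \<in> E"
    and ind: "\<And>U. definable M U \<Longrightarrow> U \<subseteq> Y \<Longrightarrow> (\<And>B. B \<in> Y \<Longrightarrow> (\<And>x. x \<in> X \<Longrightarrow> (x, B) \<notin> E) \<Longrightarrow> B \<in> U) \<Longrightarrow>
        (\<And>B a C. B \<in> U \<Longrightarrow> a \<in> X \<Longrightarrow> C \<in> Y \<Longrightarrow> (\<And>x. x \<in> X \<Longrightarrow> (x, C) \<in> E \<longleftrightarrow> (x, B) \<in> E \<or> x = a) \<Longrightarrow> C \<in> U)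
        \<Longrightarrow> Y \<subseteq> U"
  shows "is_fps M X (Y, E)"
  unfolding is_fps_def prod.case
proof (intro conjI assms(1-4,6) ballI iffI)
  show "B = C" if "B \<in> Y" "C \<in> Y" "\<forall>x\<in>X. ((x, B) \<in> E) = ((x, C) \<in> E)" for B C
    using that(3) by (intro assms(5)[OF that(1,2)]) blast
  show "\<exists>B\<in>Y. \<forall>x\<in>X. ((x, B) \<in> E) = (x = a)" if "a \<in> X" for a
    by (rule assms(7)[OF that])
  show "\<exists>D\<in>Y. \<forall>x\<in>X. ((x, D) \<in> E) = ((x, B) \<in> E \<or> (x, C) \<in> E)" if "B \<in> Y" "C \<in> Y" for B C
    by (rule assms(8)[OF that])
  show "\<forall>U. definable M U \<and> U \<subseteq> Y \<and> (\<forall>B\<in>Y. (\<forall>x\<in>X. (x, B) \<notin> E) \<longrightarrow> B \<in> U) \<and>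
      (\<forall>B\<in>U. \<forall>a\<in>X. \<forall>C\<in>Y. (\<forall>x\<in>X. ((x, C) \<in> E) = ((x, B) \<in> E \<or> x = a)) \<longrightarrow> C \<in> U) \<longrightarrow> U = Y"
  proof (intro allI impI)
    fix V
    assume V: "definable M V \<and> V \<subseteq> Y \<and> (\<forall>B\<in>Y. (\<forall>x\<in>X. (x, B) \<notin> E) \<longrightarrow> B \<in> V) \<and>
      (\<forall>B\<in>V. \<forall>a\<in>X. \<forall>C\<in>Y. (\<forall>x\<in>X. ((x, C) \<in> E) = ((x, B) \<in> E \<or> x = a)) \<longrightarrow> C \<in> V)"
    have "Y \<subseteq> V"
      by (rule ind) (use V in \<open>simp_all\<close>)
    then show "V = Y" using V by blast
  qed
qed simp_all

context fps_field
begin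

lemma real_tuples_ex: "\<exists>c. c \<in> tuples KQ (map Real cs)"
proof (induction cs)
  case (Cons s cs)
  then obtain c where "c \<in> tuples KQ (map Real cs)" ..
  moreover have "\<exists>a. a \<in> Carr KQ (Real s)" using kel_Carr[of _ mem] by (cases s) blast+
  ultimately show ?case by (auto simp: Cons_tuples)
qed auto

text \<open>A pair of \<open>D\<close> and a code \<open>c\<close> stands for the set of values, on
  the points of \<open>D\<close>, of the partial function with code \<open>c\<close>. Such pairs are
  real tuples, and identifying those with the same set of values is a quotient, so that hyperfinite
  sets of imaginaries become imaginaries themselves. The construction brings in no parameters
  besides those of \<open>X\<close>, which is the last claim.\<close>

lemma fps_exists:
  assumes X: "DS KQ U ss X"
  shows "\<exists>P. is_fps KQ X P \<and> (\<forall>B \<subseteq> U. definable_over KQ B X \<longrightarrow>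
     definable_over KQ B (fst P) \<and> definable_over KQ B (graph_of (snd P)))"
proof -
  obtain cs \<Theta> where gf: "good_fam ss cs \<Theta>" using good_exists by blast
  define cc where "cc = FSort # cs"
  define T where "T = tuples KQ (map Real cc)"
  define ex where "ex = (\<lambda>c a. \<exists>D c' d. c = fel D # c' \<and> mem d D \<and> \<Theta> d a c')"
  have T_iff: "u \<in> T \<longleftrightarrow> (\<exists>D c. u = fel D # c \<and> c \<in> tuples KQ (map Real cs))" for u
    unfolding T_def cc_def list.map Cons_tuples
    by (auto simp: Keq_def eq_struct_def KK_def)
  have ex_iff: "ex (fel D # c) a \<longleftrightarrow> (\<exists>d. mem d D \<and> \<Theta> d a c)" for D c a by (auto simp: ex_def)
  have ex_tuples: "a \<in> tuples KQ ss" if "ex c a" for c a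
    using that good_famD(1)[OF gf] by (auto simp: ex_def)

  have DPex: "DP KQ B (case_nat (map Real cc) (case_nat ss closed_ctx)) (\<lambda>e. ex (e 0) (e (Suc 0)))" for B
  proof -
    have "DP KQ B (case_nat (map Real cc) (case_nat ss closed_ctx))
        (\<lambda>e. \<exists>D. \<exists>c\<in>tuples KQ (map Real cs). \<exists>d. e 0 = fel D # c \<and> mem d D \<and> \<Theta> d (e (Suc 0)) c)"
      by (intro DP_ex dp DP_app_Theta[OF gf] | simp add: cc_def)+
    then show ?thesis
      by (rule DP_cong) (unfold ex_def, use good_famD(2)[OF gf] in blast)
  qed
  note dpex = DP_app2[OF DPex]
  \<comment> \<open>Quotient sorts exist for parameter-free real formulas, so equality of value sets
    has to be brought into that form.\<close>
  have "DS KQ {} (map Real (cc @ cc)) {u @ v |u v. u \<in> T \<and> v \<in> T \<and> (\<forall>a\<in>tuples KQ ss. ex u a \<longleftrightarrow> ex v a)}"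
    unfolding DS_def
  proof
    have "DP KQ {} (case_nat (map Real (cc @ cc)) closed_ctx)
        (\<lambda>e. \<exists>u\<in>T. \<exists>v\<in>T. e 0 = u @ v \<and> (\<forall>a\<in>tuples KQ ss. ex u a \<longleftrightarrow> ex v a))"
      unfolding T_def by (intro DP_ex DP_all dp dpex | simp)+
    then show "DP KQ {} (case_nat (map Real (cc @ cc)) closed_ctx)
        (\<lambda>e. e 0 \<in> {u @ v |u v. u \<in> T \<and> v \<in> T \<and> (\<forall>a\<in>tuples KQ ss. ex u a \<longleftrightarrow> ex v a)})"
      by (rule DP_cong) auto
  qed (auto simp: T_def intro: append_tuplesI)
  from real_definable_KK[OF this] obtain \<phi> where
    0: "fv \<phi> \<subseteq> {..<length (cc @ cc)} \<and>
    (\<forall>w\<in>tuples (KK mem) (cc @ cc). map El w \<in> {u @ v |u v. u \<in> T \<and> v \<in> T \<and> (\<forall>a\<in>tuples KQ ss. ex u a \<longleftrightarrow> ex v a)}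
       \<longleftrightarrow> holds (KK mem) \<phi> w)" by (elim exE)
  then have fv\<phi>: "fv \<phi> \<subseteq> {..<2 * length cc}" by (simp add: mult_2)
  note \<phi> = 0[THEN conjunct2, rule_format]
  have T_El: "map El u \<in> T \<longleftrightarrow> u \<in> tuples (KK mem) cc" for u
    unfolding T_def Keq_def by (rule map_El_tuples)
  have ext_iff: "(\<forall>a\<in>tuples KQ ss. ex u a \<longleftrightarrow> ex v a) \<longleftrightarrow> ex u = ex v" for u v
    using ex_tuples by (auto simp: fun_eq_iff)
  have hold: "holds (KK mem) \<phi> (u @ v) \<longleftrightarrow> ex (map El u) = ex (map El v)"
    if u: "u \<in> tuples (KK mem) cc" and v: "v \<in> tuples (KK mem) cc" for u v
  proof -
    have "holds (KK mem) \<phi> (u @ v) \<longleftrightarrow>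
      map El (u @ v) \<in> {u @ v |u v. u \<in> T \<and> v \<in> T \<and> (\<forall>a\<in>tuples KQ ss. ex u a \<longleftrightarrow> ex v a)}"
      by (rule \<phi>[symmetric, OF append_tuplesI[OF u v]])
    also have "\<dots> \<longleftrightarrow> ex (map El u) = ex (map El v)"
    proof
      assume "map El (u @ v) \<in> {u @ v |u v. u \<in> T \<and> v \<in> T \<and> (\<forall>a\<in>tuples KQ ss. ex u a \<longleftrightarrow> ex v a)}"
      then obtain u' v' where *: "map El u @ map El v = u' @ v'" "u' \<in> T" "ex u' = ex v'" unfolding ext_iff by auto
      have "length (map El u) = length u'" using tuples_length[OF u] tuples_length[OF *(2)[unfolded T_def]] by simp
      then show "ex (map El u) = ex (map El v)" using * by (simp add: append_eq_append_conv)
    next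
      assume "ex (map El u) = ex (map El v)"
      then show "map El (u @ v) \<in> {u @ v |u v. u \<in> T \<and> v \<in> T \<and> (\<forall>a\<in>tuples KQ ss. ex u a \<longleftrightarrow> ex v a)}"
        unfolding ext_iff map_append using T_El u v by blast
    qed
    finally show ?thesis .
  qed
  have q: "(cc, \<phi>) \<in> quotients (KK mem)"
    unfolding quotients_def mem_Collect_eq prod.case
    by (intro conjI fv\<phi> equivI) (auto simp: refl_on_def sym_def trans_def eqrel_def hold)
  define s where "s = [Quot cc \<phi> :: (sort, sym) eqsort]"
  define Pr where "Pr = (\<lambda>c b. c \<in> T \<and> b \<in> tuples KQ s \<and> c @ b \<in> proj_graph mem cc \<phi>)"
  have Pr_ex1: "\<exists>b. Pr c b" if c: "c \<in> T" for c
  proof -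
    obtain u where u: "u \<in> tuples (KK mem) cc" "c = map El u" using c unfolding T_def Real_tuples by blast
    let ?b = "[Cls cc \<phi> (eqrel (KK mem) cc \<phi> `` {u})]"
    have "c @ ?b \<in> proj_graph mem cc \<phi>"
      using proj_graph_iff[of c cc ?b mem \<phi>] tuples_length[OF u(1)] u q by auto
    moreover have "?b \<in> tuples KQ s" using u(1) q by (auto simp: s_def Quot_tuples)
    ultimately show ?thesis using c by (auto simp: Pr_def)
  qed
  have Pr_ex2: "\<exists>c. Pr c b" if "b \<in> tuples KQ s" for b
    using proj_graph_ex[of b mem cc \<phi>] that by (auto simp: Pr_def s_def T_def)
  have Pr_eq: "b = b' \<longleftrightarrow> ex c = ex c'" if P: "Pr c b" "Pr c' b'" for b b' c c'
  proof -
    have T: "c \<in> T" "c' \<in> T" "b \<in> tuples KQ s" "b' \<in> tuples KQ s" and p: "c @ b \<in> proj_graph mem cc \<phi>" "c' @ b' \<in> proj_graph mem cc \<phi>"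
      using P by (auto simp only: Pr_def)
    have l: "length c = length cc" "length c' = length cc" "length b = 1" "length b' = 1"
      using T tuples_length unfolding T_def s_def by fastforce+
    obtain u where u: "u \<in> tuples (KK mem) cc" "c = map El u" "b = [Cls cc \<phi> (eqrel (KK mem) cc \<phi> `` {u})]"
      using proj_graph_iff[THEN iffD1, OF l(1,3) p(1)] by blast
    obtain u' where u': "u' \<in> tuples (KK mem) cc" "c' = map El u'" "b' = [Cls cc \<phi> (eqrel (KK mem) cc \<phi> `` {u'})]"
      using proj_graph_iff[THEN iffD1, OF l(2,4) p(2)] by blast
    show ?thesis using quotients_eq_iff[OF q u(1) u'(1)] hold[OF u(1) u'(1)] u u' by simp
  qed
  have dpPr: "DT KQ B \<Gamma> (map Real cc) t \<Longrightarrow> DT KQ B \<Gamma> s t' \<Longrightarrow> DP KQ B \<Gamma> (\<lambda>e. Pr (t e) (t' e))" for B \<Gamma> t t'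
  proof -
    assume t: "DT KQ B \<Gamma> (map Real cc) t" "DT KQ B \<Gamma> s t'"
    have "DP KQ B \<Gamma> (\<lambda>e. t e @ t' e \<in> proj_graph mem cc \<phi>)"
      by (rule DP_app2[OF DP_proj t[unfolded s_def]])
    then show ?thesis by (rule DP_cong) (use DT_tuples[OF t(1)] DT_tuples[OF t(2)] in \<open>auto simp: Pr_def T_def\<close>)
  qed

  define Y where "Y = {b. \<exists>c. Pr c b \<and> (\<forall>a. ex c a \<longrightarrow> a \<in> X)}"
  define E where "E = {(a, b). \<exists>c. Pr c b \<and> (\<forall>a. ex c a \<longrightarrow> a \<in> X) \<and> ex c a}"
  have XS: "X \<subseteq> tuples KQ ss" by (rule DS_subset[OF X])
  have YI: "b \<in> Y \<longleftrightarrow> (\<forall>a. ex c a \<longrightarrow> a \<in> X)" if "Pr c b" for b c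
  proof
    assume "b \<in> Y"
    then obtain c' where "Pr c' b" "\<forall>a. ex c' a \<longrightarrow> a \<in> X" by (auto simp: Y_def)
    then show "\<forall>a. ex c a \<longrightarrow> a \<in> X" using Pr_eq[of c' b c b] that by simp
  qed (use that in \<open>auto simp: Y_def\<close>)
  have EI: "(a, b) \<in> E \<longleftrightarrow> ex c a" if "Pr c b" "b \<in> Y" for a b c
  proof
    assume "(a, b) \<in> E"
    then obtain c' where "Pr c' b" "ex c' a" by (auto simp: E_def)
    then show "ex c a" using Pr_eq[of c' b c b] that by simp
  qed (use that YI[OF that(1)] in \<open>auto simp: E_def\<close>)
  have Y_tuples: "Y \<subseteq> tuples KQ s" by (auto simp: Y_def Pr_def)
  have EXY: "E \<subseteq> X \<times> Y" by (auto simp: E_def Y_def)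
  have DS_Y: "DS KQ B s Y" if XB: "DS KQ B ss X" for B
    unfolding DS_def
  proof
    have "DP KQ B (case_nat s closed_ctx) (\<lambda>e. \<exists>c\<in>tuples KQ (map Real cc). Pr c (e 0) \<and> (\<forall>a\<in>tuples KQ ss. ex c a \<longrightarrow> a \<in> X))"
      by (intro DP_ex DP_all dp dpex dpPr DP_in[OF XB] | simp)+
    then show "DP KQ B (case_nat s closed_ctx) (\<lambda>e. e 0 \<in> Y)"
      by (rule DP_cong) (unfold Y_def mem_Collect_eq, use ex_tuples in \<open>auto simp: Pr_def T_def\<close>)
  qed (rule Y_tuples)
  have DS_E: "DS KQ B (ss @ s) (graph_of E)" if XB: "DS KQ B ss X" for B
    unfolding DS_def
  proof
    have "DP KQ B (case_nat (ss @ s) closed_ctx)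
       (\<lambda>e. \<exists>a\<in>tuples KQ ss. \<exists>b\<in>tuples KQ s. e 0 = a @ b \<and> (\<exists>c\<in>tuples KQ (map Real cc). Pr c b \<and> b \<in> Y \<and> ex c a))"
      by (intro DP_ex DP_all dp dpex dpPr DP_in[OF DS_Y[OF XB]] | simp)+
    then show "DP KQ B (case_nat (ss @ s) closed_ctx) (\<lambda>e. e 0 \<in> graph_of E)"
    proof (rule DP_cong)
      fix e
      have "(a, b) \<in> E \<longleftrightarrow> a \<in> tuples KQ ss \<and> b \<in> tuples KQ s \<and> (\<exists>c\<in>tuples KQ (map Real cc). Pr c b \<and> b \<in> Y \<and> ex c a)" for a b
      proof
        assume ab: "(a, b) \<in> E"
        then have "b \<in> Y" "a \<in> X" using EXY by auto
        moreover then obtain c where "Pr c b" by (auto simp: Y_def)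
        ultimately show "a \<in> tuples KQ ss \<and> b \<in> tuples KQ s \<and> (\<exists>c\<in>tuples KQ (map Real cc). Pr c b \<and> b \<in> Y \<and> ex c a)"
          using EI[of c b a] ab XS Y_tuples by (auto simp: Pr_def T_def)
      qed (use EI in blast)
      then show "(\<exists>a\<in>tuples KQ ss. \<exists>b\<in>tuples KQ s. e 0 = a @ b \<and> (\<exists>c\<in>tuples KQ (map Real cc). Pr c b \<and> b \<in> Y \<and> ex c a)) \<longleftrightarrow>
          e 0 \<in> graph_of E"
        unfolding graph_of_def by blast
    qed
  next
    show "graph_of E \<subseteq> tuples KQ (ss @ s)"
      unfolding graph_of_def using EXY XS Y_tuples by (auto intro!: append_tuplesI)
  qed

  have empty: "\<exists>c\<in>T. \<forall>a. \<not> ex c a"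
  proof -
    obtain D where "\<forall>x. \<not> mem x D" using F_empty by blast
    moreover obtain c where "c \<in> tuples KQ (map Real cs)" using real_tuples_ex by blast
    ultimately show ?thesis by (intro bexI[of _ "fel D # c"]) (auto simp: ex_iff T_iff)
  qed
  have insert: "\<exists>c'\<in>T. \<forall>x. ex c' x \<longleftrightarrow> ex c x \<or> x = a" if c: "c \<in> T" and a: "a \<in> tuples KQ ss" for c a
  proof -
    obtain D c1 where c1: "c = fel D # c1" "c1 \<in> tuples KQ (map Real cs)" using T_iff[THEN iffD1, OF c] by blast
    \<comment> \<open>A fresh point exists since \<open>K\<close> is not hyperfinite; it receives
      the value \<open>a\<close>.\<close>
    obtain d where d: "\<not> mem d D" using kfin_new[OF kfin_mem[of D]] by blast
    obtain c2 where c2: "c2 \<in> tuples KQ (map Real cs)" "\<Theta> d a c2" "\<And>d' a'. mem d' D \<Longrightarrow> \<Theta> d' a' c2 \<longleftrightarrow> \<Theta> d' a' c1"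
      using good_famD(5)[OF gf c1(2) d a] by blast
    obtain D' where D': "\<And>x. mem x D' \<longleftrightarrow> x \<in> insert d {x. mem x D}"
      using kfin_insert[OF kfin_mem, of d D] unfolding kfin_iff by blast
    have "ex (fel D' # c2) x \<longleftrightarrow> ex c x \<or> x = a" for x
      using c2 good_famD(4)[OF gf, of d x c2 a] by (auto simp: ex_iff c1(1) D')
    then show ?thesis using c2(1) by (intro bexI[of _ "fel D' # c2"]) (auto simp: T_iff)
  qed
  have inter: "\<exists>D'. \<forall>x. mem x D' \<longleftrightarrow> mem x A \<and> mem x D" for A D
  proof -
    have "DP1 (\<lambda>x. mem x D)" by (intro dp) simp_all
    from kfin_subset[OF kfin_mem[of A] this] show ?thesis unfolding kfin_iff by simp
  qed
  have "is_fps KQ X (Y, E)"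
  proof (rule is_fpsI)
    show "definable KQ X" "definable KQ Y" "definable KQ (graph_of E)"
      using X DS_Y[OF X] DS_E[OF X] unfolding definable_iff by blast+
    show "E \<subseteq> X \<times> Y" by (rule EXY)
    fix B C assume B: "B \<in> Y" and C: "C \<in> Y"
    obtain c where c: "Pr c B" using B by (auto simp: Y_def)
    obtain c' where c': "Pr c' C" using C by (auto simp: Y_def)
    show "B = C" if eq: "\<And>x. x \<in> X \<Longrightarrow> (x, B) \<in> E \<longleftrightarrow> (x, C) \<in> E"
    proof -
      have "ex c x \<longleftrightarrow> ex c' x" for x
        using eq[of x] EI[OF c B] EI[OF c' C] YI[OF c] YI[OF c'] B C by blast
      then show ?thesis using Pr_eq[OF c c'] by (auto simp: fun_eq_iff)
    qed
    have cT: "c \<in> T" "c' \<in> T" using c c' by (auto simp: Pr_def)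
    obtain D0 c1 where c1: "c' = fel D0 # c1" "c1 \<in> tuples KQ (map Real cs)" using T_iff[THEN iffD1, OF cT(2)] by blast
    \<comment> \<open>Union by hyperfinite induction on the points at which the second code is read,
      inserting one value at a time.\<close>
    have "\<exists>c2\<in>T. \<forall>x. ex c2 x \<longleftrightarrow> ex c x \<or> ex (fel A # c1) x" for A
    proof (induction A rule: F_induct)
      case 1
      have *: "set c \<subseteq> U" "set c1 \<subseteq> U" using cT(1) c1(2) tuples_subset_univ unfolding T_def by blast+
      have "DP KQ U (case_nat fS closed_ctx) (\<lambda>e. \<exists>c2\<in>T. \<forall>x\<in>tuples KQ ss. ex c2 x \<longleftrightarrow> ex c x \<or> ex (fel (sval (e 0)) # c1) x)"
        unfolding T_def
        by (intro DP_ex DP_all dp dpex DT_const[OF cT(1)[unfolded T_def] *(1)] DT_const[OF c1(2) *(2)] | simp add: cc_def)+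
      then show ?case by (rule DP_cong) (use ex_tuples in blast)
    next
      case (2 A)
      then show ?case using cT(1) by (intro bexI[of _ c]) (auto simp: ex_iff)
    next
      case (3 A d A')
      then obtain c2 where c2: "c2 \<in> T" "\<And>x. ex c2 x \<longleftrightarrow> ex c x \<or> ex (fel A # c1) x" by blast
      have e': "ex (fel A' # c1) x \<longleftrightarrow> ex (fel A # c1) x \<or> \<Theta> d x c1" for x by (auto simp: ex_iff 3(2))
      show ?case
      proof (cases "\<exists>a. \<Theta> d a c1")
        case True
        then obtain a where a: "\<Theta> d a c1" by blast
        then obtain c3 where c3: "c3 \<in> T" "\<And>x. ex c3 x \<longleftrightarrow> ex c2 x \<or> x = a"
          using insert[OF c2(1) good_famD(1)[OF gf a]] by blast
        have "ex c3 x \<longleftrightarrow> ex c x \<or> ex (fel A' # c1) x" for x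
          unfolding c3(2) c2(2) e' using a good_famD(4)[OF gf a, of x] by blast
        then show ?thesis using c3(1) by blast
      next
        case False
        then have "ex c2 x \<longleftrightarrow> ex c x \<or> ex (fel A' # c1) x" for x unfolding c2(2) e' by blast
        then show ?thesis using c2(1) by blast
      qed
    qed
    then obtain c2 where c2: "c2 \<in> T" "\<And>x. ex c2 x \<longleftrightarrow> ex c x \<or> ex c' x" unfolding c1(1) by meson
    obtain b where b: "Pr c2 b" using Pr_ex1[OF c2(1)] by blast
    have "b \<in> Y" using YI[OF b] YI[OF c] YI[OF c'] B C c2(2) by blast
    then show "\<exists>D\<in>Y. \<forall>x\<in>X. (x, D) \<in> E \<longleftrightarrow> (x, B) \<in> E \<or> (x, C) \<in> E"
      using EI[OF b] EI[OF c B] EI[OF c' C] c2(2) by blast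
  next
    obtain c where c: "c \<in> T" "\<forall>a. \<not> ex c a" using empty by blast
    obtain b where b: "Pr c b" using Pr_ex1[OF c(1)] by blast
    then have "b \<in> Y" using c(2) YI[OF b] by blast
    then show "\<exists>B\<in>Y. \<forall>x\<in>X. (x, B) \<notin> E" using EI[OF b] c(2) by blast
    fix a assume a: "a \<in> X"
    obtain c' where c': "c' \<in> T" "\<And>x. ex c' x \<longleftrightarrow> x = a" using insert[OF c(1), of a] c(2) a XS by blast
    obtain b' where b': "Pr c' b'" using Pr_ex1[OF c'(1)] by blast
    then have "b' \<in> Y" using c'(2) YI[OF b'] a by simp
    then show "\<exists>B\<in>Y. \<forall>x\<in>X. (x, B) \<in> E \<longleftrightarrow> x = a" using EI[OF b'] c'(2) by blast
  next
    fix V assume V: "definable KQ V" "V \<subseteq> Y"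
      and V0: "\<And>B. B \<in> Y \<Longrightarrow> (\<And>x. x \<in> X \<Longrightarrow> (x, B) \<notin> E) \<Longrightarrow> B \<in> V"
      and V1: "\<And>B a C. B \<in> V \<Longrightarrow> a \<in> X \<Longrightarrow> C \<in> Y \<Longrightarrow> (\<And>x. x \<in> X \<Longrightarrow> (x, C) \<in> E \<longleftrightarrow> (x, B) \<in> E \<or> x = a) \<Longrightarrow> C \<in> V"
    obtain s' where "DS KQ U s' V" using V(1) by (auto simp: definable_iff)
    then have DV: "DS KQ U s V" using DS_sort_transfer[of mem U s' V s] V(2) Y_tuples by blast
    show "Y \<subseteq> V"
    proof
      fix b0 assume b0: "b0 \<in> Y"
      obtain c0 where c0: "Pr c0 b0" using b0 by (auto simp: Y_def)
      then have c0T: "c0 \<in> T" by (simp add: Pr_def)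
      obtain D0 c where c: "c0 = fel D0 # c" "c \<in> tuples KQ (map Real cs)" using T_iff[THEN iffD1, OF c0T] by blast
      have cU: "set c \<subseteq> U" using c(2) tuples_subset_univ by blast
      have sub: "x \<in> X" if "ex (fel D # c) x" "\<And>d. mem d D \<Longrightarrow> mem d D0" for D x
        using that YI[OF c0] b0 unfolding c(1) ex_iff by blast
      \<comment> \<open>The induction runs over all \<open>A\<close>, but the code is read on the
        intersection with \<open>D0\<close>: there the values are known to be in
        \<open>X\<close>.\<close>
      have "\<forall>D. (\<forall>x. mem x D \<longleftrightarrow> mem x A \<and> mem x D0) \<longrightarrow> (\<forall>b\<in>tuples KQ s. Pr (fel D # c) b \<longrightarrow> b \<in> V)" for A
      proof (induction A rule: F_induct)
        case 1
        show ?case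
          by (intro DP_all dp dpPr DT_const[OF c(2) cU] DP_in[OF DV] | simp add: cc_def)+
      next
        case (2 A)
        show ?case
        proof (intro allI impI ballI)
          fix D b assume D: "\<forall>x. mem x D \<longleftrightarrow> mem x A \<and> mem x D0" and b: "Pr (fel D # c) b"
          have "\<not> ex (fel D # c) x" for x using D 2 by (simp add: ex_iff)
          then show "b \<in> V" using V0[of b] YI[OF b] EI[OF b] by blast
        qed
      next
        case (3 A d A')
        show ?case
        proof (intro allI impI ballI)
          fix D b assume D: "\<forall>x. mem x D \<longleftrightarrow> mem x A' \<and> mem x D0" and b: "Pr (fel D # c) b"
          obtain D1 where D1: "\<And>x. mem x D1 \<longleftrightarrow> mem x A \<and> mem x D0" using inter by blast
          have "fel D1 # c \<in> T" using c(2) by (auto simp: T_iff)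
          then obtain b1 where b1: "Pr (fel D1 # c) b1" using Pr_ex1 by blast
          then have b1V: "b1 \<in> V" using 3(1) D1 by (auto simp: Pr_def)
          have b1Y: "b1 \<in> Y" using b1V V(2) by blast
          have bY: "b \<in> Y" unfolding YI[OF b] using sub D by blast
          have e: "ex (fel D # c) x \<longleftrightarrow> ex (fel D1 # c) x \<or> mem d D0 \<and> \<Theta> d x c" for x
            using D D1 3(2) by (auto simp: ex_iff)
          show "b \<in> V"
          proof (cases "mem d D0 \<and> (\<exists>a. \<Theta> d a c)")
            case True
            then obtain a where a: "\<Theta> d a c" by blast
            have "a \<in> X" using sub[of D0 a] True a by (auto simp: ex_iff)
            moreover have "(x, b) \<in> E \<longleftrightarrow> (x, b1) \<in> E \<or> x = a" for x
              unfolding EI[OF b bY] EI[OF b1 b1Y] e using True a good_famD(4)[OF gf a, of x] by blast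
            ultimately show ?thesis using V1[OF b1V _ bY] by blast
          next
            case False
            then have "ex (fel D # c) = ex (fel D1 # c)" using e by (auto simp: fun_eq_iff)
            then show ?thesis using Pr_eq[OF b b1] b1V by simp
          qed
        qed
      qed
      then show "b0 \<in> V" using c0 unfolding c(1) by (meson Pr_def)
    qed
  qed
  moreover have "definable_over KQ B Y \<and> definable_over KQ B (graph_of E)" if "B \<subseteq> U" "definable_over KQ B X" for B
  proof -
    have "DS KQ B ss X" using definable_overD[OF that(2)] DS_sort_transfer XS by blast
    then show ?thesis using DS_Y DS_E definable_overI by blast
  qed
  ultimately show ?thesis by (intro exI[of _ "(Y, E)"]) simp
qed

end

section \<open>Hyperfinite sets\<close>

lemma DS_tuples: "DS M B ss (tuples M ss)"
  unfolding DS_def by (rule conjI, simp, rule DP_cong[OF DP_True]) (auto dest: Env_head)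

lemma DS_Collect2:
  assumes "DP M B (case_nat ss closed_ctx) (\<lambda>e. P (e 0))"
  shows "DS M B ss {u \<in> tuples M ss. P u}"
  unfolding DS_def using assms by (auto elim!: DP_cong dest: Env_head)

lemma DS_definable: "DS M (univ M) ss X \<Longrightarrow> definable M X"
  by (auto simp: definable_iff)

context fps_field
begin

abbreviation FinQ :: "('k, 'f) keq list set \<Rightarrow> ('k, 'f) keq list set" where
  "FinQ \<equiv> Fin KQ"
abbreviation extQ :: "('k, 'f) keq list set \<Rightarrow> ('k, 'f) keq list \<Rightarrow> ('k, 'f) keq list set" where
  "extQ \<equiv> ext KQ"

text \<open>\<open>fps_exists\<close> justifies the choice made in \<open>fps\<close>. The second
  part is what makes the power set invariant under maps that fix the parameters of
  \<open>X\<close>.\<close>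

lemma fps_spec:
  assumes "DS KQ U ss X"
  shows "is_fps KQ X (FinQ X, snd (fps KQ X))"
    and "B \<subseteq> U \<Longrightarrow> definable_over KQ B X \<Longrightarrow>
      definable_over KQ B (FinQ X) \<and> definable_over KQ B (graph_of (snd (fps KQ X)))"
proof -
  have *: "is_fps KQ X (fps KQ X) \<and> (\<forall>B \<subseteq> U. definable_over KQ B X \<longrightarrow>
     definable_over KQ B (fst (fps KQ X)) \<and> definable_over KQ B (graph_of (snd (fps KQ X))))"
    unfolding fps_def by (rule someI_ex, rule fps_exists[OF assms])
  then show "is_fps KQ X (FinQ X, snd (fps KQ X))" by (simp add: Fin_def)
  show "B \<subseteq> U \<Longrightarrow> definable_over KQ B X \<Longrightarrow>
      definable_over KQ B (FinQ X) \<and> definable_over KQ B (graph_of (snd (fps KQ X)))"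
    using * by (simp add: Fin_def)
qed

text \<open>\<open>fps\<close> is an unspecified choice, so the sorts of its elements can only be
  named by another choice.\<close>

definition fsort :: "('k, 'f) keq list set \<Rightarrow> (sort, sym) eqsort list" where
  "fsort X = (SOME s. DS KQ U s (FinQ X))"

lemma DS_Fin: "DS KQ U ss X \<Longrightarrow> DS KQ U (fsort X) (FinQ X)"
  unfolding fsort_def using is_fpsD(2)[OF fps_spec(1)] by (auto simp: definable_iff intro: someI_ex)

lemma ext_subset: "extQ X B \<subseteq> X"
  by (auto simp: ext_def)

lemma DP_ext:
  assumes X: "DS KQ U ss X" and t: "DT KQ U \<Gamma> ss t" "DT KQ U \<Gamma> (fsort X) u"
  shows "DP KQ U \<Gamma> (\<lambda>e. t e \<in> extQ X (u e))"
proof -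
  obtain s where "DS KQ U s (graph_of (snd (fps KQ X)))"
    using is_fpsD(4)[OF fps_spec(1)[OF X]] by (auto simp: definable_iff)
  moreover have "graph_of (snd (fps KQ X)) \<subseteq> tuples KQ (ss @ fsort X)"
    using is_fpsD(3)[OF fps_spec(1)[OF X]] DS_subset[OF X] DS_subset[OF DS_Fin[OF X]]
    by (auto simp: graph_of_def intro!: append_tuplesI)
  ultimately have "DS KQ U (ss @ fsort X) (graph_of (snd (fps KQ X)))" by (rule DS_sort_transfer)
  from DP_in[OF this DT_append[OF t]]
  have "DP KQ U \<Gamma> (\<lambda>e. t e @ u e \<in> graph_of (snd (fps KQ X)))" .
  then show ?thesis
  proof (rule DP_cong)
    fix e assume e: "e \<in> Env KQ \<Gamma>"
    have lt: "length (t e) = length ss" using DT_tuples[OF t(1) e] by (rule tuples_length)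
    have E: "snd (fps KQ X) \<subseteq> X \<times> FinQ X" by (rule is_fpsD(3)[OF fps_spec(1)[OF X]])
    have "length a = length ss" if "(a, b) \<in> snd (fps KQ X)" for a b
      using that E DS_subset[OF X] tuples_length by blast
    then have "t e @ u e \<in> graph_of (snd (fps KQ X)) \<longleftrightarrow> (t e, u e) \<in> snd (fps KQ X)"
      using lt by (fastforce simp: graph_of_def append_eq_append_conv)
    then show "t e @ u e \<in> graph_of (snd (fps KQ X)) \<longleftrightarrow> t e \<in> extQ X (u e)"
      using E by (auto simp: ext_def)
  qed
qed

lemma ext_inj: "DS KQ U ss X \<Longrightarrow> B \<in> FinQ X \<Longrightarrow> C \<in> FinQ X \<Longrightarrow> extQ X B = extQ X C \<Longrightarrow> B = C"
  by (rule fps_ext[OF fps_spec(1)]) (auto simp: ext_def set_eq_iff)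

lemma Fin_empty: "DS KQ U ss X \<Longrightarrow> \<exists>B\<in>FinQ X. extQ X B = {}"
  using is_fpsD(6)[OF fps_spec(1), of ss X] by (auto simp: ext_def set_eq_iff)

lemma Fin_single:
  assumes X: "DS KQ U ss X" and a: "a \<in> X"
  shows "\<exists>B\<in>FinQ X. extQ X B = {a}"
proof -
  obtain B where "B \<in> FinQ X" "\<forall>x\<in>X. (x, B) \<in> snd (fps KQ X) \<longleftrightarrow> x = a"
    using is_fpsD(7)[OF fps_spec(1)[OF X]] a by blast
  then show ?thesis using a by (intro bexI[of _ B]) (auto simp: ext_def)
qed

lemma Fin_union:
  assumes X: "DS KQ U ss X" and "B \<in> FinQ X" "C \<in> FinQ X"
  shows "\<exists>D\<in>FinQ X. extQ X D = extQ X B \<union> extQ X C"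
proof -
  obtain D where "D \<in> FinQ X" "\<forall>x\<in>X. (x, D) \<in> snd (fps KQ X) \<longleftrightarrow> (x, B) \<in> snd (fps KQ X) \<or> (x, C) \<in> snd (fps KQ X)"
    using is_fpsD(8)[OF fps_spec(1)[OF X]] assms(2,3) by blast
  then show ?thesis by (intro bexI[of _ D]) (auto simp: ext_def)
qed

lemma Fin_insert:
  assumes X: "DS KQ U ss X" and "B \<in> FinQ X" "a \<in> X"
  shows "\<exists>D\<in>FinQ X. extQ X D = insert a (extQ X B)"
  using Fin_single[OF X assms(3)] Fin_union[OF X _ assms(2)] by (metis insert_is_Un)

lemma Fin_induct:
  assumes X: "DS KQ U ss X"
    and P: "DP KQ U (case_nat (fsort X) closed_ctx) (\<lambda>e. P (e 0))"
    and empty: "\<And>B. B \<in> FinQ X \<Longrightarrow> extQ X B = {} \<Longrightarrow> P B"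
    and insert: "\<And>B a C. B \<in> FinQ X \<Longrightarrow> C \<in> FinQ X \<Longrightarrow> P B \<Longrightarrow> a \<in> X \<Longrightarrow> a \<notin> extQ X B \<Longrightarrow>
        extQ X C = insert a (extQ X B) \<Longrightarrow> P C"
    and B: "B \<in> FinQ X"
  shows "P B"
proof (rule fps_induct[OF fps_spec(1)[OF X] _ _ _ B, where P = P])
  have "DS KQ U (fsort X) {B \<in> FinQ X. P B}"
    unfolding DS_def
  proof
    have "DP KQ U (case_nat (fsort X) closed_ctx) (\<lambda>e. e 0 \<in> FinQ X \<and> P (e 0))"
      by (intro DP_conj P DP_in[OF DS_Fin[OF X]] DT_slot) simp
    then show "DP KQ U (case_nat (fsort X) closed_ctx) (\<lambda>e. e 0 \<in> {B \<in> FinQ X. P B})" by simp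
  qed (use DS_subset[OF DS_Fin[OF X]] in blast)
  then show "definable KQ {B \<in> FinQ X. P B}" by (rule DS_definable)
  show "P B" if "B \<in> FinQ X" "\<And>x. x \<in> X \<Longrightarrow> (x, B) \<notin> snd (fps KQ X)" for B
    using that by (intro empty) (auto simp: ext_def)
  fix B a C assume *: "B \<in> FinQ X" "C \<in> FinQ X" "P B" "a \<in> X"
    "\<And>x. x \<in> X \<Longrightarrow> (x, C) \<in> snd (fps KQ X) \<longleftrightarrow> (x, B) \<in> snd (fps KQ X) \<or> x = a"
  have e: "extQ X C = insert a (extQ X B)" using *(4,5) by (auto simp: ext_def)
  show "P C"
  proof (cases "a \<in> extQ X B")
    case True
    \<comment> \<open>Inserting an old element changes nothing, by extensionality; so the induction
      step may assume that \<open>a\<close> is new.\<close>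
    then have "C = B" using e by (intro ext_inj[OF X *(2,1)]) auto
    then show ?thesis using *(3) by simp
  next
    case False
    then show ?thesis using insert[OF *(1-4) _ e] by simp
  qed
qed

text \<open>The ambient set is fixed to all tuples of the given sorts, so that hyperfiniteness does
  not depend on the definable set from which the elements are taken.\<close>

definition hf :: "(sort, sym) eqsort list \<Rightarrow> ('k, 'f) keq list set \<Rightarrow> bool" where
  "hf ss S \<longleftrightarrow> (\<exists>B\<in>FinQ (tuples KQ ss). extQ (tuples KQ ss) B = S)"

lemma hf_tuples: "hf ss S \<Longrightarrow> S \<subseteq> tuples KQ ss"
  using ext_subset by (auto simp: hf_def)

lemma hf_empty [simp]: "hf ss {}"
  unfolding hf_def using Fin_empty[OF DS_tuples] .

lemma hf_insert: "hf ss S \<Longrightarrow> a \<in> tuples KQ ss \<Longrightarrow> hf ss (insert a S)"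
  unfolding hf_def using Fin_insert[OF DS_tuples] by blast

lemma hf_union: "hf ss S \<Longrightarrow> hf ss T \<Longrightarrow> hf ss (S \<union> T)"
  unfolding hf_def using Fin_union[OF DS_tuples] by blast

text \<open>The induction is on hyperfinite sets of arbitrary tuples, so the elements outside
  \<open>X\<close> are filtered out at each step.\<close>

lemma hf_Fin:
  assumes X: "DS KQ U ss X" and S: "hf ss S" "S \<subseteq> X"
  shows "\<exists>B\<in>FinQ X. extQ X B = S"
proof -
  let ?T = "tuples KQ ss"
  obtain B0 where B0: "B0 \<in> FinQ ?T" "extQ ?T B0 = S" using S(1) by (auto simp: hf_def)
  have "\<exists>C\<in>FinQ X. \<forall>x\<in>?T. x \<in> extQ X C \<longleftrightarrow> x \<in> extQ ?T B0 \<and> x \<in> X"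
  proof (rule Fin_induct[OF DS_tuples _ _ _ B0(1)])
    show "DP KQ U (case_nat (fsort ?T) closed_ctx)
       (\<lambda>e. \<exists>C\<in>FinQ X. \<forall>x\<in>?T. x \<in> extQ X C \<longleftrightarrow> x \<in> extQ ?T (e 0) \<and> x \<in> X)"
      by (intro DP_all dp DP_bex[OF DS_Fin[OF X]] DP_in[OF X] DP_ext[OF X] DP_ext[OF DS_tuples] | simp)+
  next
    fix B assume "extQ ?T B = {}"
    then show "\<exists>C\<in>FinQ X. \<forall>x\<in>?T. x \<in> extQ X C \<longleftrightarrow> x \<in> extQ ?T B \<and> x \<in> X"
      using Fin_empty[OF X] by (metis empty_iff)
  next
    fix B a C assume e: "extQ ?T C = insert a (extQ ?T B)"
      and IH: "\<exists>C\<in>FinQ X. \<forall>x\<in>?T. x \<in> extQ X C \<longleftrightarrow> x \<in> extQ ?T B \<and> x \<in> X"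
    from IH obtain D where D: "D \<in> FinQ X" "\<And>x. x \<in> ?T \<Longrightarrow> x \<in> extQ X D \<longleftrightarrow> x \<in> extQ ?T B \<and> x \<in> X" by blast
    show "\<exists>D\<in>FinQ X. \<forall>x\<in>?T. x \<in> extQ X D \<longleftrightarrow> x \<in> extQ ?T C \<and> x \<in> X"
    proof (cases "a \<in> X")
      case True
      then obtain D' where "D' \<in> FinQ X" "extQ X D' = insert a (extQ X D)" using Fin_insert[OF X D(1)] by blast
      then show ?thesis using D(2) True unfolding e by (intro bexI[of _ D']) auto
    next
      case False
      then show ?thesis using D unfolding e by (intro bexI[of _ D]) auto
    qed
  qed
  then obtain C where C: "C \<in> FinQ X" "\<And>x. x \<in> ?T \<Longrightarrow> x \<in> extQ X C \<longleftrightarrow> x \<in> S \<and> x \<in> X" unfolding B0(2) by blast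
  have "extQ X C = S"
  proof (intro set_eqI)
    fix x
    show "x \<in> extQ X C \<longleftrightarrow> x \<in> S"
      using C(2)[of x] S(2) ext_subset[of X C] DS_subset[OF X] by (cases "x \<in> ?T") blast+
  qed
  then show ?thesis using C(1) by blast
qed

lemma Fin_hf:
  assumes X: "DS KQ U ss X" and B: "B \<in> FinQ X"
  shows "hf ss (extQ X B)"
proof -
  let ?T = "tuples KQ ss"
  have "\<exists>C\<in>FinQ ?T. \<forall>x\<in>?T. x \<in> extQ ?T C \<longleftrightarrow> x \<in> extQ X B"
  proof (rule Fin_induct[OF X _ _ _ B])
    show "DP KQ U (case_nat (fsort X) closed_ctx)
       (\<lambda>e. \<exists>C\<in>FinQ ?T. \<forall>x\<in>?T. x \<in> extQ ?T C \<longleftrightarrow> x \<in> extQ X (e 0))"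
      by (intro DP_all dp DP_bex[OF DS_Fin[OF DS_tuples]] DP_ext[OF X] DP_ext[OF DS_tuples] | simp)+
  next
    fix B assume "extQ X B = {}"
    then show "\<exists>C\<in>FinQ ?T. \<forall>x\<in>?T. x \<in> extQ ?T C \<longleftrightarrow> x \<in> extQ X B"
      using Fin_empty[OF DS_tuples] by (metis empty_iff)
  next
    fix B a C assume a: "a \<in> X" and e: "extQ X C = insert a (extQ X B)"
      and IH: "\<exists>C\<in>FinQ ?T. \<forall>x\<in>?T. x \<in> extQ ?T C \<longleftrightarrow> x \<in> extQ X B"
    from IH obtain D where D: "D \<in> FinQ ?T" "\<And>x. x \<in> ?T \<Longrightarrow> x \<in> extQ ?T D \<longleftrightarrow> x \<in> extQ X B" by blast
    have "a \<in> ?T" using a DS_subset[OF X] by blast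
    then obtain D' where "D' \<in> FinQ ?T" "extQ ?T D' = insert a (extQ ?T D)" using Fin_insert[OF DS_tuples D(1)] by blast
    then show "\<exists>D\<in>FinQ ?T. \<forall>x\<in>?T. x \<in> extQ ?T D \<longleftrightarrow> x \<in> extQ X C"
      using D(2) unfolding e by (intro bexI[of _ D']) auto
  qed
  then obtain C where C: "C \<in> FinQ ?T" "\<And>x. x \<in> ?T \<Longrightarrow> x \<in> extQ ?T C \<longleftrightarrow> x \<in> extQ X B" by blast
  have "extQ ?T C = extQ X B"
    using C(2) ext_subset[of X B] ext_subset[of ?T C] DS_subset[OF X] by blast
  then show ?thesis using C(1) by (auto simp: hf_def)
qed

lemma hf_UN:
  assumes S: "hf ss S" and R: "\<And>x. x \<in> S \<Longrightarrow> hf ts {y. R x y}"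
    and D: "DP KQ U (case_nat ss (case_nat ts closed_ctx)) (\<lambda>e. R (e 0) (e (Suc 0)))"
  shows "hf ts {y. \<exists>x\<in>S. R x y}"
proof -
  let ?T = "tuples KQ ss" and ?T' = "tuples KQ ts"
  have RT: "y \<in> ?T'" if "x \<in> S" "R x y" for x y using hf_tuples[OF R[OF that(1)]] that(2) by blast
  obtain B0 where B0: "B0 \<in> FinQ ?T" "extQ ?T B0 = S" using S by (auto simp: hf_def)
  have B0T: "B0 \<in> tuples KQ (fsort ?T)" using B0(1) DS_subset[OF DS_Fin[OF DS_tuples]] by blast
  have B0U: "set B0 \<subseteq> U" by (rule tuples_subset_univ[OF B0T])
  \<comment> \<open>The condition occurs twice because its first copy is the instance
    \<open>B0\<close> of the induction variable; the second stays fixed and limits the union to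
    \<open>S\<close>.\<close>
  have "\<exists>C\<in>FinQ ?T'. \<forall>y\<in>?T'. y \<in> extQ ?T' C \<longleftrightarrow> (\<exists>x\<in>?T. x \<in> extQ ?T B0 \<and> x \<in> extQ ?T B0 \<and> R x y)"
  proof (rule Fin_induct[OF DS_tuples _ _ _ B0(1), where P = "\<lambda>B. \<exists>C\<in>FinQ ?T'. \<forall>y\<in>?T'. y \<in> extQ ?T' C \<longleftrightarrow>
      (\<exists>x\<in>?T. x \<in> extQ ?T B \<and> x \<in> extQ ?T B0 \<and> R x y)"])
    show "DP KQ U (case_nat (fsort ?T) closed_ctx) (\<lambda>e. \<exists>C\<in>FinQ ?T'. \<forall>y\<in>?T'. y \<in> extQ ?T' C \<longleftrightarrow>
      (\<exists>x\<in>?T. x \<in> extQ ?T (e 0) \<and> x \<in> extQ ?T B0 \<and> R x y))"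
      by (intro DP_all DP_ex dp DP_bex[OF DS_Fin[OF DS_tuples]] DP_ext[OF DS_tuples] DP_app2[OF D]
          DT_const[OF B0T B0U] | simp)+
  next
    fix B assume "extQ ?T B = {}"
    then show "\<exists>C\<in>FinQ ?T'. \<forall>y\<in>?T'. y \<in> extQ ?T' C \<longleftrightarrow> (\<exists>x\<in>?T. x \<in> extQ ?T B \<and> x \<in> extQ ?T B0 \<and> R x y)"
      using Fin_empty[OF DS_tuples] by (metis empty_iff)
  next
    fix B a C assume a: "a \<in> ?T" and e: "extQ ?T C = insert a (extQ ?T B)"
      and IH: "\<exists>C\<in>FinQ ?T'. \<forall>y\<in>?T'. y \<in> extQ ?T' C \<longleftrightarrow> (\<exists>x\<in>?T. x \<in> extQ ?T B \<and> x \<in> extQ ?T B0 \<and> R x y)"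
    from IH obtain D where D: "D \<in> FinQ ?T'"
      "\<And>y. y \<in> ?T' \<Longrightarrow> y \<in> extQ ?T' D \<longleftrightarrow> (\<exists>x\<in>?T. x \<in> extQ ?T B \<and> x \<in> extQ ?T B0 \<and> R x y)" by blast
    show "\<exists>D\<in>FinQ ?T'. \<forall>y\<in>?T'. y \<in> extQ ?T' D \<longleftrightarrow> (\<exists>x\<in>?T. x \<in> extQ ?T C \<and> x \<in> extQ ?T B0 \<and> R x y)"
    proof (cases "a \<in> S")
      case True
      then obtain C' where C': "C' \<in> FinQ ?T'" "extQ ?T' C' = {y. R a y}" using R unfolding hf_def by blast
      then obtain D' where "D' \<in> FinQ ?T'" "extQ ?T' D' = extQ ?T' D \<union> extQ ?T' C'" using Fin_union[OF DS_tuples D(1)] by blast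
      then show ?thesis using D(2) C'(2) True a B0(2) unfolding e by (intro bexI[of _ D']) auto
    next
      case False
      then show ?thesis using D B0(2) unfolding e by (intro bexI[of _ D]) auto
    qed
  qed
  then obtain C where C: "C \<in> FinQ ?T'" "\<And>y. y \<in> ?T' \<Longrightarrow> y \<in> extQ ?T' C \<longleftrightarrow> (\<exists>x\<in>?T. x \<in> S \<and> R x y)"
    unfolding B0(2) by blast
  have "extQ ?T' C = {y. \<exists>x\<in>S. R x y}"
    using C(2) ext_subset[of ?T' C] RT hf_tuples[OF S] by blast
  then show ?thesis using C(1) by (auto simp: hf_def)
qed

lemma hf_subset:
  assumes S: "hf ss S" and Q: "DP KQ U (case_nat ss closed_ctx) (\<lambda>e. Q (e 0))"
  shows "hf ss {x \<in> S. Q x}"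
proof -
  have "hf ss {y. \<exists>x\<in>S. y = x \<and> Q x}"
  proof (rule hf_UN[OF S])
    fix x assume "x \<in> S"
    then have "x \<in> tuples KQ ss" using hf_tuples[OF S] by blast
    moreover have "{y. y = x \<and> Q x} = (if Q x then {x} else {})" by auto
    ultimately show "hf ss {y. y = x \<and> Q x}" by (simp add: hf_insert)
  next
    show "DP KQ U (case_nat ss (case_nat ss closed_ctx)) (\<lambda>e. e (Suc 0) = e 0 \<and> Q (e 0))"
      by (intro DP_conj DP_eq_slots DP_app1[OF Q] DT_slot) simp_all
  qed
  then show ?thesis by (rule back_subst[of "hf ss"]) auto
qed

lemma hf_image:
  assumes S: "hf ss S" and h: "\<And>x. x \<in> S \<Longrightarrow> h x \<in> tuples KQ ts"
    and D: "DP KQ U (case_nat ss (case_nat ts closed_ctx)) (\<lambda>e. e (Suc 0) = h (e 0))"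
  shows "hf ts (h ` S)"
proof -
  have "hf ts {y. \<exists>x\<in>S. y = h x}"
    by (rule hf_UN[OF S _ D]) (use h hf_insert[OF hf_empty] in simp)
  then show ?thesis by (rule back_subst[of "hf ts"]) auto
qed

lemma hf_hyperfinite:
  assumes "DS KQ U ss X" "hf ss X"
  shows "hyperfinite KQ X"
proof -
  obtain B where "B \<in> FinQ X" "extQ X B = X" using hf_Fin[OF assms] by blast
  then show ?thesis unfolding hyperfinite_def using fps_spec(1)[OF assms(1)] by (auto simp: ext_def)
qed

lemma kset_iff [simp]: "[kel x] \<in> kset S \<longleftrightarrow> x \<in> S"
  by (auto simp: kset_def)

lemma kset_tuples: "kset S \<subseteq> tuples KQ kS"
  by (auto simp: kset_def)

lemma kfin_hf: "kfin S \<Longrightarrow> hf kS (kset S)"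
proof -
  assume "kfin S"
  then obtain A0 where A0: "S = {x. mem x A0}" by (auto simp: kfin_def)
  let ?T = "tuples KQ kS"
  have "\<exists>B\<in>FinQ ?T. \<forall>x. [kel x] \<in> extQ ?T B \<longleftrightarrow> mem x A" for A
  proof (induction A rule: F_induct)
    case 1
    show ?case by (intro dp DP_bex[OF DS_Fin[OF DS_tuples]] DP_ext[OF DS_tuples] | simp)+
  next
    case (2 A)
    then show ?case using Fin_empty[OF DS_tuples] by (metis empty_iff)
  next
    case (3 A a B)
    then obtain C where C: "C \<in> FinQ ?T" "\<And>x. [kel x] \<in> extQ ?T C \<longleftrightarrow> mem x A" by blast
    obtain D where "D \<in> FinQ ?T" "extQ ?T D = insert [kel a] (extQ ?T C)"
      using Fin_insert[OF DS_tuples C(1)] kel_tuples by blast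
    then show ?case using C(2) 3(2) by (intro bexI[of _ D]) auto
  qed
  then obtain B where B: "B \<in> FinQ ?T" "\<And>x. [kel x] \<in> extQ ?T B \<longleftrightarrow> mem x A0" by blast
  have "extQ ?T B = kset S"
  proof (intro set_eqI iffI)
    fix u assume "u \<in> extQ ?T B"
    then have "u = [kel (kval u)]" using ext_subset[of ?T B] kS_tuples by blast
    then show "u \<in> kset S" using B(2)[of "kval u"] \<open>u \<in> extQ ?T B\<close> by (auto simp: kset_def A0)
  qed (auto simp: kset_def A0 B(2))
  then show ?thesis using B(1) by (auto simp: hf_def)
qed

lemma hf_kfin: "hf kS (kset S) \<Longrightarrow> kfin S"
proof -
  assume "hf kS (kset S)"
  then obtain B where B: "B \<in> FinQ (tuples KQ kS)" "extQ (tuples KQ kS) B = kset S" by (auto simp: hf_def)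
  let ?T = "tuples KQ kS"
  have "\<exists>A. \<forall>x. mem x A \<longleftrightarrow> [kel x] \<in> extQ ?T B"
  proof (rule Fin_induct[OF DS_tuples _ _ _ B(1)])
    show "DP KQ U (case_nat (fsort ?T) closed_ctx) (\<lambda>e. \<exists>A. \<forall>x. mem x A \<longleftrightarrow> [kel x] \<in> extQ ?T (e 0))"
      by (intro dp DP_ext[OF DS_tuples] | simp)+
    show "\<exists>A. \<forall>x. mem x A \<longleftrightarrow> [kel x] \<in> extQ ?T B" if "extQ ?T B = {}" for B
      using that F_empty by simp
    fix B a C assume IH: "\<exists>A. \<forall>x. mem x A \<longleftrightarrow> [kel x] \<in> extQ ?T B" and a: "a \<in> ?T"
      and e: "extQ ?T C = insert a (extQ ?T B)"
    obtain c where c: "a = [kel c]" using a kS_tuples by blast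
    from IH obtain A where A: "\<And>x. mem x A \<longleftrightarrow> [kel x] \<in> extQ ?T B" by blast
    obtain A' where "\<And>x. mem x A' \<longleftrightarrow> x \<in> insert c {x. mem x A}"
      using kfin_insert[OF kfin_mem, of c A] unfolding kfin_iff by blast
    then show "\<exists>A. \<forall>x. mem x A \<longleftrightarrow> [kel x] \<in> extQ ?T C" using A unfolding e c by auto
  qed
  then show ?thesis unfolding B(2) kfin_iff by simp
qed

text \<open>The power set of \<open>K\<close> chosen by \<open>fps\<close> need not be
  \<open>F(K)\<close>, but both have the same extensions; each inclusion is an induction in one of
  them.\<close>

lemma kfin_iff_hf: "kfin S \<longleftrightarrow> hf kS (kset S)"
  using kfin_hf hf_kfin by blast

section \<open>Induction and recursion\<close>

abbreviation N :: "'k set" where "N \<equiv> NN mem"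
abbreviation bel :: "'k \<Rightarrow> 'k set" where "bel \<equiv> below mem"

lemma DP_N [dp]: "DK mem B \<Gamma> t \<Longrightarrow> DP KQ B \<Gamma> (\<lambda>e. t e \<in> N)"
proof -
  assume t: "DK mem B \<Gamma> t"
  have "DP KQ B (case_nat kS closed_ctx) (\<lambda>e. kval (e 0) \<in> N)"
    unfolding NN_def mem_Collect_eq by (intro dp | simp)+
  from DP_app_k[OF this t] show ?thesis .
qed

lemma DP_bel [dp]: "DK mem B \<Gamma> s \<Longrightarrow> DK mem B \<Gamma> t \<Longrightarrow> DP KQ B \<Gamma> (\<lambda>e. s e \<in> bel (t e))"
  unfolding below_def mem_Collect_eq by (intro dp)

lemma N_0 [simp]: "0 \<in> N"
  using F_single[of 0] unfolding NN_def by auto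

lemma N_Suc [simp]: "x \<in> N \<Longrightarrow> x + 1 \<in> N"
proof -
  assume "x \<in> N"
  then obtain A where A: "mem x A" "\<And>z. mem z A \<Longrightarrow> z \<noteq> 0 \<Longrightarrow> mem (z - 1) A" unfolding NN_def by blast
  obtain B where "\<And>z. mem z B \<longleftrightarrow> z \<in> insert (x + 1) {z. mem z A}"
    using kfin_insert[OF kfin_mem, of "x + 1" A] unfolding kfin_iff by blast
  then show ?thesis unfolding NN_def using A by (intro CollectI exI[of _ B]) auto
qed

lemma N_pred: "x \<in> N \<Longrightarrow> x \<noteq> 0 \<Longrightarrow> x - 1 \<in> N"
  unfolding NN_def by blast

lemma neg1_N: "- 1 \<notin> N"
  using K_char by (simp add: char_zero_def)

lemma N_Suc_nz [simp]: "x \<in> N \<Longrightarrow> x + 1 \<noteq> 0"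
  using neg1_N by (auto simp: add_eq_0_iff2)

text \<open>A hyperfinite set of counterexamples that is closed under \<open>z \<mapsto> z - 1\<close> can be shifted to contain \<open>- 1\<close>.\<close>

lemma N_induct:
  assumes P: "DP1 P" and x: "x \<in> N" and 0: "P 0" and Suc: "\<And>x. x \<in> N \<Longrightarrow> P x \<Longrightarrow> P (x + 1)"
  shows "P x"
proof (rule ccontr)
  assume "\<not> P x"
  obtain A where A: "mem x A" "\<And>z. mem z A \<Longrightarrow> z \<noteq> 0 \<Longrightarrow> mem (z - 1) A" using x unfolding NN_def by blast
  have AN: "z \<in> N" if "mem z A" for z using that A(2) unfolding NN_def by blast
  let ?S = "{z \<in> {z. mem z A}. \<not> P z}"
  have "kfin ?S" by (rule kfin_subset) (simp, intro DP_not P)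
  then have "kfin ((\<lambda>z. z - x - 1) ` ?S)" by (rule kfin_image) (intro dp | simp)+
  then obtain B where B: "\<And>z. mem z B \<longleftrightarrow> z \<in> (\<lambda>z. z - x - 1) ` ?S" unfolding kfin_iff by blast
  have "mem (z - 1) B" if z: "mem z B" for z
  proof -
    obtain w where w: "mem w A" "\<not> P w" "z = w - x - 1" using z B by auto
    have "w \<noteq> 0" using w 0 by auto
    moreover have "\<not> P (w - 1)" using Suc[of "w - 1"] w AN A(2)[OF w(1) \<open>w \<noteq> 0\<close>] by auto
    ultimately have "w - 1 \<in> ?S" using A(2) w(1) by simp
    then show ?thesis unfolding B by (rule rev_image_eqI) (simp add: w(3))
  qed
  moreover have "mem (- 1) B" unfolding B by (rule image_eqI[of _ _ x]) (use A(1) \<open>\<not> P x\<close> in simp_all)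
  ultimately have "- 1 \<in> N" unfolding NN_def by blast
  then show False using neg1_N by simp
qed

lemma N_add [simp]: "x \<in> N \<Longrightarrow> y \<in> N \<Longrightarrow> x + y \<in> N"
proof -
  assume x: "x \<in> N" and y: "y \<in> N"
  show ?thesis
  proof (rule N_induct[OF _ y])
    show "DP1 (\<lambda>y. x + y \<in> N)" by (intro dp | simp)+
    show "x + (y + 1) \<in> N" if "x + y \<in> N" for y using N_Suc[OF that] by (simp add: add.assoc)
  qed (use x in simp)
qed

lemma N_1 [simp]: "1 \<in> N"
  using N_Suc[OF N_0] by simp

lemma N_mult [simp]: "x \<in> N \<Longrightarrow> y \<in> N \<Longrightarrow> x * y \<in> N"
proof -
  assume x: "x \<in> N" and y: "y \<in> N"
  show ?thesis
  proof (rule N_induct[OF _ y])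
    show "DP1 (\<lambda>y. x * y \<in> N)" by (intro dp | simp)+
    show "x * (y + 1) \<in> N" if "x * y \<in> N" for y using N_add[OF that x] by (simp add: distrib_left)
  qed simp
qed

lemma N_add_eq_0: "x \<in> N \<Longrightarrow> y \<in> N \<Longrightarrow> x + y = 0 \<Longrightarrow> y = 0"
proof (rule ccontr)
  assume *: "x \<in> N" "y \<in> N" "x + y = 0" "y \<noteq> 0"
  have "x + (y - 1) \<in> N" using * N_pred by simp
  from N_Suc_nz[OF this] show False using *(3) by (simp add: algebra_simps)
qed

lemma N_antisym: "x - y \<in> N \<Longrightarrow> y - x \<in> N \<Longrightarrow> x = y"
  using N_add_eq_0[of "x - y" "y - x"] by simp

lemma N_linear: "x \<in> N \<Longrightarrow> y \<in> N \<Longrightarrow> x - y \<in> N \<or> y - x \<in> N"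
proof -
  assume x: "x \<in> N" and y: "y \<in> N"
  show ?thesis
  proof (rule N_induct[OF _ x])
    show "DP1 (\<lambda>x. x - y \<in> N \<or> y - x \<in> N)" by (intro dp | simp)+
    show "x + 1 - y \<in> N \<or> y - (x + 1) \<in> N" if IH: "x - y \<in> N \<or> y - x \<in> N" for x
    proof (cases "x - y \<in> N")
      case True
      then show ?thesis using N_Suc[OF True] by (simp add: algebra_simps)
    next
      case False
      then have "y - x \<in> N" "y - x \<noteq> 0" using IH by auto
      then show ?thesis using N_pred[of "y - x"] by (simp add: algebra_simps)
    qed
  qed (use y in simp)
qed

lemma bel_N: "i \<in> bel n \<Longrightarrow> i \<in> N"
  by (simp add: below_def)

lemma bel_0 [simp]: "bel 0 = {}"
  using N_add_eq_0 by (force simp: below_def)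

lemma bel_Suc: "n \<in> N \<Longrightarrow> bel (n + 1) = insert n (bel n)"
proof (intro set_eqI iffI)
  fix i assume n: "n \<in> N" and i: "i \<in> bel (n + 1)"
  then have "n + 1 - i \<in> N" "n + 1 - i \<noteq> 0" "i \<in> N" by (auto simp: below_def)
  then have "n - i \<in> N" using N_pred[of "n + 1 - i"] by (simp add: algebra_simps)
  then show "i \<in> insert n (bel n)" using \<open>i \<in> N\<close> by (auto simp: below_def)
next
  fix i assume n: "n \<in> N" and i: "i \<in> insert n (bel n)"
  then have "n - i \<in> N" "i \<in> N" by (auto simp: below_def)
  then have "(n - i) + 1 \<in> N" "(n - i) + 1 \<noteq> 0" by auto
  then show "i \<in> bel (n + 1)" using \<open>i \<in> N\<close> by (auto simp: below_def algebra_simps)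
qed

lemma bel_self [simp]: "n \<in> N \<Longrightarrow> n \<in> bel (n + 1)"
  by (simp add: bel_Suc)

lemma bel_irrefl [simp]: "n \<notin> bel n"
  by (simp add: below_def)

lemma bel_trans: "i \<in> bel j \<Longrightarrow> j \<in> bel k \<Longrightarrow> i \<in> bel k"
proof -
  assume i: "i \<in> bel j" and j: "j \<in> bel k"
  have "(j - i) + (k - j) \<in> N" using i j by (intro N_add) (auto simp: below_def)
  then have "k - i \<in> N" by (simp add: algebra_simps)
  moreover have "i \<noteq> k" using i j N_antisym[of j k] by (auto simp: below_def)
  ultimately show ?thesis using i by (simp add: below_def)
qed

lemma bel_add: "i \<in> N \<Longrightarrow> j \<in> N \<Longrightarrow> j \<noteq> 0 \<Longrightarrow> i \<in> bel (i + j)"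
  by (simp add: below_def)

lemma N_cases: "x \<in> N \<Longrightarrow> x = 0 \<or> (\<exists>y\<in>N. x = y + 1)"
  using N_pred[of x] by (metis diff_add_cancel)

lemma N_least:
  assumes P: "DP1 P" and x: "x \<in> N" "P x"
  shows "\<exists>x\<in>N. P x \<and> (\<forall>y\<in>bel x. \<not> P y)"
proof (rule ccontr)
  assume *: "\<not> ?thesis"
  have "\<forall>y. y \<in> bel x \<longrightarrow> \<not> P y" if "x \<in> N" for x
  proof (rule N_induct[OF _ that])
    show "DP1 (\<lambda>x. \<forall>y. y \<in> bel x \<longrightarrow> \<not> P y)" by (intro dp DP_app_k[OF P] | simp)+
    show "\<forall>y. y \<in> bel (x + 1) \<longrightarrow> \<not> P y" if "x \<in> N" "\<forall>y. y \<in> bel x \<longrightarrow> \<not> P y" for x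
      using * that by (auto simp: bel_Suc)
  qed simp
  then show False using * x by blast
qed

lemma kfin_bel: "n \<in> N \<Longrightarrow> kfin (bel n)"
proof -
  assume n: "n \<in> N"
  have "\<exists>A. \<forall>x. mem x A \<longleftrightarrow> x \<in> bel n"
  proof (rule N_induct[OF _ n])
    show "DP1 (\<lambda>n. \<exists>A. \<forall>x. mem x A \<longleftrightarrow> x \<in> bel n)" by (intro dp | simp)+
    show "\<exists>A. \<forall>x. mem x A \<longleftrightarrow> x \<in> bel (n + 1)" if n: "n \<in> N" and IH: "\<exists>A. \<forall>x. mem x A \<longleftrightarrow> x \<in> bel n" for n
    proof -
      have "kfin (insert n (bel n))" using IH by (intro kfin_insert) (simp add: kfin_iff)
      then show ?thesis by (simp add: kfin_iff bel_Suc[OF n])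
    qed
  qed (simp add: F_empty)
  then show ?thesis by (simp add: kfin_iff)
qed

subsection \<open>Definable inductive definitions\<close>

text \<open>\<open>\<Phi> u v w\<close> is the rule with premises \<open>v\<close>, \<open>w\<close>
  and conclusion \<open>u\<close>. Minimality can only be expected against definable predicates and
  takes the form of an induction principle.\<close>

definition is_closure :: "(sort, sym) eqsort list \<Rightarrow> ('k, 'f) keq list set \<Rightarrow> (('k, 'f) keq list \<Rightarrow> bool) \<Rightarrow>
    (('k, 'f) keq list \<Rightarrow> ('k, 'f) keq list \<Rightarrow> ('k, 'f) keq list \<Rightarrow> bool) \<Rightarrow> ('k, 'f) keq list set \<Rightarrow> bool" where
  "is_closure ss T \<beta> \<Phi> C \<longleftrightarrow> DS KQ U ss C \<and> C \<subseteq> T \<and> (\<forall>u\<in>T. \<beta> u \<longrightarrow> u \<in> C) \<and>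
     (\<forall>u\<in>T. \<forall>v\<in>C. \<forall>w\<in>C. \<Phi> u v w \<longrightarrow> u \<in> C) \<and>
     (\<forall>P. DP KQ U (case_nat ss closed_ctx) (\<lambda>e. P (e 0)) \<longrightarrow> (\<forall>u\<in>T. \<beta> u \<longrightarrow> P u) \<longrightarrow>
       (\<forall>u\<in>T. \<forall>v\<in>C. \<forall>w\<in>C. P v \<longrightarrow> P w \<longrightarrow> \<Phi> u v w \<longrightarrow> P u) \<longrightarrow> (\<forall>u\<in>C. P u))"

lemma is_closureD:
  assumes "is_closure ss T \<beta> \<Phi> C"
  shows "DS KQ U ss C" "C \<subseteq> T" "\<And>u. u \<in> T \<Longrightarrow> \<beta> u \<Longrightarrow> u \<in> C"
    "\<And>u v w. u \<in> T \<Longrightarrow> v \<in> C \<Longrightarrow> w \<in> C \<Longrightarrow> \<Phi> u v w \<Longrightarrow> u \<in> C"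
    "\<And>P u. DP KQ U (case_nat ss closed_ctx) (\<lambda>e. P (e 0)) \<Longrightarrow> (\<And>u. u \<in> T \<Longrightarrow> \<beta> u \<Longrightarrow> P u) \<Longrightarrow>
       (\<And>u v w. u \<in> T \<Longrightarrow> v \<in> C \<Longrightarrow> w \<in> C \<Longrightarrow> P v \<Longrightarrow> P w \<Longrightarrow> \<Phi> u v w \<Longrightarrow> P u) \<Longrightarrow> u \<in> C \<Longrightarrow> P u"
proof -
  note * = assms[unfolded is_closure_def]
  show "DS KQ U ss C" by (rule *[THEN conjunct1])
  show "C \<subseteq> T" by (rule *[THEN conjunct2, THEN conjunct1])
  show "u \<in> T \<Longrightarrow> \<beta> u \<Longrightarrow> u \<in> C" for u
    by (rule *[THEN conjunct2, THEN conjunct2, THEN conjunct1, rule_format])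
  show "u \<in> T \<Longrightarrow> v \<in> C \<Longrightarrow> w \<in> C \<Longrightarrow> \<Phi> u v w \<Longrightarrow> u \<in> C" for u v w
    by (rule *[THEN conjunct2, THEN conjunct2, THEN conjunct2, THEN conjunct1, rule_format])
  fix P u assume P: "DP KQ U (case_nat ss closed_ctx) (\<lambda>e. P (e 0))" "\<And>u. u \<in> T \<Longrightarrow> \<beta> u \<Longrightarrow> P u"
    "\<And>u v w. u \<in> T \<Longrightarrow> v \<in> C \<Longrightarrow> w \<in> C \<Longrightarrow> P v \<Longrightarrow> P w \<Longrightarrow> \<Phi> u v w \<Longrightarrow> P u" "u \<in> C"
  have "\<forall>u\<in>C. P u"
    by (rule *[THEN conjunct2, THEN conjunct2, THEN conjunct2, THEN conjunct2, THEN spec, THEN mp, THEN mp, THEN mp])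
      (use P(1) in simp, (intro ballI impI, rule P(2), assumption+), (intro ballI impI, rule P(3), assumption+))
  then show "P u" using P(4) by blast
qed

text \<open>A derivation is a hyperfinite set of pairs of a rank and a conclusion in which the premises of
  every conclusion have smaller rank.  As the ranks need not be unique, the union of two
  derivations is a derivation.\<close>

lemma definable_closure:
  assumes T: "DS KQ U ss T"
    and \<beta>: "DP KQ U (case_nat ss closed_ctx) (\<lambda>e. \<beta> (e 0))"
    and \<Phi>: "DP KQ U (case_nat ss (case_nat ss (case_nat ss closed_ctx))) (\<lambda>e. \<Phi> (e 0) (e (Suc 0)) (e (Suc (Suc 0))))"
  shows "\<exists>C. is_closure ss T \<beta> \<Phi> C"
proof -
  let ?ks = "Real KSort # ss"
  let ?X = "tuples KQ ?ks" and ?S = "tuples KQ ss"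
  define der where "der = (\<lambda>G. \<forall>j. \<forall>u\<in>?S. kel j # u \<in> G \<longrightarrow> j \<in> N \<and> u \<in> T \<and>
     (\<beta> u \<or> (\<exists>i i'. \<exists>v\<in>?S. \<exists>w\<in>?S. i \<in> bel j \<and> i' \<in> bel j \<and> kel i # v \<in> G \<and> kel i' # w \<in> G \<and> \<Phi> u v w)))"
  define C where "C = {u \<in> ?S. \<exists>G\<in>FinQ ?X. der (extQ ?X G) \<and> (\<exists>j. kel j # u \<in> extQ ?X G)}"
  have derD: "j \<in> N \<and> u \<in> T \<and>
     (\<beta> u \<or> (\<exists>i i'. \<exists>v\<in>?S. \<exists>w\<in>?S. i \<in> bel j \<and> i' \<in> bel j \<and> kel i # v \<in> G \<and> kel i' # w \<in> G \<and> \<Phi> u v w))"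
    if "der G" "u \<in> ?S" "kel j # u \<in> G" for G j u
    using that unfolding der_def by blast
  have der_mono: "\<beta> u \<or> (\<exists>i i'. \<exists>v\<in>?S. \<exists>w\<in>?S. i \<in> bel j \<and> i' \<in> bel j \<and> kel i # v \<in> H \<and> kel i' # w \<in> H \<and> \<Phi> u v w)"
    if "der G" "u \<in> ?S" "kel j # u \<in> G" "G \<subseteq> H" for G H j u
    using derD[OF that(1-3)] that(4) by blast
  have C_iff: "u \<in> C \<longleftrightarrow> u \<in> ?S \<and> (\<exists>G j. hf ?ks G \<and> der G \<and> kel j # u \<in> G)" for u
    unfolding C_def hf_def by auto
  have TS: "T \<subseteq> ?S" by (rule DS_subset[OF T])
  have CT: "C \<subseteq> T" 
  proof
    fix u assume "u \<in> C"
    then obtain G j where "der G" "u \<in> ?S" "kel j # u \<in> G" unfolding C_iff by blast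
    from derD[OF this] show "u \<in> T" by blast
  qed
  have derDP: "DP KQ U (case_nat (fsort ?X) closed_ctx) (\<lambda>e. der (extQ ?X (e 0)))"
    unfolding der_def by (intro DP_all DP_ex dp DP_in[OF T] DP_app1[OF \<beta>] DP_app3[OF \<Phi>] DP_ext[OF DS_tuples] | simp)+
  have "DP KQ U (case_nat ss closed_ctx) (\<lambda>e. \<exists>G\<in>FinQ ?X. der (extQ ?X G) \<and> (\<exists>j. kel j # e 0 \<in> extQ ?X G))"
    by (intro DP_bex[OF DS_Fin[OF DS_tuples]] dp DP_app1[OF derDP] DP_ext[OF DS_tuples] | simp)+
  then have DS_C: "DS KQ U ss C" unfolding C_def by (rule DS_Collect2)
  have closed: "u \<in> C" if u: "u \<in> T" "v \<in> C" "w \<in> C" "\<Phi> u v w" for u v w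
  proof -
    obtain G j where G: "hf ?ks G" "der G" "kel j # v \<in> G" "v \<in> ?S" using u(2) unfolding C_iff by blast
    obtain G' j' where G': "hf ?ks G'" "der G'" "kel j' # w \<in> G'" "w \<in> ?S" using u(3) unfolding C_iff by blast
    have uS: "u \<in> ?S" using u(1) TS by blast
    have j: "j \<in> N" "j' \<in> N" using derD[OF G(2) G(4) G(3)] derD[OF G'(2) G'(4) G'(3)] by auto
    have lt: "j \<in> bel (j + j' + 1)" "j' \<in> bel (j + j' + 1)"
      using j N_Suc_nz[OF j(1)] N_Suc_nz[OF j(2)] bel_add[of j "j' + 1"] bel_add[of j' "j + 1"] by (simp_all add: algebra_simps)
    \<comment> \<open>The rank \<open>j + j' + 1\<close> lies above the ranks of both premises,
      whatever their order.\<close>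
    let ?H = "insert (kel (j + j' + 1) # u) (G \<union> G')"
    have "hf ?ks ?H" using uS by (intro hf_insert hf_union G G') (auto simp: Cons_tuples)
    moreover have "der ?H"
      unfolding der_def
    proof (intro allI ballI impI)
      fix i x assume x: "x \<in> ?S" "kel i # x \<in> ?H"
      then consider "i = j + j' + 1" "x = u" | "kel i # x \<in> G" | "kel i # x \<in> G'" by auto
      then show "i \<in> N \<and> x \<in> T \<and> (\<beta> x \<or> (\<exists>k k'. \<exists>v\<in>?S. \<exists>w\<in>?S. k \<in> bel i \<and> k' \<in> bel i \<and>
          kel k # v \<in> ?H \<and> kel k' # w \<in> ?H \<and> \<Phi> x v w))"
      proof cases
        case 1
        have "kel j # v \<in> ?H" "kel j' # w \<in> ?H" using G(3) G'(3) by auto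
        then show ?thesis unfolding 1 using lt j u(1,4) G(4) G'(4) N_Suc[OF N_add[OF j]] by blast
      next
        case 2
        have "G \<subseteq> ?H" by blast
        from der_mono[OF G(2) x(1) 2 this] show ?thesis using derD[OF G(2) x(1) 2] by blast
      next
        case 3
        have "G' \<subseteq> ?H" by blast
        from der_mono[OF G'(2) x(1) 3 this] show ?thesis using derD[OF G'(2) x(1) 3] by blast
      qed
    qed
    ultimately show ?thesis unfolding C_iff using uS by blast
  qed
  have base: "u \<in> C" if u: "u \<in> T" "\<beta> u" for u
  proof -
    have uS: "u \<in> ?S" using u(1) TS by blast
    have "hf ?ks {kel 0 # u}" using uS by (intro hf_insert hf_empty) (auto simp: Cons_tuples)
    moreover have "der {kel 0 # u}" using u unfolding der_def by auto
    ultimately show ?thesis unfolding C_iff using uS by blast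
  qed
  have ind: "P u" if P: "DP KQ U (case_nat ss closed_ctx) (\<lambda>e. P (e 0))" and b: "\<And>u. u \<in> T \<Longrightarrow> \<beta> u \<Longrightarrow> P u"
    and s: "\<And>u v w. u \<in> T \<Longrightarrow> v \<in> C \<Longrightarrow> w \<in> C \<Longrightarrow> P v \<Longrightarrow> P w \<Longrightarrow> \<Phi> u v w \<Longrightarrow> P u" and u: "u \<in> C" for P u
  proof -
    obtain B j where B: "B \<in> FinQ ?X" "der (extQ ?X B)" "kel j # u \<in> extQ ?X B" "u \<in> ?S"
      using u unfolding C_def by blast
    let ?G = "extQ ?X B"
    have hfG: "hf ?ks ?G" using B(1) unfolding hf_def by blast
    have BT: "B \<in> tuples KQ (fsort ?X)" using B(1) DS_subset[OF DS_Fin[OF DS_tuples]] by blast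
    note BU = tuples_subset_univ[OF BT]
    have inC: "u \<in> C" if "u \<in> ?S" "kel j # u \<in> ?G" for u j
      unfolding C_iff using that hfG B(2) by blast
    \<comment> \<open>The derivation is fixed and the induction is on a strict bound for the ranks:
      a conclusion of rank \<open>k\<close> has premises of rank below \<open>k\<close>.\<close>
    have "\<forall>j. j \<in> bel k \<longrightarrow> (\<forall>u\<in>?S. kel j # u \<in> ?G \<longrightarrow> P u)" if k: "k \<in> N" for k
    proof (rule N_induct[OF _ k])
      show "DP1 (\<lambda>k. \<forall>j. j \<in> bel k \<longrightarrow> (\<forall>u\<in>?S. kel j # u \<in> ?G \<longrightarrow> P u))"
        by (intro DP_all dp DP_ext[OF DS_tuples] DP_app1[OF P] DT_const[OF BT BU] | simp)+
      fix k assume k: "k \<in> N" and IH: "\<forall>j. j \<in> bel k \<longrightarrow> (\<forall>u\<in>?S. kel j # u \<in> ?G \<longrightarrow> P u)"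
      show "\<forall>j. j \<in> bel (k + 1) \<longrightarrow> (\<forall>u\<in>?S. kel j # u \<in> ?G \<longrightarrow> P u)"
      proof (intro allI impI ballI)
        fix j u assume j: "j \<in> bel (k + 1)" and u: "u \<in> ?S" "kel j # u \<in> ?G"
        show "P u"
        proof (cases "j = k")
          case True
          have uT: "u \<in> T" using derD[OF B(2) u] by blast
          show ?thesis
          proof (cases "\<beta> u")
            case False
            then obtain i i' v w where "v \<in> ?S" "w \<in> ?S" "i \<in> bel k" "i' \<in> bel k" "kel i # v \<in> ?G" "kel i' # w \<in> ?G" "\<Phi> u v w"
              using derD[OF B(2) u] True by blast
            then show ?thesis using s[OF uT] IH inC by blast
          qed (use b uT in blast)
        qed (use IH u j in \<open>auto simp: bel_Suc[OF k]\<close>)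
      qed
    qed simp
    moreover have "j \<in> N" using derD[OF B(2,4,3)] by blast
    ultimately show "P u" using B(3,4) bel_self[of j] N_Suc[of j] by blast
  qed
  show ?thesis
    unfolding is_closure_def
  proof (intro exI[of _ C] conjI ballI impI allI DS_C CT)
    fix P u assume "DP KQ U (case_nat ss closed_ctx) (\<lambda>e. P (e 0))" "\<forall>u\<in>T. \<beta> u \<longrightarrow> P u"
      "\<forall>u\<in>T. \<forall>v\<in>C. \<forall>w\<in>C. P v \<longrightarrow> P w \<longrightarrow> \<Phi> u v w \<longrightarrow> P u" "u \<in> C"
    then show "P u" by (intro ind[of P u]) blast+
  qed (rule base closed; assumption)+
qed

subsection \<open>Definable recursion\<close>

lemma kel2_tuples: "\<pi> \<in> tuples KQ ps \<Longrightarrow> \<pi> @ [kel x, kel y] \<in> tuples KQ (ps @ [Real KSort, Real KSort])"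
  by (auto intro!: append_tuplesI simp: Cons_tuples)

text \<open>The graph is generated from index 0 and value \<open>c \<pi>\<close> by the recursion
  step, for all parameters \<open>\<pi>\<close> at once, so the solution is definable also as a
  function of \<open>\<pi>\<close>. It is single-valued by induction on \<open>j\<close>, using
  inversion of the rules.\<close>

lemma drec_graph:
  assumes P: "DS KQ U ps P"
    and c: "DP KQ U (case_nat ps (case_nat kS closed_ctx)) (\<lambda>e. e 0 \<in> P \<and> kval (e (Suc 0)) = c (e 0))"
    and t: "DP KQ U (case_nat (ps @ [Real KSort, Real KSort]) (case_nat (ps @ [Real KSort, Real KSort]) closed_ctx))
      (\<lambda>e. \<exists>\<pi>\<in>P. \<exists>j y. e (Suc 0) = \<pi> @ [kel j, kel y] \<and> e 0 = \<pi> @ [kel (j + 1), kel (t \<pi> j y)])"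
  obtains h where "\<And>\<pi>. \<pi> \<in> P \<Longrightarrow> h \<pi> 0 = c \<pi>" "\<And>\<pi> j. \<pi> \<in> P \<Longrightarrow> j \<in> N \<Longrightarrow> h \<pi> (j + 1) = t \<pi> j (h \<pi> j)"
    "DS KQ U (ps @ [Real KSort, Real KSort]) {\<pi> @ [kel j, kel (h \<pi> j)] |\<pi> j. \<pi> \<in> P \<and> j \<in> N}"
proof -
  let ?ss = "ps @ [Real KSort, Real KSort]"
  let ?T = "{\<pi> @ [kel j, kel y] |\<pi> j y. \<pi> \<in> P \<and> j \<in> N}"
  let ?\<beta> = "\<lambda>u. \<exists>\<pi>\<in>P. u = \<pi> @ [kel 0, kel (c \<pi>)]"
  let ?\<Phi> = "\<lambda>u v w :: ('k, 'f) keq list. \<exists>\<pi>\<in>P. \<exists>j y. v = \<pi> @ [kel j, kel y] \<and> u = \<pi> @ [kel (j + 1), kel (t \<pi> j y)]"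
  have PT: "P \<subseteq> tuples KQ ps" by (rule DS_subset[OF P])
  have inj: "\<pi> @ [kel j, kel y] = \<pi>' @ [kel j', kel y'] \<longleftrightarrow> \<pi> = \<pi>' \<and> j = j' \<and> y = y'" for \<pi> \<pi>' :: "('k, 'f) keq list" and j j' y y' :: 'k
    by auto
  have T: "DS KQ U ?ss ?T"
    unfolding DS_def
  proof
    have "DP KQ U (case_nat ?ss closed_ctx) (\<lambda>e. \<exists>\<pi>\<in>P. \<exists>j y. e 0 = \<pi> @ [kel j, kel y] \<and> j \<in> N)"
      by (intro DP_bex[OF P] dp | simp)+
    then show "DP KQ U (case_nat ?ss closed_ctx) (\<lambda>e. e 0 \<in> ?T)" by (rule DP_cong) blast
  qed (use PT kel2_tuples in blast)
  have \<beta>: "DP KQ U (case_nat ?ss closed_ctx) (\<lambda>e. ?\<beta> (e 0))"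
  proof -
    define cg where "cg = (\<lambda>\<pi> (u :: ('k, 'f) keq list). \<pi> \<in> P \<and> kval u = c \<pi>)"
    have cg: "DP KQ U (case_nat ps (case_nat kS closed_ctx)) (\<lambda>e. cg (e 0) (e (Suc 0)))"
      unfolding cg_def by (rule c)
    have "DP KQ U (case_nat ?ss closed_ctx) (\<lambda>e. \<exists>\<pi>\<in>P. \<exists>y. e 0 = \<pi> @ [kel 0, kel y] \<and> cg \<pi> [kel y])"
      by (intro DP_bex[OF P] DP_app2[OF cg] DP_ex_k dp | simp)+
    then show ?thesis by (rule DP_cong) (auto simp: cg_def)
  qed
  have \<Phi>: "DP KQ U (case_nat ?ss (case_nat ?ss (case_nat ?ss closed_ctx))) (\<lambda>e. ?\<Phi> (e 0) (e (Suc 0)) (e (Suc (Suc 0))))"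
    by (rule DP_app2[OF t]) (rule DT_slot, simp)+
  obtain C where "is_closure ?ss ?T ?\<beta> ?\<Phi> C" using definable_closure[OF T \<beta> \<Phi>] by (elim exE)
  note C = is_closureD[OF this]
  define R where "R = (\<lambda>\<pi> j y. \<pi> @ [kel j, kel y] \<in> C)"
  have RP: "\<pi> \<in> P \<and> j \<in> N" if "R \<pi> j y" for \<pi> j y
    using that C(2) unfolding R_def by auto
  have R0: "R \<pi> 0 (c \<pi>)" if "\<pi> \<in> P" for \<pi>
    unfolding R_def by (rule C(3)) (use that N_0 in blast)+
  have RS: "R \<pi> (j + 1) (t \<pi> j y)" if "R \<pi> j y" for \<pi> j y
    unfolding R_def by (rule C(4)[of _ "\<pi> @ [kel j, kel y]" "\<pi> @ [kel j, kel y]"])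
      (use that RP[OF that] N_Suc in \<open>unfold R_def, blast+\<close>)
  \<comment> \<open>Inversion of the rules. No successor in \<open>N\<close> is 0, so the base rule
    and the step never produce the same index.\<close>
  have Rinv: "if j = 0 then y = c \<pi> else (\<exists>y'. R \<pi> (j - 1) y' \<and> y = t \<pi> (j - 1) y')" if "R \<pi> j y" for \<pi> j y
  proof -
    let ?Q = "\<lambda>u. \<exists>\<pi>\<in>P. \<exists>j y. u = \<pi> @ [kel j, kel y] \<and> (?\<beta> u \<or> j \<noteq> 0 \<and> (\<exists>v\<in>C. ?\<Phi> u v v))"
    have "?Q (\<pi> @ [kel j, kel y])"
    proof (rule C(5)[where P = ?Q])
      show "DP KQ U (case_nat ?ss closed_ctx) (\<lambda>e. ?Q (e 0))"
        by (intro DP_bex[OF P] dp DP_app1[OF \<beta>] DP_bex[OF C(1)] DP_app2[OF t] | simp)+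
      show "?Q u" if "u \<in> ?T" "?\<beta> u" for u using that by blast
      show "?Q u" if T: "u \<in> ?T" "v \<in> C" "?\<Phi> u v w" for u v w
      proof -
        obtain \<pi> j y where *: "\<pi> \<in> P" "v = \<pi> @ [kel j, kel y]" "u = \<pi> @ [kel (j + 1), kel (t \<pi> j y)]" using T(3) by blast
        have "j \<in> N" using C(2) T(2) * by auto
        then have "j + 1 \<noteq> 0" by simp
        then show ?thesis using * T(2) by blast
      qed
      show "\<pi> @ [kel j, kel y] \<in> C" using that unfolding R_def .
    qed
    then consider "?\<beta> (\<pi> @ [kel j, kel y])" | v where "j \<noteq> 0" "v \<in> C" "?\<Phi> (\<pi> @ [kel j, kel y]) v v"
      unfolding inj by blast
    then show ?thesis
    proof cases
      case 1
      then show ?thesis by (auto simp: inj)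
    next
      case 2
      then obtain \<pi>' i y' where v: "v = \<pi>' @ [kel i, kel y']" "\<pi> @ [kel j, kel y] = \<pi>' @ [kel (i + 1), kel (t \<pi>' i y')]" by blast
      then have "\<pi>' = \<pi>" "j = i + 1" "y = t \<pi> i y'" by (auto simp: inj)
      then show ?thesis using 2 v by (auto simp: R_def)
    qed
  qed
  have DPR: "DT KQ U \<Gamma> ps p \<Longrightarrow> DK mem U \<Gamma> a \<Longrightarrow> DK mem U \<Gamma> b \<Longrightarrow> DP KQ U \<Gamma> (\<lambda>e. R (p e) (a e) (b e))" for \<Gamma> p a b
    unfolding R_def by (intro DP_in[OF C(1)] DT_append dp)
  have R1: "\<exists>!y. R \<pi> j y" if \<pi>: "\<pi> \<in> P" and j: "j \<in> N" for \<pi> j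
  proof -
    have \<pi>T: "\<pi> \<in> tuples KQ ps" using \<pi> PT by blast
    have "\<exists>y. R \<pi> j y \<and> (\<forall>z. R \<pi> j z \<longrightarrow> z = y)"
    proof (rule N_induct[OF _ j])
      show "DP1 (\<lambda>j. \<exists>y. R \<pi> j y \<and> (\<forall>z. R \<pi> j z \<longrightarrow> z = y))"
        by (intro DP_ex_k DP_all_k dp DPR DT_const[OF \<pi>T tuples_subset_univ[OF \<pi>T]] | simp)+
      show "\<exists>y. R \<pi> 0 y \<and> (\<forall>z. R \<pi> 0 z \<longrightarrow> z = y)" using R0[OF \<pi>] Rinv[of \<pi> 0] by auto
      fix j assume j: "j \<in> N" and "\<exists>y. R \<pi> j y \<and> (\<forall>z. R \<pi> j z \<longrightarrow> z = y)"
      then obtain y where y: "R \<pi> j y" "\<And>z. R \<pi> j z \<Longrightarrow> z = y" by blast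
      have "z = t \<pi> j y" if z: "R \<pi> (j + 1) z" for z
      proof -
        obtain y' where "R \<pi> j y'" "z = t \<pi> j y'" using Rinv[OF z] N_Suc_nz[OF j] by auto
        then show ?thesis using y(2)[of y'] by simp
      qed
      then show "\<exists>y. R \<pi> (j + 1) y \<and> (\<forall>z. R \<pi> (j + 1) z \<longrightarrow> z = y)" using RS[OF y(1)] by blast
    qed
    then show ?thesis by blast
  qed
  define h where "h = (\<lambda>\<pi> j. THE y. R \<pi> j y)"
  have h: "R \<pi> j y \<longleftrightarrow> y = h \<pi> j" if "\<pi> \<in> P" "j \<in> N" for \<pi> j y
    unfolding h_def using theI'[OF R1[OF that]] R1[OF that] by blast
  show thesis
  proof (rule that[of h])
    show "h \<pi> 0 = c \<pi>" if "\<pi> \<in> P" for \<pi> using R0[OF that] h[OF that N_0] by simp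
    show "h \<pi> (j + 1) = t \<pi> j (h \<pi> j)" if "\<pi> \<in> P" "j \<in> N" for \<pi> j
      using RS[of \<pi> j "h \<pi> j"] h[OF that] h[OF that(1) N_Suc[OF that(2)]] by simp
    have "C = {\<pi> @ [kel j, kel (h \<pi> j)] |\<pi> j. \<pi> \<in> P \<and> j \<in> N}"
    proof (intro set_eqI iffI)
      fix u assume u: "u \<in> C"
      then obtain \<pi> j y where *: "u = \<pi> @ [kel j, kel y]" "\<pi> \<in> P" "j \<in> N" using C(2) by blast
      then have "y = h \<pi> j" using u h[OF *(2,3)] unfolding R_def by blast
      then show "u \<in> {\<pi> @ [kel j, kel (h \<pi> j)] |\<pi> j. \<pi> \<in> P \<and> j \<in> N}" using * by blast
    next
      fix u assume "u \<in> {\<pi> @ [kel j, kel (h \<pi> j)] |\<pi> j. \<pi> \<in> P \<and> j \<in> N}"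
      then obtain \<pi> j where *: "u = \<pi> @ [kel j, kel (h \<pi> j)]" "\<pi> \<in> P" "j \<in> N" by blast
      then show "u \<in> C" using h[OF *(2,3), of "h \<pi> j"] unfolding R_def by simp
    qed
    then show "DS KQ U ?ss {\<pi> @ [kel j, kel (h \<pi> j)] |\<pi> j. \<pi> \<in> P \<and> j \<in> N}" using C(1) by simp
  qed
qed

end

lemma DT_slot_Cons [dp]:
  assumes "kS = \<Gamma> x" "DT (Keq mem) B \<Gamma> ts t"
  shows "DT (Keq mem) B \<Gamma> (Real KSort # ts) (\<lambda>e. e x @ t e)"
proof -
  have "DT (Keq mem) B \<Gamma> (kS @ ts) (\<lambda>e. e x @ t e)"
    by (rule DT_append[OF DT_slot' assms(2)]) (rule assms(1))
  then show ?thesis by simp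
qed

context fps_field
begin

lemma DS_kset: "DP1 (\<lambda>x. x \<in> S) \<Longrightarrow> DS KQ U kS (kset S)"
proof -
  assume S: "DP1 (\<lambda>x. x \<in> S)"
  have "DP KQ U (case_nat kS closed_ctx) (\<lambda>e. e 0 \<in> kset S)"
    by (rule DP_cong[OF S]) (metis Env_head kS_tuples kset_iff)
  then show ?thesis using kset_tuples by (simp add: DS_def)
qed

lemma DS_prod_set:
  assumes X: "DS KQ U ss X" and Y: "DS KQ U ts Y"
  shows "DS KQ U (ss @ ts) (prod_set X Y)"
  unfolding DS_def
proof
  have "DP KQ U (case_nat (ss @ ts) closed_ctx) (\<lambda>e. \<exists>u\<in>X. \<exists>v\<in>Y. e 0 = u @ v)"
    by (intro DP_bex[OF X] DP_bex[OF Y] dp | simp)+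
  then show "DP KQ U (case_nat (ss @ ts) closed_ctx) (\<lambda>e. e 0 \<in> prod_set X Y)"
    unfolding prod_set_def by (rule DP_cong) blast
qed (use DS_subset[OF X] DS_subset[OF Y] append_tuplesI in \<open>unfold prod_set_def, blast\<close>)

text \<open>\<open>drec\<close> is a definite description over functions with definable graph on the
  indices up to \<open>n\<close>. The given \<open>h\<close>, restricted to these indices, is one of
  them, and any other agrees with it by induction.\<close>

lemma drec_eq:
  assumes h: "DP2 (\<lambda>j y. j \<in> N \<and> y = h j)" and h0: "h 0 = c" and hS: "\<And>j. j \<in> bel n \<Longrightarrow> h (j + 1) = t j (h j)"
    and n: "n \<in> N"
  shows "drec mem c t n = h n"
  unfolding drec_def
proof (rule the_equality)
  let ?I = "insert n (bel n)"
  have IN: "?I \<subseteq> N" using n bel_N by blast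
  have dI: "DP KQ U \<Gamma> (\<lambda>e. s e \<in> ?I)" if "DK mem U \<Gamma> s" for \<Gamma> s
  proof -
    have "DP KQ U \<Gamma> (\<lambda>e. s e = n \<or> s e \<in> bel n)" by (intro dp that | simp)+
    then show ?thesis by simp
  qed
  have ks: "[kel x, kel y] \<in> tuples KQ [Real KSort, Real KSort]" for x y by (simp add: Cons_tuples)
  define H where "H = (\<lambda>j y. j \<in> N \<and> y = h j)"
  have "DP2 H" using h by (simp only: H_def)
  note dH = DP_app_kk[OF this]
  have "DS KQ U [Real KSort, Real KSort] {[kel j, kel (h j)] |j. j \<in> ?I}"
    unfolding DS_def
  proof
    have "DP KQ U (case_nat [Real KSort, Real KSort] closed_ctx)
        (\<lambda>e. \<exists>j y. e 0 = [kel j, kel y] \<and> j \<in> ?I \<and> H j y)"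
      by (intro DP_ex_k dp dI dH | simp only: nat.case)+
    then show "DP KQ U (case_nat [Real KSort, Real KSort] closed_ctx) (\<lambda>e. e 0 \<in> {[kel j, kel (h j)] |j. j \<in> ?I})"
      by (rule DP_cong) (use IN in \<open>auto simp: H_def\<close>)
  qed (use ks in blast)
  then show "\<exists>h'. definable KQ {[kel j, kel (h' j)] |j. j \<in> ?I} \<and> h' 0 = c \<and>
      (\<forall>j\<in>bel n. h' (j + 1) = t j (h' j)) \<and> h n = h' n"
    using h0 hS by (intro exI[of _ h]) (simp add: DS_definable)
  fix v assume "\<exists>h'. definable KQ {[kel j, kel (h' j)] |j. j \<in> ?I} \<and> h' 0 = c \<and>
      (\<forall>j\<in>bel n. h' (j + 1) = t j (h' j)) \<and> v = h' n"
  then obtain h' where h': "definable KQ {[kel j, kel (h' j)] |j. j \<in> ?I}" "h' 0 = c"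
    "\<And>j. j \<in> bel n \<Longrightarrow> h' (j + 1) = t j (h' j)" "v = h' n" by blast
  \<comment> \<open>The competitor \<open>h'\<close> is accessible to the calculus through its graph
    only, so the induction is phrased with the graphs \<open>G\<close> and \<open>H\<close>.\<close>
  define G :: "('k, 'f) keq list set" where "G = {[kel j, kel (h' j)] |j. j \<in> ?I}"
  have G: "[kel j, kel y] \<in> G \<longleftrightarrow> j \<in> ?I \<and> y = h' j" for j y by (auto simp: G_def)
  have D: "DS KQ U [Real KSort, Real KSort] G"
  proof -
    obtain s where "DS KQ U s G" using h'(1) by (auto simp: definable_iff G_def)
    then show ?thesis by (rule DS_sort_transfer) (use ks in \<open>unfold G_def, blast\<close>)
  qed
  have "j \<in> ?I \<longrightarrow> (\<exists>y. [kel j, kel y] \<in> G \<and> H j y)" if "j \<in> N" for j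
  proof (rule N_induct[OF _ that])
    show "DP1 (\<lambda>j. j \<in> ?I \<longrightarrow> (\<exists>y. [kel j, kel y] \<in> G \<and> H j y))"
      by (intro DP_imp dI dp dH DP_in[OF D] | simp only: nat.case)+
    show "0 \<in> ?I \<longrightarrow> (\<exists>y. [kel 0, kel y] \<in> G \<and> H 0 y)"
      using h0 h'(2) by (auto simp: G H_def)
    fix j assume j: "j \<in> N" and IH: "j \<in> ?I \<longrightarrow> (\<exists>y. [kel j, kel y] \<in> G \<and> H j y)"
    show "j + 1 \<in> ?I \<longrightarrow> (\<exists>y. [kel (j + 1), kel y] \<in> G \<and> H (j + 1) y)"
    proof
      assume j1: "j + 1 \<in> ?I"
      have jb: "j \<in> bel n" using j1 bel_self[OF j] bel_trans[of j "j + 1" n] by auto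
      then have "h' j = h j" using IH by (auto simp: G H_def)
      then have "h' (j + 1) = h (j + 1)" using h'(3)[OF jb] hS[OF jb] by simp
      then show "\<exists>y. [kel (j + 1), kel y] \<in> G \<and> H (j + 1) y"
        using j1 j by (auto simp: G H_def)
    qed
  qed
  from this[OF n] show "v = h n" using h'(4) by (auto simp: G H_def)
qed

subsection \<open>Powers\<close>

text \<open>The value of \<open>dpower\<close> is only meaningful for exponents in \<open>N\<close>; \<open>pw\<close> is a total
  definable version.\<close>

definition pw :: "'k \<Rightarrow> 'k \<Rightarrow> 'k" where
  "pw x k = (if k \<in> N then dpower mem x k else 0)"

lemma pw_aux:
  "(\<forall>x. pw x 0 = 1) \<and> (\<forall>x. \<forall>k\<in>N. pw x (k + 1) = pw x k * x) \<and> DP3 (\<lambda>x k y. y = pw x k)"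
proof -
  let ?P = "tuples KQ kS"
  let ?ss = "kS @ [Real KSort, Real KSort]"
  have 1: "DP KQ U (case_nat kS (case_nat kS closed_ctx)) (\<lambda>e. e 0 \<in> ?P \<and> kval (e (Suc 0)) = 1)"
    by (intro dp DP_in[OF DS_tuples] | simp)+
  have 2: "DP KQ U (case_nat ?ss (case_nat ?ss closed_ctx))
      (\<lambda>e. \<exists>\<pi>\<in>?P. \<exists>j y. e (Suc 0) = \<pi> @ [kel j, kel y] \<and> e 0 = \<pi> @ [kel (j + 1), kel (y * kval \<pi>)])"
    by (intro DP_ex dp | simp only: nat.case)+
  obtain h where h: "\<And>\<pi>. \<pi> \<in> ?P \<Longrightarrow> h \<pi> 0 = 1" "\<And>\<pi> j. \<pi> \<in> ?P \<Longrightarrow> j \<in> N \<Longrightarrow> h \<pi> (j + 1) = h \<pi> j * kval \<pi>"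
    "DS KQ U ?ss {\<pi> @ [kel j, kel (h \<pi> j)] |\<pi> j. \<pi> \<in> ?P \<and> j \<in> N}"
    using drec_graph[OF DS_tuples 1 2] by blast
  have g: "[kel x] @ [kel j, kel y] \<in> {\<pi> @ [kel j, kel (h \<pi> j)] |\<pi> j. \<pi> \<in> ?P \<and> j \<in> N} \<longleftrightarrow> j \<in> N \<and> y = h [kel x] j" for x j y
    by auto
  have D: "DP KQ U \<Gamma> (\<lambda>e. j e \<in> N \<and> y e = h [kel (x e)] (j e))"
    if "DK mem U \<Gamma> x" "DK mem U \<Gamma> j" "DK mem U \<Gamma> y" for \<Gamma> x j y
  proof -
    have "DP KQ U \<Gamma> (\<lambda>e. [kel (x e)] @ [kel (j e), kel (y e)] \<in> {\<pi> @ [kel j, kel (h \<pi> j)] |\<pi> j. \<pi> \<in> ?P \<and> j \<in> N})"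
      by (intro DP_in[OF h(3)] DT_append DT_kel_Cons DT_kel DT_Nil that)
    then show ?thesis unfolding g .
  qed
  have e: "dpower mem x k = h [kel x] k" if "k \<in> N" for x k
    unfolding dpower_def
  proof (rule drec_eq[OF _ _ _ that])
    show "DP2 (\<lambda>j y. j \<in> N \<and> y = h [kel x] j)" by (intro D dp | simp)+
  qed (use h(1,2) bel_N in auto)
  have "DP3 (\<lambda>x k y. if k \<in> N then (k \<in> N \<and> y = h [kel x] k) else y = 0)" by (intro DP_if D dp | simp)+
  then have "DP3 (\<lambda>x k y. y = pw x k)" by (rule DP_cong) (simp add: pw_def e)
  then show ?thesis using h(1,2) by (simp add: pw_def e)
qed

lemma pw_0 [simp]: "pw x 0 = 1"
  using pw_aux by blast

lemma pw_Suc: "k \<in> N \<Longrightarrow> pw x (k + 1) = pw x k * x"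
  using pw_aux by blast

lemma DK_pw [dp]: "DK mem U \<Gamma> s \<Longrightarrow> DK mem U \<Gamma> t \<Longrightarrow> DK mem U \<Gamma> (\<lambda>e. pw (s e) (t e))"
proof (rule DKI)
  have *: "DP3 (\<lambda>x k y. y = pw x k)" using pw_aux by blast
  assume "DK mem U \<Gamma> s" "DK mem U \<Gamma> t"
  then show "DP KQ U (case_nat kS \<Gamma>) (\<lambda>e. kval (e 0) = pw (s (\<lambda>x. e (Suc x))) (t (\<lambda>x. e (Suc x))))"
    by (intro DP_app_kkk[OF *] DK_weaken dp) simp_all
qed

lemma pw_1: "pw x 1 = x"
  using pw_Suc[OF N_0, of x] by simp

lemma pw_add: "a \<in> N \<Longrightarrow> b \<in> N \<Longrightarrow> pw x (a + b) = pw x a * pw x b"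
proof -
  assume a: "a \<in> N" and b: "b \<in> N"
  show ?thesis
  proof (rule N_induct[OF _ b])
    show "DP1 (\<lambda>b. pw x (a + b) = pw x a * pw x b)" by (intro dp | simp)+
    show "pw x (a + (b + 1)) = pw x a * pw x (b + 1)" if b: "b \<in> N" and IH: "pw x (a + b) = pw x a * pw x b" for b
      using pw_Suc[OF N_add[OF a b], of x] pw_Suc[OF b, of x] IH by (simp add: algebra_simps)
  qed simp
qed

subsection \<open>Hyperfinite sequences\<close>

definition seqX :: "'k \<Rightarrow> 'k set \<Rightarrow> ('k, 'f) keq list set" where
  "seqX n S = prod_set (kset (bel n)) (kset S)"

definition sq :: "'k \<Rightarrow> 'k set \<Rightarrow> (sort, sym) eqsort list" where
  "sq n S = fsort (seqX n S)"

lemma seqX_iff [simp]: "[kel i, kel v] \<in> seqX n S \<longleftrightarrow> i \<in> bel n \<and> v \<in> S"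
proof
  assume "i \<in> bel n \<and> v \<in> S"
  then have "[kel i] @ [kel v] \<in> seqX n S" unfolding seqX_def prod_set_def kset_def by blast
  then show "[kel i, kel v] \<in> seqX n S" by simp
qed (auto simp: seqX_def prod_set_def kset_def)

lemma seqX_cases: "u \<in> seqX n S \<Longrightarrow> \<exists>i v. u = [kel i, kel v] \<and> i \<in> bel n \<and> v \<in> S"
  by (auto simp: seqX_def prod_set_def kset_def)

lemma seqs_fgraph: "(d, v) \<in> fgraph mem (kset (bel n)) S f \<longleftrightarrow> (\<exists>i. d = [kel i] \<and> [kel i, kel v] \<in> extQ (seqX n S) f)"
  using ext_subset[of "seqX n S" f] seqX_iff unfolding fgraph_def seqX_def[symmetric] by (fastforce simp: kset_def)

lemma ball_kset: "(\<forall>d\<in>kset A. Q d) \<longleftrightarrow> (\<forall>i\<in>A. Q [kel i])"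
  by (auto simp: kset_def)

lemma seqs_iff: "f \<in> seqs mem n S \<longleftrightarrow> f \<in> FinQ (seqX n S) \<and> (\<forall>i\<in>bel n. \<exists>!v. [kel i, kel v] \<in> extQ (seqX n S) f)"
  unfolding seqs_def hfun_def seqs_fgraph mem_Collect_eq seqX_def[symmetric] ball_kset by simp

lemma seqs_ext:
  assumes "f \<in> seqs mem n S" "i \<in> bel n"
  shows "[kel i, kel v] \<in> extQ (seqX n S) f \<longleftrightarrow> v = entry mem n S f i"
proof -
  have e: "\<exists>!v. [kel i, kel v] \<in> extQ (seqX n S) f" using assms unfolding seqs_iff by blast
  have "entry mem n S f i = (THE v. [kel i, kel v] \<in> extQ (seqX n S) f)"
    unfolding entry_def fval_def seqs_fgraph by simp
  then show ?thesis using theI'[OF e] e by auto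
qed

lemma entry_in: "f \<in> seqs mem n S \<Longrightarrow> i \<in> bel n \<Longrightarrow> entry mem n S f i \<in> S"
  using seqs_ext[of f n S i "entry mem n S f i"] ext_subset[of "seqX n S" f] by auto

lemma seqs_ext_eq:
  assumes "f \<in> seqs mem n S"
  shows "extQ (seqX n S) f = {[kel i, kel (entry mem n S f i)] |i. i \<in> bel n}"
proof (intro set_eqI iffI)
  fix u assume u: "u \<in> extQ (seqX n S) f"
  then obtain i v where "u = [kel i, kel v]" "i \<in> bel n" using ext_subset[of "seqX n S" f] seqX_cases by blast
  then show "u \<in> {[kel i, kel (entry mem n S f i)] |i. i \<in> bel n}" using u seqs_ext[OF assms] by auto
qed (use seqs_ext[OF assms] in auto)

definition dset :: "'k set \<Rightarrow> bool" where
  "dset S \<longleftrightarrow> DP1 (\<lambda>x. x \<in> S)"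

lemma DP_dset: "dset S \<Longrightarrow> DK mem U \<Gamma> t \<Longrightarrow> DP KQ U \<Gamma> (\<lambda>e. t e \<in> S)"
  unfolding dset_def by (rule DP_app_k)

lemma dset_UNIV [simp]: "dset UNIV"
  unfolding dset_def by (simp add: DP_True)

lemma dset_N [simp]: "dset N"
  unfolding dset_def by (intro dp) simp

lemma DS_seqX: "dset S \<Longrightarrow> DS KQ U [Real KSort, Real KSort] (seqX n S)"
proof -
  assume S: "dset S"
  have "DP1 (\<lambda>x. x \<in> bel n)" by (intro dp) simp_all
  from DS_prod_set[OF DS_kset[OF this] DS_kset[OF S[unfolded dset_def]]] show ?thesis by (simp add: seqX_def)
qed

lemma DS_seqs: "dset S \<Longrightarrow> DS KQ U (sq n S) (seqs mem n S)"
proof -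
  assume S: "dset S"
  note F = DS_Fin[OF DS_seqX[OF S], of n]
  have "DP KQ U (case_nat (sq n S) closed_ctx) (\<lambda>e. e 0 \<in> FinQ (seqX n S) \<and>
      (\<forall>i. i \<in> bel n \<longrightarrow> (\<exists>v. [kel i, kel v] \<in> extQ (seqX n S) (e 0) \<and> (\<forall>w. [kel i, kel w] \<in> extQ (seqX n S) (e 0) \<longrightarrow> w = v))))"
    unfolding sq_def by (intro DP_all_k DP_ex_k dp DP_in[OF F] DP_ext[OF DS_seqX[OF S]] | simp)+
  then have "DP KQ U (case_nat (sq n S) closed_ctx) (\<lambda>e. e 0 \<in> seqs mem n S)"
    by (rule DP_cong) (unfold seqs_iff, blast)
  moreover have "seqs mem n S \<subseteq> tuples KQ (sq n S)"
    using DS_subset[OF F] by (auto simp: seqs_iff sq_def)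
  ultimately show ?thesis by (simp add: DS_def)
qed

lemma seqs_eqI:
  assumes S: "dset S" and f: "f \<in> seqs mem n S" and g: "g \<in> seqs mem n S"
    and eq: "\<And>i. i \<in> bel n \<Longrightarrow> entry mem n S f i = entry mem n S g i"
  shows "f = g"
proof (rule ext_inj[OF DS_seqX[OF S]])
  show "f \<in> FinQ (seqX n S)" "g \<in> FinQ (seqX n S)" using f g by (simp_all add: seqs_iff)
  show "extQ (seqX n S) f = extQ (seqX n S) g" unfolding seqs_ext_eq[OF f] seqs_ext_eq[OF g] using eq by force
qed

text \<open>The graph of \<open>u\<close> is the union of its single points over the hyperfinite
  index set.\<close>

lemma seqs_ex:
  assumes S: "dset S" and n: "n \<in> N" and u: "DP2 (\<lambda>i v. i \<in> bel n \<and> v = u i)" "\<And>i. i \<in> bel n \<Longrightarrow> u i \<in> S"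
  shows "\<exists>f\<in>seqs mem n S. \<forall>i\<in>bel n. entry mem n S f i = u i"
proof -
  let ?G = "{[kel i, kel (u i)] |i. i \<in> bel n}"
  have "hf [Real KSort, Real KSort] {y :: ('k, 'f) keq list. \<exists>x\<in>kset (bel n). \<exists>v. y = x @ [kel v] \<and> (kval x \<in> bel n \<and> v = u (kval x))}"
  proof (rule hf_UN[OF kfin_hf[OF kfin_bel[OF n]]])
    fix x :: "('k, 'f) keq list" assume "x \<in> kset (bel n)"
    then obtain i where i: "x = [kel i]" "i \<in> bel n" by (auto simp: kset_def)
    then have "{y. \<exists>v. y = x @ [kel v] \<and> (kval x \<in> bel n \<and> v = u (kval x))} = {[kel i, kel (u i)]}" by auto
    then show "hf [Real KSort, Real KSort] {y. \<exists>v. y = x @ [kel v] \<and> (kval x \<in> bel n \<and> v = u (kval x))}"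
      by (simp add: hf_insert Cons_tuples)
  next
    show "DP KQ U (case_nat kS (case_nat [Real KSort, Real KSort] closed_ctx))
        (\<lambda>e. \<exists>v. e (Suc 0) = e 0 @ [kel v] \<and> (kval (e 0) \<in> bel n \<and> v = u (kval (e 0))))"
      by (intro DP_ex_k DP_conj[OF _ DP_app_kk[OF u(1)]] dp | simp)+
  qed
  moreover have "{y :: ('k, 'f) keq list. \<exists>x\<in>kset (bel n). \<exists>v. y = x @ [kel v] \<and> (kval x \<in> bel n \<and> v = u (kval x))} = ?G"
    by (auto simp: kset_def)
  ultimately have "hf [Real KSort, Real KSort] ?G" by (simp only:)
  moreover have "?G \<subseteq> seqX n S" using u(2) by auto
  ultimately obtain f where f: "f \<in> FinQ (seqX n S)" "extQ (seqX n S) f = ?G" using hf_Fin[OF DS_seqX[OF S]] by blast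
  then have fs: "f \<in> seqs mem n S" unfolding seqs_iff by auto
  have "entry mem n S f i = u i" if "i \<in> bel n" for i
    using seqs_ext[OF fs that, of "u i"] f(2) that by auto
  then show ?thesis using fs by blast
qed

text \<open>A total variant of \<open>entry\<close>. The definite description in
  \<open>entry\<close> says nothing off the index set, and a default value turns it into a definable
  term.\<close>

definition en :: "'k \<Rightarrow> 'k set \<Rightarrow> ('k, 'f) keq list \<Rightarrow> 'k \<Rightarrow> 'k" where
  "en n S f i = (if f \<in> seqs mem n S \<and> i \<in> bel n then entry mem n S f i else 0)"

lemma en_entry: "f \<in> seqs mem n S \<Longrightarrow> i \<in> bel n \<Longrightarrow> en n S f i = entry mem n S f i"
  by (simp add: en_def)

lemma DK_en:
  assumes S: "dset S" and f: "DT KQ U \<Gamma> (sq n S) f" and i: "DK mem U \<Gamma> i"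
  shows "DK mem U \<Gamma> (\<lambda>e. en n S (f e) (i e))"
proof (rule DKI)
  let ?f = "\<lambda>e. f (\<lambda>x. e (Suc x))" and ?i = "\<lambda>e. i (\<lambda>x. e (Suc x))"
  note f' = DT_weaken[OF f, of kS] and i' = DK_weaken[OF i, of kS]
  have "DP KQ U (case_nat kS \<Gamma>) (\<lambda>e. if ?f e \<in> seqs mem n S \<and> ?i e \<in> bel n
      then [kel (?i e), kel (kval (e 0))] \<in> extQ (seqX n S) (?f e) else kval (e 0) = 0)"
    by (intro DP_if DP_conj DP_in[OF DS_seqs[OF S]] f' i' DP_bel DP_ext[OF DS_seqX[OF S]] f'[unfolded sq_def] dp | simp)+
  then show "DP KQ U (case_nat kS \<Gamma>) (\<lambda>e. kval (e 0) = en n S (?f e) (?i e))"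
    by (rule DP_cong) (auto simp: en_def seqs_ext)
qed

subsection \<open>Monomials\<close>

definition mon :: "'k \<Rightarrow> ('k, 'f) keq list \<Rightarrow> ('k, 'f) keq list \<Rightarrow> 'k" where
  "mon n I f = (if I \<in> exponents mem n \<and> f \<in> seqs mem n UNIV then ev_monom mem n I f else 0)"

definition mterm :: "'k \<Rightarrow> ('k, 'f) keq list \<Rightarrow> ('k, 'f) keq list \<Rightarrow> 'k \<Rightarrow> 'k" where
  "mterm n I f j = pw (en n UNIV f j) (en n N I j)"

lemma DK_mterm:
  "DT KQ U \<Gamma> (sq n N) I \<Longrightarrow> DT KQ U \<Gamma> (sq n UNIV) f \<Longrightarrow> DK mem U \<Gamma> j \<Longrightarrow> DK mem U \<Gamma> (\<lambda>e. mterm n (I e) (f e) (j e))"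
  unfolding mterm_def by (intro DK_pw DK_en dset_UNIV dset_N)

text \<open>One recursion with \<open>I @ f\<close> as parameter yields all monomials, so that
  \<open>mon\<close> is definable in both arguments together.\<close>

lemma mon_aux:
  assumes n: "n \<in> N"
  obtains h where
    "\<And>I f. I \<in> exponents mem n \<Longrightarrow> f \<in> seqs mem n UNIV \<Longrightarrow> DP2 (\<lambda>j y. j \<in> N \<and> y = h I f j)"
    "\<And>I f. I \<in> exponents mem n \<Longrightarrow> f \<in> seqs mem n UNIV \<Longrightarrow> h I f 0 = 1"
    "\<And>I f j. I \<in> exponents mem n \<Longrightarrow> f \<in> seqs mem n UNIV \<Longrightarrow> j \<in> N \<Longrightarrow> h I f (j + 1) = h I f j * mterm n I f j"
    "\<And>I f. I \<in> exponents mem n \<Longrightarrow> f \<in> seqs mem n UNIV \<Longrightarrow> mon n I f = h I f n"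
    "\<And>\<Gamma> I f. DT KQ U \<Gamma> (sq n N) I \<Longrightarrow> DT KQ U \<Gamma> (sq n UNIV) f \<Longrightarrow> DK mem U \<Gamma> (\<lambda>e. mon n (I e) (f e))"
proof -
  let ?E = "exponents mem n" and ?F = "seqs mem n UNIV"
  let ?P = "prod_set ?E ?F" and ?ps = "sq n N @ sq n UNIV"
  let ?ss = "?ps @ [Real KSort, Real KSort]"
  note E = DS_seqs[OF dset_N, of n] and F = DS_seqs[OF dset_UNIV, of n]
  \<comment> \<open>All exponents are tuples of the same length, so \<open>I\<close> and
    \<open>f\<close> can be recovered from \<open>I @ f\<close>.\<close>
  define l where "l = length (sq n N)"
  have l: "length I = l" if "I \<in> ?E" for I
    using that DS_subset[OF E] tuples_length unfolding l_def by blast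
  let ?t = "\<lambda>\<pi> j y. y * mterm n (take l \<pi>) (drop l \<pi>) j"
  note P = DS_prod_set[OF E F]
  have 1: "DP KQ U (case_nat ?ps (case_nat kS closed_ctx)) (\<lambda>e. e 0 \<in> ?P \<and> kval (e (Suc 0)) = 1)"
    by (intro dp DP_in[OF P] | simp)+
  have 2: "DP KQ U (case_nat ?ss (case_nat ?ss closed_ctx))
      (\<lambda>e. \<exists>\<pi>\<in>?P. \<exists>j y. e (Suc 0) = \<pi> @ [kel j, kel y] \<and> e 0 = \<pi> @ [kel (j + 1), kel (?t \<pi> j y)])"
  proof -
    have "DP KQ U (case_nat ?ss (case_nat ?ss closed_ctx))
        (\<lambda>e. \<exists>I\<in>?E. \<exists>f\<in>?F. \<exists>j y. e (Suc 0) = (I @ f) @ [kel j, kel y] \<and> e 0 = (I @ f) @ [kel (j + 1), kel (y * mterm n I f j)])"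
      by (intro DP_bex[OF E] DP_bex[OF F] DP_ex_k dp DK_mterm | simp del: append_assoc)+
    then show ?thesis by (rule DP_cong) (unfold prod_set_def, use l in fastforce)
  qed
  obtain h where h: "\<And>\<pi>. \<pi> \<in> ?P \<Longrightarrow> h \<pi> 0 = 1" "\<And>\<pi> j. \<pi> \<in> ?P \<Longrightarrow> j \<in> N \<Longrightarrow> h \<pi> (j + 1) = ?t \<pi> j (h \<pi> j)"
    "DS KQ U ?ss {\<pi> @ [kel j, kel (h \<pi> j)] |\<pi> j. \<pi> \<in> ?P \<and> j \<in> N}"
    using drec_graph[OF P 1 2] by blast
  let ?H = "\<lambda>I f. h (I @ f)"
  have PI: "I @ f \<in> ?P" if "I \<in> ?E" "f \<in> ?F" for I f using that unfolding prod_set_def by blast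
  have hS: "?H I f (j + 1) = ?H I f j * mterm n I f j" if "I \<in> ?E" "f \<in> ?F" "j \<in> N" for I f j
    using h(2)[OF PI[OF that(1,2)] that(3)] l[OF that(1)] by simp
  have g: "(I @ f) @ [kel j, kel y] \<in> {\<pi> @ [kel j, kel (h \<pi> j)] |\<pi> j. \<pi> \<in> ?P \<and> j \<in> N} \<longleftrightarrow> j \<in> N \<and> y = ?H I f j"
    if "I \<in> ?E" "f \<in> ?F" for I f j y
    using PI[OF that] by auto
  have D: "DP2 (\<lambda>j y. j \<in> N \<and> y = ?H I f j)" if If: "I \<in> ?E" "f \<in> ?F" for I f
  proof -
    have T: "I @ f \<in> tuples KQ ?ps" using PI[OF If] DS_subset[OF P] by blast
    have "DP2 (\<lambda>j y. (I @ f) @ [kel j, kel y] \<in> {\<pi> @ [kel j, kel (h \<pi> j)] |\<pi> j. \<pi> \<in> ?P \<and> j \<in> N})"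
      by (intro DP_in[OF h(3)] DT_append[OF DT_const[OF T tuples_subset_univ[OF T]]] DT_kel_Cons DT_kel DT_Nil DK_slot) simp_all
    then show ?thesis unfolding g[OF If] .
  qed
  have e: "ev_monom mem n I f = ?H I f n" if If: "I \<in> ?E" "f \<in> ?F" for I f
    unfolding ev_monom_def dprod_def
  proof (rule drec_eq[OF D[OF If] _ _ n])
    show "?H I f 0 = 1" by (rule h(1)[OF PI[OF If]])
    show "?H I f (j + 1) = ?H I f j * dpower mem (entry mem n UNIV f j) (entry mem n N I j)" if "j \<in> bel n" for j
      using hS[OF If bel_N[OF that]] If that entry_in[OF If(1) that] by (simp add: mterm_def en_def pw_def)
  qed
  have K: "DK mem U \<Gamma> (\<lambda>e. mon n (I e) (f e))" if t: "DT KQ U \<Gamma> (sq n N) I" "DT KQ U \<Gamma> (sq n UNIV) f" for \<Gamma> I f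
  proof (rule DKI)
    let ?I = "\<lambda>e. I (\<lambda>x. e (Suc x))" and ?f = "\<lambda>e. f (\<lambda>x. e (Suc x))"
    note t' = DT_weaken[OF t(1), of kS] DT_weaken[OF t(2), of kS]
    have "DP KQ U (case_nat kS \<Gamma>) (\<lambda>e. if ?I e \<in> ?E \<and> ?f e \<in> ?F
        then (?I e @ ?f e) @ [kel n, kel (kval (e 0))] \<in> {\<pi> @ [kel j, kel (h \<pi> j)] |\<pi> j. \<pi> \<in> ?P \<and> j \<in> N}
        else kval (e 0) = 0)"
      by (intro DP_if DP_conj DP_in[OF E t'(1)] DP_in[OF F t'(2)] DP_in[OF h(3)] DT_append t' dp | simp)+
    then show "DP KQ U (case_nat kS \<Gamma>) (\<lambda>e. kval (e 0) = mon n (?I e) (?f e))"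
    proof (rule DP_cong)
      fix e
      show "(if ?I e \<in> ?E \<and> ?f e \<in> ?F
        then (?I e @ ?f e) @ [kel n, kel (kval (e 0))] \<in> {\<pi> @ [kel j, kel (h \<pi> j)] |\<pi> j. \<pi> \<in> ?P \<and> j \<in> N}
        else kval (e 0) = 0) \<longleftrightarrow> kval (e 0) = mon n (?I e) (?f e)"
      proof (cases "?I e \<in> ?E \<and> ?f e \<in> ?F")
        case True
        then have If: "?I e \<in> ?E" "?f e \<in> ?F" by blast+
        show ?thesis using n by (simp only: g[OF If] mon_def e[OF If] If simp_thms if_True)
      next
        case False
        then show ?thesis by (simp only: mon_def if_False)
      qed
    qed
  qed
  show thesis
    by (rule that[of ?H]) (use D h(1)[OF PI] hS e K in \<open>simp_all add: mon_def\<close>)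
qed

subsection \<open>Hyperfinite sums\<close>

definition is_sum :: "('k, 'f) keq list set \<Rightarrow> ('k, 'f) keq list set \<Rightarrow> (('k, 'f) keq list \<Rightarrow> ('k, 'f) keq list \<Rightarrow> 'k)
    \<Rightarrow> (('k, 'f) keq list \<Rightarrow> ('k, 'f) keq list \<Rightarrow> 'k) \<Rightarrow> bool" where
  "is_sum X F w \<sigma> \<longleftrightarrow>
     (\<forall>f\<in>F. \<forall>B\<in>FinQ X. extQ X B = {} \<longrightarrow> \<sigma> B f = 0) \<and>
     (\<forall>f\<in>F. \<forall>B\<in>FinQ X. \<forall>C\<in>FinQ X. \<forall>a\<in>X. a \<notin> extQ X B \<longrightarrow> extQ X C = insert a (extQ X B) \<longrightarrow> \<sigma> C f = \<sigma> B f + w a f)"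

text \<open>The graph of \<open>\<sigma>\<close> is generated by the empty sum and the insertion of
  a new element. Single-valuedness is the point: a set can be built up in many orders, and
  commutativity of addition makes the results agree.\<close>

lemma sum_ex:
  assumes X: "DS KQ U ss X" and F: "DS KQ U fs F"
    and w: "DP KQ U (case_nat ss (case_nat fs (case_nat kS closed_ctx))) (\<lambda>e. kval (e (Suc (Suc 0))) = w (e 0) (e (Suc 0)))"
  shows "\<exists>\<sigma>. is_sum X F w \<sigma> \<and> DP KQ U (case_nat (fsort X) (case_nat fs (case_nat kS closed_ctx)))
     (\<lambda>e. e 0 \<in> FinQ X \<and> e (Suc 0) \<in> F \<and> kval (e (Suc (Suc 0))) = \<sigma> (e 0) (e (Suc 0)))"
proof -
  let ?Y = "FinQ X" and ?xt = "extQ X" and ?rs = "fsort X @ fs @ kS"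
  note Y = DS_Fin[OF X]
  have YT: "?Y \<subseteq> tuples KQ (fsort X)" and FT: "F \<subseteq> tuples KQ fs" by (rule DS_subset[OF Y], rule DS_subset[OF F])
  \<comment> \<open>\<open>w\<close> is known to be definable through its graph, which the rule
    therefore mentions with a separate variable \<open>y'\<close> for the summand.\<close>
  define wg where "wg = (\<lambda>a f y. y = w a f)"
  have dwg: "DP KQ U \<Gamma> (\<lambda>e. wg (a e) (f e) (y e))" if "DT KQ U \<Gamma> ss a" "DT KQ U \<Gamma> fs f" "DK mem U \<Gamma> y" for \<Gamma> a f y
    using DP_app3[OF w that(1,2) that(3)[unfolded DK_def]] by (simp add: wg_def)
  define c3 where "c3 = (\<lambda>B f (y :: 'k). B @ f @ [kel y :: ('k, 'f) keq])"
  have inj: "c3 B f y = c3 B' f' y' \<longleftrightarrow> B = B' \<and> f = f' \<and> y = y'"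
    if "B \<in> ?Y" "B' \<in> ?Y" "f \<in> F" "f' \<in> F" for B B' f f' y y'
  proof -
    have "length B = length B'" "length f = length f'"
      using that tuples_length[OF subsetD[OF YT]] tuples_length[OF subsetD[OF FT]] by simp_all
    then show ?thesis by (auto simp: c3_def append_eq_append_conv)
  qed
  have dc3: "DT KQ U \<Gamma> ?rs (\<lambda>e. c3 (B e) (f e) (y e))"
    if "DT KQ U \<Gamma> (fsort X) B" "DT KQ U \<Gamma> fs f" "DK mem U \<Gamma> y" for \<Gamma> B f y
    unfolding c3_def by (intro DT_append DT_kel that)
  let ?T = "{u. \<exists>B\<in>?Y. \<exists>f\<in>F. \<exists>y. u = c3 B f y}"
  let ?\<beta> = "\<lambda>u. \<exists>B\<in>?Y. \<exists>f\<in>F. u = c3 B f 0 \<and> (\<forall>a\<in>X. a \<notin> ?xt B)"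
  let ?\<Phi> = "\<lambda>u v w :: ('k, 'f) keq list. \<exists>B\<in>?Y. \<exists>C\<in>?Y. \<exists>f\<in>F. \<exists>a\<in>X. \<exists>y y'. v = c3 B f y \<and> a \<notin> ?xt B \<and>
     (\<forall>x\<in>X. x \<in> ?xt C \<longleftrightarrow> x \<in> ?xt B \<or> x = a) \<and> u = c3 C f (y + y') \<and> wg a f y'"
  note d = DP_bex[OF X] DP_bex[OF Y] DP_bex[OF F] DP_ball[OF X] DP_ball[OF Y] DP_ball[OF F] DP_ext[OF X] dwg
    DP_eq[where ss = ?rs] dc3
  have T: "DS KQ U ?rs ?T"
    unfolding DS_def
  proof
    show "DP KQ U (case_nat ?rs closed_ctx) (\<lambda>e. e 0 \<in> ?T)"
      unfolding mem_Collect_eq by (intro d DP_ex_k DT_slot' DK_slot | simp only: nat.case)+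
    show "?T \<subseteq> tuples KQ ?rs" unfolding c3_def using YT FT by (auto intro!: append_tuplesI)
  qed
  have \<beta>: "DP KQ U (case_nat ?rs closed_ctx) (\<lambda>e. ?\<beta> (e 0))"
    by (intro d dp | simp only: nat.case)+
  have \<Phi>: "DP KQ U (case_nat ?rs (case_nat ?rs (case_nat ?rs closed_ctx))) (\<lambda>e. ?\<Phi> (e 0) (e (Suc 0)) (e (Suc (Suc 0))))"
    by (intro d DP_ex_k DP_conj DP_not DP_iff DP_disj DP_eq_slots DT_slot' DK_slot DK_add | simp only: nat.case)+
  obtain C where "is_closure ?rs ?T ?\<beta> ?\<Phi> C" using definable_closure[OF T \<beta> \<Phi>] by (elim exE)
  note C = is_closureD[OF this]
  define R where "R = (\<lambda>B f y. B \<in> ?Y \<and> f \<in> F \<and> c3 B f y \<in> C)"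
  have dR: "DP KQ U \<Gamma> (\<lambda>e. R (B e) (f e) (y e))"
    if "DT KQ U \<Gamma> (fsort X) B" "DT KQ U \<Gamma> fs f" "DK mem U \<Gamma> y" for \<Gamma> B f y
    unfolding R_def by (intro DP_conj DP_in[OF Y] DP_in[OF F] DP_in[OF C(1)] dc3 that)
  have R0: "R B f 0" if "B \<in> ?Y" "f \<in> F" "?xt B = {}" for B f
    unfolding R_def using that C(3)[of "c3 B f 0"] by blast
  have RS: "R C' f (y + w a f)" if "R B f y" "C' \<in> ?Y" "a \<in> X" "a \<notin> ?xt B" "?xt C' = insert a (?xt B)" for B C' f y a
  proof -
    have B: "B \<in> ?Y" "f \<in> F" "c3 B f y \<in> C" using that(1) by (auto simp: R_def)
    have iff: "\<forall>x\<in>X. x \<in> ?xt C' \<longleftrightarrow> x \<in> ?xt B \<or> x = a" using that(5) by auto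
    have "?\<Phi> (c3 C' f (y + w a f)) (c3 B f y) (c3 B f y)"
      by (rule bexI[OF _ B(1)], rule bexI[OF _ that(2)], rule bexI[OF _ B(2)], rule bexI[OF _ that(3)],
          intro exI[of _ y] exI[of _ "w a f"] conjI refl that(4) iff) (simp add: wg_def)
    then have "c3 C' f (y + w a f) \<in> C" using B that(2) by (intro C(4)[OF _ B(3) B(3)]) blast+
    then show ?thesis using B(2) that(2) by (simp add: R_def)
  qed
  have ind: "Q B f y" if R: "R B f y"
    and DQ: "DP KQ U (case_nat (fsort X) (case_nat fs (case_nat kS closed_ctx))) (\<lambda>e. Q (e 0) (e (Suc 0)) (kval (e (Suc (Suc 0)))))"
    and Q0: "\<And>B f. B \<in> ?Y \<Longrightarrow> f \<in> F \<Longrightarrow> ?xt B = {} \<Longrightarrow> Q B f 0"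
    and QS: "\<And>B C' f y a. R B f y \<Longrightarrow> Q B f y \<Longrightarrow> C' \<in> ?Y \<Longrightarrow> a \<in> X \<Longrightarrow> a \<notin> ?xt B \<Longrightarrow> ?xt C' = insert a (?xt B) \<Longrightarrow>
       Q C' f (y + w a f)" for Q B f y
  proof -
    let ?P = "\<lambda>u. \<exists>B\<in>?Y. \<exists>f\<in>F. \<exists>y. u = c3 B f y \<and> Q B f y"
    have DQ': "DP KQ U \<Gamma> (\<lambda>e. Q (B e) (f e) (y e))"
      if "DT KQ U \<Gamma> (fsort X) B" "DT KQ U \<Gamma> fs f" "DK mem U \<Gamma> y" for \<Gamma> B f y
      using DP_app3[OF DQ that(1,2) that(3)[unfolded DK_def]] by simp
    have "?P (c3 B f y)"
    proof (rule C(5)[where P = ?P])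
      show "DP KQ U (case_nat ?rs closed_ctx) (\<lambda>e. ?P (e 0))"
        by (intro d DP_ex_k DP_conj DQ' DT_slot' DK_slot | simp only: nat.case)+
      show "?P u" if "u \<in> ?T" "?\<beta> u" for u
      proof -
        obtain B f where *: "B \<in> ?Y" "f \<in> F" "u = c3 B f 0" "\<forall>a\<in>X. a \<notin> ?xt B" using \<open>?\<beta> u\<close> by blast
        then have "?xt B = {}" using ext_subset[of X B] by blast
        then show ?thesis using * Q0 by blast
      qed
      show "c3 B f y \<in> C" using R by (simp add: R_def)
      fix u v w' assume v: "v \<in> C" "?P v" and \<phi>: "?\<Phi> u v w'"
      obtain B1 f1 y1 where 1: "B1 \<in> ?Y" "f1 \<in> F" "v = c3 B1 f1 y1" "Q B1 f1 y1" using v(2) by blast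
      obtain B2 C2 f2 a y2 y' where 2: "B2 \<in> ?Y" "C2 \<in> ?Y" "f2 \<in> F" "a \<in> X" "v = c3 B2 f2 y2" "a \<notin> ?xt B2"
        "\<forall>x\<in>X. x \<in> ?xt C2 \<longleftrightarrow> x \<in> ?xt B2 \<or> x = a" "u = c3 C2 f2 (y2 + y')" "wg a f2 y'" using \<phi> by blast
      have e: "B2 = B1 \<and> f2 = f1 \<and> y2 = y1" using inj[OF 2(1) 1(1) 2(3) 1(2), of y2 y1] 1(3) 2(5) by simp
      have "?xt C2 = insert a (?xt B2)" using 2(4,7) ext_subset[of X C2] ext_subset[of X B2] by blast
      moreover have "R B1 f1 y1" using 1 v(1) by (simp add: R_def)
      ultimately have "Q C2 f1 (y1 + w a f1)" using QS[of B1 f1 y1 C2 a] 1 2 e by simp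
      then show "?P u" using 2 e by (auto simp: wg_def)
    qed
    then obtain B' f' y' where "B' \<in> ?Y" "f' \<in> F" "c3 B f y = c3 B' f' y'" "Q B' f' y'" by blast
    then show ?thesis using inj[of B B' f f' y y'] R by (auto simp: R_def)
  qed
  have Rempty: "y = 0" if "R B f y" "?xt B = {}" for B f y
  proof -
    have "(\<forall>x\<in>X. x \<notin> ?xt B) \<longrightarrow> y = 0"
    proof (rule ind[OF that(1)])
      show "DP KQ U (case_nat (fsort X) (case_nat fs (case_nat kS closed_ctx)))
          (\<lambda>e. (\<forall>x\<in>X. x \<notin> ?xt (e 0)) \<longrightarrow> kval (e (Suc (Suc 0))) = 0)"
        by (intro d dp | simp)+
    qed auto
    then show ?thesis using that(2) by simp
  qed
  \<comment> \<open>Any element \<open>a\<close> of \<open>B\<close> may be taken as the last one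
    inserted: if the actual last one is \<open>b\<close>, take \<open>a\<close> out of the earlier
    set and insert \<open>b\<close> again.\<close>
  have Rrem: "\<exists>B'\<in>?Y. (\<forall>x\<in>X. x \<in> ?xt B' \<longleftrightarrow> x \<in> ?xt B \<and> x \<noteq> a) \<and> (\<exists>z z'. R B' f z \<and> wg a f z' \<and> y = z + z')"
    if "R B f y" "a \<in> ?xt B" for B f y a
  proof -
    have "\<forall>a\<in>X. a \<in> ?xt B \<longrightarrow> (\<exists>B'\<in>?Y. (\<forall>x\<in>X. x \<in> ?xt B' \<longleftrightarrow> x \<in> ?xt B \<and> x \<noteq> a) \<and> (\<exists>z z'. R B' f z \<and> wg a f z' \<and> y = z + z'))"
    proof (rule ind[OF that(1)])
      show "DP KQ U (case_nat (fsort X) (case_nat fs (case_nat kS closed_ctx)))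
          (\<lambda>e. \<forall>a\<in>X. a \<in> ?xt (e 0) \<longrightarrow> (\<exists>B'\<in>?Y. (\<forall>x\<in>X. x \<in> ?xt B' \<longleftrightarrow> x \<in> ?xt (e 0) \<and> x \<noteq> a) \<and>
             (\<exists>z z'. R B' (e (Suc 0)) z \<and> wg a (e (Suc 0)) z' \<and> kval (e (Suc (Suc 0))) = z + z')))"
        by (intro d dR DP_imp DP_conj DP_iff DP_not DP_ex_k DP_eq_slots DP_eq_k DT_slot' DK_slot DK_add | simp)+
    next
      fix B1 C1 f y b assume R: "R B1 f y" and C1: "C1 \<in> ?Y" "b \<in> X" "b \<notin> ?xt B1" "?xt C1 = insert b (?xt B1)"
        and IH: "\<forall>a\<in>X. a \<in> ?xt B1 \<longrightarrow> (\<exists>B'\<in>?Y. (\<forall>x\<in>X. x \<in> ?xt B' \<longleftrightarrow> x \<in> ?xt B1 \<and> x \<noteq> a) \<and> (\<exists>z z'. R B' f z \<and> wg a f z' \<and> y = z + z'))"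
      show "\<forall>a\<in>X. a \<in> ?xt C1 \<longrightarrow> (\<exists>B'\<in>?Y. (\<forall>x\<in>X. x \<in> ?xt B' \<longleftrightarrow> x \<in> ?xt C1 \<and> x \<noteq> a) \<and> (\<exists>z z'. R B' f z \<and> wg a f z' \<and> y + w b f = z + z'))"
      proof (intro ballI impI)
        fix a assume a: "a \<in> X" "a \<in> ?xt C1"
        show "\<exists>B'\<in>?Y. (\<forall>x\<in>X. x \<in> ?xt B' \<longleftrightarrow> x \<in> ?xt C1 \<and> x \<noteq> a) \<and> (\<exists>z z'. R B' f z \<and> wg a f z' \<and> y + w b f = z + z')"
        proof (cases "a = b")
          case True
          have "B1 \<in> ?Y" using R by (simp add: R_def)
          moreover have "\<forall>x\<in>X. x \<in> ?xt B1 \<longleftrightarrow> x \<in> ?xt C1 \<and> x \<noteq> a" using C1(3,4) True by auto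
          moreover have "\<exists>z z'. R B1 f z \<and> wg a f z' \<and> y + w b f = z + z'" using R True by (auto simp: wg_def)
          ultimately show ?thesis by blast
        next
          case False
          then have "a \<in> ?xt B1" using a C1(4) by simp
          then obtain B2 z where B2: "B2 \<in> ?Y" "\<And>x. x \<in> X \<Longrightarrow> x \<in> ?xt B2 \<longleftrightarrow> x \<in> ?xt B1 \<and> x \<noteq> a" "R B2 f z" "y = z + w a f"
            using IH a(1) unfolding wg_def by blast
          have b2: "b \<notin> ?xt B2" using B2(2)[OF C1(2)] C1(3) by simp
          obtain C2 where C2: "C2 \<in> ?Y" "?xt C2 = insert b (?xt B2)" using Fin_insert[OF X B2(1) C1(2)] by blast
          have "R C2 f (z + w b f)" by (rule RS[OF B2(3) C2(1) C1(2) b2 C2(2)])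
          moreover have "\<forall>x\<in>X. x \<in> ?xt C2 \<longleftrightarrow> x \<in> ?xt C1 \<and> x \<noteq> a" unfolding C2(2) C1(4) using B2(2) False by auto
          moreover have "y + w b f = (z + w b f) + w a f" using B2(4) by (simp add: algebra_simps)
          ultimately show ?thesis using C2(1) unfolding wg_def by blast
        qed
      qed
    qed auto
    then show ?thesis using that(2) ext_subset[of X B] by blast
  qed
  have R1: "\<exists>v. R B f v \<and> (\<forall>v'. R B f v' \<longrightarrow> v' = v)" if B: "B \<in> ?Y" and f: "f \<in> F" for B f
  proof -
    have "\<forall>f\<in>F. \<exists>v. R B f v \<and> (\<forall>v'. R B f v' \<longrightarrow> v' = v)"
    proof (rule Fin_induct[OF X _ _ _ B])
      show "DP KQ U (case_nat (fsort X) closed_ctx) (\<lambda>e. \<forall>f\<in>F. \<exists>v. R (e 0) f v \<and> (\<forall>v'. R (e 0) f v' \<longrightarrow> v' = v))"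
        by (intro d dR DP_ex_k DP_all_k DP_conj DP_imp DP_eq_k DK_slot DT_slot' | simp)+
      show "\<forall>f\<in>F. \<exists>v. R B f v \<and> (\<forall>v'. R B f v' \<longrightarrow> v' = v)" if "B \<in> ?Y" "?xt B = {}" for B
        using R0[OF that(1) _ that(2)] Rempty[OF _ that(2)] by blast
      fix B a C' assume B: "B \<in> ?Y" and C': "C' \<in> ?Y" and IH: "\<forall>f\<in>F. \<exists>v. R B f v \<and> (\<forall>v'. R B f v' \<longrightarrow> v' = v)"
        and a: "a \<in> X" "a \<notin> ?xt B" and e: "?xt C' = insert a (?xt B)"
      show "\<forall>f\<in>F. \<exists>v. R C' f v \<and> (\<forall>v'. R C' f v' \<longrightarrow> v' = v)"
      proof
        fix f assume f: "f \<in> F"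
        obtain v where v: "R B f v" "\<And>v'. R B f v' \<Longrightarrow> v' = v" using IH f by blast
        have "v' = v + w a f" if R: "R C' f v'" for v'
        proof -
          obtain B' z where B': "B' \<in> ?Y" "\<And>x. x \<in> X \<Longrightarrow> x \<in> ?xt B' \<longleftrightarrow> x \<in> ?xt C' \<and> x \<noteq> a" "R B' f z" "v' = z + w a f"
            using Rrem[OF R, of a] e unfolding wg_def by blast
          have "?xt B' = ?xt B"
          proof (intro set_eqI)
            fix x show "x \<in> ?xt B' \<longleftrightarrow> x \<in> ?xt B"
              using B'(2)[of x] a(2) ext_subset[of X B'] ext_subset[of X B] unfolding e by blast
          qed
          then have "B' = B" by (rule ext_inj[OF X B'(1) B])
          then show ?thesis using v(2)[of z] B' by simp
        qed
        then show "\<exists>v. R C' f v \<and> (\<forall>v'. R C' f v' \<longrightarrow> v' = v)" using RS[OF v(1) C' a e] by blast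
      qed
    qed
    then show ?thesis using f by blast
  qed
  define \<sigma> where "\<sigma> = (\<lambda>B f. THE v. R B f v)"
  have \<sigma>: "R B f v \<longleftrightarrow> v = \<sigma> B f" if Bf: "B \<in> ?Y" "f \<in> F" for B f v
  proof -
    obtain v0 where v0: "R B f v0" "\<And>v'. R B f v' \<Longrightarrow> v' = v0" using R1[OF Bf] by blast
    then have "\<sigma> B f = v0" unfolding \<sigma>_def by (rule the_equality)
    then show ?thesis using v0 by blast
  qed
  have "is_sum X F w \<sigma>"
    unfolding is_sum_def
  proof (intro conjI ballI impI)
    show "\<sigma> B f = 0" if "f \<in> F" "B \<in> ?Y" "?xt B = {}" for f B
      using R0[OF that(2,1,3)] \<sigma>[OF that(2,1)] by simp
    show "\<sigma> C' f = \<sigma> B f + w a f"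
      if "f \<in> F" "B \<in> ?Y" "C' \<in> ?Y" "a \<in> X" "a \<notin> ?xt B" "?xt C' = insert a (?xt B)" for f B C' a
      using RS[of B f "\<sigma> B f" C' a] \<sigma>[OF that(2,1), of "\<sigma> B f"] \<sigma>[OF that(3,1), of "\<sigma> B f + w a f"] that by simp
  qed
  moreover have "DP KQ U (case_nat (fsort X) (case_nat fs (case_nat kS closed_ctx)))
     (\<lambda>e. e 0 \<in> ?Y \<and> e (Suc 0) \<in> F \<and> kval (e (Suc (Suc 0))) = \<sigma> (e 0) (e (Suc 0)))"
  proof -
    have "DP KQ U (case_nat (fsort X) (case_nat fs (case_nat kS closed_ctx))) (\<lambda>e. R (e 0) (e (Suc 0)) (kval (e (Suc (Suc 0)))))"
      by (intro dR DT_slot' DK_slot) simp_all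
    then show ?thesis by (rule DP_cong) (use \<sigma> R_def in blast)
  qed
  ultimately show ?thesis by blast
qed

lemma is_sumD:
  assumes "is_sum X F w \<sigma>" "f \<in> F" "B \<in> FinQ X"
  shows "extQ X B = {} \<Longrightarrow> \<sigma> B f = 0"
    and "C \<in> FinQ X \<Longrightarrow> a \<in> X \<Longrightarrow> a \<notin> extQ X B \<Longrightarrow> extQ X C = insert a (extQ X B) \<Longrightarrow> \<sigma> C f = \<sigma> B f + w a f"
  using assms unfolding is_sum_def by blast+

section \<open>Evaluation of polynomials\<close>

text \<open>Terms, as an exponent followed by a non-zero coefficient. A member of
  \<open>FinQ (Zs n R)\<close> is a formal sum in which an exponent may carry several coefficients;
  the polynomials are those in which it does not.\<close>

definition Zs :: "'k \<Rightarrow> 'k set \<Rightarrow> ('k, 'f) keq list set" where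
  "Zs n R = prod_set (exponents mem n) (kset (R - {0}))"

abbreviation zsort :: "'k \<Rightarrow> (sort, sym) eqsort list" where
  "zsort n \<equiv> sq n N @ kS"

lemma exps_tuples: "I \<in> exponents mem n \<Longrightarrow> I \<in> tuples KQ (sq n N)"
  using DS_subset[OF DS_seqs[OF dset_N]] by blast

lemma seqs_tuples: "f \<in> seqs mem n UNIV \<Longrightarrow> f \<in> tuples KQ (sq n UNIV)"
  using DS_subset[OF DS_seqs[OF dset_UNIV]] by blast

lemma DS_Zs: "dset R \<Longrightarrow> DS KQ U (zsort n) (Zs n R)"
proof -
  assume R: "dset R"
  have "DP1 (\<lambda>x. x \<in> R \<and> x \<noteq> 0)" by (intro dp DP_dset[OF R]) simp_all
  then have "DP1 (\<lambda>x. x \<in> R - {0})" by (rule DP_cong) simp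
  from DS_prod_set[OF DS_seqs[OF dset_N] DS_kset[OF this]] show ?thesis by (simp add: Zs_def)
qed

lemma Zs_iff [simp]: "I @ [kel c] \<in> Zs n R \<longleftrightarrow> I \<in> exponents mem n \<and> c \<in> R \<and> c \<noteq> 0"
  by (auto simp: Zs_def prod_set_def kset_def)

lemma Zs_cases: "u \<in> Zs n R \<Longrightarrow> \<exists>I c. u = I @ [kel c] \<and> I \<in> exponents mem n \<and> c \<in> R \<and> c \<noteq> 0"
  by (auto simp: Zs_def prod_set_def kset_def)

definition wt :: "'k \<Rightarrow> ('k, 'f) keq list \<Rightarrow> ('k, 'f) keq list \<Rightarrow> 'k" where
  "wt n u f = kval [last u] * mon n (butlast u) f"

lemma wt [simp]: "wt n (I @ [kel c]) f = c * mon n I f"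
  by (simp add: wt_def)

lemma DK_mon:
  assumes "n \<in> N" "DT KQ U \<Gamma> (sq n N) I" "DT KQ U \<Gamma> (sq n UNIV) f"
  shows "DK mem U \<Gamma> (\<lambda>e. mon n (I e) (f e))"
proof (rule mon_aux[OF assms(1)])
  assume "\<And>\<Gamma> I f. DT KQ U \<Gamma> (sq n N) I \<Longrightarrow> DT KQ U \<Gamma> (sq n UNIV) f \<Longrightarrow> DK mem U \<Gamma> (\<lambda>e. mon n (I e) (f e))"
  then show ?thesis using assms(2,3) .
qed

lemma DP_wt:
  assumes n: "n \<in> N"
  shows "DP KQ U (case_nat (zsort n) (case_nat (sq n UNIV) (case_nat kS closed_ctx)))
    (\<lambda>e. kval (e (Suc (Suc 0))) = wt n (e 0) (e (Suc 0)))"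
proof -
  have "DP KQ U (case_nat (zsort n) (case_nat (sq n UNIV) (case_nat kS closed_ctx)))
    (\<lambda>e. \<exists>I\<in>tuples KQ (sq n N). \<exists>c. e 0 = I @ [kel c] \<and> kval (e (Suc (Suc 0))) = c * mon n I (e (Suc 0)))"
    by (intro DP_ex DP_ex_k DP_conj DP_eq[where ss = "zsort n"] DT_append DP_eq_k DK_mult DK_mon[OF n] DK_slot DT_slot' DT_kel | simp only: nat.case)+
  then show ?thesis
  proof (rule DP_cong)
    fix e assume "e \<in> Env KQ (case_nat (zsort n) (case_nat (sq n UNIV) (case_nat kS closed_ctx)))"
    then obtain I u where I: "e 0 = I @ u" "I \<in> tuples KQ (sq n N)" "u \<in> tuples KQ kS"
      using Env_head by (metis append_tuples)
    then obtain c where "u = [kel c]" using kS_tuples by blast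
    then show "(\<exists>I\<in>tuples KQ (sq n N). \<exists>c. e 0 = I @ [kel c] \<and> kval (e (Suc (Suc 0))) = c * mon n I (e (Suc 0))) \<longleftrightarrow>
        kval (e (Suc (Suc 0))) = wt n (e 0) (e (Suc 0))"
      using I by (auto simp: wt_def)
  qed
qed

definition sg :: "'k \<Rightarrow> 'k set \<Rightarrow> ('k, 'f) keq list \<Rightarrow> ('k, 'f) keq list \<Rightarrow> 'k" where
  "sg n R = (SOME \<sigma>. is_sum (Zs n R) (seqs mem n UNIV) (wt n) \<sigma> \<and>
     DP KQ U (case_nat (fsort (Zs n R)) (case_nat (sq n UNIV) (case_nat kS closed_ctx)))
       (\<lambda>e. e 0 \<in> FinQ (Zs n R) \<and> e (Suc 0) \<in> seqs mem n UNIV \<and> kval (e (Suc (Suc 0))) = \<sigma> (e 0) (e (Suc 0))))"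

lemma sg:
  assumes "n \<in> N" "dset R"
  shows "is_sum (Zs n R) (seqs mem n UNIV) (wt n) (sg n R)"
    and "DP KQ U (case_nat (fsort (Zs n R)) (case_nat (sq n UNIV) (case_nat kS closed_ctx)))
       (\<lambda>e. e 0 \<in> FinQ (Zs n R) \<and> e (Suc 0) \<in> seqs mem n UNIV \<and> kval (e (Suc (Suc 0))) = sg n R (e 0) (e (Suc 0)))"
  using someI_ex[OF sum_ex[OF DS_Zs[OF assms(2)] DS_seqs[OF dset_UNIV] DP_wt[OF assms(1)]]]
  unfolding sg_def by blast+

text \<open>\<open>ev\<close> recurs on the subsets of the domain of \<open>p\<close>, a power set
  that changes with \<open>p\<close>. Summing over terms stays in one power set for all
  \<open>p\<close>, which makes the value a definable term in \<open>p\<close> and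
  \<open>f\<close>.\<close>

definition evt :: "'k \<Rightarrow> 'k set \<Rightarrow> ('k, 'f) keq list \<Rightarrow> ('k, 'f) keq list \<Rightarrow> 'k" where
  "evt n R p f = (if p \<in> FinQ (Zs n R) \<and> f \<in> seqs mem n UNIV then sg n R p f else 0)"

lemma DK_evt:
  assumes n: "n \<in> N" and R: "dset R" and t: "DT KQ U \<Gamma> (fsort (Zs n R)) p" "DT KQ U \<Gamma> (sq n UNIV) f"
  shows "DK mem U \<Gamma> (\<lambda>e. evt n R (p e) (f e))"
proof (rule DKI)
  let ?p = "\<lambda>e. p (\<lambda>x. e (Suc x))" and ?f = "\<lambda>e. f (\<lambda>x. e (Suc x))"
  define H where "H = (\<lambda>p f y. p \<in> FinQ (Zs n R) \<and> f \<in> seqs mem n UNIV \<and> y = sg n R p f)"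
  note t' = DT_weaken[OF t(1), of kS] DT_weaken[OF t(2), of kS]
  have H: "DP KQ U (case_nat (fsort (Zs n R)) (case_nat (sq n UNIV) (case_nat kS closed_ctx)))
       (\<lambda>e. H (e 0) (e (Suc 0)) (kval (e (Suc (Suc 0)))))"
    unfolding H_def by (rule sg(2)[OF n R])
  have "DP KQ U (case_nat kS \<Gamma>) (\<lambda>e. if ?p e \<in> FinQ (Zs n R) \<and> ?f e \<in> seqs mem n UNIV then H (?p e) (?f e) (kval (e 0)) else kval (e 0) = 0)"
    by (rule DP_if, rule DP_conj, rule DP_in[OF DS_Fin[OF DS_Zs[OF R]] t'(1)], rule DP_in[OF DS_seqs[OF dset_UNIV] t'(2)],
        rule DP_app3[OF H t'], rule DT_slot, simp, intro dp, simp)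
  then show "DP KQ U (case_nat kS \<Gamma>) (\<lambda>e. kval (e 0) = evt n R (?p e) (?f e))"
    by (rule DP_cong) (auto simp: evt_def H_def)
qed

lemma evt_empty: "n \<in> N \<Longrightarrow> dset R \<Longrightarrow> p \<in> FinQ (Zs n R) \<Longrightarrow> extQ (Zs n R) p = {} \<Longrightarrow> evt n R p f = 0"
  using is_sumD(1)[OF sg(1)] by (simp add: evt_def)

lemma evt_insert:
  assumes "n \<in> N" "dset R" "p \<in> FinQ (Zs n R)" "q \<in> FinQ (Zs n R)" "I @ [kel c] \<in> Zs n R"
    "I @ [kel c] \<notin> extQ (Zs n R) p" "extQ (Zs n R) q = insert (I @ [kel c]) (extQ (Zs n R) p)"
  shows "evt n R q f = evt n R p f + c * mon n I f"
proof (cases "f \<in> seqs mem n UNIV")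
  case True
  then show ?thesis using is_sumD(2)[OF sg(1)[OF assms(1,2)] True assms(3-7)] assms(3,4) by (simp add: evt_def)
qed (simp add: evt_def mon_def)

lemma fgraph_polys: "(I, c) \<in> fgraph mem (exponents mem n) (R - {0}) p \<longleftrightarrow> I @ [kel c] \<in> extQ (Zs n R) p"
  using ext_subset[of "Zs n R" p] Zs_iff[of I c n R] unfolding fgraph_def Zs_def[symmetric] by auto

lemma pdom_iff: "I \<in> pdom mem n R p \<longleftrightarrow> (\<exists>c. I @ [kel c] \<in> extQ (Zs n R) p)"
  unfolding pdom_def Domain_iff fgraph_polys ..

lemma pdom_exps: "I \<in> pdom mem n R p \<Longrightarrow> I \<in> exponents mem n"
  unfolding pdom_iff using ext_subset[of "Zs n R" p] Zs_iff[of I _ n R] by blast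

lemma DS_pdom:
  assumes R: "dset R" and p: "p \<in> FinQ (Zs n R)"
  shows "DS KQ U (sq n N) (pdom mem n R p)"
  unfolding DS_def
proof
  have pT: "p \<in> tuples KQ (fsort (Zs n R))" using p DS_subset[OF DS_Fin[OF DS_Zs[OF R]]] by blast
  show "DP KQ U (case_nat (sq n N) closed_ctx) (\<lambda>e. e 0 \<in> pdom mem n R p)"
    unfolding pdom_iff by (intro DP_ex_k DP_ext[OF DS_Zs[OF R]] DT_append DT_slot' DT_kel DK_slot
        DT_const[OF pT tuples_subset_univ[OF pT]] | simp)+
qed (use pdom_exps exps_tuples in blast)

lemma hf_pdom:
  assumes R: "dset R" and p: "p \<in> FinQ (Zs n R)"
  shows "hf (sq n N) (pdom mem n R p)"
proof -
  have "hf (sq n N) {I. \<exists>u\<in>extQ (Zs n R) p. \<exists>c. u = I @ [kel c] \<and> I \<in> exponents mem n}"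
  proof (rule hf_UN[OF Fin_hf[OF DS_Zs[OF R] p]])
    fix u assume "u \<in> extQ (Zs n R) p"
    then obtain I c where *: "u = I @ [kel c]" "I \<in> exponents mem n" using Zs_cases ext_subset[of "Zs n R" p] by blast
    then have "{I. \<exists>c. u = I @ [kel c] \<and> I \<in> exponents mem n} = {I}" by auto
    then show "hf (sq n N) {I. \<exists>c. u = I @ [kel c] \<and> I \<in> exponents mem n}"
      using hf_insert[OF hf_empty exps_tuples[OF *(2)]] by simp
  next
    show "DP KQ U (case_nat (zsort n) (case_nat (sq n N) closed_ctx))
        (\<lambda>e. \<exists>c. e 0 = e (Suc 0) @ [kel c] \<and> e (Suc 0) \<in> exponents mem n)"
      by (intro DP_ex_k DP_conj DP_eq[where ss = "zsort n"] DT_append DT_slot' DT_kel DK_slot DP_in[OF DS_seqs[OF dset_N]] | simp only: nat.case)+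
  qed
  then show ?thesis
  proof (rule back_subst[of "hf (sq n N)"])
    show "{I. \<exists>u\<in>extQ (Zs n R) p. \<exists>c. u = I @ [kel c] \<and> I \<in> exponents mem n} = pdom mem n R p"
    proof (rule set_eqI)
      fix I
      show "I \<in> {I. \<exists>u\<in>extQ (Zs n R) p. \<exists>c. u = I @ [kel c] \<and> I \<in> exponents mem n} \<longleftrightarrow> I \<in> pdom mem n R p"
        using pdom_exps[of I n R p] unfolding pdom_iff mem_Collect_eq by blast
    qed
  qed
qed

lemma polys_iff:
  assumes R: "dset R"
  shows "p \<in> polys mem n R \<longleftrightarrow> p \<in> FinQ (Zs n R) \<and>
    (\<forall>I c c'. I @ [kel c] \<in> extQ (Zs n R) p \<longrightarrow> I @ [kel c'] \<in> extQ (Zs n R) p \<longrightarrow> c = c')"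
proof -
  have "hyperfinite KQ (Domain (fgraph mem (exponents mem n) (R - {0}) p))" if "p \<in> FinQ (Zs n R)"
    using hf_hyperfinite[OF DS_pdom[OF R that] hf_pdom[OF R that]] by (simp add: pdom_def)
  then show ?thesis
    unfolding polys_def hpfun_def Zs_def[symmetric] mem_Collect_eq single_valued_def fgraph_polys by blast
qed

lemma polysD: "dset R \<Longrightarrow> p \<in> polys mem n R \<Longrightarrow> p \<in> FinQ (Zs n R)"
  by (simp add: polys_iff)

lemma pcoeff_eq:
  assumes R: "dset R" and p: "p \<in> polys mem n R" and I: "I @ [kel c] \<in> extQ (Zs n R) p"
  shows "pcoeff mem n R p I = c"
proof -
  have "I \<in> pdom mem n R p" using I pdom_iff by blast
  moreover have "fval mem (exponents mem n) (R - {0}) p I = c"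
    unfolding fval_def fgraph_polys
  proof (rule the_equality)
    show "c' = c" if "I @ [kel c'] \<in> extQ (Zs n R) p" for c' using that p I polys_iff[OF R] by blast
  qed (rule I)
  ultimately show ?thesis by (simp add: pcoeff_def)
qed

text \<open>Both are hyperfinite sums of the same summands over different index sets, exponents on
  one side and terms on the other. They are compared along the subsets \<open>A\<close> of the
  domain of \<open>p\<close>.\<close>

lemma ev_evt:
  assumes n: "n \<in> N" and R: "dset R" and p: "p \<in> polys mem n R" and f: "f \<in> seqs mem n UNIV"
  shows "ev mem n R p f = evt n R p f"
proof -
  let ?Z = "Zs n R" and ?X = "pdom mem n R p"
  note pF = polysD[OF R p]
  note Z = DS_Zs[OF R, of n] and X = DS_pdom[OF R pF] and hX = hf_pdom[OF R pF]
  let ?w = "\<lambda>I (u :: ('k, 'f) keq list). pcoeff mem n R p I * mon n I f"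
  have pT: "p \<in> tuples KQ (fsort ?Z)" using pF DS_subset[OF DS_Fin[OF Z]] by blast
  note dpp = DT_const[OF pT tuples_subset_univ[OF pT]]
    and dpf = DT_const[OF seqs_tuples[OF f] tuples_subset_univ[OF seqs_tuples[OF f]]]
  have w: "DP KQ U (case_nat (sq n N) (case_nat [] (case_nat kS closed_ctx))) (\<lambda>e. kval (e (Suc (Suc 0))) = ?w (e 0) (e (Suc 0)))"
  proof -
    have "DP KQ U (case_nat (sq n N) (case_nat [] (case_nat kS closed_ctx)))
       (\<lambda>e. (\<exists>c. e 0 @ [kel c] \<in> extQ ?Z p \<and> kval (e (Suc (Suc 0))) = c * mon n (e 0) f) \<or>
          \<not> (\<exists>c. e 0 @ [kel c] \<in> extQ ?Z p) \<and> kval (e (Suc (Suc 0))) = 0)"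
      by (intro DP_ex_k DP_disj DP_not DP_conj DP_ext[OF Z] DP_eq_k DK_mult DK_mon[OF n] DT_append dpp dpf DT_slot' DT_kel DK_slot DK_zero | simp)+
    then show ?thesis
    proof (rule DP_cong)
      fix e
      show "((\<exists>c. e 0 @ [kel c] \<in> extQ ?Z p \<and> kval (e (Suc (Suc 0))) = c * mon n (e 0) f) \<or>
          \<not> (\<exists>c. e 0 @ [kel c] \<in> extQ ?Z p) \<and> kval (e (Suc (Suc 0))) = 0) \<longleftrightarrow> kval (e (Suc (Suc 0))) = ?w (e 0) (e (Suc 0))"
      proof (cases "\<exists>c. e 0 @ [kel c] \<in> extQ ?Z p")
        case True
        then obtain c where c: "e 0 @ [kel c] \<in> extQ ?Z p" by blast
        have "c' = c" if "e 0 @ [kel c'] \<in> extQ ?Z p" for c'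
          using pcoeff_eq[OF R p that] pcoeff_eq[OF R p c] by simp
        then have "(\<exists>c. e 0 @ [kel c] \<in> extQ ?Z p \<and> kval (e (Suc (Suc 0))) = c * mon n (e 0) f) \<longleftrightarrow>
            kval (e (Suc (Suc 0))) = c * mon n (e 0) f" using c by blast
        then show ?thesis using True pcoeff_eq[OF R p c] by (simp only: simp_thms)
      next
        case False
        then show ?thesis by (simp add: pcoeff_def pdom_iff)
      qed
    qed
  qed
  \<comment> \<open>\<open>f\<close> is fixed, so the sum is taken with a dummy parameter, the empty
    tuple.\<close>
  have F: "DS KQ U [] {[]}" using DS_tuples[of KQ U "[]"] by (rule back_subst[of "DS KQ U []"]) auto
  obtain \<sigma> where \<sigma>: "is_sum ?X {[]} ?w \<sigma>" and d\<sigma>: "DP KQ U (case_nat (fsort ?X) (case_nat [] (case_nat kS closed_ctx)))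
     (\<lambda>e. e 0 \<in> FinQ ?X \<and> e (Suc 0) \<in> {[]} \<and> kval (e (Suc (Suc 0))) = \<sigma> (e 0) (e (Suc 0)))"
    using sum_ex[OF X F w] by blast
  define G where "G = (\<lambda>A. \<sigma> A [])"
  define H where "H = (\<lambda>A y. A \<in> FinQ ?X \<and> y = G A)"
  have dH: "DP KQ U \<Gamma> (\<lambda>e. H (A e) (y e))" if t: "DT KQ U \<Gamma> (fsort ?X) A" "DK mem U \<Gamma> y" for \<Gamma> A y
  proof -
    have "DP KQ U (case_nat (fsort ?X) (case_nat [] (case_nat kS closed_ctx))) (\<lambda>e. H (e 0) (kval (e (Suc (Suc 0)))))"
    proof (rule DP_cong[OF d\<sigma>])
      fix e assume "e \<in> Env KQ (case_nat (fsort ?X) (case_nat [] (case_nat kS closed_ctx)))"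
      then have "e (Suc 0) = []" by (rule Env_Nil) simp
      then show "(e 0 \<in> FinQ ?X \<and> e (Suc 0) \<in> {[]} \<and> kval (e (Suc (Suc 0))) = \<sigma> (e 0) (e (Suc 0))) \<longleftrightarrow> H (e 0) (kval (e (Suc (Suc 0))))"
        by (simp add: H_def G_def)
    qed
    from DP_app3[OF this t(1) DT_Nil t(2)[unfolded DK_def]] show ?thesis by simp
  qed
  have G0: "G A = 0" if "A \<in> FinQ ?X" "extQ ?X A = {}" for A
    unfolding G_def by (rule is_sumD(1)[OF \<sigma> _ that]) simp
  have GS: "G C = G A + pcoeff mem n R p I * mon n I f"
    if "A \<in> FinQ ?X" "C \<in> FinQ ?X" "I \<in> ?X" "I \<notin> extQ ?X A" "extQ ?X C = insert I (extQ ?X A)" for A C I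
    unfolding G_def by (rule is_sumD(2)[OF \<sigma> _ that]) simp
  have me: "mon n I f = ev_monom mem n I f" if "I \<in> ?X" for I
    using pdom_exps[OF that] f by (simp add: mon_def)
  obtain A0 where A0: "A0 \<in> FinQ ?X" "extQ ?X A0 = ?X" using hf_Fin[OF X hX] by blast
  have "ev mem n R p f = G A0"
    unfolding ev_def Let_def
  proof (rule the_equality)
    have DG: "DS KQ U (fsort ?X @ kS) {A @ [kel (G A)] |A. A \<in> FinQ ?X}"
      unfolding DS_def
    proof
      have "DP KQ U (case_nat (fsort ?X @ kS) closed_ctx) (\<lambda>e. \<exists>A\<in>FinQ ?X. \<exists>y. e 0 = A @ [kel y] \<and> H A y)"
        by (intro DP_bex[OF DS_Fin[OF X]] DP_ex_k DP_conj dH DP_eq[where ss = "fsort ?X @ kS"] DT_append DT_slot' DT_kel DK_slot | simp only: nat.case)+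
      then show "DP KQ U (case_nat (fsort ?X @ kS) closed_ctx) (\<lambda>e. e 0 \<in> {A @ [kel (G A)] |A. A \<in> FinQ ?X})"
        by (rule DP_cong) (auto simp: H_def)
    qed (use DS_subset[OF DS_Fin[OF X]] in \<open>auto intro!: append_tuplesI\<close>)
    show "\<exists>G'. definable KQ {A @ [kel (G' A)] |A. A \<in> FinQ ?X} \<and> (\<forall>A\<in>FinQ ?X. extQ ?X A = {} \<longrightarrow> G' A = 0) \<and>
        (\<forall>A\<in>FinQ ?X. \<forall>I\<in>?X - extQ ?X A. \<forall>C\<in>FinQ ?X. extQ ?X C = insert I (extQ ?X A) \<longrightarrow>
           G' C = G' A + pcoeff mem n R p I * ev_monom mem n I f) \<and> (\<exists>A\<in>FinQ ?X. extQ ?X A = ?X \<and> G A0 = G' A)"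
      using DS_definable[OF DG] G0 GS A0 me by (intro exI[of _ G]) auto
    fix v assume "\<exists>G'. definable KQ {A @ [kel (G' A)] |A. A \<in> FinQ ?X} \<and> (\<forall>A\<in>FinQ ?X. extQ ?X A = {} \<longrightarrow> G' A = 0) \<and>
        (\<forall>A\<in>FinQ ?X. \<forall>I\<in>?X - extQ ?X A. \<forall>C\<in>FinQ ?X. extQ ?X C = insert I (extQ ?X A) \<longrightarrow>
           G' C = G' A + pcoeff mem n R p I * ev_monom mem n I f) \<and> (\<exists>A\<in>FinQ ?X. extQ ?X A = ?X \<and> v = G' A)"
    then obtain G' where G': "definable KQ {A @ [kel (G' A)] |A. A \<in> FinQ ?X} \<and> (\<forall>A\<in>FinQ ?X. extQ ?X A = {} \<longrightarrow> G' A = 0) \<and>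
        (\<forall>A\<in>FinQ ?X. \<forall>I\<in>?X - extQ ?X A. \<forall>C\<in>FinQ ?X. extQ ?X C = insert I (extQ ?X A) \<longrightarrow>
           G' C = G' A + pcoeff mem n R p I * ev_monom mem n I f) \<and> (\<exists>A\<in>FinQ ?X. extQ ?X A = ?X \<and> v = G' A)" by (elim exE)
    note D' = G'[THEN conjunct1] and G'0 = G'[THEN conjunct2, THEN conjunct1, rule_format]
      and G'S = G'[THEN conjunct2, THEN conjunct2, THEN conjunct1, rule_format]
    obtain A1 where A1: "A1 \<in> FinQ ?X" "extQ ?X A1 = ?X" "v = G' A1"
      using G'[THEN conjunct2, THEN conjunct2, THEN conjunct2] by blast
    \<comment> \<open>An arbitrary solution \<open>G'\<close> enters the induction through its
      definable graph.\<close>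
    define S' where "S' = {A @ [kel (G' A)] |A. A \<in> FinQ ?X}"
    obtain s where "DS KQ U s S'" using D' by (auto simp: definable_iff S'_def)
    then have S': "DS KQ U (fsort ?X @ kS) S'"
      by (rule DS_sort_transfer) (use DS_subset[OF DS_Fin[OF X]] in \<open>auto simp: S'_def intro!: append_tuplesI\<close>)
    have S'_iff: "A @ [kel y] \<in> S' \<longleftrightarrow> A \<in> FinQ ?X \<and> y = G' A" for A y by (auto simp: S'_def)
    have "\<exists>y. H A y \<and> A @ [kel y] \<in> S'" if "A \<in> FinQ ?X" for A
    proof (rule Fin_induct[OF X _ _ _ that])
      show "DP KQ U (case_nat (fsort ?X) closed_ctx) (\<lambda>e. \<exists>y. H (e 0) y \<and> e 0 @ [kel y] \<in> S')"
        by (intro DP_ex_k DP_conj dH DP_in[OF S'] DT_append DT_slot' DT_kel DK_slot | simp only: nat.case)+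
      show "\<exists>y. H A y \<and> A @ [kel y] \<in> S'" if "A \<in> FinQ ?X" "extQ ?X A = {}" for A
        using that G0 G'0 by (simp add: H_def S'_iff)
      show "\<exists>y. H C y \<and> C @ [kel y] \<in> S'" if "A \<in> FinQ ?X" "C \<in> FinQ ?X" "\<exists>y. H A y \<and> A @ [kel y] \<in> S'"
        "I \<in> ?X" "I \<notin> extQ ?X A" "extQ ?X C = insert I (extQ ?X A)" for A I C
        using that GS[OF that(1,2,4,5,6)] G'S[OF that(1) _ that(2,6)] me[OF that(4)] by (auto simp: H_def S'_iff)
    qed
    from this[OF A1(1)] have "v = G A1" using A1(3) by (auto simp: H_def S'_iff)
    moreover have "A1 = A0" by (rule ext_inj[OF X A1(1) A0(1)]) (simp add: A1(2) A0(2))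
    ultimately show "v = G A0" by simp
  qed
  also have "G A0 = evt n R p f"
  proof -
    \<comment> \<open>\<open>q\<close> is the restriction of \<open>p\<close> to the exponents in
      \<open>A\<close>, described by its terms.\<close>
    have "\<forall>q\<in>FinQ ?Z. (\<forall>I\<in>tuples KQ (sq n N). \<forall>c. I @ [kel c] \<in> extQ ?Z q \<longleftrightarrow> I @ [kel c] \<in> extQ ?Z p \<and> I \<in> extQ ?X A) \<longrightarrow> H A (evt n R q f)"
      if "A \<in> FinQ ?X" for A
    proof (rule Fin_induct[OF X _ _ _ that])
      show "DP KQ U (case_nat (fsort ?X) closed_ctx) (\<lambda>e. \<forall>q\<in>FinQ ?Z. (\<forall>I\<in>tuples KQ (sq n N). \<forall>c. I @ [kel c] \<in> extQ ?Z q \<longleftrightarrow>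
          I @ [kel c] \<in> extQ ?Z p \<and> I \<in> extQ ?X (e 0)) \<longrightarrow> H (e 0) (evt n R q f))"
        by (intro DP_ball[OF DS_Fin[OF Z]] DP_all DP_all_k DP_imp DP_iff DP_conj DP_ext[OF Z] DP_ext[OF X] dH DK_evt[OF n R]
            dpp dpf DT_append DT_slot' DT_kel DK_slot | simp only: nat.case)+
    next
      fix A assume A: "A \<in> FinQ ?X" "extQ ?X A = {}"
      show "\<forall>q\<in>FinQ ?Z. (\<forall>I\<in>tuples KQ (sq n N). \<forall>c. I @ [kel c] \<in> extQ ?Z q \<longleftrightarrow> I @ [kel c] \<in> extQ ?Z p \<and> I \<in> extQ ?X A) \<longrightarrow> H A (evt n R q f)"
      proof (intro ballI impI)
        fix q assume q: "q \<in> FinQ ?Z" "\<forall>I\<in>tuples KQ (sq n N). \<forall>c. I @ [kel c] \<in> extQ ?Z q \<longleftrightarrow> I @ [kel c] \<in> extQ ?Z p \<and> I \<in> extQ ?X A"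
        have "u \<notin> extQ ?Z q" for u
        proof
          assume u: "u \<in> extQ ?Z q"
          then obtain I c where "u = I @ [kel c]" "I \<in> exponents mem n" using ext_subset[of ?Z q] Zs_cases by blast
          then show False using q(2) A(2) u exps_tuples by blast
        qed
        then have "extQ ?Z q = {}" by blast
        then show "H A (evt n R q f)" using evt_empty[OF n R q(1)] G0[OF A] A(1) by (simp add: H_def)
      qed
    next
      fix A I C assume A: "A \<in> FinQ ?X" "C \<in> FinQ ?X" and I: "I \<in> ?X" "I \<notin> extQ ?X A" and e: "extQ ?X C = insert I (extQ ?X A)"
        and IH: "\<forall>q\<in>FinQ ?Z. (\<forall>I\<in>tuples KQ (sq n N). \<forall>c. I @ [kel c] \<in> extQ ?Z q \<longleftrightarrow> I @ [kel c] \<in> extQ ?Z p \<and> I \<in> extQ ?X A) \<longrightarrow> H A (evt n R q f)"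
      show "\<forall>q\<in>FinQ ?Z. (\<forall>I\<in>tuples KQ (sq n N). \<forall>c. I @ [kel c] \<in> extQ ?Z q \<longleftrightarrow> I @ [kel c] \<in> extQ ?Z p \<and> I \<in> extQ ?X C) \<longrightarrow> H C (evt n R q f)"
      proof (intro ballI impI)
        fix q assume q: "q \<in> FinQ ?Z" "\<forall>I\<in>tuples KQ (sq n N). \<forall>c. I @ [kel c] \<in> extQ ?Z q \<longleftrightarrow> I @ [kel c] \<in> extQ ?Z p \<and> I \<in> extQ ?X C"
        obtain c where c: "I @ [kel c] \<in> extQ ?Z p" using I(1) unfolding pdom_iff by blast
        have IT: "I \<in> tuples KQ (sq n N)" by (rule exps_tuples[OF pdom_exps[OF I(1)]])
        have "hf (zsort n) {u \<in> extQ ?Z q. u \<noteq> I @ [kel c]}"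
        proof (rule hf_subset[OF Fin_hf[OF Z q(1)]])
          have T: "I @ [kel c] \<in> tuples KQ (zsort n)" by (rule append_tuplesI[OF IT kel_tuples])
          show "DP KQ U (case_nat (zsort n) closed_ctx) (\<lambda>e. e 0 \<noteq> I @ [kel c])"
            by (intro DP_not DP_eq[where ss = "zsort n"] DT_slot' DT_const[OF T tuples_subset_univ[OF T]] | simp only: nat.case)+
        qed
        moreover have "{u \<in> extQ ?Z q. u \<noteq> I @ [kel c]} \<subseteq> ?Z" using ext_subset[of ?Z q] by blast
        ultimately obtain r where r: "r \<in> FinQ ?Z" "extQ ?Z r = {u \<in> extQ ?Z q. u \<noteq> I @ [kel c]}" using hf_Fin[OF Z] by blast
        have cq: "I @ [kel c] \<in> extQ ?Z q" using q(2) IT c e by blast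
        have one: "c' = c" if "I @ [kel c'] \<in> extQ ?Z p" for c' using pcoeff_eq[OF R p that] pcoeff_eq[OF R p c] by simp
        have "J @ [kel d] \<in> extQ ?Z r \<longleftrightarrow> J @ [kel d] \<in> extQ ?Z p \<and> J \<in> extQ ?X A" if "J \<in> tuples KQ (sq n N)" for J d
          using q(2) that one I(2) unfolding r(2) e by auto
        then have "H A (evt n R r f)" using IH r(1) by blast
        moreover have "evt n R q f = evt n R r f + c * mon n I f"
          by (rule evt_insert[OF n R r(1) q(1)]) (use ext_subset[of ?Z p] c r(2) cq in auto)
        moreover have "G C = G A + c * mon n I f" using GS[OF A I e] pcoeff_eq[OF R p c] by simp
        ultimately show "H C (evt n R q f)" using A(2) by (simp add: H_def)
      qed
    qed
    from this[OF A0(1)] have "H A0 (evt n R p f)" using pF pdom_iff unfolding A0(2) by blast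
    then show ?thesis by (simp add: H_def)
  qed
  finally show ?thesis .
qed

section \<open>Definable rings of values of polynomials\<close>

lemma N_induct_upto:
  assumes P: "DP1 P" and n: "n \<in> N" and 0: "P 0" and Suc: "\<And>j. j \<in> bel n \<Longrightarrow> P j \<Longrightarrow> P (j + 1)"
  shows "P n"
proof -
  have "j = n \<or> j \<in> bel n \<longrightarrow> P j" if "j \<in> N" for j
  proof (rule N_induct[OF _ that])
    show "DP1 (\<lambda>j. j = n \<or> j \<in> bel n \<longrightarrow> P j)" by (intro dp DP_app_k[OF P] | simp)+
    fix j assume j: "j \<in> N" and IH: "j = n \<or> j \<in> bel n \<longrightarrow> P j"
    show "j + 1 = n \<or> j + 1 \<in> bel n \<longrightarrow> P (j + 1)"
    proof
      assume "j + 1 = n \<or> j + 1 \<in> bel n"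
      then have "j \<in> bel n" using bel_self[OF j] bel_trans[of j "j + 1" n] by auto
      then show "P (j + 1)" using Suc IH by blast
    qed
  qed (use 0 in simp)
  then show ?thesis using n by blast
qed

lemma mon_h:
  assumes n: "n \<in> N" and I: "I \<in> exponents mem n" and f: "f \<in> seqs mem n UNIV"
  shows "\<exists>h. (\<forall>\<Gamma> t. DK mem U \<Gamma> t \<longrightarrow> DK mem U \<Gamma> (\<lambda>e. h (t e))) \<and> h 0 = 1 \<and>
    (\<forall>j\<in>N. h (j + 1) = h j * mterm n I f j) \<and> mon n I f = h n"
proof (rule mon_aux[OF n])
  fix h
  assume h: "\<And>I f. I \<in> exponents mem n \<Longrightarrow> f \<in> seqs mem n UNIV \<Longrightarrow> DP2 (\<lambda>j y. j \<in> N \<and> y = h I f j)"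
    "\<And>I f. I \<in> exponents mem n \<Longrightarrow> f \<in> seqs mem n UNIV \<Longrightarrow> h I f 0 = 1"
    "\<And>I f j. I \<in> exponents mem n \<Longrightarrow> f \<in> seqs mem n UNIV \<Longrightarrow> j \<in> N \<Longrightarrow> h I f (j + 1) = h I f j * mterm n I f j"
    "\<And>I f. I \<in> exponents mem n \<Longrightarrow> f \<in> seqs mem n UNIV \<Longrightarrow> mon n I f = h I f n"
  let ?h = "\<lambda>j. if j \<in> N then h I f j else 0"
  have "DK mem U \<Gamma> (\<lambda>e. ?h (t e))" if t: "DK mem U \<Gamma> t" for \<Gamma> t
  proof (rule DKI)
    define H where "H = (\<lambda>j y. j \<in> N \<and> y = h I f j)"
    have H: "DP2 H" using h(1)[OF I f] by (simp only: H_def)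
    have "DP KQ U (case_nat kS \<Gamma>) (\<lambda>e. if t (\<lambda>x. e (Suc x)) \<in> N then H (t (\<lambda>x. e (Suc x))) (kval (e 0)) else kval (e 0) = 0)"
      by (intro DP_if DP_N DP_app_kk[OF H] DK_weaken[OF t] DP_eq_k DK_zero DK_slot) simp_all
    then show "DP KQ U (case_nat kS \<Gamma>) (\<lambda>e. kval (e 0) = ?h (t (\<lambda>x. e (Suc x))))"
      by (rule DP_cong) (auto simp: H_def)
  qed
  then show ?thesis using h(2,3,4)[OF I f] n by (intro exI[of _ ?h]) auto
qed

text \<open>Three monomials are built in step because the product law relates \<open>K\<close> to
  \<open>I\<close> and \<open>J\<close>; applications to fewer monomials repeat one of them.\<close>

lemma mon_induct:
  assumes n: "n \<in> N" and IJ: "I \<in> exponents mem n" "J \<in> exponents mem n" "K \<in> exponents mem n"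
    and f: "f \<in> seqs mem n UNIV" and g: "g \<in> seqs mem n UNIV" and h: "h \<in> seqs mem n UNIV"
    and P: "DP3 P" and 1: "P 1 1 1"
    and step: "\<And>a b c j. j \<in> bel n \<Longrightarrow> P a b c \<Longrightarrow> P (a * mterm n I f j) (b * mterm n J g j) (c * mterm n K h j)"
  shows "P (mon n I f) (mon n J g) (mon n K h)"
proof -
  obtain h1 where h1: "(\<forall>\<Gamma> t. DK mem U \<Gamma> t \<longrightarrow> DK mem U \<Gamma> (\<lambda>e. h1 (t e))) \<and> h1 0 = 1 \<and>
    (\<forall>j\<in>N. h1 (j + 1) = h1 j * mterm n I f j) \<and> mon n I f = h1 n" using mon_h[OF n IJ(1) f] by (elim exE)
  obtain h2 where h2: "(\<forall>\<Gamma> t. DK mem U \<Gamma> t \<longrightarrow> DK mem U \<Gamma> (\<lambda>e. h2 (t e))) \<and> h2 0 = 1 \<and>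
    (\<forall>j\<in>N. h2 (j + 1) = h2 j * mterm n J g j) \<and> mon n J g = h2 n" using mon_h[OF n IJ(2) g] by (elim exE)
  obtain h3 where h3: "(\<forall>\<Gamma> t. DK mem U \<Gamma> t \<longrightarrow> DK mem U \<Gamma> (\<lambda>e. h3 (t e))) \<and> h3 0 = 1 \<and>
    (\<forall>j\<in>N. h3 (j + 1) = h3 j * mterm n K h j) \<and> mon n K h = h3 n" using mon_h[OF n IJ(3) h] by (elim exE)
  note d = h1[THEN conjunct1, rule_format] h2[THEN conjunct1, rule_format] h3[THEN conjunct1, rule_format]
  have "P (h1 n) (h2 n) (h3 n)"
  proof (rule N_induct_upto[OF _ n])
    show "DP1 (\<lambda>j. P (h1 j) (h2 j) (h3 j))" by (intro DP_app_kkk[OF P] d DK_slot) simp_all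
    show "P (h1 (j + 1)) (h2 (j + 1)) (h3 (j + 1))" if "j \<in> bel n" "P (h1 j) (h2 j) (h3 j)" for j
      using step[OF that] h1 h2 h3 bel_N[OF that(1)] by simp
  qed (use h1 h2 h3 1 in simp)
  then show ?thesis using h1 h2 h3 by simp
qed

lemma exps_ex:
  assumes n: "n \<in> N" and u: "\<And>\<Gamma> t. DK mem U \<Gamma> t \<Longrightarrow> DK mem U \<Gamma> (\<lambda>e. u (t e))" "\<And>i. i \<in> bel n \<Longrightarrow> u i \<in> N"
  shows "\<exists>I\<in>exponents mem n. \<forall>i\<in>bel n. en n N I i = u i"
proof -
  have "DP2 (\<lambda>i v. i \<in> bel n \<and> v = u i)" by (intro u(1) dp | simp)+
  from seqs_ex[OF dset_N n this u(2)] show ?thesis by (auto simp: en_def)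
qed

lemma exp_zero:
  assumes n: "n \<in> N"
  shows "\<exists>I\<in>exponents mem n. \<forall>f\<in>seqs mem n UNIV. mon n I f = 1"
proof -
  obtain I where I: "I \<in> exponents mem n" "\<And>i. i \<in> bel n \<Longrightarrow> en n N I i = 0"
  proof -
    have "\<exists>I\<in>exponents mem n. \<forall>i\<in>bel n. en n N I i = 0" by (rule exps_ex[OF n]) (simp_all add: DK_zero)
    then show thesis using that by blast
  qed
  have "mon n I f = 1" if f: "f \<in> seqs mem n UNIV" for f
    by (rule mon_induct[OF n I(1) I(1) I(1) f f f, where P = "\<lambda>a b c. a = 1"])
      ((intro dp | simp)+, simp_all add: mterm_def I(2))
  then show ?thesis using I(1) by blast
qed

lemma exp_add:
  assumes n: "n \<in> N" and I: "I \<in> exponents mem n" and J: "J \<in> exponents mem n"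
  shows "\<exists>K\<in>exponents mem n. \<forall>f\<in>seqs mem n UNIV. mon n K f = mon n I f * mon n J f"
proof -
  have eN: "en n N I' i \<in> N" if "I' \<in> exponents mem n" for I' i
    using that entry_in[of I' n N i] by (auto simp: en_def)
  note c = DT_const[OF exps_tuples[OF I] tuples_subset_univ[OF exps_tuples[OF I]]]
    DT_const[OF exps_tuples[OF J] tuples_subset_univ[OF exps_tuples[OF J]]]
  have "\<exists>K\<in>exponents mem n. \<forall>i\<in>bel n. en n N K i = en n N I i + en n N J i"
    by (rule exps_ex[OF n]) (intro DK_add DK_en dset_N c, simp_all add: eN I J)
  then obtain K where K: "K \<in> exponents mem n" "\<And>i. i \<in> bel n \<Longrightarrow> en n N K i = en n N I i + en n N J i" by blast
  have "mon n K f = mon n I f * mon n J f" if f: "f \<in> seqs mem n UNIV" for f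
  proof (rule mon_induct[OF n K(1) I J f f f, where P = "\<lambda>a b c. a = b * c"])
    show "DP3 (\<lambda>a b c. a = b * c)" by (intro dp) simp_all
    show "a * mterm n K f j = b * mterm n I f j * (c * mterm n J f j)" if "j \<in> bel n" "a = b * c" for a b c j
      using that(2) by (simp add: mterm_def K(2)[OF that(1)] pw_add[OF eN[OF I] eN[OF J]])
  qed simp
  then show ?thesis using K(1) by blast
qed

text \<open>This is the exponent of the variable with index \<open>i\<close>: the partial product is
  1 up to that index and keeps the value of the entry afterwards.\<close>

lemma exp_delta:
  assumes n: "n \<in> N" and i: "i \<in> bel n"
  shows "\<exists>I\<in>exponents mem n. \<forall>f\<in>seqs mem n UNIV. mon n I f = en n UNIV f i"
proof -
  have d: "DK mem U \<Gamma> (\<lambda>e. if t e = i then 1 else 0)" if t: "DK mem U \<Gamma> t" for \<Gamma> t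
  proof (rule DKI)
    have "DP KQ U (case_nat kS \<Gamma>) (\<lambda>e. if t (\<lambda>x. e (Suc x)) = i then kval (e 0) = 1 else kval (e 0) = 0)"
      by (intro DP_if DP_eq_k DK_weaken[OF t] DK_const DK_slot DK_zero DK_one) simp_all
    then show "DP KQ U (case_nat kS \<Gamma>) (\<lambda>e. kval (e 0) = (if t (\<lambda>x. e (Suc x)) = i then 1 else 0))"
      by (rule DP_cong) auto
  qed
  have "\<exists>I\<in>exponents mem n. \<forall>j\<in>bel n. en n N I j = (if j = i then 1 else 0)"
    by (rule exps_ex[OF n d]) auto
  then obtain I where I: "I \<in> exponents mem n" "\<And>j. j \<in> bel n \<Longrightarrow> en n N I j = (if j = i then 1 else 0)" by blast
  have "mon n I f = en n UNIV f i" if f: "f \<in> seqs mem n UNIV" for f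
  proof -
    obtain h where h: "(\<forall>\<Gamma> t. DK mem U \<Gamma> t \<longrightarrow> DK mem U \<Gamma> (\<lambda>e. h (t e))) \<and> h 0 = 1 \<and>
      (\<forall>j\<in>N. h (j + 1) = h j * mterm n I f j) \<and> mon n I f = h n" using mon_h[OF n I(1) f] by (elim exE)
    note dh = h[THEN conjunct1, rule_format]
    have "h n = (if i \<in> bel n then en n UNIV f i else 1)"
    proof (rule N_induct_upto[where P = "\<lambda>j. h j = (if i \<in> bel j then en n UNIV f i else 1)", OF _ n])
      show "DP1 (\<lambda>j. h j = (if i \<in> bel j then en n UNIV f i else 1))"
      proof -
        have "DP1 (\<lambda>j. if i \<in> bel j then h j = en n UNIV f i else h j = 1)"
          by (intro DP_if dh dp | simp)+
        then show ?thesis by (rule DP_cong) auto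
      qed
      fix j assume j: "j \<in> bel n" and IH: "h j = (if i \<in> bel j then en n UNIV f i else 1)"
      have "h (j + 1) = h j * mterm n I f j" using h bel_N[OF j] by blast
      then show "h (j + 1) = (if i \<in> bel (j + 1) then en n UNIV f i else 1)"
        using IH I(2)[OF j] by (auto simp: bel_Suc[OF bel_N[OF j]] mterm_def pw_1)
    qed (use h in simp)
    then show ?thesis using h i by simp
  qed
  then show ?thesis using I(1) by blast
qed

section \<open>Terms of polynomials, and pairs of values at two points\<close>

definition dring :: "'k set \<Rightarrow> bool" where
  "dring R \<longleftrightarrow> dset R \<and> 1 \<in> R \<and> - 1 \<in> R \<and> (\<forall>x\<in>R. \<forall>y\<in>R. x + y \<in> R \<and> x * y \<in> R)"

lemma dringD:
  assumes "dring R"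
  shows "dset R" "1 \<in> R" "- 1 \<in> R" "x \<in> R \<Longrightarrow> y \<in> R \<Longrightarrow> x + y \<in> R" "x \<in> R \<Longrightarrow> y \<in> R \<Longrightarrow> x * y \<in> R" "0 \<in> R"
    "x \<in> R \<Longrightarrow> - x \<in> R"
proof -
  show *: "dset R" "1 \<in> R" "- 1 \<in> R" "x \<in> R \<Longrightarrow> y \<in> R \<Longrightarrow> x + y \<in> R" "x \<in> R \<Longrightarrow> y \<in> R \<Longrightarrow> x * y \<in> R" for x y
    using assms unfolding dring_def by blast+
  show "0 \<in> R" using *(4)[OF *(2,3)] by simp
  show "x \<in> R \<Longrightarrow> - x \<in> R" using *(5)[OF *(3), of x] by simp
qed

lemma polys_ex:
  assumes R: "dset R" and S: "hf (zsort n) S" "S \<subseteq> Zs n R"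
    and sv: "\<And>I c c'. I @ [kel c] \<in> S \<Longrightarrow> I @ [kel c'] \<in> S \<Longrightarrow> c = c'"
  shows "\<exists>p\<in>polys mem n R. extQ (Zs n R) p = S"
  using hf_Fin[OF DS_Zs[OF R] S] polys_iff[OF R] sv by blast

lemma polys_zero:
  assumes n: "n \<in> N" and R: "dset R"
  shows "\<exists>p\<in>polys mem n R. pdom mem n R p = {} \<and> (\<forall>f. evt n R p f = 0)"
proof -
  obtain p where p: "p \<in> polys mem n R" "extQ (Zs n R) p = {}" using polys_ex[OF R, of n "{}"] by auto
  then show ?thesis using evt_empty[OF n R polysD[OF R p(1)]] by (intro bexI[of _ p]) (auto simp: pdom_iff)
qed

lemma polys_insert:
  assumes n: "n \<in> N" and R: "dset R" and p: "p \<in> polys mem n R" and I: "I \<in> exponents mem n" "I \<notin> pdom mem n R p"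
    and c: "c \<in> R" "c \<noteq> 0"
  shows "\<exists>p'\<in>polys mem n R. (\<forall>f. evt n R p' f = evt n R p f + c * mon n I f) \<and> pdom mem n R p' = insert I (pdom mem n R p)"
proof -
  let ?S = "insert (I @ [kel c]) (extQ (Zs n R) p)"
  have pF: "p \<in> FinQ (Zs n R)" by (rule polysD[OF R p])
  have Z: "I @ [kel c] \<in> Zs n R" using I c by simp
  have "hf (zsort n) ?S" using hf_insert[OF Fin_hf[OF DS_Zs[OF R] pF]] Z DS_subset[OF DS_Zs[OF R]] by blast
  moreover have "?S \<subseteq> Zs n R" using Z ext_subset by blast
  moreover have "d = d'" if "J @ [kel d] \<in> ?S" "J @ [kel d'] \<in> ?S" for J d d'
    using that I(2) p unfolding polys_iff[OF R] pdom_iff by auto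
  ultimately have "\<exists>p'\<in>polys mem n R. extQ (Zs n R) p' = ?S" by (rule polys_ex[OF R])
  then obtain p' where p': "p' \<in> polys mem n R" "extQ (Zs n R) p' = ?S" by (elim bexE)
  have "I @ [kel c] \<notin> extQ (Zs n R) p" using I(2) pdom_iff by blast
  then have "evt n R p' f = evt n R p f + c * mon n I f" for f
    using evt_insert[OF n R pF polysD[OF R p'(1)] Z _ p'(2)] by blast
  moreover have "pdom mem n R p' = insert I (pdom mem n R p)" by (auto simp: pdom_iff p'(2))
  ultimately show ?thesis using p'(1) by blast
qed

lemma polys_remove:
  assumes n: "n \<in> N" and R: "dset R" and p: "p \<in> polys mem n R" and I: "I \<in> pdom mem n R p"
  shows "\<exists>r\<in>polys mem n R. \<exists>c\<in>R. (\<forall>f. evt n R p f = evt n R r f + c * mon n I f) \<and> pdom mem n R r = pdom mem n R p - {I}"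
proof -
  obtain c where c: "I @ [kel c] \<in> extQ (Zs n R) p" using I pdom_iff by blast
  let ?S = "{u \<in> extQ (Zs n R) p. u \<noteq> I @ [kel c]}"
  have pF: "p \<in> FinQ (Zs n R)" by (rule polysD[OF R p])
  have Z: "I @ [kel c] \<in> Zs n R" using c ext_subset by blast
  have T: "I @ [kel c] \<in> tuples KQ (zsort n)" using Z DS_subset[OF DS_Zs[OF R]] by blast
  have "DP KQ U (case_nat (zsort n) closed_ctx) (\<lambda>e. e 0 \<noteq> I @ [kel c])"
    by (intro DP_not DP_eq[where ss = "zsort n"] DT_slot' DT_const[OF T tuples_subset_univ[OF T]]) simp
  then have "hf (zsort n) ?S" by (rule hf_subset[OF Fin_hf[OF DS_Zs[OF R] pF]])
  moreover have "?S \<subseteq> Zs n R" using ext_subset by blast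
  moreover have "d = d'" if "J @ [kel d] \<in> ?S" "J @ [kel d'] \<in> ?S" for J d d'
    using that p unfolding polys_iff[OF R] by blast
  ultimately have "\<exists>r\<in>polys mem n R. extQ (Zs n R) r = ?S" by (rule polys_ex[OF R])
  then obtain r where r: "r \<in> polys mem n R" "extQ (Zs n R) r = ?S" by (elim bexE)
  have "evt n R p f = evt n R r f + c * mon n I f" for f
    by (rule evt_insert[OF n R polysD[OF R r(1)] pF Z]) (use c r(2) in auto)
  moreover have "pdom mem n R r = pdom mem n R p - {I}"
  proof (intro set_eqI)
    fix J
    have "d = c" if "I @ [kel d] \<in> extQ (Zs n R) p" for d using that c p unfolding polys_iff[OF R] by blast
    then show "J \<in> pdom mem n R r \<longleftrightarrow> J \<in> pdom mem n R p - {I}" unfolding pdom_iff r(2) Diff_iff by auto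
  qed
  moreover have "c \<in> R" using Z by simp
  ultimately show ?thesis using r(1) by blast
qed

text \<open>Coefficients must be non-zero and exponents occur once. If \<open>I\<close> is present,
  its term is removed, and the sum of both coefficients is inserted unless it is 0.\<close>

lemma polys_addterm:
  assumes n: "n \<in> N" and R: "dring R" and p: "p \<in> polys mem n R" and I: "I \<in> exponents mem n" and c: "c \<in> R"
  shows "\<exists>p'\<in>polys mem n R. \<forall>f. evt n R p' f = evt n R p f + c * mon n I f"
proof -
  note R' = dringD(1)[OF R]
  have *: "\<exists>p'\<in>polys mem n R. \<forall>f. evt n R p' f = evt n R r f + d * mon n I f"
    if "r \<in> polys mem n R" "I \<notin> pdom mem n R r" "d \<in> R" for r d
    using polys_insert[OF n R' that(1) I that(2,3)] that(1) by (cases "d = 0") auto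
  show ?thesis
  proof (cases "I \<in> pdom mem n R p")
    case True
    obtain r d where r: "r \<in> polys mem n R" "d \<in> R" "\<And>f. evt n R p f = evt n R r f + d * mon n I f"
      "pdom mem n R r = pdom mem n R p - {I}" using polys_remove[OF n R' p True] by blast
    obtain p' where "p' \<in> polys mem n R" "\<And>f. evt n R p' f = evt n R r f + (d + c) * mon n I f"
      using *[OF r(1) _ dringD(4)[OF R r(2) c]] r(4) by auto
    then show ?thesis using r(3) by (intro bexI[of _ p']) (simp_all add: algebra_simps)
  next
    case False
    then show ?thesis using *[OF p False c] by blast
  qed
qed

lemma evt_induct:
  assumes n: "n \<in> N" and R: "dset R" and f: "f \<in> seqs mem n UNIV" and g: "g \<in> seqs mem n UNIV"
    and Q: "DP2 Q" and 0: "Q 0 0"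
    and step: "\<And>a b I c. Q a b \<Longrightarrow> I \<in> exponents mem n \<Longrightarrow> c \<in> R \<Longrightarrow> Q (a + c * mon n I f) (b + c * mon n I g)"
    and q: "q \<in> FinQ (Zs n R)"
  shows "Q (evt n R q f) (evt n R q g)"
proof (rule Fin_induct[OF DS_Zs[OF R] _ _ _ q])
  note c = DT_const[OF seqs_tuples[OF f] tuples_subset_univ[OF seqs_tuples[OF f]]]
    DT_const[OF seqs_tuples[OF g] tuples_subset_univ[OF seqs_tuples[OF g]]]
  show "DP KQ U (case_nat (fsort (Zs n R)) closed_ctx) (\<lambda>e. Q (evt n R (e 0) f) (evt n R (e 0) g))"
    by (intro DP_app_kk[OF Q] DK_evt[OF n R] c DT_slot') simp_all
  show "Q (evt n R B f) (evt n R B g)" if "B \<in> FinQ (Zs n R)" "extQ (Zs n R) B = {}" for B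
    using evt_empty[OF n R that] 0 by simp
  fix B a C assume *: "B \<in> FinQ (Zs n R)" "C \<in> FinQ (Zs n R)" "Q (evt n R B f) (evt n R B g)" "a \<in> Zs n R"
    "a \<notin> extQ (Zs n R) B" "extQ (Zs n R) C = insert a (extQ (Zs n R) B)"
  obtain I c where I: "a = I @ [kel c]" "I \<in> exponents mem n" "c \<in> R" using Zs_cases[OF *(4)] by blast
  show "Q (evt n R C f) (evt n R C g)"
    using step[OF *(3) I(2,3)] evt_insert[OF n R *(1,2) *(4-6)[unfolded I(1)]] by simp
qed

text \<open>Pairs of values of one polynomial at two points. For \<open>f = g\<close> this is the
  diagonal of the ring generated over \<open>R\<close> by the entries; for two points it is the
  relation that becomes an isomorphism when the ideals agree.\<close>

definition EV :: "'k \<Rightarrow> 'k set \<Rightarrow> ('k, 'f) keq list \<Rightarrow> ('k, 'f) keq list \<Rightarrow> 'k \<Rightarrow> 'k \<Rightarrow> bool" where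
  "EV n R f g a b \<longleftrightarrow> (\<exists>p\<in>polys mem n R. evt n R p f = a \<and> evt n R p g = b)"

lemma DS_polys:
  assumes R: "dset R"
  shows "DS KQ U (fsort (Zs n R)) (polys mem n R)"
proof -
  note F = DS_Fin[OF DS_Zs[OF R], of n]
  have "DP KQ U (case_nat (fsort (Zs n R)) closed_ctx) (\<lambda>e. e 0 \<in> FinQ (Zs n R) \<and>
    (\<forall>I\<in>tuples KQ (sq n N). \<forall>c c'. I @ [kel c] \<in> extQ (Zs n R) (e 0) \<longrightarrow> I @ [kel c'] \<in> extQ (Zs n R) (e 0) \<longrightarrow> c = c'))"
    by (intro DP_all DP_all_k DP_imp DP_conj DP_in[OF F] DP_ext[OF DS_Zs[OF R]] DP_eq_k DT_append DT_slot' DT_kel DK_slot | simp only: nat.case)+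
  then have "DP KQ U (case_nat (fsort (Zs n R)) closed_ctx) (\<lambda>e. e 0 \<in> polys mem n R)"
  proof (rule DP_cong)
    fix e
    have "I \<in> tuples KQ (sq n N)" if "I @ [kel c] \<in> extQ (Zs n R) (e 0)" for I c
      using that ext_subset[of "Zs n R" "e 0"] Zs_iff exps_tuples by blast
    then show "(e 0 \<in> FinQ (Zs n R) \<and>
      (\<forall>I\<in>tuples KQ (sq n N). \<forall>c c'. I @ [kel c] \<in> extQ (Zs n R) (e 0) \<longrightarrow> I @ [kel c'] \<in> extQ (Zs n R) (e 0) \<longrightarrow> c = c')) \<longleftrightarrow>
      e 0 \<in> polys mem n R"
      unfolding polys_iff[OF R] by blast
  qed
  moreover have "polys mem n R \<subseteq> tuples KQ (fsort (Zs n R))" using DS_subset[OF F] polysD[OF R] by blast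
  ultimately show ?thesis by (simp add: DS_def)
qed

context
  fixes n R f g
  assumes n: "n \<in> N" and R: "dring R" and f: "f \<in> seqs mem n UNIV" and g: "g \<in> seqs mem n UNIV"
begin

lemma DP2_EV: "DP2 (EV n R f g)"
proof -
  note c = DT_const[OF seqs_tuples[OF f] tuples_subset_univ[OF seqs_tuples[OF f]]]
    DT_const[OF seqs_tuples[OF g] tuples_subset_univ[OF seqs_tuples[OF g]]]
  show ?thesis
    unfolding EV_def
    by (intro DP_bex[OF DS_polys[OF dringD(1)[OF R]]] DP_conj DP_eq_k DK_evt[OF n dringD(1)[OF R]] c DT_slot' DK_slot) simp_all
qed

lemma EV_0: "EV n R f g 0 0"
  unfolding EV_def using polys_zero[OF n dringD(1)[OF R]] by blast

lemma EV_addterm: "EV n R f g a b \<Longrightarrow> I \<in> exponents mem n \<Longrightarrow> c \<in> R \<Longrightarrow> EV n R f g (a + c * mon n I f) (b + c * mon n I g)"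
  unfolding EV_def using polys_addterm[OF n R] by metis

lemma EV_induct:
  assumes "EV n R f g x y" "DP2 Q" "Q 0 0"
    "\<And>a b I c. Q a b \<Longrightarrow> I \<in> exponents mem n \<Longrightarrow> c \<in> R \<Longrightarrow> Q (a + c * mon n I f) (b + c * mon n I g)"
  shows "Q x y"
proof -
  obtain p where p: "p \<in> polys mem n R" "evt n R p f = x" "evt n R p g = y" using assms(1) by (auto simp: EV_def)
  show ?thesis
    using evt_induct[where Q = Q, OF n dringD(1)[OF R] f g assms(2-4) polysD[OF dringD(1)[OF R] p(1)]] p by simp
qed

lemma EV_add:
  assumes "EV n R f g a b" "EV n R f g x y"
  shows "EV n R f g (a + x) (b + y)"
proof (rule EV_induct[OF assms(2)])
  show "DP2 (\<lambda>x y. EV n R f g (a + x) (b + y))" by (intro DP_app_kk[OF DP2_EV] dp) simp_all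
  show "EV n R f g (a + (x + c * mon n I f)) (b + (y + c * mon n I g))"
    if "EV n R f g (a + x) (b + y)" "I \<in> exponents mem n" "c \<in> R" for x y I c
    using EV_addterm[OF that] by (simp add: add.assoc)
qed (use assms(1) in simp)

text \<open>Products are formed on the level of values: exponents add by \<open>exp_add\<close>, and
  \<open>EV_addterm\<close> collects the results. General products then follow by induction on one
  factor.\<close>

lemma EV_multterm:
  assumes "EV n R f g x y" "I \<in> exponents mem n" "c \<in> R"
  shows "EV n R f g (x * (c * mon n I f)) (y * (c * mon n I g))"
proof (rule EV_induct[OF assms(1)])
  show "DP2 (\<lambda>x y. EV n R f g (x * (c * mon n I f)) (y * (c * mon n I g)))" by (intro DP_app_kk[OF DP2_EV] dp) simp_all
  fix x y J d assume *: "EV n R f g (x * (c * mon n I f)) (y * (c * mon n I g))" "J \<in> exponents mem n" "d \<in> R"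
  obtain K where K: "K \<in> exponents mem n" "\<And>f. f \<in> seqs mem n UNIV \<Longrightarrow> mon n K f = mon n I f * mon n J f"
    using exp_add[OF n assms(2) *(2)] by blast
  show "EV n R f g ((x + d * mon n J f) * (c * mon n I f)) ((y + d * mon n J g) * (c * mon n I g))"
    using EV_addterm[OF *(1) K(1) dringD(5)[OF R assms(3) *(3)]] K(2)[OF f] K(2)[OF g] by (simp add: algebra_simps)
qed (use EV_0 in simp)

lemma EV_mult:
  assumes "EV n R f g a b" "EV n R f g x y"
  shows "EV n R f g (a * x) (b * y)"
proof (rule EV_induct[OF assms(2)])
  show "DP2 (\<lambda>x y. EV n R f g (a * x) (b * y))" by (intro DP_app_kk[OF DP2_EV] dp) simp_all
  show "EV n R f g (a * (x + c * mon n I f)) (b * (y + c * mon n I g))"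
    if "EV n R f g (a * x) (b * y)" "I \<in> exponents mem n" "c \<in> R" for x y I c
    using EV_add[OF that(1) EV_multterm[OF assms(1) that(2,3)]] by (simp add: distrib_left)
qed (use EV_0 in simp)

lemma EV_const: "c \<in> R \<Longrightarrow> EV n R f g c c"
  using exp_zero[OF n] EV_addterm[OF EV_0, of _ c] f g by fastforce

lemma EV_entry: "i \<in> bel n \<Longrightarrow> EV n R f g (en n UNIV f i) (en n UNIV g i)"
  using exp_delta[OF n] EV_addterm[OF EV_0 _ dringD(2)[OF R]] f g by fastforce

text \<open>With the closure properties above, this makes \<open>EV\<close> the least definable ring
  of pairs that contains the diagonal of \<open>R\<close> and the pairs of entries. Membership in
  \<open>V\<close> is followed through the recursions for powers, monomials and sums.\<close>

lemma EV_min: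
  assumes EV: "EV n R f g x y" and V: "DP2 V" and c: "\<And>c. c \<in> R \<Longrightarrow> V c c"
    and fg: "\<And>i. i \<in> bel n \<Longrightarrow> V (en n UNIV f i) (en n UNIV g i)"
    and add: "\<And>a b x y. V a b \<Longrightarrow> V x y \<Longrightarrow> V (a + x) (b + y)"
    and mult: "\<And>a b x y. V a b \<Longrightarrow> V x y \<Longrightarrow> V (a * x) (b * y)"
  shows "V x y"
proof -
  have V1: "V 1 1" and V0: "V 0 0" using c[OF dringD(2)[OF R]] c[OF dringD(6)[OF R]] .
  have pw: "V (pw a k) (pw b k)" if "V a b" "k \<in> N" for a b k
  proof (rule N_induct[OF _ that(2)])
    show "DP1 (\<lambda>k. V (pw a k) (pw b k))" by (intro DP_app_kk[OF V] dp) simp_all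
    show "V (pw a (k + 1)) (pw b (k + 1))" if "k \<in> N" "V (pw a k) (pw b k)" for k
      using mult[OF that(2) \<open>V a b\<close>] by (simp add: pw_Suc that(1))
  qed (simp add: V1)
  have mon: "V (mon n I f) (mon n I g)" if I: "I \<in> exponents mem n" for I
  proof (rule mon_induct[OF n I I I f g f, where P = "\<lambda>a b c. V a b"])
    show "DP3 (\<lambda>a b c. V a b)" by (intro DP_app_kk[OF V] dp) simp_all
    show "V (a * mterm n I f j) (b * mterm n I g j)" if "j \<in> bel n" "V a b" for a b j
      unfolding mterm_def using mult[OF that(2) pw[OF fg[OF that(1)]]] entry_in[OF I that(1)] I that(1)
      by (simp add: en_def)
  qed (rule V1)
  show ?thesis
    by (rule EV_induct[OF EV V V0]) (intro add mult c mon)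
qed

end

section \<open>Polynomials in one variable\<close>

text \<open>Written as differences, integers can be added and multiplied without distinguishing
  signs; linearity of the order is used only here.\<close>

lemma ZZ_iff: "x \<in> ZZ mem \<longleftrightarrow> (\<exists>a\<in>N. \<exists>b\<in>N. x = a - b)"
proof
  assume "x \<in> ZZ mem"
  then consider "x \<in> N" | a where "a \<in> N" "x = - a" by (auto simp: ZZ_def)
  then show "\<exists>a\<in>N. \<exists>b\<in>N. x = a - b"
  proof cases
    case 1
    then show ?thesis using N_0 by (intro bexI[of _ x] bexI[of _ 0]) simp_all
  next
    case 2
    then show ?thesis using N_0 by (intro bexI[of _ 0] bexI[of _ a]) simp_all
  qed
next
  assume "\<exists>a\<in>N. \<exists>b\<in>N. x = a - b"
  then obtain a b where ab: "a \<in> N" "b \<in> N" "x = a - b" by blast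
  have "x \<in> N \<or> - x \<in> N" using N_linear[OF ab(1,2)] ab(3) by simp
  then show "x \<in> ZZ mem" unfolding ZZ_def by (metis Un_iff image_eqI minus_minus)
qed

lemma ZZ_add: "x \<in> ZZ mem \<Longrightarrow> y \<in> ZZ mem \<Longrightarrow> x + y \<in> ZZ mem"
  unfolding ZZ_iff
proof (elim bexE)
  fix a b c d assume "a \<in> N" "b \<in> N" "c \<in> N" "d \<in> N" "x = a - b" "y = c - d"
  then show "\<exists>a\<in>N. \<exists>b\<in>N. x + y = a - b"
    by (intro bexI[of _ "a + c"] bexI[of _ "b + d"]) simp_all
qed

lemma ZZ_mult: "x \<in> ZZ mem \<Longrightarrow> y \<in> ZZ mem \<Longrightarrow> x * y \<in> ZZ mem"
  unfolding ZZ_iff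
proof (elim bexE)
  fix a b c d assume *: "a \<in> N" "b \<in> N" "c \<in> N" "d \<in> N" "x = a - b" "y = c - d"
  have "x * y = (a * c + b * d) - (a * d + b * c)" by (simp add: *(5,6) algebra_simps)
  then show "\<exists>a\<in>N. \<exists>b\<in>N. x * y = a - b" using *(1-4) N_add N_mult by blast
qed

lemma dring_QQ: "dring (QQ mem)"
  unfolding dring_def
proof (intro conjI ballI)
  have "DP1 (\<lambda>x. \<exists>a b c d. a \<in> N \<and> b \<in> N \<and> c \<in> N \<and> d \<in> N \<and> c - d \<noteq> 0 \<and> x = (a - b) / (c - d))"
    by (intro dp | simp)+
  then show "dset (QQ mem)"
    unfolding dset_def by (rule DP_cong) (unfold QQ_def mem_Collect_eq Bex_def ZZ_iff, blast)
  have 1: "1 \<in> ZZ mem" "- 1 \<in> ZZ mem" by (simp_all add: ZZ_def)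
  show "1 \<in> QQ mem" "- 1 \<in> QQ mem" unfolding QQ_def using 1 by force+
  fix x y assume "x \<in> QQ mem" "y \<in> QQ mem"
  then obtain a b c d where *: "a \<in> ZZ mem" "b \<in> ZZ mem" "b \<noteq> 0" "x = a / b"
    "c \<in> ZZ mem" "d \<in> ZZ mem" "d \<noteq> 0" "y = c / d" by (auto simp: QQ_def)
  have "x + y = (a * d + c * b) / (b * d)" using * by (simp add: field_simps)
  then show "x + y \<in> QQ mem" using * ZZ_add[OF ZZ_mult[OF *(1,6)] ZZ_mult[OF *(5,2)]] ZZ_mult[OF *(2,6)]
    unfolding QQ_def mem_Collect_eq by (metis no_zero_divisors)
  have "x * y = (a * c) / (b * d)" using * by simp
  then show "x * y \<in> QQ mem" using * ZZ_mult[OF *(1,5)] ZZ_mult[OF *(2,6)]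
    unfolding QQ_def mem_Collect_eq by (metis no_zero_divisors)
qed

lemma bel_1: "bel 1 = {0}"
  using bel_Suc[OF N_0] by simp

lemma single: "single mem a \<in> seqs mem 1 UNIV \<and> en 1 UNIV (single mem a) 0 = a"
proof -
  have "DP2 (\<lambda>i v. i \<in> bel 1 \<and> v = a)" by (intro dp | simp)+
  from seqs_ex[OF dset_UNIV N_1 this] obtain f where f: "f \<in> seqs mem 1 UNIV" "entry mem 1 UNIV f 0 = a"
    by (auto simp: bel_1)
  have "single mem a = f"
    unfolding single_def by (rule the_equality) (use f in \<open>auto intro!: seqs_eqI[OF dset_UNIV] simp: bel_1\<close>)
  then show ?thesis using f by (simp add: en_entry bel_1)
qed

lemma single_eq: "f \<in> seqs mem 1 UNIV \<Longrightarrow> f = single mem a \<longleftrightarrow> en 1 UNIV f 0 = a"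
  using single[of a] seqs_eqI[OF dset_UNIV, of f 1 "single mem a"] by (auto simp: bel_1 en_entry)

lemma DT_single:
  assumes t: "DK mem U \<Gamma> t"
  shows "DT KQ U \<Gamma> (sq 1 UNIV) (\<lambda>e. single mem (t e))"
  unfolding DT_def
proof (intro conjI ballI)
  show "single mem (t e) \<in> tuples KQ (sq 1 UNIV)" for e using single seqs_tuples by blast
  have "DP KQ U (case_nat (sq 1 UNIV) \<Gamma>) (\<lambda>e. e 0 \<in> seqs mem 1 UNIV \<and> en 1 UNIV (e 0) 0 = t (\<lambda>x. e (Suc x)))"
    by (intro DP_conj DP_in[OF DS_seqs[OF dset_UNIV]] DP_eq_k DK_en dset_UNIV DT_slot' DK_zero DK_weaken[OF t]) simp_all
  then show "DP KQ U (case_nat (sq 1 UNIV) \<Gamma>) (\<lambda>e. e 0 = single mem (t (\<lambda>x. e (Suc x))))"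
    by (rule DP_cong) (use single single_eq in metis)
qed

lemma mon1:
  assumes "I \<in> exponents mem 1"
  shows "mon 1 I (single mem y) = pw y (en 1 N I 0)"
proof -
  obtain h where h: "(\<forall>\<Gamma> t. DK mem U \<Gamma> t \<longrightarrow> DK mem U \<Gamma> (\<lambda>e. h (t e))) \<and> h 0 = 1 \<and>
    (\<forall>j\<in>N. h (j + 1) = h j * mterm 1 I (single mem y) j) \<and> mon 1 I (single mem y) = h 1"
    using mon_h[OF N_1 assms single[of y, THEN conjunct1]] by (elim exE)
  have "h (0 + 1) = h 0 * mterm 1 I (single mem y) 0" using h N_0 by blast
  then show ?thesis using h single[of y] by (simp add: mterm_def)
qed

lemma exp1_ex: "d \<in> N \<Longrightarrow> \<exists>I\<in>exponents mem 1. en 1 N I 0 = d"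
proof -
  assume d: "d \<in> N"
  have "\<exists>I\<in>exponents mem 1. \<forall>i\<in>bel 1. en 1 N I i = d" by (rule exps_ex[OF N_1]) (simp_all add: DK_const d)
  then show ?thesis by (simp add: bel_1)
qed

definition pv :: "'k set \<Rightarrow> ('k, 'f) keq list \<Rightarrow> 'k \<Rightarrow> 'k" where
  "pv R p y = evt 1 R p (single mem y)"

lemma DK_pv:
  assumes "dset R" "DT KQ U \<Gamma> (fsort (Zs 1 R)) p" "DK mem U \<Gamma> y"
  shows "DK mem U \<Gamma> (\<lambda>e. pv R (p e) (y e))"
  unfolding pv_def by (rule DK_evt[OF N_1 assms(1,2) DT_single[OF assms(3)]])

lemma is_root_pv: "dset R \<Longrightarrow> p \<in> polys mem 1 R \<Longrightarrow> is_root mem R p a \<longleftrightarrow> pv R p a = 0"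
  by (simp add: is_root_def pv_def ev_evt[OF N_1 _ _ single[THEN conjunct1]])

definition deg_below :: "'k set \<Rightarrow> 'k \<Rightarrow> ('k, 'f) keq list \<Rightarrow> bool" where
  "deg_below R m p \<longleftrightarrow> p \<in> polys mem 1 R \<and> (\<forall>I\<in>pdom mem 1 R p. en 1 N I 0 \<in> bel m)"

lemma DP_deg_below:
  assumes R: "dset R" and p: "DT KQ U \<Gamma> (fsort (Zs 1 R)) p" and m: "DK mem U \<Gamma> m"
  shows "DP KQ U \<Gamma> (\<lambda>e. deg_below R (m e) (p e))"
proof -
  have "DP KQ U \<Gamma> (\<lambda>e. p e \<in> polys mem 1 R \<and> (\<forall>I\<in>tuples KQ (sq 1 N). \<forall>c. I @ [kel c] \<in> extQ (Zs 1 R) (p e) \<longrightarrow> en 1 N I 0 \<in> bel (m e)))"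
    by (intro DP_conj DP_in[OF DS_polys[OF R]] p DP_all DP_all_k DP_imp DP_ext[OF DS_Zs[OF R]] DP_bel DK_en dset_N DK_zero
      DK_weaken m DT_append DT_slot' DT_kel DK_slot DT_weaken | simp only: nat.case)+
  then show ?thesis
    by (rule DP_cong) (unfold deg_below_def pdom_iff Ball_def, use ext_subset[of "Zs 1 R"] Zs_iff exps_tuples in blast)
qed

lemma deg_below_0: "dset R \<Longrightarrow> \<exists>p. deg_below R 0 p \<and> (\<forall>y. pv R p y = 0)"
  using polys_zero[OF N_1] unfolding deg_below_def pv_def by fastforce

text \<open>The exponent \<open>m\<close> does not occur in \<open>p\<close>, so nothing cancels and
  the new top term remains visible; it later witnesses that a polynomial is non-constant or
  non-zero.\<close>

lemma deg_below_Suc: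
  assumes R: "dset R" and p: "deg_below R m p" and m: "m \<in> N" and c: "c \<in> R"
  shows "\<exists>p'. deg_below R (m + 1) p' \<and> (\<forall>y. pv R p' y = pv R p y + c * pw y m) \<and>
    (c \<noteq> 0 \<longrightarrow> (\<exists>I\<in>pdom mem 1 R p'. entry mem 1 N I 0 = m))"
proof (cases "c = 0")
  case True
  then show ?thesis using p m by (intro exI[of _ p]) (auto simp: deg_below_def bel_Suc)
next
  case False
  obtain I where I: "I \<in> exponents mem 1" "en 1 N I 0 = m" using exp1_ex[OF m] by blast
  have "I \<notin> pdom mem 1 R p" using p I(2) by (auto simp: deg_below_def)
  then obtain p' where p': "p' \<in> polys mem 1 R" "\<And>f. evt 1 R p' f = evt 1 R p f + c * mon 1 I f"
    "pdom mem 1 R p' = insert I (pdom mem 1 R p)"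
    using polys_insert[OF N_1 R _ I(1) _ c False, of p] p by (auto simp: deg_below_def)
  have "deg_below R (m + 1) p'" using p p' I(2) by (auto simp: deg_below_def bel_Suc[OF m])
  moreover have "pv R p' y = pv R p y + c * pw y m" for y by (simp add: pv_def p' mon1[OF I(1)] I(2))
  moreover have "entry mem 1 N I 0 = m" using I en_entry[of I 1 N 0] bel_1 by simp
  ultimately show ?thesis using p'(3) by auto
qed

section \<open>Rings generated by hyperfinite sets\<close>

abbreviation PS :: "(sort, sym) eqsort list" where "PS \<equiv> [Real KSort, Real KSort]"

abbreviation K2 :: "('k, 'f) keq list set" where "K2 \<equiv> tuples KQ PS"

definition pr :: "('k, 'f) keq list \<Rightarrow> 'k \<Rightarrow> 'k \<Rightarrow> bool" where
  "pr h a b \<longleftrightarrow> [kel a, kel b] \<in> extQ K2 h"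

lemma K2_cases: "u \<in> K2 \<Longrightarrow> \<exists>a b. u = [kel a, kel b]"
  by (auto simp: Cons_tuples Keq_def eq_struct_def KK_def)

lemma K2_I [simp]: "[kel a, kel b] \<in> K2"
  by (simp add: Cons_tuples)

lemma DP_pr [dp]: "DT KQ U \<Gamma> (fsort K2) h \<Longrightarrow> DK mem U \<Gamma> a \<Longrightarrow> DK mem U \<Gamma> b \<Longrightarrow> DP KQ U \<Gamma> (\<lambda>e. pr (h e) (a e) (b e))"
  unfolding pr_def by (intro DP_ext[OF DS_tuples] DT_kel_Cons DT_kel)

lemma extQ_pr: "extQ K2 h = {[kel a, kel b] |a b. pr h a b}"
  unfolding pr_def using ext_subset[of K2 h] K2_cases by blast

lemma pr_insert: "h \<in> FinQ K2 \<Longrightarrow> \<exists>h'\<in>FinQ K2. \<forall>a b. pr h' a b \<longleftrightarrow> pr h a b \<or> a = x \<and> b = y"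
proof -
  assume "h \<in> FinQ K2"
  from Fin_insert[OF DS_tuples this K2_I[of x y]] obtain h' where h': "h' \<in> FinQ K2" "extQ K2 h' = insert [kel x, kel y] (extQ K2 h)"
    by (elim bexE)
  have "pr h' a b \<longleftrightarrow> pr h a b \<or> a = x \<and> b = y" for a b unfolding pr_def h'(2) by auto
  then show ?thesis using h'(1) by blast
qed

lemma pr_hf: "h \<in> FinQ K2 \<Longrightarrow> hf PS {[kel a, kel b] |a b. pr h a b}"
  using Fin_hf[OF DS_tuples, of h PS] by (simp add: extQ_pr)

lemma hf_pr:
  assumes "hf PS {[kel a, kel b] |a b. Q a b}"
  shows "\<exists>h\<in>FinQ K2. \<forall>a b. pr h a b \<longleftrightarrow> Q a b"
proof -
  obtain h where h: "h \<in> FinQ K2" "extQ K2 h = {[kel a, kel b] |a b. Q a b}" using assms unfolding hf_def by (elim bexE)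
  have "pr h a b \<longleftrightarrow> Q a b" for a b unfolding pr_def h(2) by simp
  then show ?thesis using h(1) by blast
qed

text \<open>Induction on \<open>A\<close>. Sequences of length \<open>n\<close> live in a power set
  that depends on \<open>n\<close>, so during the induction an enumeration is a hyperfinite set of
  pairs, which is turned into a sequence at the end.\<close>

lemma enum_ex:
  shows "\<exists>n\<in>N. \<exists>f\<in>seqs mem n UNIV. entry mem n UNIV f ` bel n = {x. mem x A}"
proof -
  let ?P = "\<lambda>A. \<exists>n. \<exists>h\<in>FinQ K2. n \<in> N \<and> (\<forall>i v. pr h i v \<longrightarrow> i \<in> bel n \<and> mem v A) \<and>
    (\<forall>i. i \<in> bel n \<longrightarrow> (\<exists>v. pr h i v \<and> (\<forall>w. pr h i w \<longrightarrow> w = v))) \<and> (\<forall>x. mem x A \<longrightarrow> (\<exists>i. pr h i x))"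
  have "?P A"
  proof (rule F_induct[of ?P])
    show "DP KQ U (case_nat fS closed_ctx) (\<lambda>e. ?P (sval (e 0)))"
      by (intro DP_ex_k DP_all_k DP_bex[OF DS_Fin[OF DS_tuples]] DP_conj DP_imp DP_pr DP_N DP_bel DP_mem DP_eq_k DT_slot' DK_slot DF_slot
        | simp only: nat.case)+
    show "?P A" if "\<And>x. \<not> mem x A" for A
    proof -
      obtain h where h: "h \<in> FinQ K2" "extQ K2 h = {}" using Fin_empty[OF DS_tuples] by blast
      then have "\<not> pr h a b" for a b by (simp add: pr_def)
      then show ?thesis using that h(1) by (intro exI[of _ 0] bexI[of _ h]) auto
    qed
    fix A a B assume "?P A" and B: "\<And>x. mem x B \<longleftrightarrow> mem x A \<or> x = a"
    then obtain n h where h: "h \<in> FinQ K2" "n \<in> N" "\<And>i v. pr h i v \<Longrightarrow> i \<in> bel n \<and> mem v A"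
      "\<And>i. i \<in> bel n \<Longrightarrow> \<exists>v. pr h i v \<and> (\<forall>w. pr h i w \<longrightarrow> w = v)" "\<And>x. mem x A \<Longrightarrow> \<exists>i. pr h i x" by blast
    obtain h' where h': "h' \<in> FinQ K2" "\<And>i v. pr h' i v \<longleftrightarrow> pr h i v \<or> i = n \<and> v = a"
      using pr_insert[OF h(1), of n a] by blast
    have "\<not> pr h n v" for v using h(3) bel_irrefl by blast
    then have "\<exists>v. pr h' i v \<and> (\<forall>w. pr h' i w \<longrightarrow> w = v)" if "i \<in> bel (n + 1)" for i
      using that h(4)[of i] unfolding h'(2) bel_Suc[OF h(2)] insert_iff by (metis bel_irrefl)
    moreover have "i \<in> bel (n + 1) \<and> mem v B" if "pr h' i v" for i v
      using that h(3)[of i v] unfolding h'(2) bel_Suc[OF h(2)] B by auto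
    moreover have "\<exists>i. pr h' i x" if "mem x B" for x using that h(5)[of x] unfolding h'(2) B by blast
    ultimately show "?P B" using h'(1) N_Suc[OF h(2)] by blast
  qed
  then obtain n h where h: "h \<in> FinQ K2" "n \<in> N" "\<And>i v. pr h i v \<Longrightarrow> i \<in> bel n \<and> mem v A"
    "\<And>i. i \<in> bel n \<Longrightarrow> \<exists>v. pr h i v \<and> (\<forall>w. pr h i w \<longrightarrow> w = v)" "\<And>x. mem x A \<Longrightarrow> \<exists>i. pr h i x" by blast
  have "{[kel a, kel b] |a b. pr h a b} \<subseteq> seqX n UNIV" using h(3) by auto
  then obtain f where f: "f \<in> FinQ (seqX n UNIV)" "extQ (seqX n UNIV) f = {[kel a, kel b] |a b. pr h a b}"
    using hf_Fin[OF DS_seqX[OF dset_UNIV] pr_hf[OF h(1)]] by blast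
  then have pf: "[kel i, kel v] \<in> extQ (seqX n UNIV) f \<longleftrightarrow> pr h i v" for i v by simp
  have fs: "f \<in> seqs mem n UNIV" unfolding seqs_iff pf using f(1) h(4) by blast
  have "entry mem n UNIV f ` bel n = {x. mem x A}"
  proof (intro set_eqI iffI)
    fix x assume "x \<in> entry mem n UNIV f ` bel n"
    then show "x \<in> {x. mem x A}" using seqs_ext[OF fs] h(3) unfolding pf by blast
  next
    fix x assume "x \<in> {x. mem x A}"
    then obtain i where "pr h i x" using h(5) by blast
    then show "x \<in> entry mem n UNIV f ` bel n" using seqs_ext[OF fs, of i x] h(3) unfolding pf by blast
  qed
  then show ?thesis by (intro bexI[OF _ h(2)] bexI[OF _ fs])
qed

text \<open>For one enumeration \<open>f\<close> of \<open>A\<close> the ring is the diagonal of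
  \<open>EV\<close>. Another enumeration gives nothing more by \<open>EV_min\<close>, since its
  entries are entries of \<open>f\<close> too.\<close>

lemma Q_adjoin:
  shows "dring (Q_adjoin mem A)" "mem x A \<Longrightarrow> x \<in> Q_adjoin mem A"
proof -
  note R = dring_QQ
  obtain n f where n: "n \<in> N" and f: "f \<in> seqs mem n UNIV" and fA: "entry mem n UNIV f ` bel n = {x. mem x A}"
    using enum_ex[of A] by blast
  note EV = EV_const[OF n R f f] EV_add[OF n R f f] EV_mult[OF n R f f] EV_entry[OF n R f f] DP2_EV[OF n R f f]
  have A: "EV n (QQ mem) f f x x" if x: "mem x A" for x
  proof -
    obtain i where "i \<in> bel n" "x = en n UNIV f i" using x fA en_entry[OF f] by (smt (verit) imageE mem_Collect_eq)
    then show ?thesis using EV(4) by simp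
  qed
  have eq: "Q_adjoin mem A = {x. EV n (QQ mem) f f x x}"
  proof (intro set_eqI iffI)
    fix x assume "x \<in> Q_adjoin mem A"
    then obtain m g p where g: "m \<in> N" "g \<in> seqs mem m UNIV" "entry mem m UNIV g ` bel m = {x. mem x A}"
      "p \<in> polys mem m (QQ mem)" "x = ev mem m (QQ mem) p g" by (auto simp: Q_adjoin_def)
    then have "x = evt m (QQ mem) p g" using ev_evt[OF _ dringD(1)[OF R]] by blast
    then have "EV m (QQ mem) g g x x" using g(4) by (auto simp: EV_def)
    then have "EV n (QQ mem) f f x x"
    proof (rule EV_min[OF g(1) R g(2,2) _ EV(5)])
      fix i assume i: "i \<in> bel m"
      then have "mem (en m UNIV g i) A" using g(3) en_entry[OF g(2) i] by auto
      then show "EV n (QQ mem) f f (en m UNIV g i) (en m UNIV g i)" by (rule A)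
    qed (use EV in simp_all)
    then show "x \<in> {x. EV n (QQ mem) f f x x}" by simp
  next
    fix x assume "x \<in> {x. EV n (QQ mem) f f x x}"
    then obtain p where "p \<in> polys mem n (QQ mem)" "x = evt n (QQ mem) p f" by (auto simp: EV_def)
    then show "x \<in> Q_adjoin mem A"
      unfolding Q_adjoin_def mem_Collect_eq
      by (intro bexI[OF _ n] bexI[OF _ f] conjI[OF fA] bexI[of _ p]) (simp_all only: ev_evt[OF n dringD(1)[OF R] _ f])
  qed
  show "mem x A \<Longrightarrow> x \<in> Q_adjoin mem A" using A eq by simp
  have "DP1 (\<lambda>x. EV n (QQ mem) f f x x)" by (intro DP_app_kk[OF EV(5)] DK_slot) simp_all
  then show "dring (Q_adjoin mem A)"
    unfolding dring_def dset_def eq using EV(1-3) dringD(2,3)[OF R] by simp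
qed

section \<open>The field of pairs generated by a hyperfinite set\<close>

lemma Sg_closure:
  "\<exists>C. is_closure (fsort K2 @ PS) (prod_set (FinQ K2) K2)
    (\<lambda>u. \<exists>h\<in>FinQ K2. \<exists>a b. u = h @ [kel a, kel b] \<and> (pr h a b \<or> a = 1 \<and> b = 1))
    (\<lambda>u v w. \<exists>h\<in>FinQ K2. \<exists>a b x y. v = h @ [kel a, kel b] \<and> w = h @ [kel x, kel y] \<and>
      (u = h @ [kel (a + x), kel (b + y)] \<or> u = h @ [kel (a - x), kel (b - y)] \<or> u = h @ [kel (a * x), kel (b * y)] \<or>
       u = h @ [kel (inverse a), kel (inverse b)])) C"
proof (rule definable_closure)
  note F = DS_Fin[OF DS_tuples, of PS]
  show "DS KQ U (fsort K2 @ PS) (prod_set (FinQ K2) K2)"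
    by (intro DS_prod_set F DS_tuples)
  note r = DP_bex[OF F] DP_ex_k DP_conj DP_disj DP_pr DP_eq_k DP_eq[where ss = "fsort K2 @ PS"] DT_append DT_slot' DT_kel_Cons DT_kel
    DK_slot DK_one DK_add DK_diff DK_mult DK_inverse
  show "DP KQ U (case_nat (fsort K2 @ PS) closed_ctx)
    (\<lambda>e. \<exists>h\<in>FinQ K2. \<exists>a b. e 0 = h @ [kel a, kel b] \<and> (pr h a b \<or> a = 1 \<and> b = 1))"
    by (intro r | simp only: nat.case)+
  show "DP KQ U (case_nat (fsort K2 @ PS) (case_nat (fsort K2 @ PS) (case_nat (fsort K2 @ PS) closed_ctx)))
    (\<lambda>e. \<exists>h\<in>FinQ K2. \<exists>a b x y. e (Suc 0) = h @ [kel a, kel b] \<and> e (Suc (Suc 0)) = h @ [kel x, kel y] \<and>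
      (e 0 = h @ [kel (a + x), kel (b + y)] \<or> e 0 = h @ [kel (a - x), kel (b - y)] \<or> e 0 = h @ [kel (a * x), kel (b * y)] \<or>
       e 0 = h @ [kel (inverse a), kel (inverse b)]))"
    by (intro r | simp only: nat.case)+
qed

text \<open>The code \<open>h\<close> is carried along as the first part of every generated tuple,
  so one closure serves all \<open>h\<close>. As \<open>inverse 0 = 0\<close>, inversion has no side
  condition.\<close>

definition Sg :: "('k, 'f) keq list \<Rightarrow> 'k \<Rightarrow> 'k \<Rightarrow> bool" where
  "Sg h a b \<longleftrightarrow> h @ [kel a, kel b] \<in> (SOME C. is_closure (fsort K2 @ PS) (prod_set (FinQ K2) K2)
    (\<lambda>u. \<exists>h\<in>FinQ K2. \<exists>a b. u = h @ [kel a, kel b] \<and> (pr h a b \<or> a = 1 \<and> b = 1))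
    (\<lambda>u v w. \<exists>h\<in>FinQ K2. \<exists>a b x y. v = h @ [kel a, kel b] \<and> w = h @ [kel x, kel y] \<and>
      (u = h @ [kel (a + x), kel (b + y)] \<or> u = h @ [kel (a - x), kel (b - y)] \<or> u = h @ [kel (a * x), kel (b * y)] \<or>
       u = h @ [kel (inverse a), kel (inverse b)])) C)"

lemmas Sg_closure' = is_closureD[OF someI_ex[OF Sg_closure], folded Sg_def]

lemma prod_K2: "h @ [kel a, kel b] \<in> prod_set (FinQ K2) K2 \<longleftrightarrow> h \<in> FinQ K2"
proof
  assume "h @ [kel a, kel b] \<in> prod_set (FinQ K2) K2"
  then obtain g u where *: "h @ [kel a, kel b] = g @ u" "g \<in> FinQ K2" "u \<in> K2" by (auto simp: prod_set_def)
  obtain c d where "u = [kel c, kel d]" using K2_cases[OF *(3)] by blast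
  then show "h \<in> FinQ K2" using * by simp
next
  assume "h \<in> FinQ K2"
  then show "h @ [kel a, kel b] \<in> prod_set (FinQ K2) K2" unfolding prod_set_def using K2_I by blast
qed

lemma DP_Sg [dp]:
  "DT KQ U \<Gamma> (fsort K2) h \<Longrightarrow> DK mem U \<Gamma> a \<Longrightarrow> DK mem U \<Gamma> b \<Longrightarrow> DP KQ U \<Gamma> (\<lambda>e. Sg (h e) (a e) (b e))"
  unfolding Sg_def by (intro DP_in[OF Sg_closure'(1)] DT_append DT_kel_Cons DT_kel)

lemma Sg_pr: "h \<in> FinQ K2 \<Longrightarrow> pr h a b \<Longrightarrow> Sg h a b"
  and Sg_1: "h \<in> FinQ K2 \<Longrightarrow> Sg h 1 1"
  unfolding Sg_def by (rule Sg_closure'(3), simp only: prod_K2, blast)+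

lemma
  assumes h: "h \<in> FinQ K2" and "Sg h a b"
  shows Sg_add: "Sg h x y \<Longrightarrow> Sg h (a + x) (b + y)"
    and Sg_diff: "Sg h x y \<Longrightarrow> Sg h (a - x) (b - y)"
    and Sg_mult: "Sg h x y \<Longrightarrow> Sg h (a * x) (b * y)"
    and Sg_inverse: "Sg h (inverse a) (inverse b)"
  using assms(2) unfolding Sg_def
  by (rule Sg_closure'(4)[rotated]; (simp only: prod_K2 h)?; use h in blast)+

lemma Sg_induct:
  assumes h: "h \<in> FinQ K2" and Q: "DP2 Q" and S: "Sg h a b"
    and pr: "\<And>a b. pr h a b \<Longrightarrow> Q a b" and 1: "Q 1 1"
    and add: "\<And>a b x y. Q a b \<Longrightarrow> Q x y \<Longrightarrow> Q (a + x) (b + y)"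
    and diff: "\<And>a b x y. Q a b \<Longrightarrow> Q x y \<Longrightarrow> Q (a - x) (b - y)"
    and mult: "\<And>a b x y. Q a b \<Longrightarrow> Q x y \<Longrightarrow> Q (a * x) (b * y)"
    and inverse: "\<And>a b. Q a b \<Longrightarrow> Q (inverse a) (inverse b)"
  shows "Q a b"
proof -
  note T = DT_const[OF DS_subset[OF DS_Fin[OF DS_tuples], THEN subsetD, OF h] tuples_subset_univ[OF DS_subset[OF DS_Fin[OF DS_tuples], THEN subsetD, OF h]]]
  let ?P = "\<lambda>u. \<forall>a b. u = h @ [kel a, kel b] \<longrightarrow> Q a b"
  have "?P (h @ [kel a, kel b])"
  proof (rule Sg_closure'(5)[of ?P, OF _ _ _ S[unfolded Sg_def]])
    show "DP KQ U (case_nat (fsort K2 @ PS) closed_ctx) (\<lambda>e. ?P (e 0))"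
      by (intro DP_all_k DP_imp DP_eq[where ss = "fsort K2 @ PS"] DT_append T DT_slot' DT_kel_Cons DT_kel DK_slot DP_app_kk[OF Q] | simp only: nat.case)+
    fix u assume "\<exists>h\<in>FinQ K2. \<exists>a b. u = h @ [kel a, kel b] \<and> (pr h a b \<or> a = 1 \<and> b = 1)"
    then show "?P u" using pr 1 by auto
  next
    fix u v w
    assume "?P v" "?P w" "\<exists>h\<in>FinQ K2. \<exists>a b x y. v = h @ [kel a, kel b] \<and> w = h @ [kel x, kel y] \<and>
      (u = h @ [kel (a + x), kel (b + y)] \<or> u = h @ [kel (a - x), kel (b - y)] \<or> u = h @ [kel (a * x), kel (b * y)] \<or>
       u = h @ [kel (inverse a), kel (inverse b)])"
    then show "?P u" using add diff mult inverse by auto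
  qed
  then show ?thesis by blast
qed

text \<open>\<open>Sg h\<close> is closed under differences, so comparing with 0 is enough to make
  it single-valued and injective; being closed under the field operations, it is then an isomorphism
  of subfields.\<close>

definition Good :: "('k, 'f) keq list \<Rightarrow> bool" where
  "Good h \<longleftrightarrow> h \<in> FinQ K2 \<and> (\<forall>a b. Sg h a b \<longrightarrow> (a = 0 \<longleftrightarrow> b = 0))"

lemma FinQ_DT: "h \<in> FinQ K2 \<Longrightarrow> DT KQ U \<Gamma> (fsort K2) (\<lambda>e. h)"
  using DS_subset[OF DS_Fin[OF DS_tuples], of PS] by (intro DT_const tuples_subset_univ) blast+

lemma Sg_DP2: "h \<in> FinQ K2 \<Longrightarrow> DP2 (Sg h)"
  by (intro DP_Sg FinQ_DT DK_slot) simp_all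

lemma Sg_0: "h \<in> FinQ K2 \<Longrightarrow> Sg h 0 0"
  using Sg_diff[OF _ Sg_1 Sg_1] by simp

lemma Sg_N: "h \<in> FinQ K2 \<Longrightarrow> j \<in> N \<Longrightarrow> Sg h j j"
  by (rule N_induct[where P = "\<lambda>j. Sg h j j"])
    (auto intro!: DP_app_kk[OF Sg_DP2] DK_slot intro: Sg_0 Sg_1 Sg_add)

lemma Sg_mono:
  assumes "h \<in> FinQ K2" "h' \<in> FinQ K2" "\<And>a b. pr h a b \<Longrightarrow> pr h' a b" "Sg h a b"
  shows "Sg h' a b"
  by (rule Sg_induct[OF assms(1) Sg_DP2[OF assms(2)] assms(4)])
    (use assms(2,3) in \<open>blast intro: Sg_pr Sg_1 Sg_add Sg_diff Sg_mult Sg_inverse\<close>)+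

lemma Sg_swap1:
  assumes "h \<in> FinQ K2" "h' \<in> FinQ K2" "\<And>a b. pr h a b \<Longrightarrow> pr h' b a" "Sg h a b"
  shows "Sg h' b a"
proof (rule Sg_induct[OF assms(1) _ assms(4), where Q = "\<lambda>a b. Sg h' b a"])
  show "DP2 (\<lambda>a b. Sg h' b a)" by (intro DP_app_kk[OF Sg_DP2[OF assms(2)]] DK_slot) simp_all
qed (use assms(2,3) in \<open>blast intro: Sg_pr Sg_1 Sg_add Sg_diff Sg_mult Sg_inverse\<close>)+

text \<open>The inverse isomorphism again has a code, so extension properties have to be proved in
  one direction only.\<close>

lemma Good_swap:
  assumes "Good h"
  shows "\<exists>h'. Good h' \<and> (\<forall>a b. pr h' a b \<longleftrightarrow> pr h b a) \<and> (\<forall>a b. Sg h' a b \<longleftrightarrow> Sg h b a)"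
proof -
  have h: "h \<in> FinQ K2" using assms by (simp add: Good_def)
  have "hf PS {y. \<exists>u\<in>{[kel a, kel b] |a b. pr h a b} :: ('k, 'f) keq list set. \<exists>a b. u = [kel a, kel b] \<and> y = [kel b, kel a]}"
  proof (rule hf_UN[OF pr_hf[OF h], where R = "\<lambda>u y. \<exists>a b. u = [kel a, kel b] \<and> y = [kel b, kel a]"])
    fix u :: "('k, 'f) keq list" assume "u \<in> {[kel a, kel b] |a b. pr h a b}"
    then obtain a b where u: "u = [kel a, kel b]" by blast
    have "{y. \<exists>a b. u = [kel a, kel b] \<and> y = [kel b, kel a]} = insert [kel b, kel a] {}" using u by auto
    then show "hf PS {y. \<exists>a b. u = [kel a, kel b] \<and> y = [kel b, kel a]}" using hf_insert[OF hf_empty K2_I] by metis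
  next
    show "DP KQ U (case_nat PS (case_nat PS closed_ctx)) (\<lambda>e. \<exists>a b. e 0 = [kel a, kel b] \<and> e (Suc 0) = [kel b, kel a])"
      by (intro DP_ex_k DP_conj DP_eq[where ss = PS] DT_slot' DT_kel_Cons DT_kel DK_slot | simp only: nat.case)+
  qed
  also have "{y :: ('k, 'f) keq list. \<exists>u\<in>{[kel a, kel b] |a b. pr h a b} :: ('k, 'f) keq list set. \<exists>a b. u = [kel a, kel b] \<and> y = [kel b, kel a]} = ({[kel a, kel b] |a b. pr h b a} :: ('k, 'f) keq list set)"
    by auto
  finally have "\<exists>h'\<in>FinQ K2. \<forall>a b. pr h' a b \<longleftrightarrow> pr h b a" by (rule hf_pr)
  then obtain h' where h': "h' \<in> FinQ K2" "\<And>a b. pr h' a b \<longleftrightarrow> pr h b a" by blast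
  have S: "Sg h' a b \<longleftrightarrow> Sg h b a" for a b
    using Sg_swap1[OF h h'(1), of b a] Sg_swap1[OF h'(1) h, of a b] h'(2) by blast
  have "Good h'" using assms h'(1) unfolding Good_def S by blast
  then show ?thesis using h'(2) S by blast
qed

lemma Good_inj: "Good h \<Longrightarrow> Sg h a b \<Longrightarrow> Sg h a' b' \<Longrightarrow> a = a' \<longleftrightarrow> b = b'"
  using Sg_diff[of h a b a' b'] unfolding Good_def by (metis eq_iff_diff_eq_0)

text \<open>A ring \<open>D\<close> of pairs that matches zeros also matches them in its fractions,
  and the fractions contain \<open>Sg h\<close>. It therefore suffices to test vanishing on a ring,
  such as one of values of polynomials.\<close>

lemma Good_criterion:
  assumes h: "h \<in> FinQ K2" and D: "DP2 D" and "D 1 1" and z: "\<And>a b. D a b \<Longrightarrow> a = 0 \<longleftrightarrow> b = 0"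
    and add: "\<And>a b x y. D a b \<Longrightarrow> D x y \<Longrightarrow> D (a + x) (b + y)"
    and neg: "\<And>a b. D a b \<Longrightarrow> D (- a) (- b)"
    and mult: "\<And>a b x y. D a b \<Longrightarrow> D x y \<Longrightarrow> D (a * x) (b * y)"
    and pr: "\<And>a b. pr h a b \<Longrightarrow> D a b"
  shows "Good h"
proof -
  \<comment> \<open>Fractions of pairs. By the zero condition one denominator is non-zero exactly if
    the other is.\<close>
  define Q where "Q = (\<lambda>a b. \<exists>p q r s. D p q \<and> D r s \<and> r \<noteq> 0 \<and> s \<noteq> 0 \<and> a = p / r \<and> b = q / s)"
  have Q: "DP2 Q" unfolding Q_def by (intro DP_ex_k DP_conj DP_app_kk[OF D] dp | simp)+
  have QI: "Q (p / r) (q / s)" if "D p q" "D r s" "r \<noteq> 0" for p q r s using that z[OF that(2)] unfolding Q_def by blast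
  have DQ: "Q a b" if "D a b" for a b using QI[OF that \<open>D 1 1\<close>] by simp
  have Qadd: "Q (a + x) (b + y)" if "Q a b" "Q x y" for a b x y
  proof -
    obtain p q r s where 1: "D p q" "D r s" "r \<noteq> 0" "s \<noteq> 0" "a = p / r" "b = q / s" using \<open>Q a b\<close> by (auto simp: Q_def)
    obtain p' q' r' s' where 2: "D p' q'" "D r' s'" "r' \<noteq> 0" "s' \<noteq> 0" "x = p' / r'" "y = q' / s'" using \<open>Q x y\<close> by (auto simp: Q_def)
    have "Q ((p * r' + p' * r) / (r * r')) ((q * s' + q' * s) / (s * s'))" using 1 2 by (intro QI add mult) auto
    then show ?thesis using 1 2 by (simp add: add_frac_eq)
  qed
  have Qmult: "Q (a * x) (b * y)" if "Q a b" "Q x y" for a b x y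
  proof -
    obtain p q r s where 1: "D p q" "D r s" "r \<noteq> 0" "s \<noteq> 0" "a = p / r" "b = q / s" using \<open>Q a b\<close> by (auto simp: Q_def)
    obtain p' q' r' s' where 2: "D p' q'" "D r' s'" "r' \<noteq> 0" "s' \<noteq> 0" "x = p' / r'" "y = q' / s'" using \<open>Q x y\<close> by (auto simp: Q_def)
    have "Q ((p * p') / (r * r')) ((q * q') / (s * s'))" using 1 2 by (intro QI mult) auto
    then show ?thesis using 1 2 by simp
  qed
  have Qneg: "Q (- 1) (- 1)" by (rule DQ[OF neg[OF \<open>D 1 1\<close>]])
  have Qz: "a = 0 \<longleftrightarrow> b = 0" if "Q a b" for a b using that z unfolding Q_def by auto
  have "Q a b" if "Sg h a b" for a b
  proof (rule Sg_induct[OF h Q that DQ[OF pr] DQ[OF \<open>D 1 1\<close>] Qadd _ Qmult])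
    fix a b x y assume "Q a b" "Q x y"
    then show "Q (a - x) (b - y)" using Qadd[OF _ Qmult[OF Qneg], of a b x y] by simp
  next
    fix a b assume "Q a b"
    then obtain p q r s where 1: "D p q" "D r s" "r \<noteq> 0" "s \<noteq> 0" "a = p / r" "b = q / s" by (auto simp: Q_def)
    show "Q (inverse a) (inverse b)"
    proof (cases "p = 0")
      case True
      then show ?thesis using 1 \<open>Q a b\<close> z[OF 1(1)] by simp
    next
      case False
      then show ?thesis using QI[OF 1(2,1)] 1 by simp
    qed
  qed assumption
  then show ?thesis using h Qz unfolding Good_def by blast
qed

section \<open>Adjoining one element\<close>

text \<open>\<open>W x y m\<close> stands for the pairs \<open>(\<Sum>i<m. c i * x ^ i, \<Sum>i<m. d i * y ^ i)\<close> with
  \<open>(c i, d i)\<close> in the field generated by \<open>h\<close>.\<close>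

definition wspec :: "('k, 'f) keq list \<Rightarrow> ('k \<Rightarrow> 'k \<Rightarrow> 'k \<Rightarrow> 'k \<Rightarrow> 'k \<Rightarrow> bool) \<Rightarrow> bool" where
  "wspec h W \<longleftrightarrow>
    (\<forall>\<Gamma> x y m a b. DK mem U \<Gamma> x \<longrightarrow> DK mem U \<Gamma> y \<longrightarrow> DK mem U \<Gamma> m \<longrightarrow> DK mem U \<Gamma> a \<longrightarrow> DK mem U \<Gamma> b \<longrightarrow>
      DP KQ U \<Gamma> (\<lambda>e. W (x e) (y e) (m e) (a e) (b e))) \<and>
    (\<forall>x y a b. W x y 0 a b \<longleftrightarrow> a = 0 \<and> b = 0) \<and>
    (\<forall>x y a b. \<forall>m\<in>N. W x y (m + 1) a b \<longleftrightarrow>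
      (\<exists>a' b' c d. W x y m a' b' \<and> Sg h c d \<and> a = a' + c * pw x m \<and> b = b' + d * pw y m))"

text \<open>\<open>x\<close>, \<open>y\<close> and the degree bound are coordinates of one closure,
  so \<open>W\<close> is definable in all five arguments. The predicate \<open>V\<close> describes
  how an element can have been generated and yields the converse of each clause.\<close>

lemma wspec_ex:
  assumes h: "h \<in> FinQ K2"
  shows "\<exists>W. wspec h W"
proof -
  let ?s = "Real KSort # Real KSort # Real KSort # PS"
  let ?T = "tuples KQ ?s"
  have T: "[kel x, kel y, kel m, kel a, kel b] \<in> ?T" for x y m a b by (simp add: Cons_tuples)
  define \<beta> :: "('k, 'f) keq list \<Rightarrow> bool" where "\<beta> = (\<lambda>u. \<exists>x y. u = [kel x, kel y, kel 0, kel 0, kel 0])"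
  define \<Phi> :: "('k, 'f) keq list \<Rightarrow> ('k, 'f) keq list \<Rightarrow> bool" where "\<Phi> = (\<lambda>u v. \<exists>x y m a b c d. m \<in> N \<and> Sg h c d \<and>
    v = [kel x, kel y, kel m, kel a, kel b] \<and> u = [kel x, kel y, kel (m + 1), kel (a + c * pw x m), kel (b + d * pw y m)])"
  note r = DP_ex_k DP_conj DP_eq[where ss = ?s] DP_Sg FinQ_DT[OF h] DT_slot' DT_kel_Cons DT_kel DK_slot DK_zero DK_one DK_add DK_mult DK_pw DP_N
  have "\<exists>C. is_closure ?s ?T \<beta> (\<lambda>u v w. \<Phi> u v) C"
  proof (rule definable_closure[OF DS_tuples])
    show "DP KQ U (case_nat ?s closed_ctx) (\<lambda>e. \<beta> (e 0))" unfolding \<beta>_def by (intro r | simp only: nat.case)+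
    show "DP KQ U (case_nat ?s (case_nat ?s (case_nat ?s closed_ctx))) (\<lambda>e. \<Phi> (e 0) (e (Suc 0)))"
      unfolding \<Phi>_def by (intro r | simp only: nat.case)+
  qed
  then obtain C where C: "is_closure ?s ?T \<beta> (\<lambda>u v w. \<Phi> u v) C" by blast
  define W where "W = (\<lambda>x y m a b. [kel x, kel y, kel m, kel a, kel b] \<in> C)"
  have dW: "DP KQ U \<Gamma> (\<lambda>e. W (x e) (y e) (m e) (a e) (b e))"
    if "DK mem U \<Gamma> x" "DK mem U \<Gamma> y" "DK mem U \<Gamma> m" "DK mem U \<Gamma> a" "DK mem U \<Gamma> b" for \<Gamma> x y m a b
    unfolding W_def by (intro DP_in[OF is_closureD(1)[OF C]] DT_kel_Cons DT_kel that)
  have W0: "W x y 0 0 0" for x y unfolding W_def by (rule is_closureD(3)[OF C T]) (auto simp: \<beta>_def)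
  have WS: "W x y (m + 1) (a + c * pw x m) (b + d * pw y m)" if "W x y m a b" "m \<in> N" "Sg h c d" for x y m a b c d
    unfolding W_def by (rule is_closureD(4)[OF C T that(1)[unfolded W_def] that(1)[unfolded W_def]]) (use that in \<open>unfold \<Phi>_def, blast\<close>)
  define V where "V = (\<lambda>x y m a b. m = 0 \<and> a = 0 \<and> b = 0 \<or> (\<exists>k a' b' c d. k \<in> N \<and> m = k + 1 \<and>
    W x y k a' b' \<and> Sg h c d \<and> a = a' + c * pw x k \<and> b = b' + d * pw y k))"
  have inv: "V x y m a b" if "W x y m a b" for x y m a b
  proof -
    let ?P = "\<lambda>u :: ('k, 'f) keq list. \<exists>x y m a b. u = [kel x, kel y, kel m, kel a, kel b] \<and> V x y m a b"
    have "?P [kel x, kel y, kel m, kel a, kel b]"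
    proof (rule is_closureD(5)[where P = ?P, OF C _ _ _ that[unfolded W_def]])
      show "DP KQ U (case_nat ?s closed_ctx) (\<lambda>e. ?P (e 0))"
        unfolding V_def by (intro r DP_disj dW DP_eq_k | simp only: nat.case)+
      show "?P u" if "\<beta> u" for u using that unfolding \<beta>_def V_def by blast
      show "?P u" if "v \<in> C" "\<Phi> u v" for u v
        using that unfolding \<Phi>_def V_def W_def by blast
    qed
    then show ?thesis by auto
  qed
  have "W x y 0 a b \<longleftrightarrow> a = 0 \<and> b = 0" for x y a b
    using inv[of x y 0 a b] W0 N_Suc_nz unfolding V_def by metis
  moreover have "W x y (m + 1) a b \<longleftrightarrow> (\<exists>a' b' c d. W x y m a' b' \<and> Sg h c d \<and> a = a' + c * pw x m \<and> b = b' + d * pw y m)"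
    if m: "m \<in> N" for x y m a b
  proof
    assume "W x y (m + 1) a b"
    then show "\<exists>a' b' c d. W x y m a' b' \<and> Sg h c d \<and> a = a' + c * pw x m \<and> b = b' + d * pw y m"
      using inv[of x y "m + 1" a b] N_Suc_nz[OF m] unfolding V_def by auto
  next
    assume "\<exists>a' b' c d. W x y m a' b' \<and> Sg h c d \<and> a = a' + c * pw x m \<and> b = b' + d * pw y m"
    then show "W x y (m + 1) a b" using WS m by blast
  qed
  ultimately show ?thesis using dW unfolding wspec_def by blast
qed

context
  fixes h W
  assumes G: "Good h" and W: "wspec h W"
begin

lemma h: "h \<in> FinQ K2" and Sg_zero_iff: "Sg h a b \<Longrightarrow> a = 0 \<longleftrightarrow> b = 0"
  using G by (auto simp: Good_def)

lemmas S_intros = Sg_0[OF h] Sg_1[OF h] Sg_add[OF h] Sg_diff[OF h] Sg_mult[OF h] Sg_inverse[OF h]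

lemma Sg_neg: "Sg h a b \<Longrightarrow> Sg h (- a) (- b)"
  using S_intros(4)[OF S_intros(1), of a b] by simp

lemmas DW = W[unfolded wspec_def, THEN conjunct1, rule_format]

lemma W_0: "W x y 0 a b \<longleftrightarrow> a = 0 \<and> b = 0"
  and W_Suc: "m \<in> N \<Longrightarrow> W x y (m + 1) a b \<longleftrightarrow>
      (\<exists>a' b' c d. W x y m a' b' \<and> Sg h c d \<and> a = a' + c * pw x m \<and> b = b' + d * pw y m)"
  using W by (simp_all add: wspec_def)

lemma W_SucI: "m \<in> N \<Longrightarrow> W x y m a b \<Longrightarrow> Sg h c d \<Longrightarrow> W x y (m + 1) (a + c * pw x m) (b + d * pw y m)"
  using W_Suc by blast

lemma W_ind:
  assumes "m \<in> N" and Q: "DP3 Q" and "W x y m a b" "Q 0 0 0"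
    and step: "\<And>m a b c d. m \<in> N \<Longrightarrow> W x y m a b \<Longrightarrow> Q m a b \<Longrightarrow> Sg h c d \<Longrightarrow> Q (m + 1) (a + c * pw x m) (b + d * pw y m)"
  shows "Q m a b"
proof -
  have "\<forall>a b. W x y m a b \<longrightarrow> Q m a b"
  proof (rule N_induct[OF _ assms(1)])
    show "DP1 (\<lambda>m. \<forall>a b. W x y m a b \<longrightarrow> Q m a b)"
      by (intro DP_all_k DP_imp DW DP_app_kkk[OF Q] DK_slot DK_const | simp)+
    show "\<forall>a b. W x y (m + 1) a b \<longrightarrow> Q (m + 1) a b" if "m \<in> N" "\<forall>a b. W x y m a b \<longrightarrow> Q m a b" for m
      using that step unfolding W_Suc[OF that(1)] by blast
  qed (use assms(4) in \<open>simp add: W_0\<close>)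
  then show ?thesis using assms(3) by blast
qed

lemma W_zero: "m \<in> N \<Longrightarrow> W x y m 0 0"
proof (rule N_induct[where P = "\<lambda>m. W x y m 0 0"])
  show "DP1 (\<lambda>m. W x y m 0 0)" by (intro DW DK_slot DK_const) simp_all
  show "W x y (m + 1) 0 0" if "m \<in> N" "W x y m 0 0" for m using W_SucI[OF that S_intros(1)] by simp
qed (simp_all add: W_0)

lemma W_add:
  assumes m: "m \<in> N" and "W x y m a b" "W x y m a' b'"
  shows "W x y m (a + a') (b + b')"
proof -
  have "\<forall>a' b'. W x y m a' b' \<longrightarrow> W x y m (a + a') (b + b')"
  proof (rule W_ind[OF m _ assms(2)])
    show "DP3 (\<lambda>m a b. \<forall>a' b'. W x y m a' b' \<longrightarrow> W x y m (a + a') (b + b'))"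
      by (intro DP_all_k DP_imp DW DK_slot DK_const DK_add | simp)+
    fix m a b c d assume m: "m \<in> N" and IH: "\<forall>a' b'. W x y m a' b' \<longrightarrow> W x y m (a + a') (b + b')" and cd: "Sg h c d"
    show "\<forall>a' b'. W x y (m + 1) a' b' \<longrightarrow> W x y (m + 1) (a + c * pw x m + a') (b + d * pw y m + b')"
    proof (intro allI impI)
      fix a' b' assume "W x y (m + 1) a' b'"
      then obtain p q r s where *: "W x y m p q" "Sg h r s" "a' = p + r * pw x m" "b' = q + s * pw y m"
        using W_Suc[OF m] by blast
      have "W x y (m + 1) (a + p + (c + r) * pw x m) (b + q + (d + s) * pw y m)"
        using W_SucI[OF m _ S_intros(3)[OF cd *(2)]] IH *(1) by blast
      then show "W x y (m + 1) (a + c * pw x m + a') (b + d * pw y m + b')" by (simp add: * algebra_simps)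
    qed
  qed (simp_all add: W_0)
  then show ?thesis using assms(3) by blast
qed

lemma W_scal:
  assumes m: "m \<in> N" and "Sg h c d" "W x y m a b"
  shows "W x y m (c * a) (d * b)"
proof (rule W_ind[where Q = "\<lambda>m a b. W x y m (c * a) (d * b)", OF m _ assms(3)])
  show "DP3 (\<lambda>m a b. W x y m (c * a) (d * b))" by (intro DW DK_slot DK_const DK_mult | simp)+
  show "W x y (m + 1) (c * (a + r * pw x m)) (d * (b + s * pw y m))"
    if "m \<in> N" "W x y m (c * a) (d * b)" "Sg h r s" for m a b r s
    using W_SucI[OF that(1,2) S_intros(5)[OF assms(2) that(3)]] by (simp add: algebra_simps)
qed (simp add: W_0)

lemma W_Suc_mono: "m \<in> N \<Longrightarrow> W x y m a b \<Longrightarrow> W x y (m + 1) a b"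
  using W_SucI[OF _ _ S_intros(1), of m x y a b] by simp

lemma W_mono:
  assumes m: "m \<in> N" and k: "k \<in> N" and w: "W x y m a b"
  shows "W x y (m + k) a b"
proof (rule N_induct[where P = "\<lambda>k. W x y (m + k) a b", OF _ k])
  show "DP1 (\<lambda>k. W x y (m + k) a b)" by (intro DW DK_slot DK_const DK_add | simp)+
  show "W x y (m + (k + 1)) a b" if "k \<in> N" "W x y (m + k) a b" for k
    using W_Suc_mono[OF N_add[OF m that(1)] that(2)] by (simp add: add.assoc)
qed (use w in simp)

lemma W_pow: "m \<in> N \<Longrightarrow> W x y (m + 1) (pw x m) (pw y m)"
  using W_SucI[OF _ W_zero S_intros(2), of m x y] by simp

lemma W_shift:
  assumes m: "m \<in> N" and "W x y m a b"
  shows "W x y (m + 1) (x * a) (y * b)"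
proof (rule W_ind[where Q = "\<lambda>m a b. W x y (m + 1) (x * a) (y * b)", OF m _ assms(2)])
  show "DP3 (\<lambda>m a b. W x y (m + 1) (x * a) (y * b))" by (intro DW DK_slot DK_const DK_mult DK_add DK_one | simp)+
  show "W x y (m + 1 + 1) (x * (a + c * pw x m)) (y * (b + d * pw y m))"
    if "m \<in> N" "W x y (m + 1) (x * a) (y * b)" "Sg h c d" for m a b c d
    using W_SucI[OF N_Suc[OF that(1)] that(2,3)] unfolding pw_Suc[OF that(1)] by (simp add: algebra_simps)
qed (use W_Suc_mono[OF N_0, of x y 0 0] in \<open>simp add: W_0\<close>)

lemma W_shift_pow:
  assumes m: "m \<in> N" and j: "j \<in> N" and w: "W x y m a b"
  shows "W x y (m + j) (pw x j * a) (pw y j * b)"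
proof (rule N_induct[where P = "\<lambda>j. W x y (m + j) (pw x j * a) (pw y j * b)", OF _ j])
  show "DP1 (\<lambda>j. W x y (m + j) (pw x j * a) (pw y j * b))" by (intro DW DK_slot DK_const DK_mult DK_add DK_pw | simp)+
  show "W x y (m + (k + 1)) (pw x (k + 1) * a) (pw y (k + 1) * b)" if "k \<in> N" "W x y (m + k) (pw x k * a) (pw y k * b)" for k
    using W_shift[OF N_add[OF m that(1)] that(2)] unfolding pw_Suc[OF that(1)] by (simp add: ac_simps)
qed (use w in simp)

text \<open>The second factor is expanded: each of its terms contributes a scalar multiple of a
  shifted copy of the first factor.\<close>

lemma W_mult:
  assumes m: "m \<in> N" and k: "k \<in> N" and w: "W x y m a b" and "W x y k a' b'"
  shows "W x y (m + k) (a * a') (b * b')"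
proof (rule W_ind[where Q = "\<lambda>k a' b'. W x y (m + k) (a * a') (b * b')", OF k _ assms(4)])
  show "DP3 (\<lambda>k a' b'. W x y (m + k) (a * a') (b * b'))" by (intro DW DK_slot DK_const DK_mult DK_add | simp)+
  fix k a' b' c d assume k: "k \<in> N" and IH: "W x y (m + k) (a * a') (b * b')" and cd: "Sg h c d"
  have mk: "m + k \<in> N" using m k by simp
  have "W x y (m + k) (a * a' + c * (pw x k * a)) (b * b' + d * (pw y k * b))"
    by (rule W_add[OF mk IH W_scal[OF mk cd W_shift_pow[OF m k w]]])
  then show "W x y (m + (k + 1)) (a * (a' + c * pw x k)) (b * (b' + d * pw y k))"
    using W_Suc_mono[OF mk] by (simp add: algebra_simps)
qed (use W_zero[OF m] in simp)

lemma W_neg: "m \<in> N \<Longrightarrow> W x y m a b \<Longrightarrow> W x y m (- a) (- b)"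
  using W_scal[OF _ Sg_neg[OF S_intros(2)]] by fastforce

text \<open>If a combination of powers of \<open>x\<close> vanishes, its top coefficient is 0, since
  otherwise division by it would express that power by lower ones, against \<open>free\<close>. The
  matching coefficient on the other side is then 0 as well, and the induction hypothesis handles the
  lower part.\<close>

lemma W_0_left:
  assumes m: "m \<in> N" and free: "\<And>k b. k \<in> bel m \<Longrightarrow> \<not> W x y k (pw x k) b" and w: "W x y m 0 v"
  shows "v = 0"
proof -
  have "\<forall>v. W x y m 0 v \<longrightarrow> v = 0"
  proof (rule N_induct_upto[OF _ m])
    show "DP1 (\<lambda>m. \<forall>v. W x y m 0 v \<longrightarrow> v = 0)" by (intro DP_all_k DP_imp DW DK_slot DK_const DP_eq_k | simp)+
    fix k assume k: "k \<in> bel m" and IH: "\<forall>v. W x y k 0 v \<longrightarrow> v = 0"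
    note kN = bel_N[OF k]
    show "\<forall>v. W x y (k + 1) 0 v \<longrightarrow> v = 0"
    proof (intro allI impI)
      fix v assume "W x y (k + 1) 0 v"
      then obtain a b c d where *: "W x y k a b" "Sg h c d" "0 = a + c * pw x k" "v = b + d * pw y k"
        using W_Suc[OF kN] by blast
      have "c = 0"
      proof (rule ccontr)
        assume "c \<noteq> 0"
        then have "pw x k = - inverse c * a" using *(3) by (simp add: field_simps eq_neg_iff_add_eq_0)
        then show False using W_scal[OF kN Sg_neg[OF S_intros(6)[OF *(2)]] *(1)] free[OF k] by metis
      qed
      then show "v = 0" using * Sg_zero_iff[OF *(2)] IH by simp
    qed
  qed (simp add: W_0)
  then show ?thesis using w by blast
qed

text \<open>Only the second components depend on the second point: moving the coefficients through
  the isomorphism gives one polynomial \<open>p\<close> that works for every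
  \<open>y'\<close>.\<close>

lemma W_poly:
  assumes m: "m \<in> N" and w: "W x y m a b"
  shows "\<exists>p\<in>polys mem 1 UNIV. deg_below UNIV m p \<and> (\<forall>y'. W x y' m a (pv UNIV p y'))"
proof (rule W_ind[where Q = "\<lambda>m a b. \<exists>p\<in>polys mem 1 UNIV. deg_below UNIV m p \<and> (\<forall>y'. W x y' m a (pv UNIV p y'))", OF m _ w])
  show "DP3 (\<lambda>m a b. \<exists>p\<in>polys mem 1 UNIV. deg_below UNIV m p \<and> (\<forall>y'. W x y' m a (pv UNIV p y')))"
    by (intro DP_bex[OF DS_polys[OF dset_UNIV]] DP_conj DP_deg_below DP_all_k DW DK_pv dset_UNIV DT_slot' DK_slot DK_const | simp)+
  show "\<exists>p\<in>polys mem 1 UNIV. deg_below UNIV 0 p \<and> (\<forall>y'. W x y' 0 0 (pv UNIV p y'))"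
    using deg_below_0[OF dset_UNIV] W_0 unfolding deg_below_def by metis
  fix m a b c d
  assume m: "m \<in> N" and IH: "\<exists>p\<in>polys mem 1 UNIV. deg_below UNIV m p \<and> (\<forall>y'. W x y' m a (pv UNIV p y'))" and cd: "Sg h c d"
  then obtain p where p: "deg_below UNIV m p" "\<And>y'. W x y' m a (pv UNIV p y')" by blast
  obtain q where q: "deg_below UNIV (m + 1) q" "\<And>y. pv UNIV q y = pv UNIV p y + d * pw y m"
    using deg_below_Suc[OF dset_UNIV p(1) m] by blast
  have "W x y' (m + 1) (a + c * pw x m) (pv UNIV q y')" for y'
    unfolding q(2) by (rule W_SucI[OF m p(2) cd])
  then show "\<exists>p\<in>polys mem 1 UNIV. deg_below UNIV (m + 1) p \<and> (\<forall>y'. W x y' (m + 1) (a + c * pw x m) (pv UNIV p y'))"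
    using q(1) unfolding deg_below_def by blast
qed

text \<open>The relation that expresses \<open>x ^ d\<close> by lower powers is transported to the
  range, where it becomes a monic polynomial of degree \<open>d\<close>; the new \<open>y\<close> is
  one of its roots.\<close>

lemma W_root:
  assumes root: "\<And>p. p \<in> polys mem 1 UNIV \<Longrightarrow> nonconstant mem UNIV p \<Longrightarrow> \<exists>a. is_root mem UNIV p a"
    and d: "d \<in> N" "d \<noteq> 0" and w: "W x y d (pw x d) b"
  shows "\<exists>y. W x y d (pw x d) (pw y d)"
proof -
  \<comment> \<open>The sign is chosen so that \<open>p\<close> is the lower part of the monic
    polynomial \<open>q\<close>.\<close>
  obtain p where p: "deg_below UNIV d p" "\<And>y'. W x y' d (- pw x d) (pv UNIV p y')"
    using W_poly[OF d(1) W_neg[OF d(1) w]] by blast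
  obtain q where q: "deg_below UNIV (d + 1) q" "\<And>y. pv UNIV q y = pv UNIV p y + 1 * pw y d"
    "\<exists>I\<in>pdom mem 1 UNIV q. entry mem 1 N I 0 = d"
    using deg_below_Suc[OF dset_UNIV p(1) d(1) UNIV_I[of 1]] by auto
  have q1: "q \<in> polys mem 1 UNIV" using q(1) by (simp add: deg_below_def)
  have "nonconstant mem UNIV q" using q(3) d(2) unfolding nonconstant_def by blast
  from root[OF q1 this] obtain y where "pv UNIV q y = 0" using is_root_pv[OF dset_UNIV q1] by blast
  then have "- pv UNIV p y = pw y d" unfolding q(2) by (simp add: minus_unique)
  then show ?thesis using W_neg[OF d(1) p(2)[of y]] by auto
qed

text \<open>The union of the \<open>W x y m\<close> is the ring of pairs generated by
  \<open>x\<close> and \<open>y\<close> over the field of \<open>h\<close>; matching zeros there is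
  what \<open>Good_criterion\<close> asks for.\<close>

lemma W_extension:
  assumes Z: "\<And>m a b. m \<in> N \<Longrightarrow> W x y m a b \<Longrightarrow> a = 0 \<longleftrightarrow> b = 0"
  shows "\<exists>h'. Good h' \<and> (\<forall>a b. pr h' a b \<longleftrightarrow> pr h a b \<or> a = x \<and> b = y)"
proof -
  obtain h' where h': "h' \<in> FinQ K2" "\<And>a b. pr h' a b \<longleftrightarrow> pr h a b \<or> a = x \<and> b = y" using pr_insert[OF h] by blast
  \<comment> \<open>Constants have degree bound 1, since the bound 0 leaves only the pair of
    zeros.\<close>
  have c: "W x y 1 c d" if "Sg h c d" for c d using W_SucI[OF N_0 _ that, of x y 0 0] by (simp add: W_0)
  let ?D = "\<lambda>a b. \<exists>m. m \<in> N \<and> W x y m a b"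
  have "Good h'"
  proof (rule Good_criterion[of _ ?D, OF h'(1)])
    show "DP2 ?D" by (intro DP_ex_k DP_conj DP_N DW DK_slot DK_const | simp)+
    show "?D 1 1" using c[OF S_intros(2)] N_1 by blast
    show "?D (a + r) (b + s)" if "?D a b" "?D r s" for a b r s
    proof -
      obtain m k where *: "m \<in> N" "W x y m a b" "k \<in> N" "W x y k r s" using \<open>?D a b\<close> \<open>?D r s\<close> by blast
      then show ?thesis
        using W_add[OF N_add[OF *(1,3)] W_mono[OF *(1,3,2)] W_mono[OF *(3,1,4), unfolded add.commute[of k]]] N_add by blast
    qed
    show "?D (a * r) (b * s)" if "?D a b" "?D r s" for a b r s using that W_mult N_add by blast
    show "?D (- a) (- b)" if "?D a b" for a b using that W_neg by blast
    show "?D a b" if "pr h' a b" for a b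
      using that W_pow[OF N_1, of x y] c[OF Sg_pr[OF h, of a b]] N_1 N_Suc[OF N_1] unfolding h'(2) pw_1 by blast
  qed (use Z in blast)
  then show ?thesis using h'(2) by blast
qed

section \<open>Adjoining an algebraic element\<close>

lemma W_reduce:
  assumes d: "d \<in> N" and w: "W x y d (pw x d) (pw y d)" and "W x y (d + 1) a b"
  shows "W x y d a b"
proof -
  obtain a' b' r s where *: "W x y d a' b'" "Sg h r s" "a = a' + r * pw x d" "b = b' + s * pw y d"
    using assms(3) W_Suc[OF d] by blast
  show ?thesis unfolding *(3,4) by (rule W_add[OF d *(1) W_scal[OF d *(2) w]])
qed

text \<open>All higher powers reduce to degree below \<open>d\<close>, with matching coefficients on
  both sides, so \<open>W x y d\<close> is already the whole generated ring.\<close>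

lemma W_stable:
  assumes d: "d \<in> N" "d \<noteq> 0" and w: "W x y d (pw x d) (pw y d)" and m: "m \<in> N" "W x y m a b"
  shows "W x y d a b"
proof (rule W_ind[where Q = "\<lambda>m a b. W x y d a b", OF m(1) _ m(2) W_zero[OF d(1)]])
  show "DP3 (\<lambda>m a b. W x y d a b)" by (intro DW DK_slot DK_const | simp)+
  \<comment> \<open>\<open>d \<noteq> 0\<close> is used for the constant 1, whose degree bound is
    1.\<close>
  obtain e where e: "e \<in> N" "d = e + 1" using N_cases[OF d(1)] d(2) by blast
  have 1: "W x y d 1 1" using W_mono[OF N_1 e(1), of x y 1 1] W_pow[OF N_0, of x y] by (simp add: e add.commute)
  have pow: "W x y d (pw x m) (pw y m)" if "m \<in> N" for m
  proof (rule N_induct[where P = "\<lambda>m. W x y d (pw x m) (pw y m)", OF _ that])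
    show "DP1 (\<lambda>m. W x y d (pw x m) (pw y m))" by (intro DW DK_slot DK_const DK_pw | simp)+
    show "W x y d (pw x (k + 1)) (pw y (k + 1))" if "k \<in> N" "W x y d (pw x k) (pw y k)" for k
      using W_reduce[OF d(1) w W_shift[OF d(1) that(2)]] unfolding pw_Suc[OF that(1)] by (simp add: mult.commute)
  qed (use 1 in simp)
  show "W x y d (a + r * pw x m) (b + s * pw y m)" if "m \<in> N" "W x y d a b" "Sg h r s" for m a b r s
    by (rule W_add[OF d(1) that(2) W_scal[OF d(1) that(3) pow[OF that(1)]]])
qed

text \<open>Division with remainder by the monic \<open>x ^ k + w\<close>.\<close>

lemma W_divide:
  assumes k: "k \<in> N" and w: "W x y k w w'" and j: "j \<in> N" and u: "W x y (k + j) u u'"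
  shows "\<exists>s s' t t'. W x y j s s' \<and> W x y k t t' \<and> u = s * (pw x k + w) + t"
proof -
  let ?P = "\<lambda>j. \<forall>u u'. W x y (k + j) u u' \<longrightarrow> (\<exists>s s' t t'. W x y j s s' \<and> W x y k t t' \<and> u = s * (pw x k + w) + t)"
  have "?P j"
  proof (rule N_induct[where P = ?P, OF _ j])
    show "DP1 ?P"
      by (intro DP_all_k DP_imp DP_ex_k DP_conj DW DP_eq_k DK_slot DK_const DK_pw DK_add DK_mult | simp)+
    show "?P 0"
    proof (intro allI impI)
      fix u u' assume "W x y (k + 0) u u'"
      then show "\<exists>s s' t t'. W x y 0 s s' \<and> W x y k t t' \<and> u = s * (pw x k + w) + t"
        by (intro exI[of _ 0] exI[of _ u] exI[of _ u']) (simp add: W_0)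
    qed
    fix j assume j: "j \<in> N" and IH: "?P j"
    show "?P (j + 1)"
    proof (intro allI impI)
      fix u u' assume "W x y (k + (j + 1)) u u'"
      then have "W x y (k + j + 1) u u'" by (simp add: add.assoc)
      then obtain a b c d where *: "W x y (k + j) a b" "Sg h c d" "u = a + c * pw x (k + j)"
        using W_Suc[OF N_add[OF k j]] by blast
      have "W x y (k + j) (a + (- c) * (pw x j * w)) (b + (- d) * (pw y j * w'))"
        by (rule W_add[OF N_add[OF k j] *(1) W_scal[OF N_add[OF k j] Sg_neg[OF *(2)] W_shift_pow[OF k j w]]])
      then obtain s s' t t' where st: "W x y j s s'" "W x y k t t'" "a + (- c) * (pw x j * w) = s * (pw x k + w) + t"
        using IH by blast
      have "u = (s + c * pw x j) * (pw x k + w) + t"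
        using st(3) unfolding *(3) pw_add[OF k j] by (simp add: algebra_simps)
      then show "\<exists>s s' t t'. W x y (j + 1) s s' \<and> W x y k t t' \<and> u = s * (pw x k + w) + t"
        using W_SucI[OF j st(1) *(2)] st(2) by blast
    qed
  qed
  then show ?thesis using u by blast
qed

text \<open>Dividing the equation of minimal degree of \<open>x\<close> by \<open>z\<close> leaves a nonzero remainder of smaller
  degree, which is invertible by induction.\<close>

lemma W_inverse:
  assumes d: "d \<in> N" "d \<noteq> 0" and w: "W x y d (pw x d) (pw y d)"
    and min: "\<And>k b. k \<in> bel d \<Longrightarrow> \<not> W x y k (pw x k) b"
    and z: "W x y d z v" "z \<noteq> 0"
  shows "\<exists>z' v'. W x y d z' v' \<and> z * z' = 1"
proof -
  note stable = W_stable[OF d w]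
  have mult: "W x y d (a * r) (b * s)" if "W x y d a b" "W x y d r s" for a b r s
    by (rule stable[OF N_add[OF d(1) d(1)] W_mult[OF d(1) d(1) that]])
  let ?P = "\<lambda>k. \<forall>z v. W x y k z v \<longrightarrow> z \<noteq> 0 \<longrightarrow> (\<exists>z' v'. W x y d z' v' \<and> z * z' = 1)"
  have "?P d"
  proof (rule N_induct_upto[where P = ?P, OF _ d(1)])
    show "DP1 ?P" by (intro DP_all_k DP_imp DP_ex_k DP_conj DP_not DW DP_eq_k DK_slot DK_const DK_mult | simp)+
    show "?P 0" by (simp add: W_0)
    fix k assume kd: "k \<in> bel d" and IH: "?P k"
    have k: "k \<in> N" by (rule bel_N[OF kd])
    show "?P (k + 1)"
    proof (intro allI impI)
      fix z v assume zv: "W x y (k + 1) z v" "z \<noteq> 0"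
      obtain a b r s where *: "W x y k a b" "Sg h r s" "z = a + r * pw x k" using zv(1) W_Suc[OF k] by blast
      show "\<exists>z' v'. W x y d z' v' \<and> z * z' = 1"
      proof (cases "r = 0")
        case True
        then have "z = a" using *(3) by simp
        then show ?thesis using IH *(1) zv(2) by blast
      next
        case False
        note ri = S_intros(6)[OF *(2)]
        define w1 where "w1 = inverse r * a"
        have w1: "W x y k w1 (inverse s * b)" unfolding w1_def by (rule W_scal[OF k ri *(1)])
        have z: "z = r * (pw x k + w1)" using False by (simp add: w1_def *(3) field_simps)
        \<comment> \<open>Up to the unit \<open>r\<close>, \<open>z\<close> is the monic element
          \<open>pw x k + w1\<close>, so it suffices to invert that.\<close>
        have fin: "\<exists>z' v'. W x y d z' v' \<and> z * z' = 1" if "W x y d p q" "(pw x k + w1) * p = 1" for p q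
        proof (intro exI conjI)
          show "W x y d (inverse r * p) (inverse s * q)" by (rule W_scal[OF d(1) ri that(1)])
          show "z * (inverse r * p) = 1" using False that(2) by (simp add: z mult.assoc mult.left_commute[of _ "inverse r"])
        qed
        show ?thesis
        proof (cases "k = 0")
          \<comment> \<open>Here \<open>j\<close> would be \<open>d\<close> itself, which
            \<open>min\<close> does not cover; but \<open>z\<close> is then a constant.\<close>
          case True
          then have "w1 = 0" using w1 by (simp add: W_0)
          moreover have "W x y d 1 1" using stable[OF N_1, of 1 1] W_pow[OF N_0, of x y] by simp
          ultimately show ?thesis using True by (intro fin[of 1 1]) simp_all
        next
          case False
          obtain j where j: "j \<in> N" "d = k + j" "j \<noteq> 0"
          proof (rule that[of "d - k"])
            show "d - k \<in> N" "d - k \<noteq> 0" using kd by (auto simp: below_def)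
          qed simp
          have jd: "j \<in> bel d" using bel_add[OF j(1) k False] j(2) by (simp add: add.commute)
          \<comment> \<open>\<open>pw x d\<close> enters as the combination of lower powers that
            \<open>w\<close> provides, so the sum stands for \<open>X ^ j * (X ^ k + w1)\<close>
            minus the minimal polynomial. Dividing it by \<open>X ^ k + w1\<close> makes
            \<open>X ^ j - p\<close> the quotient of the minimal polynomial, with remainder
            \<open>- t\<close>.\<close>
          have "W x y (k + j) (pw x d + pw x j * w1) (pw y d + pw y j * (inverse s * b))"
            using W_add[OF d(1) w] W_shift_pow[OF k j(1) w1] j(2) by simp
          then obtain p p' t t' where pt: "W x y j p p'" "W x y k t t'" "pw x d + pw x j * w1 = p * (pw x k + w1) + t"
            using W_divide[OF k w1 j(1)] by blast
          have e: "(pw x j - p) * (pw x k + w1) = t" using pt(3) unfolding j(2) pw_add[OF k j(1)] by (simp add: algebra_simps)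
          \<comment> \<open>Otherwise \<open>x ^ j\<close> would be the combination \<open>p\<close>
            of lower powers, although \<open>j\<close> is below the minimal degree.\<close>
          have "t \<noteq> 0"
          proof
            assume "t = 0"
            then have "pw x j = p" using e zv(2) z by auto
            then show False using min[OF jd] pt(1) by simp
          qed
          then obtain u u' where u: "W x y d u u'" "t * u = 1" using IH pt(2) by blast
          have "W x y d (pw x j + - p) (pw y j + - p')"
            using W_add[OF d(1) stable[OF N_Suc[OF j(1)] W_pow[OF j(1)]] stable[OF j(1) W_neg[OF j(1) pt(1)]]] .
          then have "W x y d ((pw x j + - p) * u) ((pw y j + - p') * u')" by (rule mult[OF _ u(1)])
          moreover have "(pw x k + w1) * ((pw x j + - p) * u) = 1" using u(2) e by (simp add: algebra_simps)
          ultimately show ?thesis by (rule fin)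
        qed
      qed
    qed
  qed
  then show ?thesis using z by blast
qed

text \<open>One direction is independence of the powers below \<open>d\<close>. For the other, an
  element \<open>a\<close> that is not 0 but is paired with 0 would, multiplied by its inverse, put
  the pair of 1 and 0 into the ring; subtracting the pair of ones gives 0 paired with
  \<open>- 1\<close>, against the first direction.\<close>

lemma W_algebraic:
  assumes d: "d \<in> N" "d \<noteq> 0" and w: "W x y d (pw x d) (pw y d)"
    and min: "\<And>k b. k \<in> bel d \<Longrightarrow> \<not> W x y k (pw x k) b"
    and m: "m \<in> N" and ab: "W x y m a b"
  shows "a = 0 \<longleftrightarrow> b = 0"
proof
  note stable = W_stable[OF d w]
  have ab: "W x y d a b" by (rule stable[OF m ab])
  note z = W_0_left[OF d(1) min]
  show "b = 0" if "a = 0" using z ab that by blast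
  assume b: "b = 0"
  show "a = 0"
  proof (rule ccontr)
    assume "a \<noteq> 0"
    then obtain a' b' where *: "W x y d a' b'" "a * a' = 1" using W_inverse[OF d w min ab] by blast
    have "W x y d 1 1" using stable[OF N_1, of 1 1] W_pow[OF N_0, of x y] by simp
    moreover have "W x y d 1 0" using stable[OF N_add[OF d(1) d(1)] W_mult[OF d(1) d(1) ab *(1)]] *(2) b by simp
    ultimately have "W x y d (1 + - 1) (0 + - 1)" by (intro W_add[OF d(1)] W_neg[OF d(1)])
    then show False using z[of "- 1"] by simp
  qed
qed

section \<open>Adjoining a transcendental element\<close>

lemma Sg_fraction:
  assumes R: "dring R" and pr: "\<forall>a b. pr h a b \<longrightarrow> a \<in> R" and S: "Sg h a b"
  shows "\<exists>r s. r \<in> R \<and> s \<in> R \<and> s \<noteq> 0 \<and> a = r / s"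
proof (rule Sg_induct[OF h _ S, where Q = "\<lambda>a b. \<exists>r s. r \<in> R \<and> s \<in> R \<and> s \<noteq> 0 \<and> a = r / s"])
  note D = dringD[OF R]
  show "DP2 (\<lambda>a b. \<exists>r s. r \<in> R \<and> s \<in> R \<and> s \<noteq> 0 \<and> a = r / s)"
    by (intro DP_ex_k DP_conj DP_dset[OF D(1)] DP_not DP_eq_k DK_divide DK_slot DK_const | simp)+
  show "\<exists>r s. r \<in> R \<and> s \<in> R \<and> s \<noteq> 0 \<and> a = r / s" if "pr h a b" for a b
    using pr that D(2) by (intro exI[of _ a] exI[of _ 1]) auto
  show "\<exists>r s. r \<in> R \<and> s \<in> R \<and> s \<noteq> 0 \<and> 1 = r / s" using D(2) by (intro exI[of _ 1]) simp
  fix a b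
  assume "\<exists>r s. r \<in> R \<and> s \<in> R \<and> s \<noteq> 0 \<and> a = r / s"
  then obtain r s where 1: "r \<in> R" "s \<in> R" "s \<noteq> 0" "a = r / s" by blast
  show "\<exists>r s. r \<in> R \<and> s \<in> R \<and> s \<noteq> 0 \<and> inverse a = r / s"
  proof (cases "r = 0")
    case True
    then show ?thesis using 1 D(2,6) by (intro exI[of _ 0] exI[of _ 1]) simp
  next
    case False
    then show ?thesis using 1 by (intro exI[of _ s] exI[of _ r]) simp
  qed
  fix x y
  assume "\<exists>r s. r \<in> R \<and> s \<in> R \<and> s \<noteq> 0 \<and> x = r / s"
  then obtain p q where 2: "p \<in> R" "q \<in> R" "q \<noteq> 0" "x = p / q" by blast
  show "\<exists>r s. r \<in> R \<and> s \<in> R \<and> s \<noteq> 0 \<and> a + x = r / s"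
    using 1 2 D(4,5) by (intro exI[of _ "r * q + p * s"] exI[of _ "s * q"]) (simp add: add_frac_eq)
  show "\<exists>r s. r \<in> R \<and> s \<in> R \<and> s \<noteq> 0 \<and> a - x = r / s"
    using 1 2 D(4)[OF D(5)[OF 1(1) 2(2)] D(7)[OF D(5)[OF 2(1) 1(2)]]] D(5) by (intro exI[of _ "r * q + - (p * s)"] exI[of _ "s * q"]) (simp add: diff_frac_eq)
  show "\<exists>r s. r \<in> R \<and> s \<in> R \<and> s \<noteq> 0 \<and> a * x = r / s"
    using 1 2 D(5) by (intro exI[of _ "r * p"] exI[of _ "s * q"]) simp
qed

text \<open>\<open>e\<close> is a common denominator. The additional factor \<open>b\<close> gives
  the induction room: the denominator of the next coefficient has to multiply all earlier
  terms.\<close>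

lemma W_clear:
  assumes R: "dring R" and pr: "\<forall>a b. pr h a b \<longrightarrow> a \<in> R" and m: "m \<in> N" and w: "W x y m u v"
  shows "\<exists>e. e \<in> R \<and> e \<noteq> 0 \<and> (\<forall>b. b \<in> R \<longrightarrow> (\<exists>p\<in>polys mem 1 R. deg_below R m p \<and> pv R p x = b * e * u))"
proof (rule W_ind[where Q = "\<lambda>m u v. \<exists>e. e \<in> R \<and> e \<noteq> 0 \<and> (\<forall>b. b \<in> R \<longrightarrow> (\<exists>p\<in>polys mem 1 R. deg_below R m p \<and> pv R p x = b * e * u))", OF m _ w])
  note D = dringD[OF R]
  show "DP3 (\<lambda>m u v. \<exists>e. e \<in> R \<and> e \<noteq> 0 \<and> (\<forall>b. b \<in> R \<longrightarrow> (\<exists>p\<in>polys mem 1 R. deg_below R m p \<and> pv R p x = b * e * u)))"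
    by (intro DP_ex_k DP_all_k DP_imp DP_not DP_bex[OF DS_polys[OF D(1)]] DP_conj DP_deg_below DK_pv DP_eq_k DP_dset[OF D(1)] D(1)
      DT_slot' DK_slot DK_const DK_mult | simp)+
  show "\<exists>e. e \<in> R \<and> e \<noteq> 0 \<and> (\<forall>b. b \<in> R \<longrightarrow> (\<exists>p\<in>polys mem 1 R. deg_below R 0 p \<and> pv R p x = b * e * 0))"
    using deg_below_0[OF D(1)] D(2) unfolding deg_below_def by (intro exI[of _ 1]) fastforce
  fix m a b c d
  assume m: "m \<in> N" and cd: "Sg h c d"
    and "\<exists>e. e \<in> R \<and> e \<noteq> 0 \<and> (\<forall>b. b \<in> R \<longrightarrow> (\<exists>p\<in>polys mem 1 R. deg_below R m p \<and> pv R p x = b * e * a))"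
  then obtain e where e: "e \<in> R" "e \<noteq> 0" "\<And>b. b \<in> R \<Longrightarrow> \<exists>p\<in>polys mem 1 R. deg_below R m p \<and> pv R p x = b * e * a"
    by blast
  obtain r s where rs: "r \<in> R" "s \<in> R" "s \<noteq> 0" "c = r / s" using Sg_fraction[OF R pr cd] by blast
  have "\<exists>p\<in>polys mem 1 R. deg_below R (m + 1) p \<and> pv R p x = b * (e * s) * (a + c * pw x m)" if b: "b \<in> R" for b
  proof -
    obtain p where p: "deg_below R m p" "pv R p x = (b * s) * e * a" using e(3)[OF D(5)[OF b rs(2)]] by blast
    obtain q where q: "deg_below R (m + 1) q" "\<And>y. pv R q y = pv R p y + b * e * r * pw y m"
      using deg_below_Suc[OF D(1) p(1) m D(5)[OF D(5)[OF b e(1)] rs(1)]] by blast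
    have "pv R q x = b * (e * s) * (a + c * pw x m)" using rs(3) by (simp add: q(2) p(2) rs(4) algebra_simps)
    then show ?thesis using q(1) unfolding deg_below_def by blast
  qed
  then show "\<exists>e. e \<in> R \<and> e \<noteq> 0 \<and> (\<forall>b. b \<in> R \<longrightarrow> (\<exists>p\<in>polys mem 1 R. deg_below R (m + 1) p \<and> pv R p x = b * e * (a + c * pw x m)))"
    using e rs(2,3) D(5) by (intro exI[of _ "e * s"]) simp
qed

text \<open>After clearing denominators, an expression of \<open>x ^ m\<close> by lower powers would
  give a polynomial over \<open>R\<close> with root \<open>x\<close>, and its top coefficient
  \<open>e\<close> is not 0.\<close>

lemma W_transcendental:
  assumes R: "dring R" and pr: "\<forall>a b. pr h a b \<longrightarrow> a \<in> R" and m: "m \<in> N" and x: "\<not> def_algebraic mem R x"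
  shows "\<not> W x y m (pw x m) v"
proof
  note D = dringD[OF R]
  assume "W x y m (pw x m) v"
  from W_clear[OF R pr m this] obtain e where e: "e \<in> R" "e \<noteq> 0"
    "\<And>b. b \<in> R \<Longrightarrow> \<exists>p\<in>polys mem 1 R. deg_below R m p \<and> pv R p x = b * e * pw x m" by blast
  \<comment> \<open>The factor \<open>- 1\<close> makes \<open>p\<close> cancel the top term
    \<open>e * x ^ m\<close>, added next, at the point \<open>x\<close>.\<close>
  obtain p where p: "deg_below R m p" "pv R p x = - 1 * e * pw x m" using e(3)[OF D(3)] by blast
  obtain q where q: "deg_below R (m + 1) q" "\<And>y. pv R q y = pv R p y + e * pw y m" "\<exists>I\<in>pdom mem 1 R q. entry mem 1 N I 0 = m"
    using deg_below_Suc[OF D(1) p(1) m e(1)] e(2) by blast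
  have "q \<in> polys mem 1 R" using q(1) by (simp add: deg_below_def)
  moreover have "is_root mem R q x" using is_root_pv[OF D(1) calculation] by (simp add: q(2) p(2))
  ultimately show False using x q(3) unfolding def_algebraic_def by blast
qed

end

lemma W_swap:
  assumes h: "Good h" "wspec h W" and h': "Good h'" "wspec h' W'" and S: "\<And>a b. Sg h' a b \<longleftrightarrow> Sg h b a" and m: "m \<in> N"
  shows "W x y m a b \<longleftrightarrow> W' y x m b a"
proof -
  have "\<forall>a b. W x y m a b \<longleftrightarrow> W' y x m b a"
  proof (rule N_induct[OF _ m])
    show "DP1 (\<lambda>m. \<forall>a b. W x y m a b \<longleftrightarrow> W' y x m b a)"
      by (intro DP_all_k DP_iff DW[OF h] DW[OF h'] DK_slot DK_const | simp)+
    show "\<forall>a b. W x y (m + 1) a b \<longleftrightarrow> W' y x (m + 1) b a" if "m \<in> N" "\<forall>a b. W x y m a b \<longleftrightarrow> W' y x m b a" for m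
      using that(2) unfolding W_Suc[OF h that(1)] W_Suc[OF h' that(1)] S by blast
  qed (auto simp: W_0[OF h] W_0[OF h'])
  then show ?thesis by blast
qed

lemma range_ex:
  assumes h: "h \<in> FinQ K2"
  shows "\<exists>A. \<forall>b. mem b A \<longleftrightarrow> (\<exists>a. pr h a b)"
proof -
  have "hf kS {y. \<exists>u\<in>{[kel a, kel b] |a b. pr h a b} :: ('k, 'f) keq list set. \<exists>a b. u = [kel a, kel b] \<and> y = [kel b]}"
  proof (rule hf_UN[OF pr_hf[OF h], where R = "\<lambda>u y. \<exists>a b. u = [kel a, kel b] \<and> y = [kel b]"])
    fix u :: "('k, 'f) keq list" assume "u \<in> {[kel a, kel b] |a b. pr h a b}"
    then obtain a b where u: "u = [kel a, kel b]" by blast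
    have "{y. \<exists>a b. u = [kel a, kel b] \<and> y = [kel b]} = insert [kel b] {}" using u by auto
    then show "hf kS {y. \<exists>a b. u = [kel a, kel b] \<and> y = [kel b]}" using hf_insert[OF hf_empty kel_tuples] by metis
  next
    show "DP KQ U (case_nat PS (case_nat kS closed_ctx)) (\<lambda>e. \<exists>a b. e 0 = [kel a, kel b] \<and> e (Suc 0) = [kel b])"
      by (intro DP_ex_k DP_conj DP_eq[where ss = PS] DP_eq[where ss = kS] DT_slot' DT_kel_Cons DT_kel DK_slot | simp only: nat.case)+
  qed
  also have "{y. \<exists>u\<in>{[kel a, kel b] |a b. pr h a b} :: ('k, 'f) keq list set. \<exists>a b. u = [kel a, kel b] \<and> y = [kel b]} =
    (kset {b. \<exists>a. pr h a b} :: ('k, 'f) keq list set)"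
    by (auto simp: kset_def)
  finally show ?thesis unfolding kfin_iff_hf[symmetric] kfin_iff by simp
qed

end

section \<open>Back-and-forth systems\<close>

definition pres :: "('a, 's, 'r) fostruct \<Rightarrow> ('a \<Rightarrow> 'a \<Rightarrow> bool) \<Rightarrow> bool" where
  "pres M R \<longleftrightarrow> (\<forall>\<phi> e e'. (\<forall>x\<in>fv \<phi>. R (e x) (e' x)) \<longrightarrow> (sat M e \<phi> \<longleftrightarrow> sat M e' \<phi>))"

text \<open>The extensions must contain the given relation, so that elements matched before remain
  matched under a quantifier.\<close>

definition back_forth :: "('a, 's, 'r) fostruct \<Rightarrow> ('a \<Rightarrow> 'a \<Rightarrow> bool) set \<Rightarrow> bool" where
  "back_forth M F \<longleftrightarrow> (\<forall>R\<in>F.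
     (\<forall>r xs ys. list_all2 R xs ys \<longrightarrow> (xs \<in> Intp M r \<longleftrightarrow> ys \<in> Intp M r)) \<and>
     (\<forall>a b a' b'. R a b \<longrightarrow> R a' b' \<longrightarrow> (a = a' \<longleftrightarrow> b = b')) \<and>
     (\<forall>s. \<forall>a\<in>Carr M s. \<exists>R'\<in>F. R \<le> R' \<and> (\<exists>b\<in>Carr M s. R' a b)) \<and>
     (\<forall>s. \<forall>b\<in>Carr M s. \<exists>R'\<in>F. R \<le> R' \<and> (\<exists>a\<in>Carr M s. R' a b)))"

lemma back_forthD:
  assumes "back_forth M F" "R \<in> F"
  shows "list_all2 R xs ys \<Longrightarrow> xs \<in> Intp M r \<longleftrightarrow> ys \<in> Intp M r"
    and "R a b \<Longrightarrow> R a' b' \<Longrightarrow> a = a' \<longleftrightarrow> b = b'"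
    and "a \<in> Carr M s \<Longrightarrow> \<exists>R'\<in>F. R \<le> R' \<and> (\<exists>b\<in>Carr M s. R' a b)"
    and "b \<in> Carr M s \<Longrightarrow> \<exists>R'\<in>F. R \<le> R' \<and> (\<exists>a\<in>Carr M s. R' a b)"
  using assms(1)[unfolded back_forth_def, rule_format, OF assms(2)] by blast+

lemma back_forth_pres:
  assumes F: "back_forth M F" and R: "R \<in> F"
  shows "pres M R"
proof -
  have "R \<in> F \<Longrightarrow> \<forall>x\<in>fv \<phi>. R (e x) (e' x) \<Longrightarrow> sat M e \<phi> \<longleftrightarrow> sat M e' \<phi>" for \<phi> R e e'
  proof (induction \<phi> arbitrary: R e e')
    case (Rel r xs)
    then have "list_all2 R (map e xs) (map e' xs)" by (simp add: list_all2_conv_all_nth)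
    from back_forthD(1)[OF F Rel(1) this] show ?case by simp
  next
    case (Equal x y)
    then show ?case using back_forthD(2)[OF F Equal(1)] by simp
  next
    case (Neg \<phi>)
    show ?case using Neg.IH[OF Neg.prems(1), of e e'] Neg.prems(2) by simp
  next
    case (Conj \<phi> \<psi>)
    show ?case using Conj.IH[OF Conj.prems(1), of e e'] Conj.prems(2) by simp
  next
    case (Ex s x \<phi>)
    show ?case
    proof
      assume "sat M e (Ex s x \<phi>)"
      then obtain a where a: "a \<in> Carr M s" "sat M (e(x := a)) \<phi>" by auto
      obtain R' b where R': "R' \<in> F" "R \<le> R'" "b \<in> Carr M s" "R' a b"
        using back_forthD(3)[OF F Ex.prems(1) a(1)] by blast
      have "\<forall>y\<in>fv \<phi>. R' ((e(x := a)) y) ((e'(x := b)) y)" using Ex.prems(2) R'(2,4) by auto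
      from Ex.IH[OF R'(1) this] show "sat M e' (Ex s x \<phi>)" using a(2) R'(3) unfolding sat.simps by blast
    next
      assume "sat M e' (Ex s x \<phi>)"
      then obtain b where b: "b \<in> Carr M s" "sat M (e'(x := b)) \<phi>" by auto
      obtain R' a where R': "R' \<in> F" "R \<le> R'" "a \<in> Carr M s" "R' a b"
        using back_forthD(4)[OF F Ex.prems(1) b(1)] by blast
      have "\<forall>y\<in>fv \<phi>. R' ((e(x := a)) y) ((e'(x := b)) y)" using Ex.prems(2) R'(2,4) by auto
      from Ex.IH[OF R'(1) this] show "sat M e (Ex s x \<phi>)" using b(2) R'(3) unfolding sat.simps by blast
    qed
  qed
  then show ?thesis using R unfolding pres_def by blast
qed

lemma back_forth_tuple:
  assumes F: "back_forth M F" and "R \<in> F" "u \<in> tuples M ss"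
  shows "\<exists>R'\<in>F. R \<le> R' \<and> (\<exists>v\<in>tuples M ss. list_all2 R' u v)"
    and "\<exists>R'\<in>F. R \<le> R' \<and> (\<exists>v\<in>tuples M ss. list_all2 R' v u)"
  using assms(2,3)
proof (induction ss arbitrary: u R)
  case Nil
  { case 1 then show ?case by auto }
  { case 2 then show ?case by auto }
next
  case (Cons s ss)
  { case 1
    then obtain a w where u: "u = a # w" "a \<in> Carr M s" "w \<in> tuples M ss" by (auto simp: Cons_tuples)
    obtain R1 v where R1: "R1 \<in> F" "R \<le> R1" "v \<in> tuples M ss" "list_all2 R1 w v" using Cons.IH(1)[OF 1(1) u(3)] by blast
    obtain R2 b where R2: "R2 \<in> F" "R1 \<le> R2" "b \<in> Carr M s" "R2 a b" using back_forthD(3)[OF F R1(1) u(2)] by blast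
    have "list_all2 R2 u (b # v)" using list_all2_mono[OF R1(4)] R2(2,4) u(1) by auto
    then show ?case using R1 R2 by (intro bexI[of _ R2] conjI bexI[of _ "b # v"]) (auto simp: Cons_tuples) }
  { case 2
    then obtain a w where u: "u = a # w" "a \<in> Carr M s" "w \<in> tuples M ss" by (auto simp: Cons_tuples)
    obtain R1 v where R1: "R1 \<in> F" "R \<le> R1" "v \<in> tuples M ss" "list_all2 R1 v w" using Cons.IH(2)[OF 2(1) u(3)] by blast
    obtain R2 b where R2: "R2 \<in> F" "R1 \<le> R2" "b \<in> Carr M s" "R2 b a" using back_forthD(4)[OF F R1(1) u(2)] by blast
    have "list_all2 R2 (b # v) u" using list_all2_mono[OF R1(4)] R2(2,4) u(1) by auto
    then show ?case using R1 R2 by (intro bexI[of _ R2] conjI bexI[of _ "b # v"]) (auto simp: Cons_tuples) }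
qed

lemma pres_holds:
  assumes "pres M R" "list_all2 R u v" "fv \<phi> \<subseteq> {..<length u}"
  shows "holds M \<phi> u \<longleftrightarrow> holds M \<phi> v"
  unfolding holds_def
  by (rule assms(1)[unfolded pres_def, rule_format]) (use assms(2,3) in \<open>auto simp: list_all2_conv_all_nth\<close>)

lemma pres_eq:
  assumes "pres M R" "R a b" "R a' b'"
  shows "a = a' \<longleftrightarrow> b = b'"
  using pres_holds[OF assms(1), of "[a, a']" "[b, b']" "Equal 0 1"] assms(2,3) by (simp add: holds_def)

lemma pres_tuples:
  assumes P: "pres M R" and uv: "list_all2 R u v"
  shows "u \<in> tuples M ss \<longleftrightarrow> v \<in> tuples M ss"
proof -
  have c: "a \<in> Carr M s \<longleftrightarrow> b \<in> Carr M s" if "R a b" for a b s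
    using pres_holds[OF P, of "[a]" "[b]" "Ex s 1 (Equal 0 1)"] that by (auto simp: holds_def)
  have "length u = length v" "\<And>i. i < length u \<Longrightarrow> R (u ! i) (v ! i)" using uv by (auto simp: list_all2_conv_all_nth)
  then show ?thesis unfolding tuples_def mem_Collect_eq list_all2_conv_all_nth using c by metis
qed

lemma pres_converse: "pres M R \<Longrightarrow> pres M (\<lambda>a b. R b a)"
  unfolding pres_def by blast

section \<open>Lifting to imaginaries through representatives\<close>

definition eqrel_lift :: "('a, 's, 'r) fostruct \<Rightarrow> ('a \<Rightarrow> 'a \<Rightarrow> bool) \<Rightarrow> ('a, 's, 'r) eqelem \<Rightarrow> ('a, 's, 'r) eqelem \<Rightarrow> bool" where
  "eqrel_lift M R c c' \<longleftrightarrow> (\<exists>s. valid_sort M s \<and> (\<exists>u\<in>tuples M (rsorts s). \<exists>v\<in>tuples M (rsorts s).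
     list_all2 R u v \<and> c = elem_of M s u \<and> c' = elem_of M s v))"

lemma eqrel_lift_mono: "R \<le> R' \<Longrightarrow> eqrel_lift M R \<le> eqrel_lift M R'"
  unfolding eqrel_lift_def by (intro predicate2I) (meson list_all2_mono predicate2D)

lemma eqrel_lift_converse: "eqrel_lift M R c c' \<longleftrightarrow> eqrel_lift M (\<lambda>a b. R b a) c' c"
  unfolding eqrel_lift_def list_all2_conv_all_nth by metis

lemma eqrel_lift_El: "eqrel_lift M R (El a) c \<longleftrightarrow> (\<exists>s b. c = El b \<and> a \<in> Carr M s \<and> b \<in> Carr M s \<and> R a b)"
proof
  assume "eqrel_lift M R (El a) c"
  then obtain s u v where *: "u \<in> tuples M (rsorts s)" "v \<in> tuples M (rsorts s)" "list_all2 R u v"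
    "El a = elem_of M s u" "c = elem_of M s v" by (auto simp: eqrel_lift_def)
  show "\<exists>s b. c = El b \<and> a \<in> Carr M s \<and> b \<in> Carr M s \<and> R a b"
    using * by (cases s) (auto simp: Cons_tuples)
next
  assume "\<exists>s b. c = El b \<and> a \<in> Carr M s \<and> b \<in> Carr M s \<and> R a b"
  then obtain s b where *: "c = El b" "a \<in> Carr M s" "b \<in> Carr M s" "R a b" by blast
  show "eqrel_lift M R (El a) c"
    unfolding eqrel_lift_def
    by (intro exI[of _ "Real s"] conjI bexI[of _ "[a]"] bexI[of _ "[b]"]) (use * in \<open>auto simp: Cons_tuples\<close>)
qed

lemma eqrel_lift_Cls:
  "eqrel_lift M R (Cls ss \<phi> X) c \<longleftrightarrow> (ss, \<phi>) \<in> quotients M \<and> (\<exists>u\<in>tuples M ss. \<exists>v\<in>tuples M ss.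
     list_all2 R u v \<and> X = eqrel M ss \<phi> `` {u} \<and> c = Cls ss \<phi> (eqrel M ss \<phi> `` {v}))"
proof
  assume "eqrel_lift M R (Cls ss \<phi> X) c"
  then obtain s u v where *: "valid_sort M s" "u \<in> tuples M (rsorts s)" "v \<in> tuples M (rsorts s)" "list_all2 R u v"
    "Cls ss \<phi> X = elem_of M s u" "c = elem_of M s v" by (auto simp: eqrel_lift_def)
  show "(ss, \<phi>) \<in> quotients M \<and> (\<exists>u\<in>tuples M ss. \<exists>v\<in>tuples M ss.
     list_all2 R u v \<and> X = eqrel M ss \<phi> `` {u} \<and> c = Cls ss \<phi> (eqrel M ss \<phi> `` {v}))"
    using * by (cases s) auto
next
  assume "(ss, \<phi>) \<in> quotients M \<and> (\<exists>u\<in>tuples M ss. \<exists>v\<in>tuples M ss.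
     list_all2 R u v \<and> X = eqrel M ss \<phi> `` {u} \<and> c = Cls ss \<phi> (eqrel M ss \<phi> `` {v}))"
  then obtain u v where *: "(ss, \<phi>) \<in> quotients M" "u \<in> tuples M ss" "v \<in> tuples M ss"
     "list_all2 R u v" "X = eqrel M ss \<phi> `` {u}" "c = Cls ss \<phi> (eqrel M ss \<phi> `` {v})" by blast
  show "eqrel_lift M R (Cls ss \<phi> X) c"
    unfolding eqrel_lift_def
    by (intro exI[of _ "Quot ss \<phi>"] conjI bexI[of _ u] bexI[of _ v]) (use * in simp_all)
qed

text \<open>The formula of the equivalence relation is preserved, so the relation on classes does
  not depend on the representatives.\<close>

lemma eqrel_lift_class:
  assumes P: "pres M R" and q: "(ss, \<phi>) \<in> quotients M" and t: "u \<in> tuples M ss" "u' \<in> tuples M ss"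
    and R: "list_all2 R u v" "list_all2 R u' v'"
  shows "eqrel M ss \<phi> `` {u} = eqrel M ss \<phi> `` {u'} \<longleftrightarrow> eqrel M ss \<phi> `` {v} = eqrel M ss \<phi> `` {v'}"
proof -
  have t': "v \<in> tuples M ss" "v' \<in> tuples M ss" using pres_tuples[OF P] R t by blast+
  have "fv \<phi> \<subseteq> {..<length (u @ u')}" using q t[THEN tuples_length] by (auto simp: quotients_def)
  from pres_holds[OF P list_all2_appendI[OF R] this] show ?thesis
    unfolding quotients_eq_iff[OF q t] quotients_eq_iff[OF q t'] .
qed

lemma eqrel_lift_eq:
  assumes P: "pres M R" and "eqrel_lift M R a b" "eqrel_lift M R a b'"
  shows "b = b'"
proof (cases a)
  case (El x)
  then show ?thesis using assms pres_eq[OF P, of x _ x] by (auto simp: eqrel_lift_El)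
next
  case (Cls ss \<phi> X)
  obtain u v where 1: "(ss, \<phi>) \<in> quotients M" "u \<in> tuples M ss" "list_all2 R u v" "X = eqrel M ss \<phi> `` {u}"
    "b = Cls ss \<phi> (eqrel M ss \<phi> `` {v})" using assms(2) Cls by (auto simp: eqrel_lift_Cls)
  obtain u' v' where 2: "u' \<in> tuples M ss" "list_all2 R u' v'" "X = eqrel M ss \<phi> `` {u'}"
    "b' = Cls ss \<phi> (eqrel M ss \<phi> `` {v'})" using assms(3) Cls by (auto simp: eqrel_lift_Cls)
  show ?thesis using eqrel_lift_class[OF P 1(1,2) 2(1) 1(3) 2(2)] 1 2 by simp
qed

lemma eqrel_lift_map_El:
  assumes "list_all2 (eqrel_lift M R) (map El u) ys"
  shows "\<exists>v. ys = map El v \<and> list_all2 R u v"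
  using assms
proof (induction u arbitrary: ys)
  case (Cons a u)
  then obtain c zs where "ys = c # zs" "eqrel_lift M R (El a) c" "list_all2 (eqrel_lift M R) (map El u) zs"
    by (auto simp: list_all2_Cons1)
  moreover from this obtain b where "c = El b" "R a b" by (auto simp: eqrel_lift_El)
  moreover obtain v where "zs = map El v" "list_all2 R u v" using Cons.IH[OF calculation(3)] by blast
  ultimately show ?case by (intro exI[of _ "b # v"]) simp
qed simp

lemma eqrel_lift_intp:
  assumes P: "pres M R" and L: "list_all2 (eqrel_lift M R) xs ys" and xs: "xs \<in> Intp (eq_struct M) r"
  shows "ys \<in> Intp (eq_struct M) r"
proof (cases r)
  case (Base q)
  then obtain u where u: "xs = map El u" "u \<in> Intp M q" using xs by (auto simp: eq_struct_def)
  obtain v where v: "ys = map El v" "list_all2 R u v" using eqrel_lift_map_El[of M R u ys] L u(1) by blast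
  have "map ((!) u) [0..<length u] = u" "map ((!) v) [0..<length u] = v"
    using list_all2_lengthD[OF v(2)] map_nth[of u] map_nth[of v] by simp_all
  then have "u \<in> Intp M q \<longleftrightarrow> v \<in> Intp M q"
    using pres_holds[OF P v(2), of "Rel q [0..<length u]"] by (simp add: holds_def lessThan_atLeast0)
  then show ?thesis using u(2) v(1) Base by (simp add: eq_struct_def)
next
  case (Proj ss \<phi>)
  then obtain u where u: "xs = map El u @ [Cls ss \<phi> (eqrel M ss \<phi> `` {u})]" "(ss, \<phi>) \<in> quotients M" "u \<in> tuples M ss"
    using xs by (auto simp: eq_struct_def)
  obtain zs c where zs: "ys = zs @ [c]" "list_all2 (eqrel_lift M R) (map El u) zs"
    "eqrel_lift M R (Cls ss \<phi> (eqrel M ss \<phi> `` {u})) c"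
    using L unfolding u(1) by (auto simp: list_all2_append1 list_all2_Cons1)
  obtain v where v: "zs = map El v" "list_all2 R u v" using eqrel_lift_map_El[OF zs(2)] by blast
  obtain u' v' where w: "u' \<in> tuples M ss" "list_all2 R u' v'" "eqrel M ss \<phi> `` {u} = eqrel M ss \<phi> `` {u'}"
    "c = Cls ss \<phi> (eqrel M ss \<phi> `` {v'})" using zs(3) unfolding eqrel_lift_Cls by blast
  have "eqrel M ss \<phi> `` {v} = eqrel M ss \<phi> `` {v'}" using eqrel_lift_class[OF P u(2,3) w(1) v(2) w(2)] w(3) by blast
  moreover have "v \<in> tuples M ss" using pres_tuples[OF P v(2)] u(3) by blast
  ultimately show ?thesis unfolding zs(1) v(1) w(4) Proj using u(2) by (auto simp: eq_struct_def)
qed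

text \<open>An imaginary is matched by matching the components of a representative one after
  another. Properties shown in one direction are applied to the converse relation for the
  other.\<close>

lemma back_forth_lift:
  assumes F: "back_forth M F"
  shows "back_forth (eq_struct M) (eqrel_lift M ` F)"
  unfolding back_forth_def ball_simps
proof (intro ballI conjI allI impI)
  fix R assume R: "R \<in> F"
  note P = back_forth_pres[OF F R]
  note P' = pres_converse[OF P]
  show "xs \<in> Intp (eq_struct M) r \<longleftrightarrow> ys \<in> Intp (eq_struct M) r" if "list_all2 (eqrel_lift M R) xs ys" for r xs ys
  proof -
    have "list_all2 (eqrel_lift M (\<lambda>a b. R b a)) ys xs"
      using that eqrel_lift_converse[of M R] by (auto simp: list_all2_conv_all_nth)
    then show ?thesis using eqrel_lift_intp[OF P that] eqrel_lift_intp[OF P'] by blast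
  qed
  show "a = a' \<longleftrightarrow> b = b'" if "eqrel_lift M R a b" "eqrel_lift M R a' b'" for a b a' b'
    using that eqrel_lift_eq[OF P] eqrel_lift_eq[OF P'] eqrel_lift_converse[of M R] by metis
  show "\<exists>R'\<in>eqrel_lift M ` F. eqrel_lift M R \<le> R' \<and> (\<exists>b\<in>Carr (eq_struct M) s. R' a b)" if c: "a \<in> Carr (eq_struct M) s" for a s
  proof -
    obtain u where u: "a = elem_of M s u" "u \<in> tuples M (rsorts s)" "valid_sort M s" using c unfolding Carr_eq_struct by blast
    obtain R' v where R': "R' \<in> F" "R \<le> R'" "v \<in> tuples M (rsorts s)" "list_all2 R' u v"
      using back_forth_tuple(1)[OF F R u(2)] by blast
    have "eqrel_lift M R' a (elem_of M s v)" "elem_of M s v \<in> Carr (eq_struct M) s"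
      unfolding eqrel_lift_def Carr_eq_struct using u R' by blast+
    then show ?thesis using eqrel_lift_mono[OF R'(2)] R'(1) by blast
  qed
  show "\<exists>R'\<in>eqrel_lift M ` F. eqrel_lift M R \<le> R' \<and> (\<exists>a\<in>Carr (eq_struct M) s. R' a b)" if c: "b \<in> Carr (eq_struct M) s" for b s
  proof -
    obtain u where u: "b = elem_of M s u" "u \<in> tuples M (rsorts s)" "valid_sort M s" using c unfolding Carr_eq_struct by blast
    obtain R' v where R': "R' \<in> F" "R \<le> R'" "v \<in> tuples M (rsorts s)" "list_all2 R' v u"
      using back_forth_tuple(2)[OF F R u(2)] by blast
    have "eqrel_lift M R' (elem_of M s v) b" "elem_of M s v \<in> Carr (eq_struct M) s"
      unfolding eqrel_lift_def Carr_eq_struct using u R' by blast+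
    then show ?thesis using eqrel_lift_mono[OF R'(2)] R'(1) by blast
  qed
qed

text \<open>Sets definable over parameters that are related to themselves are respected. The main
  use is for the power set that contains \<open>f\<close>, with the parameter
  \<open>n\<close>.\<close>

lemma pres_definable:
  assumes P: "pres M R" and Y: "definable_over M B Y" and B: "\<forall>b\<in>B. R b b" and uv: "list_all2 R u v"
  shows "u \<in> Y \<longleftrightarrow> v \<in> Y"
proof -
  obtain ss \<phi> bs where *: "set bs \<subseteq> B" "fv \<phi> \<subseteq> {..<length ss + length bs}" "Y = {as \<in> tuples M ss. holds M \<phi> (as @ bs)}"
    using Y unfolding definable_over_def by blast
  have "list_all2 R bs bs" using *(1) B by (auto simp: list_all2_same)
  then have "holds M \<phi> (u @ bs) \<longleftrightarrow> holds M \<phi> (v @ bs)" if "u \<in> tuples M ss"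
    using pres_holds[OF P list_all2_appendI[OF uv], of bs bs \<phi>] *(2) tuples_length[OF that] by simp
  then show ?thesis using pres_tuples[OF P uv, of ss] *(3) by blast
qed

section \<open>Homogeneity\<close>

locale rec_field = fps_field mem for mem :: "'k::field \<Rightarrow> 'f \<Rightarrow> bool" +
  assumes root: "p \<in> polys mem 1 UNIV \<Longrightarrow> nonconstant mem UNIV p \<Longrightarrow> \<exists>a. is_root mem UNIV p a"
    and transcendental: "\<exists>x. \<not> def_algebraic mem (Q_adjoin mem A) x"
begin

lemma Good_step:
  assumes h: "Good h"
  shows "\<exists>h' y. Good h' \<and> (\<forall>a b. pr h' a b \<longleftrightarrow> pr h a b \<or> a = x \<and> b = y)"
proof -
  have hF: "h \<in> FinQ K2" using h by (simp add: Good_def)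
  obtain W where W: "wspec h W" using wspec_ex[OF hF] by blast
  note hW = h W
  show ?thesis
  proof (cases "\<exists>d\<in>N. \<exists>y b. W x y d (pw x d) b")
    case True
    have "DP1 (\<lambda>d. \<exists>y b. W x y d (pw x d) b)" by (intro DP_ex_k DW[OF hW] DK_slot DK_const DK_pw | simp)+
    \<comment> \<open>The least such \<open>d\<close> is the degree of the minimal polynomial of
      \<open>x\<close> over the domain; \<open>y\<close> can be quantified away since the first
      components do not depend on it.\<close>
    from N_least[OF this] True obtain d where d: "d \<in> N" "\<exists>y b. W x y d (pw x d) b"
      "\<And>k. k \<in> bel d \<Longrightarrow> \<not> (\<exists>y b. W x y k (pw x k) b)" by blast
    have "d \<noteq> 0" using d(2) W_0[OF hW] by auto
    obtain y0 b0 where y0: "W x y0 d (pw x d) b0" using d(2) by blast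
    obtain y where y: "W x y d (pw x d) (pw y d)" using W_root[OF hW root d(1) \<open>d \<noteq> 0\<close> y0] by blast
    have "a = 0 \<longleftrightarrow> b = 0" if "m \<in> N" "W x y m a b" for m a b
      by (rule W_algebraic[OF hW d(1) \<open>d \<noteq> 0\<close> y _ that]) (use d(3) in blast)
    then show ?thesis using W_extension[OF hW, of x y] by blast
  next
    case False
    obtain A where A: "\<And>b. mem b A \<longleftrightarrow> (\<exists>a. pr h a b)" using range_ex[OF hF] by blast
    obtain y where y: "\<not> def_algebraic mem (Q_adjoin mem A) y" using transcendental by blast
    \<comment> \<open>Swapping the sides turns the range into a domain, so that independence of the
      powers of \<open>y\<close> can be expressed with \<open>W'\<close>; it settles the converse
      implication.\<close>
    obtain h' where h': "Good h'" "\<And>a b. pr h' a b \<longleftrightarrow> pr h b a" "\<And>a b. Sg h' a b \<longleftrightarrow> Sg h b a" using Good_swap[OF h] by blast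
    have "h' \<in> FinQ K2" using h'(1) by (simp add: Good_def)
    then obtain W' where W': "wspec h' W'" using wspec_ex by blast
    have pr: "\<forall>a b. pr h' a b \<longrightarrow> a \<in> Q_adjoin mem A" using Q_adjoin(2) A h'(2) by blast
    have "a = 0 \<longleftrightarrow> b = 0" if m: "m \<in> N" and ab: "W x y m a b" for m a b
    proof
      assume "a = 0"
      then show "b = 0" using W_0_left[OF hW m _ ab[unfolded \<open>a = 0\<close>]] False bel_N by blast
    next
      assume "b = 0"
      then have "W' y x m 0 a" using ab W_swap[OF hW h'(1) W' h'(3) m] by simp
      then show "a = 0"
        using W_0_left[OF h'(1) W' m _] W_transcendental[OF h'(1) W' Q_adjoin(1) pr bel_N y] by blast
    qed
    then show ?thesis using W_extension[OF hW, of x y] by blast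
  qed
qed

lemma GoodD: "Good h \<Longrightarrow> h \<in> FinQ K2"
  by (simp add: Good_def)

lemma Good_mono:
  "Good h \<Longrightarrow> Good h' \<Longrightarrow> \<forall>a b. pr h a b \<longrightarrow> pr h' a b \<Longrightarrow> Sg h a b \<Longrightarrow> Sg h' a b"
  by (rule Sg_mono[OF GoodD GoodD]) blast+

text \<open>\<open>Good_step\<close> adds one element, and iterating it from outside would reach
  externally finite sets only. The hyperfinite induction needs the existence of a good code as a
  definable predicate, so \<open>Good\<close> is spelled out in \<open>?P\<close>.\<close>

lemma Good_set:
  assumes h: "Good h"
  shows "\<exists>h'. Good h' \<and> (\<forall>a b. pr h a b \<longrightarrow> pr h' a b) \<and> (\<forall>x. mem x A \<longrightarrow> (\<exists>b. pr h' x b))"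
proof -
  let ?P = "\<lambda>A. \<exists>h'\<in>FinQ K2. (\<forall>a b. Sg h' a b \<longrightarrow> (a = 0 \<longleftrightarrow> b = 0)) \<and> (\<forall>a b. pr h a b \<longrightarrow> pr h' a b) \<and>
    (\<forall>x. mem x A \<longrightarrow> (\<exists>b. pr h' x b))"
  have "?P A"
  proof (rule F_induct[of ?P])
    show "DP KQ U (case_nat fS closed_ctx) (\<lambda>e. ?P (sval (e 0)))"
      by (intro DP_ex_k DP_all_k DP_bex[OF DS_Fin[OF DS_tuples]] DP_conj DP_imp DP_iff DP_pr DP_Sg DP_mem DP_eq_k DK_zero
        FinQ_DT[OF GoodD[OF h]] DT_slot' DK_slot DF_slot | simp only: nat.case)+
    show "?P A" if "\<And>x. \<not> mem x A" for A using that h unfolding Good_def by blast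
    fix A a B assume "?P A" and B: "\<And>x. mem x B \<longleftrightarrow> mem x A \<or> x = a"
    then obtain h1 where h1: "Good h1" "\<forall>a b. pr h a b \<longrightarrow> pr h1 a b" "\<forall>x. mem x A \<longrightarrow> (\<exists>b. pr h1 x b)"
      unfolding Good_def by blast
    obtain h2 y where h2: "Good h2" "\<forall>r s. pr h2 r s \<longleftrightarrow> pr h1 r s \<or> r = a \<and> s = y" using Good_step[OF h1(1)] by blast
    have "\<forall>x. mem x B \<longrightarrow> (\<exists>b. pr h2 x b)" using h1(3) h2(2) B by blast
    moreover have "\<forall>a b. pr h a b \<longrightarrow> pr h2 a b" using h1(2) h2(2) by blast
    ultimately show "?P B" using h2(1) unfolding Good_def by blast
  qed
  then show ?thesis unfolding Good_def by blast
qed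

section \<open>The relations on both sorts of the structure\<close>

definition elrel :: "('k, 'f) keq list \<Rightarrow> ('k, 'f) elem \<Rightarrow> ('k, 'f) elem \<Rightarrow> bool" where
  "elrel h u v \<longleftrightarrow> (\<exists>a b. u = KEl a \<and> v = KEl b \<and> Sg h a b) \<or>
    (\<exists>A B. u = FEl A \<and> v = FEl B \<and> (\<forall>a. mem a A \<longrightarrow> (\<exists>b. mem b B \<and> Sg h a b)) \<and> (\<forall>b. mem b B \<longrightarrow> (\<exists>a. mem a A \<and> Sg h a b)))"

lemma elrel_mono: "Good h \<Longrightarrow> Good h' \<Longrightarrow> \<forall>a b. pr h a b \<longrightarrow> pr h' a b \<Longrightarrow> elrel h \<le> elrel h'"
proof (intro predicate2I)
  assume "Good h" "Good h'" "\<forall>a b. pr h a b \<longrightarrow> pr h' a b"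
  then have S: "Sg h a b \<Longrightarrow> Sg h' a b" for a b by (rule Good_mono)
  have S': "\<exists>b. P b \<and> Sg h' a b" if "\<exists>b. P b \<and> Sg h a b" for P a using that S by blast
  have S'': "\<exists>a. P a \<and> Sg h' a b" if "\<exists>a. P a \<and> Sg h a b" for P b using that S by blast
  show "elrel h' u v" if "elrel h u v" for u v
    using that[unfolded elrel_def]
  proof (elim disjE)
    assume "\<exists>a b. u = KEl a \<and> v = KEl b \<and> Sg h a b"
    then show ?thesis unfolding elrel_def using S by blast
  next
    assume "\<exists>A B. u = FEl A \<and> v = FEl B \<and> (\<forall>a. mem a A \<longrightarrow> (\<exists>b. mem b B \<and> Sg h a b)) \<and> (\<forall>b. mem b B \<longrightarrow> (\<exists>a. mem a A \<and> Sg h a b))"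
    then obtain A B where "u = FEl A" "v = FEl B" "\<forall>a. mem a A \<longrightarrow> (\<exists>b. mem b B \<and> Sg h a b)"
      "\<forall>b. mem b B \<longrightarrow> (\<exists>a. mem a A \<and> Sg h a b)" by blast
    then show ?thesis unfolding elrel_def by (intro disjI2 exI[of _ A] exI[of _ B]) (simp add: S' S'')
  qed
qed

lemma elrel_swap: "(\<And>a b. Sg h' a b \<longleftrightarrow> Sg h b a) \<Longrightarrow> elrel h' u v \<longleftrightarrow> elrel h v u"
  unfolding elrel_def by auto

text \<open>For an element of \<open>F(K)\<close>, all its members are first brought into the
  domain; its image is then hyperfinite because the isomorphism is definable and
  single-valued.\<close>

lemma elrel_forth:
  assumes h: "Good h" and u: "u \<in> Carr (KK mem) s"
  shows "\<exists>h'. Good h' \<and> (\<forall>a b. pr h a b \<longrightarrow> pr h' a b) \<and> (\<exists>v\<in>Carr (KK mem) s. elrel h' u v)"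
proof (cases s)
  case KSort
  then obtain x where x: "u = KEl x" using u by (auto simp: KK_def)
  obtain h' y where h': "Good h'" "\<forall>a b. pr h' a b \<longleftrightarrow> pr h a b \<or> a = x \<and> b = y" using Good_step[OF h] by blast
  have "Sg h' x y" by (rule Sg_pr[OF GoodD[OF h'(1)]]) (simp add: h'(2))
  then have "elrel h' u (KEl y)" unfolding elrel_def x by blast
  moreover have "KEl y \<in> Carr (KK mem) s" using KSort by (simp add: KK_def)
  ultimately show ?thesis using h' by blast
next
  case FSort
  then obtain A where A: "u = FEl A" using u by (auto simp: KK_def)
  obtain h' where h': "Good h'" "\<forall>a b. pr h a b \<longrightarrow> pr h' a b" "\<forall>x. mem x A \<longrightarrow> (\<exists>b. pr h' x b)" using Good_set[OF h] by blast
  have "kfin {b. \<exists>a\<in>{x. mem x A}. Sg h' a b}"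
  proof (rule kfin_UN[OF kfin_mem _ Sg_DP2[OF GoodD[OF h'(1)]]])
    fix a assume "a \<in> {x. mem x A}"
    then obtain b where "Sg h' a b" using h'(3) Sg_pr[OF GoodD[OF h'(1)]] by blast
    then have "{b. Sg h' a b} = {b}" using Good_inj[OF h'(1)] by blast
    then show "kfin {b. Sg h' a b}" using kfin_single by simp
  qed
  then obtain B where B: "\<And>b. mem b B \<longleftrightarrow> (\<exists>a. mem a A \<and> Sg h' a b)" unfolding kfin_iff by auto
  have "\<forall>a. mem a A \<longrightarrow> (\<exists>b. mem b B \<and> Sg h' a b)" using B h'(3) Sg_pr[OF GoodD[OF h'(1)]] by blast
  moreover have "\<forall>b. mem b B \<longrightarrow> (\<exists>a. mem a A \<and> Sg h' a b)" using B by blast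
  ultimately have "elrel h' u (FEl B)" unfolding elrel_def A by blast
  moreover have "FEl B \<in> Carr (KK mem) s" using FSort by (simp add: KK_def)
  ultimately show ?thesis using h' by blast
qed

lemma elrel_eq:
  assumes h: "Good h" and "elrel h u v" "elrel h u v'"
  shows "v = v'"
proof (cases u)
  case (KEl a)
  then show ?thesis using assms Good_inj[OF h, of a _ a] unfolding elrel_def by auto
next
  case (FEl A)
  obtain B B' where B: "v = FEl B" "v' = FEl B'" "\<forall>a. mem a A \<longrightarrow> (\<exists>b. mem b B \<and> Sg h a b)"
    "\<forall>b. mem b B \<longrightarrow> (\<exists>a. mem a A \<and> Sg h a b)" "\<forall>a. mem a A \<longrightarrow> (\<exists>b. mem b B' \<and> Sg h a b)"
    "\<forall>b. mem b B' \<longrightarrow> (\<exists>a. mem a A \<and> Sg h a b)" using assms(2,3) FEl unfolding elrel_def by auto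
  have "mem b B \<longleftrightarrow> mem b B'" for b using B(3-6) Good_inj[OF h] by metis
  then show ?thesis using F_ext B(1,2) by blast
qed

lemma elrel_intp:
  assumes h: "Good h" and L: "list_all2 (elrel h) us vs" and u: "us \<in> Intp (KK mem) r"
  shows "vs \<in> Intp (KK mem) r"
proof (cases r)
  case Add
  then obtain x y where "us = [KEl x, KEl y, KEl (x + y)]" using u by (auto simp: KK_def)
  then obtain x' y' z' where v: "vs = [KEl x', KEl y', KEl z']" "Sg h x x'" "Sg h y y'" "Sg h (x + y) z'"
    using L by (auto simp: list_all2_Cons1 elrel_def)
  have "z' = x' + y'" using Good_inj[OF h v(4) Sg_add[OF GoodD[OF h] v(2,3)]] by simp
  then show ?thesis using Add v(1) by (simp add: KK_def)
next
  case Mult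
  then obtain x y where "us = [KEl x, KEl y, KEl (x * y)]" using u by (auto simp: KK_def)
  then obtain x' y' z' where v: "vs = [KEl x', KEl y', KEl z']" "Sg h x x'" "Sg h y y'" "Sg h (x * y) z'"
    using L by (auto simp: list_all2_Cons1 elrel_def)
  have "z' = x' * y'" using Good_inj[OF h v(4) Sg_mult[OF GoodD[OF h] v(2,3)]] by simp
  then show ?thesis using Mult v(1) by (simp add: KK_def)
next
  case Mem
  then obtain x A where "us = [KEl x, FEl A]" "mem x A" using u by (auto simp: KK_def)
  then obtain x' A' where v: "vs = [KEl x', FEl A']" "Sg h x x'" "\<exists>b. mem b A' \<and> Sg h x b"
    using L by (auto simp: list_all2_Cons1 elrel_def)
  then have "mem x' A'" using Good_inj[OF h] by metis
  then show ?thesis using Mem v(1) by (simp add: KK_def)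
qed

lemma back_forth_elrel: "back_forth (KK mem) {elrel h |h. Good h}"
  unfolding back_forth_def
proof (intro ballI)
  fix R assume "R \<in> {elrel h |h. Good h}"
  then obtain h where R: "R = elrel h" and h: "Good h" by blast
  obtain h' where h': "Good h'" "\<And>a b. pr h' a b \<longleftrightarrow> pr h b a" "\<And>a b. Sg h' a b \<longleftrightarrow> Sg h b a" using Good_swap[OF h] by blast
  note sw = elrel_swap[of h' h, OF h'(3)]
  show "(\<forall>r xs ys. list_all2 R xs ys \<longrightarrow> (xs \<in> Intp (KK mem) r \<longleftrightarrow> ys \<in> Intp (KK mem) r)) \<and>
     (\<forall>a b a' b'. R a b \<longrightarrow> R a' b' \<longrightarrow> (a = a' \<longleftrightarrow> b = b')) \<and>
     (\<forall>s. \<forall>a\<in>Carr (KK mem) s. \<exists>R'\<in>{elrel h |h. Good h}. R \<le> R' \<and> (\<exists>b\<in>Carr (KK mem) s. R' a b)) \<and>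
     (\<forall>s. \<forall>b\<in>Carr (KK mem) s. \<exists>R'\<in>{elrel h |h. Good h}. R \<le> R' \<and> (\<exists>a\<in>Carr (KK mem) s. R' a b))"
  proof (intro conjI allI impI ballI)
    fix r xs ys assume L: "list_all2 R xs ys"
    then have "list_all2 (elrel h') ys xs" by (simp add: R list_all2_conv_all_nth sw)
    then show "xs \<in> Intp (KK mem) r \<longleftrightarrow> ys \<in> Intp (KK mem) r"
      using elrel_intp[OF h L[unfolded R]] elrel_intp[OF h'(1)] by blast
  next
    fix a b a' b' assume "R a b" "R a' b'"
    then show "a = a' \<longleftrightarrow> b = b'" using elrel_eq[OF h] elrel_eq[OF h'(1)] unfolding R sw by blast
  next
    fix s a assume "a \<in> Carr (KK mem) s"
    from elrel_forth[OF h this] elrel_mono[OF h]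
    show "\<exists>R'\<in>{elrel h |h. Good h}. R \<le> R' \<and> (\<exists>b\<in>Carr (KK mem) s. R' a b)" unfolding R by blast
  next
    fix s b assume "b \<in> Carr (KK mem) s"
    \<comment> \<open>The back step is the forth step for the inverse isomorphism.\<close>
    then obtain h1 a where h1: "Good h1" "\<forall>a b. pr h' a b \<longrightarrow> pr h1 a b" "a \<in> Carr (KK mem) s" "elrel h1 b a"
      using elrel_forth[OF h'(1)] by blast
    obtain h2 where h2: "Good h2" "\<And>a b. pr h2 a b \<longleftrightarrow> pr h1 b a" "\<And>a b. Sg h2 a b \<longleftrightarrow> Sg h1 b a" using Good_swap[OF h1(1)] by blast
    have "elrel h \<le> elrel h2" using elrel_mono[OF h h2(1)] h1(2) h2(2) h'(2) by blast
    moreover have "elrel h2 a b" using elrel_swap[of h2 h1, OF h2(3)] h1(4) by blast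
    ultimately show "\<exists>R'\<in>{elrel h |h. Good h}. R \<le> R' \<and> (\<exists>a\<in>Carr (KK mem) s. R' a b)"
      unfolding R using h2(1) h1(3) by blast
  qed
qed

lemma back_forth_KQ: "back_forth KQ {eqrel_lift (KK mem) (elrel h) |h. Good h}"
proof -
  have "eqrel_lift (KK mem) ` {elrel h |h. Good h} = {eqrel_lift (KK mem) (elrel h) |h. Good h}" by blast
  then show ?thesis using back_forth_lift[OF back_forth_elrel] unfolding Keq_def by simp
qed

abbreviation "qrel h \<equiv> eqrel_lift (KK mem) (elrel h)"

lemma qrel_kel: "qrel h (kel a) c \<longleftrightarrow> (\<exists>b. c = kel b \<and> Sg h a b)"
proof
  assume "qrel h (kel a) c"
  then show "\<exists>b. c = kel b \<and> Sg h a b" by (auto simp: eqrel_lift_El elrel_def)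
next
  assume "\<exists>b. c = kel b \<and> Sg h a b"
  then show "qrel h (kel a) c" unfolding eqrel_lift_El
    by (intro exI[of _ KSort]) (auto simp: elrel_def KK_def)
qed

text \<open>Both components of a pair in \<open>EV\<close> are values of one polynomial over
  \<open>QQ mem\<close>, so equal ideals make them vanish together. \<open>EV\<close> thus serves as
  the ring of pairs in \<open>Good_criterion\<close>.\<close>

lemma Good_ideal:
  assumes n: "n \<in> N" and f: "f \<in> seqs mem n UNIV" and g: "g \<in> seqs mem n UNIV"
    and eq: "def_ideal mem n f = def_ideal mem n g"
  shows "\<exists>h. Good h \<and> (\<forall>i\<in>bel n. pr h (entry mem n UNIV f i) (entry mem n UNIV g i))"
proof -
  note R = dring_QQ
  note EV = DP2_EV[OF n R f g] EV_const[OF n R f g] EV_add[OF n R f g] EV_mult[OF n R f g] EV_entry[OF n R f g]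
  let ?Q = "\<lambda>a b. \<exists>i. i \<in> bel n \<and> a = en n UNIV f i \<and> b = en n UNIV g i"
  note c = DT_const[OF seqs_tuples[OF f] tuples_subset_univ[OF seqs_tuples[OF f]]]
    DT_const[OF seqs_tuples[OF g] tuples_subset_univ[OF seqs_tuples[OF g]]]
  have "hf PS ((\<lambda>u :: ('k, 'f) keq list. [kel (en n UNIV f (kval u)), kel (en n UNIV g (kval u))]) ` kset (bel n))"
    by (rule hf_image[OF kfin_hf[OF kfin_bel[OF n]]])
      (simp, (intro DP_eq[where ss = PS] DT_kel_Cons DT_kel DK_en dset_UNIV c DT_slot' DK_slot | simp only: nat.case)+)
  also have "(\<lambda>u :: ('k, 'f) keq list. [kel (en n UNIV f (kval u)), kel (en n UNIV g (kval u))]) ` kset (bel n) = ({[kel a, kel b] |a b. ?Q a b} :: ('k, 'f) keq list set)"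
    by (auto simp: kset_def image_def)
  finally obtain h where h: "h \<in> FinQ K2" "\<And>a b. pr h a b \<longleftrightarrow> ?Q a b" using hf_pr[of ?Q] by blast
  have "Good h"
  proof (rule Good_criterion[of h "EV n (QQ mem) f g", OF h(1) EV(1)])
    show "EV n (QQ mem) f g 1 1" using EV(2) dringD(2)[OF R] by blast
    fix a b assume ab: "EV n (QQ mem) f g a b"
    obtain p where p: "p \<in> polys mem n (QQ mem)" "a = evt n (QQ mem) p f" "b = evt n (QQ mem) p g" using ab by (auto simp: EV_def)
    have "p \<in> def_ideal mem n f \<longleftrightarrow> p \<in> def_ideal mem n g" using eq by simp
    then show "a = 0 \<longleftrightarrow> b = 0"
      using p unfolding def_ideal_def mem_Collect_eq ev_evt[OF n dringD(1)[OF R] p(1) f] ev_evt[OF n dringD(1)[OF R] p(1) g] by simp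
    show "EV n (QQ mem) f g (- a) (- b)" using EV(4)[OF EV(2)[OF dringD(3)[OF R]] ab] by simp
    show "EV n (QQ mem) f g (a + x) (b + y)" "EV n (QQ mem) f g (a * x) (b * y)" if "EV n (QQ mem) f g x y" for x y
      using EV(3,4)[OF ab that] by blast+
  next
    fix a b assume "pr h a b"
    then obtain i where "i \<in> bel n" "a = en n UNIV f i" "b = en n UNIV g i" unfolding h(2) by (elim exE conjE)
    then show "EV n (QQ mem) f g a b" using EV(5) by simp
  qed
  then show ?thesis using h(2) en_entry[OF f] en_entry[OF g] by metis
qed

text \<open>\<open>f\<close> is an imaginary, so matching its entries is not yet enough: its partner
  under the extended isomorphism must be identified with \<open>g\<close>. This is possible because
  the power set of the graphs and its membership relation are definable over
  \<open>n\<close>.\<close>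

theorem tp_eq:
  assumes n: "n \<in> N" and f: "f \<in> seqs mem n UNIV" and g: "g \<in> seqs mem n UNIV"
    and eq: "def_ideal mem n f = def_ideal mem n g"
  shows "tp KQ (kel ` N) f = tp KQ (kel ` N) g"
proof -
  let ?X = "seqX n UNIV"
  let ?E = "snd (fps KQ ?X)"
  note X = DS_seqX[OF dset_UNIV, of n]
  note BF = back_forth_KQ
  obtain h0 where h0: "Good h0" "\<And>i. i \<in> bel n \<Longrightarrow> pr h0 (entry mem n UNIV f i) (entry mem n UNIV g i)"
    using Good_ideal[OF n f g eq] by blast
  have "qrel h0 \<in> {qrel h |h. Good h}" using h0(1) by blast
  from back_forth_tuple(1)[OF BF this seqs_tuples[OF f]] obtain h g' where h: "Good h" "qrel h0 \<le> qrel h"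
    and g': "list_all2 (qrel h) f g'" by blast
  have hF: "qrel h \<in> {qrel h |h. Good h}" using h(1) by blast
  note P = back_forth_pres[OF BF hF]
  have fg: "qrel h (kel (entry mem n UNIV f i)) (kel (entry mem n UNIV g i))" if "i \<in> bel n" for i
    using h(2) qrel_kel[of h0] Sg_pr[OF GoodD[OF h0(1)] h0(2)[OF that]] by blast
  have NR: "\<forall>b\<in>kel ` N. qrel h b b" using qrel_kel Sg_N[OF GoodD[OF h(1)]] by blast
  then have nR: "\<forall>b\<in>{kel n}. qrel h b b" using n by blast
  \<comment> \<open>The points of the graphs form a set that is definable over \<open>n\<close>
    alone; by the choice of \<open>fps\<close> the same holds for its power set.\<close>
  have "DS KQ {kel n} PS ?X"
    unfolding DS_def
  proof
    show "?X \<subseteq> K2" by (rule DS_subset[OF X])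
    have "DP KQ {kel n} (case_nat PS closed_ctx) (\<lambda>e. \<exists>i v. i \<in> bel n \<and> e 0 = [kel i, kel v])"
      by (intro DP_ex_k DP_conj DP_bel DK_const DP_eq[where ss = PS] DT_slot' DT_kel_Cons DT_kel DK_slot | simp only: nat.case insertI1)+
    then show "DP KQ {kel n} (case_nat PS closed_ctx) (\<lambda>e. e 0 \<in> ?X)"
    proof (rule DP_cong)
      show "(\<exists>i v. i \<in> bel n \<and> e 0 = [kel i, kel v]) \<longleftrightarrow> e 0 \<in> ?X" for e
      proof
        assume "\<exists>i v. i \<in> bel n \<and> e 0 = [kel i, kel v]"
        then obtain i v where "i \<in> bel n" "e 0 = [kel i, kel v]" by (elim exE conjE)
        then show "e 0 \<in> ?X" by simp
      next
        assume "e 0 \<in> ?X"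
        from seqX_cases[OF this] show "\<exists>i v. i \<in> bel n \<and> e 0 = [kel i, kel v]" by (elim exE conjE) (intro exI conjI)
      qed
    qed
  qed
  from fps_spec(2)[OF X _ definable_overI[OF this]]
  have over: "definable_over KQ {kel n} (FinQ ?X)" "definable_over KQ {kel n} (graph_of ?E)" by simp_all
  have "f \<in> FinQ ?X" using f seqs_iff by blast
  then have g'F: "g' \<in> FinQ ?X" using pres_definable[OF P over(1) nR g'] by blast
  have E: "?E \<subseteq> ?X \<times> FinQ ?X" using is_fpsD(3)[OF fps_spec(1)[OF X]] .
  have gr: "[kel i, kel v] \<in> extQ ?X u \<longleftrightarrow> [kel i, kel v] @ u \<in> graph_of ?E" for i v u
  proof
    assume "[kel i, kel v] \<in> extQ ?X u"
    then show "[kel i, kel v] @ u \<in> graph_of ?E" unfolding ext_def graph_of_def by blast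
  next
    assume "[kel i, kel v] @ u \<in> graph_of ?E"
    then obtain x y where xy: "[kel i, kel v] @ u = x @ y" "(x, y) \<in> ?E" unfolding graph_of_def by blast
    then have x: "x \<in> ?X" using E by blast
    obtain j w where "x = [kel j, kel w]" using seqX_cases[OF x] by (elim exE conjE)
    then have "x = [kel i, kel v]" "y = u" using xy(1) by simp_all
    then show "[kel i, kel v] \<in> extQ ?X u" using x xy(2) unfolding ext_def by blast
  qed
  \<comment> \<open>Stated for extensions \<open>h'\<close> of \<open>h\<close>, because a value
    \<open>w\<close> of \<open>g'\<close> need not be in the range of \<open>h\<close>.\<close>
  have iff: "[kel i, kel v] \<in> extQ ?X f \<longleftrightarrow> [kel i, kel w] \<in> extQ ?X g'"
    if "i \<in> bel n" "qrel h' (kel v) (kel w)" "Good h'" "qrel h \<le> qrel h'" for i v w h'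
  proof -
    have h'F: "qrel h' \<in> {qrel h |h. Good h}" using that(3) by blast
    have 1: "\<forall>b\<in>{kel n}. qrel h' b b" using nR that(4) by blast
    have "qrel h' (kel i) (kel i)" using that(4) NR bel_N[OF that(1)] by blast
    then have "list_all2 (qrel h') ([kel i, kel v] @ f) ([kel i, kel w] @ g')"
      using that(2) list_all2_mono[OF g', of "qrel h'"] that(4) by auto
    from pres_definable[OF back_forth_pres[OF BF h'F] over(2) 1 this] show ?thesis unfolding gr .
  qed
  have "extQ ?X g' = extQ ?X g"
  proof (intro set_eqI iffI)
    fix u assume u: "u \<in> extQ ?X g'"
    then obtain i w where i: "u = [kel i, kel w]" "i \<in> bel n" using ext_subset seqX_cases by blast
    \<comment> \<open>A further back step supplies a preimage of \<open>w\<close>. It has to be the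
      entry of \<open>f\<close>, whose partner is the entry of \<open>g\<close>, and so
      \<open>w\<close> is that entry.\<close>
    obtain R a where R: "R \<in> {qrel h |h. Good h}" "qrel h \<le> R" "a \<in> Carr KQ (Real KSort)" "R a (kel w)"
      using back_forthD(4)[OF BF hF kel_Carr(1)] by blast
    obtain h' where h': "R = qrel h'" "Good h'" using R(1) by blast
    have "[a] \<in> tuples KQ kS" using R(3) by (simp add: Cons_tuples)
    then obtain v where v: "a = kel v" using kS_tuples by blast
    have "[kel i, kel v] \<in> extQ ?X f" using iff[OF i(2), of h' v w] R(2,4) h' u v i(1) by blast
    then have "v = entry mem n UNIV f i" using seqs_ext[OF f i(2)] by blast
    moreover have "R (kel (entry mem n UNIV f i)) (kel (entry mem n UNIV g i))" using fg[OF i(2)] R(2) by blast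
    ultimately have "kel w = (kel (entry mem n UNIV g i) :: ('k, 'f) keq)"
      using back_forthD(2)[OF BF R(1) R(4)] v by blast
    then show "u \<in> extQ ?X g" unfolding seqs_ext_eq[OF g] i(1) using i(2) by blast
  next
    fix u assume "u \<in> extQ ?X g"
    then obtain i where i: "u = [kel i, kel (entry mem n UNIV g i)]" "i \<in> bel n" unfolding seqs_ext_eq[OF g] by blast
    have "[kel i, kel (entry mem n UNIV f i)] \<in> extQ ?X f" unfolding seqs_ext_eq[OF f] using i(2) by blast
    then show "u \<in> extQ ?X g'" using iff[OF i(2) fg[OF i(2)] h(1)] i(1) by blast
  qed
  moreover have "g \<in> FinQ ?X" using g seqs_iff by blast
  ultimately have "g' = g" using ext_inj[OF X g'F] by blast
  then have L: "list_all2 (qrel h) f g" using g' by simp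
  have "fv \<phi> \<subseteq> {..<length f + length bs} \<and> holds KQ \<phi> (f @ bs) \<longleftrightarrow> fv \<phi> \<subseteq> {..<length g + length bs} \<and> holds KQ \<phi> (g @ bs)"
    if "set bs \<subseteq> kel ` N" for \<phi> bs
  proof -
    have "list_all2 (qrel h) bs bs" using that NR by (auto simp: list_all2_same)
    from pres_holds[OF P list_all2_appendI[OF L this]] show ?thesis using list_all2_lengthD[OF L] by auto
  qed
  then show ?thesis unfolding tp_def by blast
qed

end

theorem corollary10p5:
  fixes mem :: "'k::field \<Rightarrow> 'f \<Rightarrow> bool"
    and n :: 'k
    and f g :: "('k, 'f) keq list"
  assumes "T_rec mem"
    and "n \<in> NN mem"
    and "f \<in> seqs mem n UNIV"
    and "g \<in> seqs mem n UNIV"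
    and "def_ideal mem n f = def_ideal mem n g"
  shows "tp (Keq mem) (kel ` NN mem) f = tp (Keq mem) (kel ` NN mem) g"
  proof -
  interpret rec_field mem
    by unfold_locales (use assms(1) in \<open>auto simp: T_rec_def\<close>)
  show ?thesis by (rule tp_eq[OF assms(2-5)])
qed

end
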